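(* $(1+\varepsilon)$-Approximate Directed All-Pairs Shortest Paths can be solved in strongly polynomial time $\tilde{\mathcal{O}}(n^{\frac{\omega+3}{2}}/\varepsilon)$.
   Context: Input: a directed graph $G$ on $n$ nodes with edge weights in $\mathbb{R}_+=\{a\in\mathbb{R}:a\ge1\}\cup\{\infty\}$, and $0<\varepsilon<1/10$; $W$ is the largest finite weight. Output: values $\tilde d(u,v)$ for all nodes $u,v$ with $d_G(u,v)\le\tilde d(u,v)\le(1+\varepsilon)d_G(u,v)$, where $d_G(u,v)$ is the shortest-path distance from $u$ to $v$. "Strongly polynomial time $T$" means the number of arithmetic operations (on a RAM / Word RAM with input weights in floating-point representation, unit-cost arithmetic) is at most $T$, independent of $W$. $\tilde{\mathcal{O}}$ hides polylogarithmic factors in $n$ and $1/\varepsilon$, but never $\log W$. $\omega$ is the matrix multiplication exponent. *)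

theory Defs
  imports Complex_Main "HOL-Library.Extended_Real"
begin

section \<open>Word RAM\<close>

text \<open>
  A deterministic Word RAM with word size \<open>w\<close>: registers and memory cells hold naturals below
  \<open>2 ^ w\<close>, every instruction has unit cost, and a program has to work uniformly in \<open>w\<close>.
  The bound on the word size matters: with unit-cost arithmetic on unbounded integers one could
  pack whole matrices into single numbers.
\<close>

datatype binop = Add | Sub | Mul | Div | Mod | And | Or | Xor | Shl | Shr

fun eval_binop :: "nat \<Rightarrow> binop \<Rightarrow> nat \<Rightarrow> nat \<Rightarrow> nat" where
  "eval_binop w Add x y = (x + y) mod 2 ^ w"
| "eval_binop w Sub x y = (if y \<le> x then x - y else 2 ^ w + x - y)"
| "eval_binop w Mul x y = (x * y) mod 2 ^ w"
| "eval_binop w Div x y = x div y"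
| "eval_binop w Mod x y = x mod y"
| "eval_binop w And x y = semiring_bit_operations_class.and x y"
| "eval_binop w Or x y = semiring_bit_operations_class.or x y"
| "eval_binop w Xor x y = semiring_bit_operations_class.xor x y"
| "eval_binop w Shl x y = (x * 2 ^ y) mod 2 ^ w"
| "eval_binop w Shr x y = x div 2 ^ y"

datatype instr =
    Imm nat nat               \<comment> \<open>\<open>Imm r k\<close>: \<open>r := k mod 2 ^ w\<close>\<close>
  | Op binop nat nat nat      \<comment> \<open>\<open>Op f r a b\<close>: \<open>r := f a b\<close>\<close>
  | Load nat nat              \<comment> \<open>\<open>Load r a\<close>: \<open>r := mem[a]\<close>\<close>
  | Store nat nat             \<comment> \<open>\<open>Store a r\<close>: \<open>mem[a] := r\<close>\<close>
  | Jump nat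
  | JumpLess nat nat nat      \<comment> \<open>\<open>JumpLess a b l\<close>: if \<open>a < b\<close> goto \<open>l\<close>\<close>

type_synonym prog = "instr list"

record state =
  pc :: nat
  reg :: "nat \<Rightarrow> nat"
  mem :: "nat \<Rightarrow> nat"

fun exec :: "nat \<Rightarrow> instr \<Rightarrow> state \<Rightarrow> state" where
  "exec w (Imm r k) s = s\<lparr>pc := pc s + 1, reg := (reg s)(r := k mod 2 ^ w)\<rparr>"
| "exec w (Op f r a b) s =
     s\<lparr>pc := pc s + 1, reg := (reg s)(r := eval_binop w f (reg s a) (reg s b))\<rparr>"
| "exec w (Load r a) s = s\<lparr>pc := pc s + 1, reg := (reg s)(r := mem s (reg s a))\<rparr>"
| "exec w (Store a r) s = s\<lparr>pc := pc s + 1, mem := (mem s)(reg s a := reg s r)\<rparr>"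
| "exec w (Jump l) s = s\<lparr>pc := l\<rparr>"
| "exec w (JumpLess a b l) s = s\<lparr>pc := (if reg s a < reg s b then l else pc s + 1)\<rparr>"

definition halted :: "prog \<Rightarrow> state \<Rightarrow> bool" where
  "halted P s \<longleftrightarrow> length P \<le> pc s"

definition step :: "nat \<Rightarrow> prog \<Rightarrow> state \<Rightarrow> state" where
  "step w P s = (if halted P s then s else exec w (P ! pc s) s)"

definition halts_within :: "nat \<Rightarrow> prog \<Rightarrow> real \<Rightarrow> state \<Rightarrow> state \<Rightarrow> bool" where
  "halts_within w P T s s' \<longleftrightarrow>
     (\<exists>t. real t \<le> T \<and> (step w P ^^ t) s = s' \<and> halted P s')"

section \<open>The matrix multiplication exponent\<close>

definition matmul_input :: "nat \<Rightarrow> nat \<Rightarrow> (nat \<Rightarrow> nat \<Rightarrow> nat) \<Rightarrow> (nat \<Rightarrow> nat \<Rightarrow> nat) \<Rightarrow> state \<Rightarrow> bool" where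
  "matmul_input w n A B s \<longleftrightarrow>
     pc s = 0 \<and>
     reg s = (\<lambda>r. if r = 0 then w else if r = 1 then n else 0) \<and>
     (\<forall>i<n. \<forall>j<n. mem s (i * n + j) = A i j \<and> mem s (n * n + i * n + j) = B i j) \<and>
     (\<forall>a\<ge>2 * n * n. mem s a = 0)"

definition matmul_output :: "nat \<Rightarrow> (nat \<Rightarrow> nat \<Rightarrow> nat) \<Rightarrow> state \<Rightarrow> bool" where
  "matmul_output n D s \<longleftrightarrow> (\<forall>i<n. \<forall>j<n. mem s (2 * n * n + i * n + j) = D i j)"

text \<open>
  Multiplication of \<open>n \<times> n\<close> integer matrices in \<open>O(n\<^sup>\<tau>)\<close> operations. The word size is any number
  that is at least a constant factor times the bit length of the input numbers; the number of
  operations does not depend on it.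
\<close>

definition matmul_in_time :: "real \<Rightarrow> bool" where
  "matmul_in_time \<tau> \<longleftrightarrow>
     (\<exists>P C c. c > 0 \<and>
       (\<forall>n w K A B s.
          n \<ge> 1 \<longrightarrow> (\<forall>i<n. \<forall>j<n. A i j \<le> K \<and> B i j \<le> K) \<longrightarrow>
          c * log 2 (real n + real K + 1) \<le> real w \<longrightarrow>
          matmul_input w n A B s \<longrightarrow>
          (\<exists>s'. halts_within w P (C * real n powr \<tau>) s s' \<and>
                matmul_output n (\<lambda>i j. \<Sum>k<n. A i k * B k j) s')))"

text \<open>
  The infimum need not be attained. A bound in terms of \<open>\<omega>\<close> therefore means: the bound with \<open>\<omega>\<close> itself if
  matrix multiplication is possible in \<open>O(n\<^sup>\<omega>)\<close>, and the bound with \<open>\<omega> + \<delta>\<close> for every \<open>\<delta> > 0\<close>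
  in any case.
\<close>

definition omega :: real ("\<omega>") where
  "\<omega> = Inf {\<tau>. matmul_in_time \<tau>}"

section \<open>Weighted directed graphs\<close>

text \<open>
  The nodes are \<open>0, \<dots>, n - 1\<close>; the weight \<open>\<infinity>\<close> stands for a missing edge.
\<close>

definition weighted_digraph :: "nat \<Rightarrow> (nat \<Rightarrow> nat \<Rightarrow> ereal) \<Rightarrow> bool" where
  "weighted_digraph n G \<longleftrightarrow> n \<ge> 1 \<and> (\<forall>u<n. \<forall>v<n. 1 \<le> G u v)"

definition walks :: "nat \<Rightarrow> nat \<Rightarrow> nat \<Rightarrow> nat list set" where
  "walks n u v = {p. p \<noteq> [] \<and> hd p = u \<and> last p = v \<and> set p \<subseteq> {..<n}}"

definition walk_weight :: "(nat \<Rightarrow> nat \<Rightarrow> ereal) \<Rightarrow> nat list \<Rightarrow> ereal" where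
  "walk_weight G p = (\<Sum>i<length p - 1. G (p ! i) (p ! Suc i))"

definition distance :: "nat \<Rightarrow> (nat \<Rightarrow> nat \<Rightarrow> ereal) \<Rightarrow> nat \<Rightarrow> nat \<Rightarrow> ereal" where
  "distance n G u v = (INF p\<in>walks n u v. walk_weight G p)"

text \<open>The additional \<open>1\<close> only matters if there is no finite weight at all.\<close>

definition max_weight :: "nat \<Rightarrow> (nat \<Rightarrow> nat \<Rightarrow> ereal) \<Rightarrow> real" where
  "max_weight n G =
     Max (insert 1 {real_of_ereal (G u v) |u v. u < n \<and> v < n \<and> G u v \<noteq> \<infinity>})"

section \<open>Floating-point representation\<close>

text \<open>
  A real \<open>x > 0\<close> is represented by its exponent \<open>e = \<lfloor>log 2 x\<rfloor>\<close> and the \<open>w\<close>-bit mantissa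
  \<open>m \<in> {2 ^ (w - 1)..<2 ^ w}\<close> with \<open>x = m * 2 ^ e / 2 ^ (w - 1)\<close>. The mantissa is truncated if
  \<open>x\<close> has a longer binary expansion, so that arbitrary real inputs are covered and inputs that are
  \<open>w\<close>-bit floating-point numbers are represented exactly.
\<close>

definition fl_exponent :: "real \<Rightarrow> int" where
  "fl_exponent x = \<lfloor>log 2 x\<rfloor>"

definition fl_mantissa :: "nat \<Rightarrow> real \<Rightarrow> nat" where
  "fl_mantissa w x = nat \<lfloor>x * 2 powr (real w - 1 - real_of_int (fl_exponent x))\<rfloor>"

text \<open>
  Weights and distances are \<open>0\<close>, at least \<open>1\<close>, or infinite, hence their exponents are natural
  numbers. Mantissa \<open>0\<close> encodes \<open>0\<close> or, with a nonzero exponent word, infinity.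
\<close>

definition fl_encode :: "nat \<Rightarrow> ereal \<Rightarrow> nat \<times> nat" where
  "fl_encode w x =
     (if x = \<infinity> then (0, 1)
      else (fl_mantissa w (real_of_ereal x), nat (fl_exponent (real_of_ereal x))))"

definition fl_decode :: "nat \<Rightarrow> nat \<times> nat \<Rightarrow> ereal" where
  "fl_decode w me = (case me of (m, e) \<Rightarrow>
     if m = 0 then (if e = 0 then 0 else \<infinity>)
     else ereal (real m * 2 ^ e / 2 ^ (w - 1)))"

section \<open>Approximate all-pairs shortest paths\<close>

text \<open>Since \<open>\<epsilon> < 1\<close>, its exponent is negative and register 3 holds the absolute value.\<close>

definition apsp_input :: "nat \<Rightarrow> nat \<Rightarrow> (nat \<Rightarrow> nat \<Rightarrow> ereal) \<Rightarrow> real \<Rightarrow> state \<Rightarrow> bool" where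
  "apsp_input w n G \<epsilon> s \<longleftrightarrow>
     pc s = 0 \<and>
     reg s = (\<lambda>r. if r = 0 then w else if r = 1 then n
                  else if r = 2 then fl_mantissa w \<epsilon>
                  else if r = 3 then nat (- fl_exponent \<epsilon>) else 0) \<and>
     (\<forall>u<n. \<forall>v<n.
        (mem s (2 * (u * n + v)), mem s (2 * (u * n + v) + 1)) = fl_encode w (G u v)) \<and>
     (\<forall>a\<ge>2 * n * n. mem s a = 0)"

definition apsp_output :: "nat \<Rightarrow> nat \<Rightarrow> state \<Rightarrow> nat \<Rightarrow> nat \<Rightarrow> ereal" where
  "apsp_output w n s u v =
     fl_decode w (mem s (2 * (u * n + v)), mem s (2 * (u * n + v) + 1))"

text \<open>
  Solvability of \<open>(1 + \<epsilon>)\<close>-approximate directed all-pairs shortest paths in strongly polynomial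
  time \<open>T n \<epsilon>\<close>, up to a factor polylogarithmic in \<open>n / \<epsilon>\<close>. The numbers of the input fit into
  a constant number of words of \<open>O(log (n / \<epsilon>) + log log W)\<close> bits; the number of operations
  depends neither on the word size nor on \<open>W\<close>.
\<close>

definition approx_apsp_in_soft_time :: "(nat \<Rightarrow> real \<Rightarrow> real) \<Rightarrow> bool" where
  "approx_apsp_in_soft_time T \<longleftrightarrow>
     (\<exists>P C (k::nat) c. c > 0 \<and>
       (\<forall>n G \<epsilon> w s.
          weighted_digraph n G \<longrightarrow> 0 < \<epsilon> \<longrightarrow> \<epsilon> < 1 / 10 \<longrightarrow>
          c * (log 2 (real n / \<epsilon>) + log 2 (2 + log 2 (max_weight n G))) \<le> real w \<longrightarrow>
          apsp_input w n G \<epsilon> s \<longrightarrow>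
          (\<exists>s'. halts_within w P (C * T n \<epsilon> * ln (real n / \<epsilon>) ^ k) s s' \<and>
                (\<forall>u<n. \<forall>v<n.
                   distance n G u v \<le> apsp_output w n s' u v \<and>
                   apsp_output w n s' u v \<le> ereal (1 + \<epsilon>) * distance n G u v))))"

end

theory Submission
  imports Defs
begin

text \<open>
  Distances are obtained by \<open>\<lceil>log 2 n\<rceil>\<close> approximate min-plus squarings. A distance is stored as an integer
  multiple of a small logarithmic unit, so its key has only \<open>O(log (n / \<epsilon>) + log log W)\<close> bits and no
  scaling over the weights is needed. On this scale \<open>x + y\<close> with \<open>y \<le> x\<close> is \<open>x (1 + t / U)\<close> up to a factor
  \<open>1 + O(1 / U)\<close>, where \<open>t\<close> is the least number with \<open>y \<le> x t / U\<close>. Hence one squaring amounts, for every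
  \<open>t \<le> U = O(log n / \<epsilon>)\<close>, to finding the least \<open>D i k\<close> with \<open>D k j + l\<^sub>t \<le> D i k\<close>, and symmetrically:
  a dominance problem that does not depend on the size of the keys.

  The dominance problem is solved in the style of Matousek. All entries are sorted, rows and columns are cut into
  blocks of \<open>q\<close> entries, the entries are processed in groups of \<open>n q\<close> consecutive ranks, and each of the \<open>n / q\<close>
  groups costs one Boolean product of dimension \<open>O(n)\<close>; what is left inside the blocks is scanned in
  \<open>O(n\<^sup>2 q)\<close> steps. Balancing gives \<open>n q\<^sup>2 = n\<^sup>\<tau>\<close>, that is \<open>O(n powr ((\<tau> + 3) / 2))\<close>. Since \<open>\<tau>\<close> need not be
  computable, the matrix multiplication program is run with a budget of \<open>n q\<^sup>2\<close> steps and \<open>q\<close> is doubled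
  whenever a run does not finish.
\<close>

section \<open>A structured language and its compilation to the Word RAM\<close>

text \<open>Three obstacles shape the construction. The program for matrix multiplication is known
  only to exist: it has to run inside the memory of another program and from cleared memory. A
  quarter of the word is therefore reserved for indices, so that three indices form one address, and
  the foreign program runs with this smaller word size. Every product gets a memory row of its own,
  which is never cleaned.

  An interrupted product may leave arbitrary values behind, so every conclusion about the marks is
  conditional on a flag saying that all products of the attempt halted.

  The logarithmic unit is such that \<open>U\<^sup>2 ln (1 + u / U)\<close> can be tabulated by
  adding the integer quotients \<open>U * U div (U + v)\<close>, with an error of
  \<open>O(U)\<close> units, that is a factor \<open>1 + O(1 / U)\<close>. Each of the
  \<open>L\<close> squarings, the encoding and the decoding loses at most a factor
  \<open>\<gamma> \<le> exp (17 / U)\<close>; the choice \<open>U \<ge> 64 * (L + 2) * 2 ^ e\<close>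
  with \<open>1 / 2 ^ e \<le> \<epsilon>\<close> keeps the product of all losses below
  \<open>1 + \<epsilon>\<close>.\<close>

datatype aexp = N nat | V nat | Bin binop aexp aexp | Rd nat aexp aexp

datatype com =
    Skip
  | Assign nat aexp
  | Wr nat aexp aexp aexp
  | Seq com com  (infixr ";;" 60)
  | If aexp aexp com com
  | While aexp aexp com
  | Sim

text \<open>\<open>ar s a i j\<close> is cell \<open>j\<close> of row \<open>i\<close> of array
  \<open>a\<close>. Two indices per array allow for matrices as well as for a separate memory row
  for every simulated run.\<close>

record store =
  vr :: "nat \<Rightarrow> nat"
  ar :: "nat \<Rightarrow> nat \<Rightarrow> nat \<Rightarrow> nat"

fun opv :: "binop \<Rightarrow> nat \<Rightarrow> nat \<Rightarrow> nat" where
  "opv Add x y = x + y"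
| "opv Sub x y = x - y"
| "opv Mul x y = x * y"
| "opv Div x y = x div y"
| "opv Mod x y = x mod y"
| "opv Shl x y = x * 2 ^ y"
| "opv Shr x y = x div 2 ^ y"
| "opv _ x y = 0"

fun opok :: "nat \<Rightarrow> binop \<Rightarrow> nat \<Rightarrow> nat \<Rightarrow> bool" where
  "opok W Add x y \<longleftrightarrow> x + y < W"
| "opok W Sub x y \<longleftrightarrow> y \<le> x"
| "opok W Mul x y \<longleftrightarrow> x * y < W"
| "opok W Div x y \<longleftrightarrow> True"
| "opok W Mod x y \<longleftrightarrow> True"
| "opok W Shl x y \<longleftrightarrow> x * 2 ^ y < W"
| "opok W Shr x y \<longleftrightarrow> True"
| "opok W _ x y \<longleftrightarrow> False"

lemma eval_binop_opv: "opok (2 ^ w) f x y \<Longrightarrow> eval_binop w f x y = opv f x y"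
  by (cases f) auto

fun ev :: "aexp \<Rightarrow> store \<Rightarrow> nat" where
  "ev (N k) s = k"
| "ev (V x) s = vr s x"
| "ev (Bin f a b) s = opv f (ev a s) (ev b s)"
| "ev (Rd a e1 e2) s = ar s a (ev e1 s) (ev e2 s)"

definition upd3 :: "(nat \<Rightarrow> nat \<Rightarrow> nat \<Rightarrow> nat) \<Rightarrow> nat \<Rightarrow> nat \<Rightarrow> nat \<Rightarrow> nat \<Rightarrow> nat \<Rightarrow> nat \<Rightarrow> nat \<Rightarrow> nat" where
  "upd3 f a i j v = (\<lambda>a' i' j'. if a' = a \<and> i' = i \<and> j' = j then v else f a' i' j')"

lemma upd3_other [simp]: "a' \<noteq> a \<Longrightarrow> upd3 f a i j v a' = f a'"
  by (auto simp: upd3_def)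

lemma upd3_same [simp]: "upd3 f a i j v a = (\<lambda>i' j'. if i' = i \<and> j' = j then v else f a i' j')"
  by (auto simp: upd3_def)

text \<open>
  \<open>Sim\<close> runs a foreign program (later: matrix multiplication) for a bounded number of steps inside
  the memory row \<open>(aMM, vr s vCnt)\<close>. Variables \<open>vWs\<close> and \<open>vDim\<close> hold its two input registers,
  \<open>vBud\<close> the bound on the number of steps, and \<open>vFlag\<close> receives whether it halted.
\<close>

abbreviation (input) "vWs \<equiv> 3 :: nat"
abbreviation (input) "vInf \<equiv> 4 :: nat"
abbreviation (input) "vDim \<equiv> 5 :: nat"
abbreviation (input) "vCnt \<equiv> 6 :: nat"
abbreviation (input) "vBud \<equiv> 7 :: nat"
abbreviation (input) "vFlag \<equiv> 8 :: nat"
abbreviation (input) "aMM \<equiv> 2 :: nat"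

text \<open>Together with \<open>wa\<close> a syntactic bound on what a command may change. All
  frame facts come from these two functions, which keeps loop invariants free of statements about
  untouched data.\<close>

fun wv :: "com \<Rightarrow> nat set" where
  "wv Skip = {}"
| "wv (Assign x e) = {x}"
| "wv (Wr a e1 e2 e3) = {}"
| "wv (c1 ;; c2) = wv c1 \<union> wv c2"
| "wv (If e1 e2 c1 c2) = wv c1 \<union> wv c2"
| "wv (While e1 e2 c) = wv c"
| "wv Sim = {vFlag}"

fun wa :: "com \<Rightarrow> nat set" where
  "wa Skip = {}"
| "wa (Assign x e) = {}"
| "wa (Wr a e1 e2 e3) = {a}"
| "wa (c1 ;; c2) = wa c1 \<union> wa c2"
| "wa (If e1 e2 c1 c2) = wa c1 \<union> wa c2"
| "wa (While e1 e2 c) = wa c"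
| "wa Sim = {aMM}"

text \<open>Commands without loops and simulations: they cost no ticks, and their triples can be
  evaluated by rewriting.\<close>

fun sl :: "com \<Rightarrow> bool" where
  "sl (c1 ;; c2) \<longleftrightarrow> sl c1 \<and> sl c2"
| "sl (If e1 e2 c1 c2) \<longleftrightarrow> sl c1 \<and> sl c2"
| "sl (While e1 e2 c) \<longleftrightarrow> False"
| "sl Sim \<longleftrightarrow> False"
| "sl _ \<longleftrightarrow> True"

definition sim_start :: "store \<Rightarrow> state" where
  "sim_start s = \<lparr>pc = 0, reg = (\<lambda>r. if r = 0 then vr s vWs else if r = 1 then vr s vDim else 0),
     mem = ar s aMM (vr s vCnt)\<rparr>"

text \<open>\<open>W\<close> bounds the machine words, \<open>R\<close> bounds array indices and the
  words of the simulated machine. Taking a quarter of the word size makes three indices fit into one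
  address.\<close>

locale ram =
  fixes w :: nat and P :: prog and W R ws :: nat
  assumes W_def: "W = 2 ^ w" and R_def: "R = 2 ^ ws" and ws_def: "ws = w div 4" and R_ge: "1000 \<le> R"
begin

lemma R3_le_W: "R * R * R \<le> W"
proof -
  have "R * R * R = 2 ^ (ws + ws + ws)" unfolding R_def by (simp only: power_add)
  also have "\<dots> \<le> 2 ^ w" by (rule power_increasing) (auto simp: ws_def)
  finally show ?thesis by (simp add: W_def)
qed

lemma R_less_W: "1000 * R \<le> W"
proof -
  have "1000 * R * 1 \<le> R * R * R" using R_ge by (intro mult_le_mono) auto
  then show ?thesis using R3_le_W by linarith
qed

lemma ws_less: "ws < R" by (simp add: R_def)

section \<open>Cost semantics and total-correctness triples\<close>

fun ok :: "aexp \<Rightarrow> store \<Rightarrow> bool" where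
  "ok (N k) s \<longleftrightarrow> k < W"
| "ok (V x) s \<longleftrightarrow> True"
| "ok (Bin f a b) s \<longleftrightarrow> ok a s \<and> ok b s \<and> opok W f (ev a s) (ev b s)"
| "ok (Rd a e1 e2) s \<longleftrightarrow> ok e1 s \<and> ok e2 s \<and> a < 1000 \<and> ev e1 s < R \<and> ev e2 s < R"

text \<open>The tick count covers only loop iterations and simulated steps; the constant overhead of
  the remaining code is restored at compilation by \<open>csz\<close>. A derivation exists only if
  no operation overflows and all indices stay below \<open>R\<close>.\<close>

inductive big :: "com \<Rightarrow> store \<Rightarrow> nat \<Rightarrow> store \<Rightarrow> bool" where
  Skip: "big Skip s 0 s"
| Assign: "ok e s \<Longrightarrow> big (Assign x e) s 0 (s\<lparr>vr := (vr s)(x := ev e s)\<rparr>)"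
| Wr: "ok e1 s \<Longrightarrow> ok e2 s \<Longrightarrow> ok e3 s \<Longrightarrow> a < 1000 \<Longrightarrow> ev e1 s < R \<Longrightarrow> ev e2 s < R \<Longrightarrow>
    big (Wr a e1 e2 e3) s 0 (s\<lparr>ar := upd3 (ar s) a (ev e1 s) (ev e2 s) (ev e3 s)\<rparr>)"
| Seq: "big c1 s t1 s1 \<Longrightarrow> big c2 s1 t2 s2 \<Longrightarrow> big (c1 ;; c2) s (t1 + t2) s2"
| IfT: "ok e1 s \<Longrightarrow> ok e2 s \<Longrightarrow> ev e1 s < ev e2 s \<Longrightarrow> big c1 s t s' \<Longrightarrow> big (If e1 e2 c1 c2) s t s'"
| IfF: "ok e1 s \<Longrightarrow> ok e2 s \<Longrightarrow> \<not> ev e1 s < ev e2 s \<Longrightarrow> big c2 s t s' \<Longrightarrow> big (If e1 e2 c1 c2) s t s'"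
| WhileT: "ok e1 s \<Longrightarrow> ok e2 s \<Longrightarrow> ev e1 s < ev e2 s \<Longrightarrow> big c s t1 s1 \<Longrightarrow>
    big (While e1 e2 c) s1 t2 s2 \<Longrightarrow> big (While e1 e2 c) s (Suc (t1 + t2)) s2"
| WhileF: "ok e1 s \<Longrightarrow> ok e2 s \<Longrightarrow> \<not> ev e1 s < ev e2 s \<Longrightarrow> big (While e1 e2 c) s 0 s"
| Sim: "vr s vBud < W \<Longrightarrow> vr s vCnt < R \<Longrightarrow> vr s vWs = ws \<Longrightarrow> vr s vDim < R \<Longrightarrow> \<forall>j. ar s aMM (vr s vCnt) j < R \<Longrightarrow>
    \<sigma> = (step ws P ^^ vr s vBud) (sim_start s) \<Longrightarrow>
    big Sim s (vr s vBud) (s\<lparr>vr := (vr s)(vFlag := (if halted P \<sigma> then 1 else 0)),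
                              ar := (ar s)(aMM := (ar s aMM)(vr s vCnt := mem \<sigma>))\<rparr>)"

inductive_cases SkipE: "big Skip s t s'"
inductive_cases AssignE: "big (Assign x e) s t s'"
inductive_cases WrE: "big (Wr a e1 e2 e3) s t s'"
inductive_cases SeqE: "big (c1 ;; c2) s t s'"
inductive_cases IfE: "big (If e1 e2 c1 c2) s t s'"

text \<open>The existence of one terminating run suffices, because compilation turns it into the run
  of a deterministic machine.\<close>

definition tri :: "com \<Rightarrow> store \<Rightarrow> nat \<Rightarrow> (store \<Rightarrow> bool) \<Rightarrow> bool" where
  "tri c s T Q \<longleftrightarrow> (\<exists>t s'. big c s t s' \<and> t \<le> T \<and> Q s')"

definition frame :: "nat set \<Rightarrow> nat set \<Rightarrow> store \<Rightarrow> store \<Rightarrow> bool" where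
  "frame X A s s' \<longleftrightarrow> (\<forall>y. y \<notin> X \<longrightarrow> vr s' y = vr s y) \<and> (\<forall>a. a \<notin> A \<longrightarrow> ar s' a = ar s a)"

lemma frame_refl: "frame X A s s" by (simp add: frame_def)

lemma frame_trans: "frame X A s s1 \<Longrightarrow> frame X' A' s1 s2 \<Longrightarrow> frame (X \<union> X') (A \<union> A') s s2"
  by (auto simp: frame_def)

lemma frame_mono: "frame X A s s' \<Longrightarrow> X \<subseteq> X' \<Longrightarrow> A \<subseteq> A' \<Longrightarrow> frame X' A' s s'"
  by (auto simp: frame_def)

lemma big_frame: "big c s t s' \<Longrightarrow> frame (wv c) (wa c) s s'"
proof (induction rule: big.induct)
  case (Seq c1 s t1 s1 c2 t2 s2)
  then show ?case by (simp add: frame_trans)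
next
  case (WhileT e1 s e2 c t1 s1 t2 s2)
  then show ?case using frame_trans by fastforce
qed (auto simp: frame_def)

lemma big_sl: "big c s t s' \<Longrightarrow> sl c \<Longrightarrow> t = 0"
  by (induction rule: big.induct) auto

lemma triI: "big c s t s' \<Longrightarrow> t \<le> T \<Longrightarrow> Q s' \<Longrightarrow> tri c s T Q"
  by (auto simp: tri_def)

lemma tri_weaken: "tri c s T Q \<Longrightarrow> T \<le> T' \<Longrightarrow> (\<And>s'. Q s' \<Longrightarrow> frame (wv c) (wa c) s s' \<Longrightarrow> Q' s') \<Longrightarrow> tri c s T' Q'"
  unfolding tri_def using big_frame le_trans by blast

lemma tri_mono: "tri c s T Q \<Longrightarrow> T \<le> T' \<Longrightarrow> tri c s T' Q"
  unfolding tri_def using le_trans by blast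

lemma tri_Skip [simp]: "tri Skip s T Q \<longleftrightarrow> Q s"
  by (auto simp: tri_def intro: big.intros elim: SkipE)

lemma tri_Assign [simp]: "tri (Assign x e) s T Q \<longleftrightarrow> ok e s \<and> Q (s\<lparr>vr := (vr s)(x := ev e s)\<rparr>)"
proof
  assume "ok e s \<and> Q (s\<lparr>vr := (vr s)(x := ev e s)\<rparr>)"
  then show "tri (Assign x e) s T Q" unfolding tri_def using big.Assign by blast
qed (auto simp: tri_def elim!: AssignE)

lemma tri_Wr [simp]: "tri (Wr a e1 e2 e3) s T Q \<longleftrightarrow> ok e1 s \<and> ok e2 s \<and> ok e3 s \<and> a < 1000 \<and> ev e1 s < R \<and>
    ev e2 s < R \<and> Q (s\<lparr>ar := upd3 (ar s) a (ev e1 s) (ev e2 s) (ev e3 s)\<rparr>)" (is "?l \<longleftrightarrow> ?r")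
proof
  assume ?r
  then show ?l unfolding tri_def using big.Wr[of e1 s e2 e3 a] by blast
qed (auto simp: tri_def elim!: WrE)

lemma tri_If [simp]: "tri (If e1 e2 c1 c2) s T Q \<longleftrightarrow> ok e1 s \<and> ok e2 s \<and>
    (if ev e1 s < ev e2 s then tri c1 s T Q else tri c2 s T Q)"
proof (cases "ev e1 s < ev e2 s")
  case True
  then have "big (If e1 e2 c1 c2) s t s' \<longleftrightarrow> ok e1 s \<and> ok e2 s \<and> big c1 s t s'" for t s'
    by (auto elim!: IfE intro: big.IfT)
  with True show ?thesis by (auto simp: tri_def)
next
  case False
  then have "big (If e1 e2 c1 c2) s t s' \<longleftrightarrow> ok e1 s \<and> ok e2 s \<and> big c2 s t s'" for t s'
    by (auto elim!: IfE intro: big.IfF)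
  with False show ?thesis by (auto simp: tri_def)
qed

text \<open>A loop-free prefix costs nothing, so the triple turns into a weakest precondition that
  the simplifier computes by itself.\<close>

lemma tri_Seq_sl [simp]: "sl c1 \<Longrightarrow> tri (c1 ;; c2) s T Q \<longleftrightarrow> tri c1 s 0 (\<lambda>s1. tri c2 s1 T Q)"
proof -
  assume sl: "sl c1"
  have "big (c1 ;; c2) s t s2 \<longleftrightarrow> (\<exists>s1. big c1 s 0 s1 \<and> big c2 s1 t s2)" for t s2
  proof
    assume "big (c1 ;; c2) s t s2"
    then obtain t1 s1 t2 where 1: "big c1 s t1 s1" "big c2 s1 t2 s2" "t = t1 + t2" by (rule SeqE)
    then show "\<exists>s1. big c1 s 0 s1 \<and> big c2 s1 t s2" using big_sl[OF 1(1) sl] by auto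
  next
    assume "\<exists>s1. big c1 s 0 s1 \<and> big c2 s1 t s2"
    then show "big (c1 ;; c2) s t s2" using big.Seq[of c1 s 0 _ c2 t s2] by auto
  qed
  then show ?thesis unfolding tri_def by auto
qed

lemma tri_Seq:
  assumes "tri c1 s Ta Q1"
    and "\<And>s1. Q1 s1 \<Longrightarrow> frame (wv c1) (wa c1) s s1 \<Longrightarrow> tri c2 s1 Tb Q"
    and "Ta + Tb \<le> T"
  shows "tri (c1 ;; c2) s T Q"
proof -
  obtain t1 s1 where 1: "big c1 s t1 s1" "t1 \<le> Ta" "Q1 s1" using assms(1) by (auto simp: tri_def)
  then obtain t2 s2 where 2: "big c2 s1 t2 s2" "t2 \<le> Tb" "Q s2"
    using assms(2) big_frame by (force simp: tri_def)
  show ?thesis by (rule triI[OF big.Seq[OF 1(1) 2(1)]]) (use 1 2 assms(3) in auto)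
qed

text \<open>The first argument of the invariant is fuel that decreases with every iteration, so
  there are at most \<open>Suc F\<close> iterations. The second disjunct lets the last iteration
  leave the loop with \<open>Q\<close> established instead of the invariant; the search for the
  block length ends in this way.\<close>

lemma tri_While:
  assumes "I F s"
    and "\<And>f s1. I f s1 \<Longrightarrow> frame (wv c) (wa c) s s1 \<Longrightarrow> ok e1 s1 \<and> ok e2 s1"
    and "\<And>f s1. I f s1 \<Longrightarrow> frame (wv c) (wa c) s s1 \<Longrightarrow> ev e1 s1 < ev e2 s1 \<Longrightarrow>
       tri c s1 b (\<lambda>s2. (\<exists>f'<f. I f' s2) \<or> (Q s2 \<and> ok e1 s2 \<and> ok e2 s2 \<and> \<not> ev e1 s2 < ev e2 s2))"
    and "\<And>f s1. I f s1 \<Longrightarrow> frame (wv c) (wa c) s s1 \<Longrightarrow> \<not> ev e1 s1 < ev e2 s1 \<Longrightarrow> Q s1"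
    and "Suc F * Suc b \<le> T"
  shows "tri (While e1 e2 c) s T Q"
proof -
  have "frame (wv c) (wa c) s s1 \<Longrightarrow> I f s1 \<Longrightarrow> tri (While e1 e2 c) s1 (Suc f * Suc b) Q" for f s1
  proof (induction f arbitrary: s1 rule: less_induct)
    case (less f s1)
    show ?case
    proof (cases "ev e1 s1 < ev e2 s1")
      case False
      then show ?thesis using assms(2,4) less.prems by (blast intro: triI big.WhileF)
    next
      case True
      from assms(3)[OF less.prems(2,1) True]
      obtain t2 s2 where 2: "big c s1 t2 s2" "t2 \<le> b"
        "(\<exists>f'<f. I f' s2) \<or> (Q s2 \<and> ok e1 s2 \<and> ok e2 s2 \<and> \<not> ev e1 s2 < ev e2 s2)"
        by (auto simp: tri_def)
      have fr: "frame (wv c) (wa c) s s2"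
        using frame_trans[OF less.prems(1) big_frame[OF 2(1)]] by simp
      from 2(3) show ?thesis
      proof
        assume "\<exists>f'<f. I f' s2"
        then obtain f' where f': "f' < f" "I f' s2" by blast
        from less.IH[OF f'(1) fr f'(2)] obtain t3 s3 where
          3: "big (While e1 e2 c) s2 t3 s3" "t3 \<le> Suc f' * Suc b" "Q s3" by (auto simp: tri_def)
        have "Suc f' * Suc b \<le> f * Suc b" using f'(1) by (intro mult_right_mono) auto
        then show ?thesis using 2 3 assms(2)[OF less.prems(2,1)] True
          by (intro triI[OF big.WhileT[OF _ _ True 2(1) 3(1)]]) auto
      next
        assume q: "Q s2 \<and> ok e1 s2 \<and> ok e2 s2 \<and> \<not> ev e1 s2 < ev e2 s2"
        show ?thesis
          using 2 q assms(2)[OF less.prems(2,1)] True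
          by (intro triI[OF big.WhileT[OF _ _ True 2(1) big.WhileF]]) auto
      qed
    qed
  qed
  from this[OF frame_refl assms(1)] show ?thesis by (rule tri_mono) (rule assms(5))
qed

end

definition For :: "nat \<Rightarrow> nat \<Rightarrow> com \<Rightarrow> com" where
  "For x h c = Assign x (N 0) ;; While (V x) (V h) (c ;; Assign x (Bin Add (V x) (N 1)))"

lemma wv_For [simp]: "wv (For x h c) = insert x (wv c)"
  and wa_For [simp]: "wa (For x h c) = wa c"
  and sl_For [simp]: "\<not> sl (For x h c)"
  by (auto simp: For_def)

context ram
begin

text \<open>The body writes neither the counter nor the bound, which fixes the number of iterations.
  The invariant is required of the store with the counter already advanced, so that it may mention
  the counter.\<close>

lemma tri_For:
  assumes "x \<notin> wv c" "h \<notin> wv c" "h \<noteq> x" "vr s h = m" "m < W"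
    and I0: "I 0 (s\<lparr>vr := (vr s)(x := 0)\<rparr>)"
    and IS: "\<And>i s1. i < m \<Longrightarrow> vr s1 x = i \<Longrightarrow> vr s1 h = m \<Longrightarrow> I i s1 \<Longrightarrow> frame (insert x (wv c)) (wa c) s s1 \<Longrightarrow>
      tri c s1 b (\<lambda>s2. I (Suc i) (s2\<lparr>vr := (vr s2)(x := Suc i)\<rparr>))"
    and IQ: "\<And>s1. vr s1 x = m \<Longrightarrow> I m s1 \<Longrightarrow> frame (insert x (wv c)) (wa c) s s1 \<Longrightarrow> Q s1"
    and T: "m * Suc b \<le> T"
  shows "tri (For x h c) s T Q"
proof -
  let ?b = "c ;; Assign x (Bin Add (V x) (N 1))"
  have W1: "1 < W" using R_less_W R_ge by linarith
  have "i \<le> m \<Longrightarrow> vr s1 x = i \<Longrightarrow> I i s1 \<Longrightarrow> frame (insert x (wv c)) (wa c) s s1 \<Longrightarrow>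
      tri (While (V x) (V h) ?b) s1 ((m - i) * Suc b) Q" for i s1
  proof (induction "m - i" arbitrary: i s1)
    case 0
    then have "vr s1 h = m" using assms by (auto simp: frame_def)
    then have "Q s1" "\<not> vr s1 x < vr s1 h" using IQ 0 by auto
    then show ?case by (auto intro!: triI[OF big.WhileF])
  next
    case (Suc k)
    have h: "vr s1 h = m" using assms Suc by (auto simp: frame_def)
    have i: "i < m" using Suc by linarith
    from IS[OF i Suc(4) h Suc(5,6)] obtain t2 s2 where 2: "big c s1 t2 s2" "t2 \<le> b"
      "I (Suc i) (s2\<lparr>vr := (vr s2)(x := Suc i)\<rparr>)" by (auto simp: tri_def)
    have x2: "vr s2 x = i" using big_frame[OF 2(1)] assms(1) Suc(4) by (auto simp: frame_def)
    let ?s3 = "s2\<lparr>vr := (vr s2)(x := Suc i)\<rparr>"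
    have "big (Assign x (Bin Add (V x) (N 1))) s2 0 (s2\<lparr>vr := (vr s2)(x := ev (Bin Add (V x) (N 1)) s2)\<rparr>)"
      using assms(5) i x2 W1 by (intro big.Assign) auto
    then have 3: "big ?b s1 (t2 + 0) ?s3" using 2(1) x2 by (intro big.Seq) auto
    have fr: "frame (insert x (wv c)) (wa c) s ?s3"
      using Suc(6) big_frame[OF 2(1)] by (auto simp: frame_def)
    have "k = m - Suc i" "Suc i \<le> m" using Suc(2) i by auto
    from Suc(1)[OF this _ 2(3) fr] obtain t4 s4 where
      4: "big (While (V x) (V h) ?b) ?s3 t4 s4" "t4 \<le> (m - Suc i) * Suc b" "Q s4"
      by (auto simp: tri_def)
    have e: "(m - i) * Suc b = Suc b + (m - Suc i) * Suc b"
      using i by (metis Suc_diff_Suc mult_Suc)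
    show ?case
      by (rule triI[OF big.WhileT[OF _ _ _ 3 4(1)]]) (use Suc(4) h i 2 4 e in auto)
  qed
  from this[of 0 "s\<lparr>vr := (vr s)(x := 0)\<rparr>"] I0
  have "tri (While (V x) (V h) ?b) (s\<lparr>vr := (vr s)(x := 0)\<rparr>) (m * Suc b) Q"
    by (simp add: frame_def)
  then have "tri (While (V x) (V h) ?b) (s\<lparr>vr := (vr s)(x := 0)\<rparr>) T Q"
    using T by (rule tri_mono)
  then show ?thesis using W1 by (simp add: For_def)
qed

end

section \<open>Code generation\<close>

definition rv :: "nat \<Rightarrow> nat" where "rv x = 3 * x + 4"
definition rt :: "nat \<Rightarrow> nat" where "rt d = 3 * d + 5"
definition rp :: "nat \<Rightarrow> nat" where "rp r = 3 * r + 6"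

text \<open>Registers \<open>0\<close> to \<open>3\<close> are reserved for \<open>R\<close>, the
  base address of the simulated memory, the step counter of the simulation and a scratch address.
  The others are split by their residue modulo \<open>3\<close> into variables, temporaries and
  registers of the simulated program, so these cannot collide.\<close>

lemma reg_eq [simp]: "rv x = rv y \<longleftrightarrow> x = y" "rt x = rt y \<longleftrightarrow> x = y" "rp x = rp y \<longleftrightarrow> x = y"
  by (auto simp: rv_def rt_def rp_def)

lemma reg_neq [simp]: "rv x \<noteq> rt y" "rt y \<noteq> rv x" "rv x \<noteq> rp y" "rp y \<noteq> rv x" "rt x \<noteq> rp y" "rp y \<noteq> rt x"
  unfolding rv_def rt_def rp_def by presburger+

lemma reg_neq_num [simp]:
  "rv x \<noteq> 0" "rv x \<noteq> Suc 0" "rv x \<noteq> 2" "rv x \<noteq> 3" "rt x \<noteq> 0" "rt x \<noteq> Suc 0" "rt x \<noteq> 2" "rt x \<noteq> 3"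
  "rp x \<noteq> 0" "rp x \<noteq> Suc 0" "rp x \<noteq> 2" "rp x \<noteq> 3"
  "0 \<noteq> rv x" "Suc 0 \<noteq> rv x" "2 \<noteq> rv x" "3 \<noteq> rv x" "0 \<noteq> rt x" "Suc 0 \<noteq> rt x" "2 \<noteq> rt x" "3 \<noteq> rt x"
  "0 \<noteq> rp x" "Suc 0 \<noteq> rp x" "2 \<noteq> rp x" "3 \<noteq> rp x"
  by (auto simp: rv_def rt_def rp_def)

text \<open>Horner evaluation of the address \<open>(a * R + i) * R + j\<close> in register
  \<open>3\<close>, with \<open>R\<close> taken from register \<open>0\<close>.\<close>

definition addr :: "nat \<Rightarrow> nat \<Rightarrow> instr list" where
  "addr a d = [Imm 3 a, Op Mul 3 3 0, Op Add 3 3 (rt d), Op Mul 3 3 0, Op Add 3 3 (rt (Suc d))]"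

text \<open>The temporaries from \<open>rt d\<close> on serve as evaluation stack.
  \<open>Op Or\<close> with two equal operands is a register copy.\<close>

fun cexp :: "aexp \<Rightarrow> nat \<Rightarrow> instr list" where
  "cexp (N k) d = [Imm (rt d) k]"
| "cexp (V x) d = [Op Or (rt d) (rv x) (rv x)]"
| "cexp (Bin f a b) d = cexp a d @ cexp b (Suc d) @ [Op f (rt d) (rt d) (rt (Suc d))]"
| "cexp (Rd a e1 e2) d = cexp e1 d @ cexp e2 (Suc d) @ addr a d @ [Load (rt d) 3]"

fun regs :: "instr \<Rightarrow> nat list" where
  "regs (Imm r k) = [r]"
| "regs (Op f r a b) = [r, a, b]"
| "regs (Load r a) = [r, a]"
| "regs (Store a r) = [a, r]"
| "regs (Jump l) = []"
| "regs (JumpLess a b l) = [a, b]"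

text \<open>A sum of naturals bounds each summand; the additional \<open>2\<close> makes the bound
  strict and includes the input registers \<open>0\<close> and \<open>1\<close>.\<close>

definition nregs :: "prog \<Rightarrow> nat" where
  "nregs P = 2 + sum_list (concat (map regs P))"

lemma regs_less_nregs: "k < length P \<Longrightarrow> r \<in> set (regs (P ! k)) \<Longrightarrow> r < nregs P"
  unfolding nregs_def using member_le_sum_list[of r "concat (map regs P)"] nth_mem by fastforce

text \<open>Every instruction becomes exactly two. Results are reduced modulo register
  \<open>0\<close>, that is modulo \<open>2 ^ ws\<close>, which turns an operation of word size
  \<open>w\<close> into one of word size \<open>ws\<close>; addresses are shifted by the base of the
  memory row in register \<open>1\<close>.\<close>

fun sim_ins :: "(nat \<Rightarrow> nat) \<Rightarrow> nat \<Rightarrow> instr \<Rightarrow> instr list" where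
  "sim_ins t nx (Imm r k) = [Imm (rp r) k, Op Mod (rp r) (rp r) 0]"
| "sim_ins t nx (Op f r a b) = [Op f (rp r) (rp a) (rp b), Op Mod (rp r) (rp r) 0]"
| "sim_ins t nx (Load r a) = [Op Add 3 (rp a) 1, Load (rp r) 3]"
| "sim_ins t nx (Store a r) = [Op Add 3 (rp a) 1, Store 3 (rp r)]"
| "sim_ins t nx (Jump l) = [Jump (t l), Jump nx]"
| "sim_ins t nx (JumpLess a b l) = [JumpLess (rp a) (rp b) (t l), Jump nx]"

definition sim_pre :: "prog \<Rightarrow> instr list" where
  "sim_pre P = map (\<lambda>r. Imm (rp r) 0) [0..<nregs P] @
    [Op Or (rp 0) (rv vWs) (rv vWs), Op Or (rp 1) (rv vDim) (rv vDim),
     Imm 1 aMM, Op Mul 1 1 0, Op Add 1 1 (rv vCnt), Op Mul 1 1 0, Imm 2 0]"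

text \<open>Six instructions per simulated instruction: comparison of the step counter with the
  budget, its increment, and the translated instruction. The fixed length makes jump targets
  computable; a target behind the end of \<open>P\<close> is cut to \<open>length P\<close>, where
  the exit for a halted run lies.\<close>

definition sim_blk :: "prog \<Rightarrow> nat \<Rightarrow> nat \<Rightarrow> instr list" where
  "sim_blk P B k = [JumpLess 2 (rv vBud) (B + 6 * k + 2), Jump (B + 6 * length P + 2), Imm 3 1, Op Add 2 2 3] @
     sim_ins (\<lambda>l. B + 6 * min l (length P)) (B + 6 * k + 6) (P ! k)"

text \<open>The code directly behind the last block reports a halt, the instruction two places
  further an exhausted budget.\<close>

definition sim_code :: "prog \<Rightarrow> nat \<Rightarrow> instr list" where
  "sim_code P off = (let B = off + length (sim_pre P) in
     sim_pre P @ concat (map (sim_blk P B) [0..<length P]) @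
     [Imm (rv vFlag) 1, Jump (B + 6 * length P + 3), Imm (rv vFlag) 0])"

lemma length_sim_blk [simp]: "length (sim_blk P B k) = 6"
  by (cases "P ! k") (auto simp: sim_blk_def)

lemma length_concat_blk: "length (concat (map (sim_blk P B) xs)) = 6 * length xs"
  by (induction xs) auto

lemma length_sim_code: "length (sim_code P off) = length (sim_pre P) + 6 * length P + 3"
  by (simp add: sim_code_def Let_def length_concat_blk)

text \<open>Jumps of the machine are absolute, hence the offset \<open>off\<close> of the generated
  code as an argument.\<close>

fun ccom :: "prog \<Rightarrow> com \<Rightarrow> nat \<Rightarrow> instr list" where
  "ccom P Skip off = []"
| "ccom P (Assign x e) off = cexp e 0 @ [Op Or (rv x) (rt 0) (rt 0)]"
| "ccom P (Wr a e1 e2 e3) off = cexp e1 0 @ cexp e2 1 @ cexp e3 2 @ addr a 0 @ [Store 3 (rt 2)]"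
| "ccom P (c1 ;; c2) off = ccom P c1 off @ ccom P c2 (off + length (ccom P c1 off))"
| "ccom P (If e1 e2 c1 c2) off =
    (let k = cexp e1 0 @ cexp e2 1; t = off + length k; d1 = ccom P c1 (t + 2);
         l2 = t + length d1 + 3; d2 = ccom P c2 l2
     in k @ [JumpLess (rt 0) (rt 1) (t + 2), Jump l2] @ d1 @ [Jump (l2 + length d2)] @ d2)"
| "ccom P (While e1 e2 c) off =
    (let k = cexp e1 0 @ cexp e2 1; t = off + length k; d = ccom P c (t + 2)
     in k @ [JumpLess (rt 0) (rt 1) (t + 2), Jump (t + length d + 3)] @ d @ [Jump off])"
| "ccom P Sim off = sim_code P off"

text \<open>Machine steps to be charged per tick: enough for one traversal of the code, the summand
  \<open>6\<close> paying for one simulated instruction.\<close>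

fun csz :: "prog \<Rightarrow> com \<Rightarrow> nat" where
  "csz P (c1 ;; c2) = csz P c1 + csz P c2"
| "csz P (If e1 e2 c1 c2) = length (cexp e1 0) + length (cexp e2 1) + 3 + csz P c1 + csz P c2"
| "csz P (While e1 e2 c) = length (cexp e1 0) + length (cexp e2 1) + 3 + csz P c"
| "csz P c = length (ccom P c 0) + 6"

fun nonjump :: "instr \<Rightarrow> bool" where
  "nonjump (Jump l) = False"
| "nonjump (JumpLess a b l) = False"
| "nonjump _ = True"

definition code_at :: "prog \<Rightarrow> nat \<Rightarrow> instr list \<Rightarrow> bool" where
  "code_at p off is \<longleftrightarrow> (\<forall>i<length is. off + i < length p \<and> p ! (off + i) = is ! i)"

lemma code_at_Nil [simp]: "code_at p off []"
  by (simp add: code_at_def)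

lemma code_at_Cons [simp]: "code_at p off (i # is) \<longleftrightarrow> off < length p \<and> p ! off = i \<and> code_at p (Suc off) is"
  unfolding code_at_def by (auto simp: less_Suc_eq_0_disj)

lemma code_at_append [simp]: "code_at p off (xs @ ys) \<longleftrightarrow> code_at p off xs \<and> code_at p (off + length xs) ys"
  by (induction xs arbitrary: off) auto

lemma code_at_concat:
  assumes "code_at p off (concat (map f [0..<n]))" "\<And>k. length (f k) = m" "k < n"
  shows "code_at p (off + m * k) (f k)"
proof -
  have len: "length (concat (map f xs)) = m * length xs" for xs
    by (induction xs) (auto simp: assms(2))
  have "[0..<n] = [0..<k] @ k # [Suc k..<n]"
    using assms(3) by (metis le_add1 less_imp_le plus_nat.add_0 upt_add_eq_append upt_conv_Cons le_add_diff_inverse)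
  then show ?thesis using assms(1) by (simp add: len)
qed

lemma step_at: "code_at p (pc m) (i # is) \<Longrightarrow> step w p m = exec w i m"
  by (simp add: step_def halted_def)

lemma pc_exec: "nonjump i \<Longrightarrow> pc (exec w i m) = Suc (pc m)"
  by (cases i) auto

lemma straight_run:
  "code_at p (pc m) is \<Longrightarrow> list_all nonjump is \<Longrightarrow> (step w p ^^ length is) m = fold (exec w) is m"
proof (induction "is" arbitrary: m)
  case (Cons i "is")
  have "step w p m = exec w i m" using Cons.prems step_at by blast
  moreover have "code_at p (pc (exec w i m)) is" using Cons.prems pc_exec by auto
  ultimately show ?case using Cons by (simp add: funpow_Suc_right del: funpow.simps)
qed auto

lemma nonjump_cexp: "list_all nonjump (cexp e d)"
  by (induction e arbitrary: d) (auto simp: addr_def)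

lemma run_trans: "(f ^^ k) m = m' \<Longrightarrow> (f ^^ k') m' = m'' \<Longrightarrow> (f ^^ (k + k')) m = m''"
  by (subst add.commute) (simp add: funpow_add)

context ram
begin

definition rel :: "store \<Rightarrow> state \<Rightarrow> bool" where
  "rel s m \<longleftrightarrow> reg m 0 = R \<and> (\<forall>x. reg m (rv x) = vr s x) \<and>
     (\<forall>a i j. a < R \<longrightarrow> i < R \<longrightarrow> j < R \<longrightarrow> mem m ((a * R + i) * R + j) = ar s a i j)"

lemma addr_less: "a < R \<Longrightarrow> i < R \<Longrightarrow> j < R \<Longrightarrow> (a * R + i) * R + j < W"
proof -
  assume h: "a < R" "i < R" "j < R"
  have "a * R + i < Suc a * R" using h by simp
  also have "Suc a * R \<le> R * R" using h by (intro mult_right_mono) auto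
  finally have 1: "Suc (a * R + i) \<le> R * R" by simp
  have "(a * R + i) * R + j < Suc (a * R + i) * R" using h by simp
  also have "\<dots> \<le> R * R * R" using 1 by (rule mult_right_mono) simp
  finally show ?thesis using R3_le_W by linarith
qed

lemma addr_less': "a < R \<Longrightarrow> i < R \<Longrightarrow> a * R < W \<and> a * R + i < W \<and> (a * R + i) * R < W"
proof -
  assume h: "a < R" "i < R"
  have "a * R + i \<le> (a * R + i) * R" using R_ge by simp
  then show ?thesis using addr_less[OF h, of 0] h R_ge by (simp; linarith)
qed

text \<open>Digits in base \<open>R\<close> are unique, which makes distinct array cells distinct
  memory cells.\<close>

lemma addr_inj:
  assumes "i < R" "j < R" "i' < R" "j' < R" "(a * R + i) * R + j = (a' * R + i') * R + j'"
  shows "a = a' \<and> i = i' \<and> j = j'"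
proof -
  have "((a * R + i) * R + j) div R = a * R + i" "((a' * R + i') * R + j') div R = a' * R + i'"
    "((a * R + i) * R + j) mod R = j" "((a' * R + i') * R + j') mod R = j'"
    using assms(1-4) by auto
  then have 1: "a * R + i = a' * R + i'" "j = j'" using assms(5) by auto
  have "(a * R + i) div R = a" "(a' * R + i') div R = a'" "(a * R + i) mod R = i" "(a' * R + i') mod R = i'"
    using assms(1-4) by auto
  then show ?thesis using 1 by auto
qed

lemma op_eq: "opok W f x y \<Longrightarrow> eval_binop w f x y = opv f x y"
  using eval_binop_opv W_def by simp

lemma addr_correct:
  assumes "reg m 0 = R" "a < R" "reg m (rt d) = i" "reg m (rt (Suc d)) = j" "i < R" "j < R"
  shows "fold (exec w) (addr a d) m = m\<lparr>pc := pc m + 5, reg := (reg m)(3 := (a * R + i) * R + j)\<rparr>"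
proof -
  have "a < W" using assms R_less_W by linarith
  then show ?thesis
    using addr_less'[OF assms(2,5)] addr_less[OF assms(2,5,6)] assms
    by (simp add: addr_def flip: W_def)
qed

text \<open>The induction needs that temporaries below the current level survive: the value of a
  left operand waits in \<open>rt d\<close> while the right operand is evaluated one level
  higher.\<close>

lemma cexp_correct:
  assumes "ok e s" "rel s m"
  shows "reg (fold (exec w) (cexp e d) m) (rt d) = ev e s \<and>
    (\<forall>r. (\<forall>d'\<ge>d. r \<noteq> rt d') \<longrightarrow> r \<noteq> 3 \<longrightarrow> reg (fold (exec w) (cexp e d) m) r = reg m r) \<and>
    mem (fold (exec w) (cexp e d) m) = mem m \<and> pc (fold (exec w) (cexp e d) m) = pc m + length (cexp e d)"
  using assms
proof (induction e arbitrary: d m)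
  case (N k)
  then show ?case by (auto simp flip: W_def)
next
  case (V x)
  then show ?case by (auto simp: rel_def)
next
  case (Bin f e1 e2)
  let ?m1 = "fold (exec w) (cexp e1 d) m"
  let ?m2 = "fold (exec w) (cexp e2 (Suc d)) ?m1"
  have 1: "reg ?m1 (rt d) = ev e1 s" "\<forall>r. (\<forall>d'\<ge>d. r \<noteq> rt d') \<longrightarrow> r \<noteq> 3 \<longrightarrow> reg ?m1 r = reg m r"
    "mem ?m1 = mem m" "pc ?m1 = pc m + length (cexp e1 d)" using Bin.IH(1)[of m d] Bin.prems by auto
  then have "rel s ?m1" using Bin.prems(2) by (auto simp: rel_def)
  then have 2: "reg ?m2 (rt (Suc d)) = ev e2 s" "\<forall>r. (\<forall>d'\<ge>Suc d. r \<noteq> rt d') \<longrightarrow> r \<noteq> 3 \<longrightarrow> reg ?m2 r = reg ?m1 r"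
    "mem ?m2 = mem m" "pc ?m2 = pc ?m1 + length (cexp e2 (Suc d))"
    using Bin.IH(2)[of ?m1 "Suc d"] Bin.prems 1 by auto
  have 3: "reg ?m2 (rt d) = ev e1 s" using 1 2 by auto
  show ?case using 1 2 3 Bin.prems(1) by (auto simp: op_eq)
next
  case (Rd a e1 e2)
  let ?m1 = "fold (exec w) (cexp e1 d) m"
  let ?m2 = "fold (exec w) (cexp e2 (Suc d)) ?m1"
  have 1: "reg ?m1 (rt d) = ev e1 s" "\<forall>r. (\<forall>d'\<ge>d. r \<noteq> rt d') \<longrightarrow> r \<noteq> 3 \<longrightarrow> reg ?m1 r = reg m r"
    "mem ?m1 = mem m" "pc ?m1 = pc m + length (cexp e1 d)" using Rd.IH(1)[of m d] Rd.prems by auto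
  then have "rel s ?m1" using Rd.prems(2) by (auto simp: rel_def)
  then have 2: "reg ?m2 (rt (Suc d)) = ev e2 s" "\<forall>r. (\<forall>d'\<ge>Suc d. r \<noteq> rt d') \<longrightarrow> r \<noteq> 3 \<longrightarrow> reg ?m2 r = reg ?m1 r"
    "mem ?m2 = mem m" "pc ?m2 = pc ?m1 + length (cexp e2 (Suc d))"
    using Rd.IH(2)[of ?m1 "Suc d"] Rd.prems 1 by auto
  have 3: "reg ?m2 (rt d) = ev e1 s" using 1 2 by auto
  have 4: "reg ?m2 0 = R" using 1 2 Rd.prems(2) by (auto simp: rel_def)
  have a: "a < R" "ev e1 s < R" "ev e2 s < R" using Rd.prems(1) R_ge by auto
  have 5: "fold (exec w) (addr a d) ?m2 = ?m2\<lparr>pc := pc ?m2 + 5, reg := (reg ?m2)(3 := (a * R + ev e1 s) * R + ev e2 s)\<rparr>"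
    using addr_correct[OF 4 a(1) 3 2(1) a(2,3)] .
  show ?case using 1 2 3 5 Rd.prems(2) a by (auto simp: rel_def addr_def)
qed

lemma cexp_run:
  assumes "ok e s" "rel s m" "code_at p (pc m) (cexp e d)"
  obtains m' where "(step w p ^^ length (cexp e d)) m = m'" "reg m' (rt d) = ev e s" "rel s m'"
    "pc m' = pc m + length (cexp e d)" "\<And>d'. d' < d \<Longrightarrow> reg m' (rt d') = reg m (rt d')" "mem m' = mem m"
proof -
  let ?m = "fold (exec w) (cexp e d) m"
  have 1: "reg ?m (rt d) = ev e s" "\<forall>r. (\<forall>d'\<ge>d. r \<noteq> rt d') \<longrightarrow> r \<noteq> 3 \<longrightarrow> reg ?m r = reg m r" 
    "mem ?m = mem m" "pc ?m = pc m + length (cexp e d)"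
    using cexp_correct[OF assms(1,2), of d] by auto
  show ?thesis
    by (rule that[of ?m]) (use 1 assms straight_run[OF assms(3) nonjump_cexp] in \<open>auto simp: rel_def\<close>)
qed

end

lemma and_or_xor_less:
  fixes x y :: nat
  assumes "x < 2 ^ n" "y < 2 ^ n"
  shows "and x y < 2 ^ n" "or x y < 2 ^ n" "xor x y < 2 ^ n"
proof -
  have "take_bit n x = x" "take_bit n y = y" using assms by (auto simp: take_bit_nat_eq_self_iff)
  then have "take_bit n (and x y) = and x y" "take_bit n (or x y) = or x y" "take_bit n (xor x y) = xor x y"
    by simp_all
  then show "and x y < 2 ^ n" "or x y < 2 ^ n" "xor x y < 2 ^ n"
    by (metis take_bit_nat_less_exp)+
qed

lemma eval_binop_less:
  assumes "x < 2 ^ n" "y < 2 ^ n"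
  shows "eval_binop n f x y < 2 ^ n"
proof (cases f)
  case Div
  then show ?thesis using assms by (simp) (meson div_le_dividend le_less_trans)
next
  case Mod
  then show ?thesis using assms by simp (meson mod_less_eq_dividend le_less_trans)
next
  case Shr
  then show ?thesis using assms by simp (meson div_le_dividend le_less_trans)
qed (use assms and_or_xor_less[OF assms] in auto)

text \<open>Since \<open>2 ^ n\<close> divides \<open>2 ^ w\<close>, wrapping around modulo
  \<open>2 ^ w\<close> is invisible after reduction modulo \<open>2 ^ n\<close>, and operations that
  never wrap give results below \<open>2 ^ n\<close> anyway. A borrowing subtraction needs an
  argument of its own: \<open>2 ^ w\<close> and \<open>2 ^ n\<close> differ by a multiple of
  \<open>2 ^ n\<close>.\<close>

lemma eval_binop_mod:
  assumes "x < 2 ^ n" "y < 2 ^ n" "n \<le> w"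
  shows "eval_binop w f x y mod 2 ^ n = eval_binop n f x y"
proof -
  have d: "(2::nat) ^ n dvd 2 ^ w" using assms(3) by (rule le_imp_power_dvd)
  have less: "eval_binop n f x y < 2 ^ n" by (rule eval_binop_less[OF assms(1,2)])
  show ?thesis
  proof (cases f)
    case Sub
    obtain k where k: "(2::nat) ^ w = 2 ^ n * k" using d by (elim dvdE)
    have "k \<noteq> 0" using k by (metis mult_0_right power_not_zero zero_neq_numeral)
    then obtain k' where k': "k = Suc k'" using not0_implies_Suc by blast
    show ?thesis
    proof (cases "y \<le> x")
      case False
      then have "2 ^ w + x - y = (2 ^ n + x - y) + 2 ^ n * k'" using assms(2) k k' by simp
      then have "(2 ^ w + x - y) mod 2 ^ n = (2 ^ n + x - y) mod 2 ^ n" by simp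
      then show ?thesis using Sub False less by simp
    qed (use Sub less in simp)
  qed (use less d in \<open>auto simp: mod_mod_cancel\<close>)
qed

lemma halted_stay: "halted p m \<Longrightarrow> (step v p ^^ k) m = m"
  by (induction k) (auto simp: step_def)

lemma funpow2: "(f ^^ 2) x = f (f x)"
  by (simp add: numeral_2_eq_2)

lemma step_nth: "pc m < length p \<Longrightarrow> step w p m = exec w (p ! pc m) m"
  by (simp add: step_def halted_def)

section \<open>Simulation of a program of smaller word size\<close>

context ram
begin

text \<open>\<open>\<sigma>\<close> is the simulated state, \<open>m\<close> the simulating one,
  \<open>c\<close> the number of steps counted so far. The bounds on \<open>\<sigma>\<close> keep
  every simulated address inside the memory row \<open>(aMM, vr s vCnt)\<close>.\<close>

definition srel :: "nat \<Rightarrow> store \<Rightarrow> state \<Rightarrow> nat \<Rightarrow> state \<Rightarrow> bool" where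
  "srel B s \<sigma> c m \<longleftrightarrow> pc m = B + 6 * min (pc \<sigma>) (length P) \<and> reg m 0 = R \<and>
     reg m 1 = (aMM * R + vr s vCnt) * R \<and> reg m 2 = c \<and> (\<forall>x. reg m (rv x) = vr s x) \<and>
     (\<forall>r<nregs P. reg m (rp r) = reg \<sigma> r) \<and>
     (\<forall>a i j. a < R \<longrightarrow> i < R \<longrightarrow> j < R \<longrightarrow> mem m ((a * R + i) * R + j) =
        (if a = aMM \<and> i = vr s vCnt then mem \<sigma> j else ar s a i j)) \<and>
     (\<forall>r. reg \<sigma> r < R) \<and> (\<forall>j. mem \<sigma> j < R)"

lemma sim_step:
  assumes s: "srel B s \<sigma> c m" and nh: "\<not> halted P \<sigma>" and c: "c < vr s vBud" "vr s vBud < W" "vr s vCnt < R"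
    and code: "code_at p B (concat (map (sim_blk P B) [0..<length P]))"
  shows "\<exists>k\<le>6. \<exists>m'. (step w p ^^ k) m = m' \<and> srel B s (step ws P \<sigma>) (Suc c) m'"
proof -
  let ?k = "pc \<sigma>"
  let ?o = "B + 6 * ?k"
  have k: "?k < length P" using nh by (simp add: halted_def)
  have "code_at p ?o (sim_blk P B ?k)"
    using code_at_concat[OF code, of 6 ?k] k by simp
  then have p: "?o + 5 < length p" "p ! ?o = JumpLess 2 (rv vBud) (?o + 2)"
    "p ! (?o + 2) = Imm 3 1" "p ! (?o + 3) = Op Add 2 2 3"
    and p2: "code_at p (?o + 4) (sim_ins (\<lambda>l. B + 6 * min l (length P)) (?o + 6) (P ! ?k))"
    by (cases "P ! ?k"; simp add: sim_blk_def eval_nat_numeral)+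
  have m: "pc m = ?o" "reg m 0 = R" "reg m 1 = (aMM * R + vr s vCnt) * R" "reg m 2 = c"
    "\<And>x. reg m (rv x) = vr s x" "\<And>r. r < nregs P \<Longrightarrow> reg m (rp r) = reg \<sigma> r"
    "\<And>a i j. a < R \<Longrightarrow> i < R \<Longrightarrow> j < R \<Longrightarrow> mem m ((a * R + i) * R + j) =
        (if a = aMM \<and> i = vr s vCnt then mem \<sigma> j else ar s a i j)"
    and \<sigma>: "\<And>r. reg \<sigma> r < R" "\<And>j. mem \<sigma> j < R"
    using s k by (auto simp: srel_def min_def)
  define q where "q = ?o + 4"
  have q: "q < length p" "Suc q < length p" using p(1) by (auto simp: q_def)
  have q6: "B + 6 * Suc ?k = Suc (Suc q)" by (simp add: q_def)
  define m3 where "m3 = m\<lparr>pc := q, reg := (reg m)(3 := 1, 2 := Suc c)\<rparr>"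
  have W1: "1 < W" "c + 1 < W" using R_less_W R_ge c by linarith+
  have 1: "step w p m = m\<lparr>pc := ?o + 2\<rparr>" using m c p by (simp add: step_nth)
  have 2: "step w p (m\<lparr>pc := ?o + 2\<rparr>) = m\<lparr>pc := ?o + 3, reg := (reg m)(3 := 1)\<rparr>"
    using p W1 by (simp add: step_nth flip: W_def)
  have 3: "step w p (m\<lparr>pc := ?o + 3, reg := (reg m)(3 := 1)\<rparr>) = m3"
    using p W1 m by (simp add: step_nth m3_def q_def flip: W_def)
  have run3: "(step w p ^^ 3) m = m3"
    using 1 2 3 by (simp add: eval_nat_numeral)
  have "(step w p ^^ (2 + 3)) m = (step w p ^^ 2) ((step w p ^^ 3) m)" unfolding funpow_add by simp
  then have run5: "(step w p ^^ 5) m = (step w p ^^ 2) m3" unfolding run3 by simp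
  have "(step w p ^^ (1 + 3)) m = (step w p ^^ 1) ((step w p ^^ 3) m)" unfolding funpow_add by simp
  then have run4: "(step w p ^^ 4) m = (step w p ^^ 1) m3" unfolding run3 by simp
  have st: "step ws P \<sigma> = exec ws (P ! ?k) \<sigma>" using k by (simp add: step_nth)
  have rl: "r \<in> set (regs (P ! ?k)) \<Longrightarrow> reg m (rp r) = reg \<sigma> r" for r
    using regs_less_nregs[OF k] m(6) by blast
  have sk: "min (Suc ?k) (length P) = Suc ?k" using k by simp
  have addr: "(aMM * R + vr s vCnt) * R + j < W" if "j < R" for j
    using addr_less[OF _ c(3) that, of aMM] R_ge by simp
  have aMM: "aMM < R" using R_ge by simp
  have R0: "R > 0" using R_ge by simp
  note m3 = m3_def
  show ?thesis
  proof (cases "P ! ?k")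
    case (Imm r x)
    have p3: "p ! q = Imm (rp r) x" "p ! Suc q = Op Mod (rp r) (rp r) 0"
      using p2 Imm by (auto simp: eval_nat_numeral q_def)
    have md: "x mod 2 ^ w mod R = x mod 2 ^ ws" unfolding R_def
      by (rule mod_mod_cancel) (simp add: le_imp_power_dvd ws_def)
    have xl: "x mod 2 ^ ws < R" by (simp add: R_def)
    have "(step w p ^^ 2) m3 = m3\<lparr>pc := Suc (Suc q), reg := (reg m3)(rp r := x mod 2 ^ ws)\<rparr>"
      using q p3 m md by (simp add: m3 step_nth funpow2)
    then have "(step w p ^^ 5) m = m3\<lparr>pc := Suc (Suc q), reg := (reg m3)(rp r := x mod 2 ^ ws)\<rparr>"
      unfolding run5 .
    moreover have "srel B s (step ws P \<sigma>) (Suc c) (m3\<lparr>pc := Suc (Suc q), reg := (reg m3)(rp r := x mod 2 ^ ws)\<rparr>)"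
      using m \<sigma> sk q6 xl by (auto simp: srel_def st Imm m3)
    ultimately show ?thesis by (intro exI[of _ 5]) auto
  next
    case (Op f r a b)
    have p3: "p ! q = Op f (rp r) (rp a) (rp b)" "p ! Suc q = Op Mod (rp r) (rp r) 0"
      using p2 Op by (auto simp: eval_nat_numeral q_def)
    have ab: "reg m (rp a) = reg \<sigma> a" "reg m (rp b) = reg \<sigma> b" using rl Op by auto
    have md: "eval_binop w f (reg \<sigma> a) (reg \<sigma> b) mod R = eval_binop ws f (reg \<sigma> a) (reg \<sigma> b)" 
      unfolding R_def using \<sigma>(1)[unfolded R_def] by (intro eval_binop_mod) (auto simp: ws_def)
    have le: "eval_binop ws f (reg \<sigma> a) (reg \<sigma> b) < R"
      unfolding R_def using \<sigma>(1)[unfolded R_def] by (intro eval_binop_less) auto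
    let ?m = "m3\<lparr>pc := Suc (Suc q), reg := (reg m3)(rp r := eval_binop ws f (reg \<sigma> a) (reg \<sigma> b))\<rparr>"
    have "(step w p ^^ 2) m3 = ?m"
      using q p3 m md ab by (simp add: m3 step_nth funpow2)
    then have "(step w p ^^ 5) m = ?m"
      unfolding run5 .
    moreover have "srel B s (step ws P \<sigma>) (Suc c) ?m"
      using m \<sigma> sk q6 le by (auto simp: srel_def st Op m3)
    ultimately show ?thesis by (intro exI[of _ 5]) auto
  next
    case (Load r a)
    have p3: "p ! q = Op Add 3 (rp a) 1" "p ! Suc q = Load (rp r) 3"
      using p2 Load by (auto simp: eval_nat_numeral q_def)
    have ab: "reg m (rp a) = reg \<sigma> a" using rl Load by auto
    let ?m = "m3\<lparr>pc := Suc (Suc q), reg := (reg m3)(3 := (aMM * R + vr s vCnt) * R + reg \<sigma> a, rp r := mem \<sigma> (reg \<sigma> a))\<rparr>"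
    have "(step w p ^^ 2) m3 = ?m"
      using q p3 m ab addr[OF \<sigma>(1), of a] m(7)[OF aMM c(3) \<sigma>(1), of a]
      by (simp add: m3 step_nth funpow2 add.commute flip: W_def)
    then have "(step w p ^^ 5) m = ?m"
      unfolding run5 .
    moreover have "srel B s (step ws P \<sigma>) (Suc c) ?m"
      using m \<sigma> sk q6 by (auto simp: srel_def st Load m3)
    ultimately show ?thesis by (intro exI[of _ 5]) auto
  next
    case (Store a r)
    have p3: "p ! q = Op Add 3 (rp a) 1" "p ! Suc q = Store 3 (rp r)"
      using p2 Store by (auto simp: eval_nat_numeral q_def)
    have ab: "reg m (rp a) = reg \<sigma> a" "reg m (rp r) = reg \<sigma> r" using rl Store by auto
    let ?a = "(aMM * R + vr s vCnt) * R + reg \<sigma> a"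
    let ?m = "m3\<lparr>pc := Suc (Suc q), reg := (reg m3)(3 := ?a), mem := (mem m3)(?a := reg \<sigma> r)\<rparr>"
    have "(step w p ^^ 2) m3 = ?m"
      using q p3 m ab addr[OF \<sigma>(1), of a]
      by (simp add: m3 step_nth funpow2 add.commute flip: W_def)
    then have "(step w p ^^ 5) m = ?m"
      unfolding run5 .
    moreover have "srel B s (step ws P \<sigma>) (Suc c) ?m"
      unfolding srel_def
    proof (intro conjI allI impI)
      fix x i j assume h: "x < R" "i < R" "j < R"
      show "mem ?m ((x * R + i) * R + j) =
        (if x = aMM \<and> i = vr s vCnt then mem (step ws P \<sigma>) j else ar s x i j)"
        using addr_inj[OF h(2,3) c(3) \<sigma>(1), of x aMM a] m(7)[OF h] by (auto simp: st Store m3)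
    qed (use m \<sigma> sk q6 in \<open>auto simp: st Store m3\<close>)
    ultimately show ?thesis by (intro exI[of _ 5]) auto
  next
    case (Jump l)
    have p3: "p ! q = Jump (B + 6 * min l (length P))"
      using p2 Jump by (auto simp: eval_nat_numeral q_def)
    let ?m = "m3\<lparr>pc := B + 6 * min l (length P)\<rparr>"
    have "(step w p ^^ 1) m3 = ?m"
      using q p3 m by (simp add: m3 step_nth funpow2)
    then have "(step w p ^^ 4) m = ?m"
      unfolding run4 .
    moreover have "srel B s (step ws P \<sigma>) (Suc c) ?m"
      using m \<sigma> sk q6 by (auto simp: srel_def st Jump m3)
    ultimately show ?thesis by (intro exI[of _ 4]) auto
  next
    case (JumpLess a b l)
    have p3: "p ! q = JumpLess (rp a) (rp b) (B + 6 * min l (length P))" "p ! Suc q = Jump (Suc (Suc q))"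
      using p2 JumpLess by (auto simp: eval_nat_numeral q_def)
    have ab: "reg m (rp a) = reg \<sigma> a" "reg m (rp b) = reg \<sigma> b" using rl JumpLess by auto
    show ?thesis
    proof (cases "reg \<sigma> a < reg \<sigma> b")
      case True
      let ?m = "m3\<lparr>pc := B + 6 * min l (length P)\<rparr>"
      have "(step w p ^^ 1) m3 = ?m"
        using q p3 m ab True by (simp add: m3 step_nth funpow2)
      then have "(step w p ^^ 4) m = ?m"
        unfolding run4 .
      moreover have "srel B s (step ws P \<sigma>) (Suc c) ?m"
        using m \<sigma> sk q6 True by (auto simp: srel_def st JumpLess m3)
      ultimately show ?thesis by (intro exI[of _ 4]) auto
    next
      case False
      let ?m = "m3\<lparr>pc := Suc (Suc q)\<rparr>"
      have "(step w p ^^ 2) m3 = ?m"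
        using q p3 m ab False by (simp add: m3 step_nth funpow2)
      then have "(step w p ^^ 5) m = ?m"
        unfolding run5 .
      moreover have "srel B s (step ws P \<sigma>) (Suc c) ?m"
        using m \<sigma> sk q6 False by (auto simp: srel_def st JumpLess m3)
      ultimately show ?thesis by (intro exI[of _ 5]) auto
    qed
  qed
qed

text \<open>A halted machine no longer moves, so the simulation may stop early with a counter below
  the budget; otherwise the counter reaches the budget. The final disjunction tells which exit the
  code takes.\<close>

lemma sim_steps:
  assumes "srel B s \<sigma> c m" "vr s vBud < W" "vr s vCnt < R" "c + L = vr s vBud"
    and code: "code_at p B (concat (map (sim_blk P B) [0..<length P]))"
  shows "\<exists>k\<le>6 * L. \<exists>m' c'. (step w p ^^ k) m = m' \<and> srel B s ((step ws P ^^ L) \<sigma>) c' m' \<and>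
     (halted P ((step ws P ^^ L) \<sigma>) \<or> c' = vr s vBud)"
  using assms(1,4)
proof (induction L arbitrary: \<sigma> c m)
  case 0
  then show ?case by (intro exI[of _ 0]) auto
next
  case (Suc L)
  show ?case
  proof (cases "halted P \<sigma>")
    case True
    then show ?thesis using Suc.prems halted_stay[OF True, where v = ws and k = "Suc L"]
      by (intro exI[of _ 0]) auto
  next
    case False
    from sim_step[OF Suc.prems(1) False _ assms(2,3) code] Suc.prems(2) obtain k m' where
      1: "k \<le> 6" "(step w p ^^ k) m = m'" "srel B s (step ws P \<sigma>) (Suc c) m'" by auto
    from Suc.IH[OF 1(3)] Suc.prems(2) obtain k2 m2 c2 where
      2: "k2 \<le> 6 * L" "(step w p ^^ k2) m' = m2" "srel B s ((step ws P ^^ L) (step ws P \<sigma>)) c2 m2"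
      "halted P ((step ws P ^^ L) (step ws P \<sigma>)) \<or> c2 = vr s vBud" by auto
    have "(step ws P ^^ Suc L) \<sigma> = (step ws P ^^ L) (step ws P \<sigma>)"
      by (simp add: funpow_swap1)
    then show ?thesis using 1 2 run_trans[OF 1(2) 2(2)]
      by (intro exI[of _ "k + k2"]) (simp, blast)
  qed
qed

lemma sim_init_run:
  "fold (exec w) (map (\<lambda>r. Imm (rp r) 0) [0..<k]) m =
     m\<lparr>pc := pc m + k, reg := (\<lambda>x. if \<exists>r<k. x = rp r then 0 else reg m x)\<rparr>"
proof (induction k)
  case (Suc k)
  have "(\<lambda>x. if \<exists>r<k. x = rp r then 0 else reg m x)(rp k := 0) = (\<lambda>x. if \<exists>r<Suc k. x = rp r then 0 else reg m x)"
    by (auto simp: fun_eq_iff less_Suc_eq)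
  with Suc show ?case by simp
qed auto

lemma sim_correct:
  assumes "rel s m" and code: "code_at p (pc m) (sim_code P (pc m))"
    and s: "vr s vBud < W" "vr s vCnt < R" "vr s vWs = ws" "vr s vDim < R" "\<forall>j. ar s aMM (vr s vCnt) j < R"
    and \<sigma>: "\<sigma> = (step ws P ^^ vr s vBud) (sim_start s)"
  shows "\<exists>k\<le>length (sim_code P (pc m)) + 6 * vr s vBud. \<exists>m'. (step w p ^^ k) m = m' \<and> pc m' = pc m + length (sim_code P (pc m)) \<and>
    rel (s\<lparr>vr := (vr s)(vFlag := (if halted P \<sigma> then 1 else 0)),
           ar := (ar s)(aMM := (ar s aMM)(vr s vCnt := mem \<sigma>))\<rparr>) m'"
proof -
  let ?B = "pc m + length (sim_pre P)"
  let ?E = "?B + 6 * length P"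
  have c: "code_at p (pc m) (sim_pre P)" "code_at p ?B (concat (map (sim_blk P ?B) [0..<length P]))"
    "code_at p ?E [Imm (rv vFlag) 1, Jump (?E + 3), Imm (rv vFlag) 0]"
    using code by (simp_all add: sim_code_def Let_def length_concat_blk)
  let ?m1 = "fold (exec w) (sim_pre P) m"
  have nj: "list_all nonjump (sim_pre P)" by (auto simp: sim_pre_def list_all_iff)
  have run1: "(step w p ^^ length (sim_pre P)) m = ?m1" by (rule straight_run[OF c(1) nj])
  have n2: "2 \<le> nregs P" by (simp add: nregs_def)
  have R1: "1 < W" "aMM < W" "aMM < R" "0 < R" using R_ge R_less_W by linarith+
  have "pc ?m1 = ?B \<and> reg ?m1 = (\<lambda>x. if \<exists>r<nregs P. x = rp r then 0 else reg m x)
      (rp 0 := vr s vWs, rp 1 := vr s vDim, 1 := (aMM * R + vr s vCnt) * R, 2 := 0) \<and> mem ?m1 = mem m"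
    using assms(1) addr_less'[OF R1(3) s(2)] R1
    by (auto simp: sim_pre_def sim_init_run rel_def fun_eq_iff simp flip: W_def)
  then have m1: "pc ?m1 = ?B" "reg ?m1 = (\<lambda>x. if \<exists>r<nregs P. x = rp r then 0 else reg m x)
      (rp 0 := vr s vWs, rp 1 := vr s vDim, 1 := (aMM * R + vr s vCnt) * R, 2 := 0)" "mem ?m1 = mem m"
    by auto
  have "srel ?B s (sim_start s) 0 ?m1"
    using assms(1) s ws_less R1 n2 unfolding srel_def m1 by (auto simp: sim_start_def rel_def)
  from sim_steps[OF this s(1,2) _ c(2)] obtain k m2 c2 where
    2: "k \<le> 6 * vr s vBud" "(step w p ^^ k) ?m1 = m2" "srel ?B s \<sigma> c2 m2" "halted P \<sigma> \<or> c2 = vr s vBud"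
    unfolding \<sigma> by auto
  let ?s = "s\<lparr>vr := (vr s)(vFlag := (if halted P \<sigma> then 1 else 0)),
           ar := (ar s)(aMM := (ar s aMM)(vr s vCnt := mem \<sigma>))\<rparr>"
  have "\<exists>k3\<le>3. \<exists>m'. (step w p ^^ k3) m2 = m' \<and> pc m' = ?E + 3 \<and> rel ?s m'"
  proof (cases "halted P \<sigma>")
    case True
    then have pc2: "pc m2 = ?E" using 2(3) by (simp add: srel_def halted_def min_def)
    have "step w p m2 = m2\<lparr>pc := Suc ?E, reg := (reg m2)(rv vFlag := 1)\<rparr>"
      using c(3) pc2 R1 by (simp add: step_nth flip: W_def)
    moreover have "step w p (m2\<lparr>pc := Suc ?E, reg := (reg m2)(rv vFlag := 1)\<rparr>) =
        m2\<lparr>pc := ?E + 3, reg := (reg m2)(rv vFlag := 1)\<rparr>"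
      using c(3) by (simp add: step_nth)
    ultimately have "(step w p ^^ 2) m2 = m2\<lparr>pc := ?E + 3, reg := (reg m2)(rv vFlag := 1)\<rparr>"
      by (simp add: numeral_2_eq_2)
    moreover have "rel ?s (m2\<lparr>pc := ?E + 3, reg := (reg m2)(rv vFlag := 1)\<rparr>)"
      using 2(3) True by (auto simp: srel_def rel_def)
    ultimately show ?thesis by (intro exI[of _ 2]) auto
  next
    case False
    then have k: "pc \<sigma> < length P" by (simp add: halted_def)
    let ?o = "?B + 6 * pc \<sigma>"
    have pc2: "pc m2 = ?o" using 2(3) k by (simp add: srel_def)
    have "code_at p ?o (sim_blk P ?B (pc \<sigma>))"
      using code_at_concat[OF c(2), of 6 "pc \<sigma>"] k by simp
    then have p: "?o < length p" "Suc ?o < length p" "p ! ?o = JumpLess 2 (rv vBud) (?o + 2)" "p ! Suc ?o = Jump (?E + 2)"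
      by (auto simp: sim_blk_def)
    have nb: "reg m2 2 = vr s vBud" "reg m2 (rv vBud) = vr s vBud" using 2(3,4) False by (auto simp: srel_def)
    have "step w p m2 = m2\<lparr>pc := Suc ?o\<rparr>" using p nb pc2 by (simp add: step_nth)
    moreover have "step w p (m2\<lparr>pc := Suc ?o\<rparr>) = m2\<lparr>pc := ?E + 2\<rparr>" using p by (simp add: step_nth)
    moreover have "step w p (m2\<lparr>pc := ?E + 2\<rparr>) = m2\<lparr>pc := ?E + 3, reg := (reg m2)(rv vFlag := 0)\<rparr>"
      using c(3) by (simp add: step_nth)
    ultimately have "(step w p ^^ 3) m2 = m2\<lparr>pc := ?E + 3, reg := (reg m2)(rv vFlag := 0)\<rparr>"
      by (simp add: numeral_3_eq_3)
    moreover have "rel ?s (m2\<lparr>pc := ?E + 3, reg := (reg m2)(rv vFlag := 0)\<rparr>)"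
      using 2(3) False by (auto simp: srel_def rel_def)
    ultimately show ?thesis by (intro exI[of _ 3]) auto
  qed
  then obtain k3 m3 where 3: "k3 \<le> 3" "(step w p ^^ k3) m2 = m3" "pc m3 = ?E + 3" "rel ?s m3" by auto
  have "(step w p ^^ (length (sim_pre P) + k + k3)) m = m3"
    using run_trans[OF run_trans[OF run1 2(2)] 3(2)] .
  then show ?thesis using 2(1) 3
    by (intro exI[of _ "length (sim_pre P) + k + k3"]) (auto simp: length_sim_code)
qed

lemma cond_run:
  assumes "rel s m" "ok e1 s" "ok e2 s" "code_at p (pc m) (cexp e1 0 @ cexp e2 1 @ [JumpLess (rt 0) (rt 1) l])"
  obtains m' where "(step w p ^^ (length (cexp e1 0) + length (cexp e2 1) + 1)) m = m'" "rel s m'"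
    "pc m' = (if ev e1 s < ev e2 s then l else pc m + length (cexp e1 0) + length (cexp e2 1) + 1)"
proof -
  from assms(4) have c: "code_at p (pc m) (cexp e1 0)" "code_at p (pc m + length (cexp e1 0)) (cexp e2 1)"
    "pc m + length (cexp e1 0) + length (cexp e2 1) < length p"
    "p ! (pc m + length (cexp e1 0) + length (cexp e2 1)) = JumpLess (rt 0) (rt 1) l"
    by (auto simp: add.assoc)
  obtain m1 where 1: "(step w p ^^ length (cexp e1 0)) m = m1" "reg m1 (rt 0) = ev e1 s" "rel s m1"
    "pc m1 = pc m + length (cexp e1 0)" using cexp_run[OF assms(2,1) c(1)] by metis
  obtain m2 where 2: "(step w p ^^ length (cexp e2 1)) m1 = m2" "reg m2 (rt 1) = ev e2 s" "rel s m2"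
    "pc m2 = pc m1 + length (cexp e2 1)" "reg m2 (rt 0) = reg m1 (rt 0)"
    using cexp_run[OF assms(3) 1(3), of p 1] c(2) 1(4) by (metis less_one)
  have 3: "(step w p ^^ 1) m2 = m2\<lparr>pc := (if ev e1 s < ev e2 s then l else pc m2 + 1)\<rparr>"
    using c(3,4) 1 2 by (simp add: step_nth)
  show ?thesis
    by (rule that[OF run_trans[OF run_trans[OF 1(1) 2(1)] 3]])
      (use 1(4) 2(3,4) in \<open>auto simp: rel_def\<close>)
qed

text \<open>One factor \<open>csz P c\<close> pays for the code outside of loops; each tick pays for
  a further loop iteration together with its test, or for one simulated step.\<close>

theorem ccom_correct:
  assumes "big c s t s'" "rel s m" "code_at p (pc m) (ccom P c (pc m))"
  shows "\<exists>k\<le>csz P c * Suc t. \<exists>m'. (step w p ^^ k) m = m' \<and> pc m' = pc m + length (ccom P c (pc m)) \<and> rel s' m'"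
  using assms
proof (induction arbitrary: m rule: big.induct)
  case (Skip s)
  then show ?case by (intro exI[of _ 0]) auto
next
  case (Assign e s x)
  obtain m1 where 1: "(step w p ^^ length (cexp e 0)) m = m1" "reg m1 (rt 0) = ev e s" "rel s m1"
    "pc m1 = pc m + length (cexp e 0)" using cexp_run[OF Assign(1,2), of p 0] Assign(3) by auto
  have 2: "(step w p ^^ 1) m1 = m1\<lparr>pc := pc m1 + 1, reg := (reg m1)(rv x := ev e s)\<rparr>"
    using Assign(3) 1 by (simp add: step_nth)
  show ?case
    by (rule exI[of _ "length (cexp e 0) + 1"]) (use run_trans[OF 1(1) 2] 1 in \<open>auto simp: rel_def\<close>)
next
  case (Wr e1 s e2 e3 a)
  have c: "code_at p (pc m) (cexp e1 0)" "code_at p (pc m + length (cexp e1 0)) (cexp e2 1)"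
    "code_at p (pc m + length (cexp e1 0) + length (cexp e2 1)) (cexp e3 2)"
    "code_at p (pc m + length (cexp e1 0) + length (cexp e2 1) + length (cexp e3 2)) (addr a 0 @ [Store 3 (rt 2)])"
    using Wr.prems(2) by (simp_all add: add.assoc)
  obtain m1 where 1: "(step w p ^^ length (cexp e1 0)) m = m1" "reg m1 (rt 0) = ev e1 s" "rel s m1"
    "pc m1 = pc m + length (cexp e1 0)" using cexp_run[OF Wr(1) Wr.prems(1) c(1)] by metis
  obtain m2 where 2: "(step w p ^^ length (cexp e2 1)) m1 = m2" "reg m2 (rt 1) = ev e2 s" "rel s m2"
    "pc m2 = pc m1 + length (cexp e2 1)" "reg m2 (rt 0) = reg m1 (rt 0)"
    using cexp_run[OF Wr(2) 1(3), of p 1] c(2) 1(4) by (metis less_one)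
  obtain m3 where 3: "(step w p ^^ length (cexp e3 2)) m2 = m3" "reg m3 (rt 2) = ev e3 s" "rel s m3"
    "pc m3 = pc m2 + length (cexp e3 2)" "reg m3 (rt 0) = reg m2 (rt 0)" "reg m3 (rt 1) = reg m2 (rt 1)"
    using cexp_run[OF Wr(3) 2(3), of p 2] c(3) 1(4) 2(4) by (metis one_less_numeral_iff semiring_norm(76) zero_less_numeral)
  have a: "a < R" using Wr(4) R_ge by simp
  let ?a = "(a * R + ev e1 s) * R + ev e2 s"
  let ?m4 = "m3\<lparr>pc := pc m3 + 5, reg := (reg m3)(3 := ?a)\<rparr>"
  have f4: "fold (exec w) (addr a 0) m3 = ?m4"
    using Wr(5,6) 1(2) 2(2,5) 3(3,5,6) by (intro addr_correct a) (auto simp: rel_def)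
  have len: "length (addr a 0) = 5" by (simp add: addr_def)
  have "(step w p ^^ length (addr a 0)) m3 = fold (exec w) (addr a 0) m3"
    by (rule straight_run) (use c(4) 1 2 3 in \<open>auto simp: addr_def\<close>)
  then have 4: "(step w p ^^ 5) m3 = ?m4" unfolding f4 len .
  have p5: "pc m3 + 5 < length p" "p ! (pc m3 + 5) = Store 3 (rt 2)"
    using c(4) 1(4) 2(4) 3(4) by (simp_all add: addr_def eval_nat_numeral)
  have 5: "(step w p ^^ 1) ?m4 = ?m4\<lparr>pc := pc m3 + 6, mem := (mem m3)(?a := ev e3 s)\<rparr>"
    using p5 3 by (simp add: step_nth)
  have rel: "rel (s\<lparr>ar := upd3 (ar s) a (ev e1 s) (ev e2 s) (ev e3 s)\<rparr>) (?m4\<lparr>pc := pc m3 + 6, mem := (mem m3)(?a := ev e3 s)\<rparr>)"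
    unfolding rel_def
  proof (intro conjI allI impI)
    fix x i j assume h: "x < R" "i < R" "j < R"
    have "(x * R + i) * R + j = ?a \<longleftrightarrow> x = a \<and> i = ev e1 s \<and> j = ev e2 s"
      using addr_inj[OF h(2,3) Wr(5,6)] by auto
    then show "mem (?m4\<lparr>pc := pc m3 + 6, mem := (mem m3)(?a := ev e3 s)\<rparr>) ((x * R + i) * R + j) =
      ar (s\<lparr>ar := upd3 (ar s) a (ev e1 s) (ev e2 s) (ev e3 s)\<rparr>) x i j"
      using 3(3) h by (simp add: rel_def upd3_def)
  qed (use 3(3) in \<open>auto simp: rel_def\<close>)
  let ?m5 = "?m4\<lparr>pc := pc m3 + 6, mem := (mem m3)(?a := ev e3 s)\<rparr>"
  let ?K = "length (cexp e1 0) + length (cexp e2 1) + length (cexp e3 2) + 5 + 1"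
  have run: "(step w p ^^ ?K) m = ?m5"
    using run_trans[OF run_trans[OF run_trans[OF run_trans[OF 1(1) 2(1)] 3(1)] 4] 5] .
  have pc: "pc ?m5 = pc m + length (ccom P (Wr a e1 e2 e3) (pc m))"
    using 1(4) 2(4) 3(4) by (simp add: addr_def)
  have "?K \<le> csz P (Wr a e1 e2 e3) * Suc 0" by (simp add: addr_def)
  then show ?case using run pc rel by blast
next
  case (Seq c1 s t1 s1 c2 t2 s2)
  from Seq.prems(2) have c: "code_at p (pc m) (ccom P c1 (pc m))"
    "code_at p (pc m + length (ccom P c1 (pc m))) (ccom P c2 (pc m + length (ccom P c1 (pc m))))" by auto
  from Seq.IH(1)[OF Seq.prems(1) c(1)] obtain k1 m1 where 1: "k1 \<le> csz P c1 * Suc t1" "(step w p ^^ k1) m = m1"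
    "pc m1 = pc m + length (ccom P c1 (pc m))" "rel s1 m1" by auto
  from Seq.IH(2)[OF 1(4)] c(2) 1(3) obtain k2 m2 where 2: "k2 \<le> csz P c2 * Suc t2" "(step w p ^^ k2) m1 = m2"
    "pc m2 = pc m1 + length (ccom P c2 (pc m1))" "rel s2 m2" by auto
  have "csz P c1 * Suc t1 \<le> csz P c1 * Suc (t1 + t2)" "csz P c2 * Suc t2 \<le> csz P c2 * Suc (t1 + t2)"
    by (auto intro!: mult_le_mono)
  then have "k1 + k2 \<le> csz P (c1 ;; c2) * Suc (t1 + t2)"
    using 1(1) 2(1) unfolding csz.simps distrib_right by linarith
  then show ?case using run_trans[OF 1(2) 2(2)] 1 2 by (intro exI[of _ "k1 + k2"]) auto
next
  case (IfT e1 s e2 c1 t s' c2)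
  let ?n = "length (cexp e1 0) + length (cexp e2 1)"
  let ?d1 = "ccom P c1 (pc m + ?n + 2)"
  let ?l2 = "pc m + ?n + length ?d1 + 3"
  let ?d2 = "ccom P c2 ?l2"
  have c: "code_at p (pc m) (cexp e1 0 @ cexp e2 1 @ [JumpLess (rt 0) (rt 1) (pc m + ?n + 2)])"
     "code_at p (pc m + ?n + 2) ?d1" "code_at p (pc m + ?n + 2 + length ?d1) [Jump (?l2 + length ?d2)]"
    using IfT.prems(2) by (simp_all add: Let_def add.assoc add.commute add.left_commute)
  obtain m1 where m1: "(step w p ^^ (?n + 1)) m = m1" "rel s m1"
    "pc m1 = (if ev e1 s < ev e2 s then pc m + ?n + 2 else pc m + length (cexp e1 0) + length (cexp e2 1) + 1)"
    by (rule cond_run[OF IfT.prems(1) IfT(1,2) c(1)])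
  have "pc m1 = pc m + ?n + 2" using m1(3) IfT(3) by simp
  note 1 = m1(1,2) this
  from IfT.IH[OF 1(2)] c(2) 1(3) obtain k2 m2 where 2: "k2 \<le> csz P c1 * Suc t" "(step w p ^^ k2) m1 = m2"
    "pc m2 = pc m1 + length ?d1" "rel s' m2" by auto
  have 3: "(step w p ^^ 1) m2 = m2\<lparr>pc := ?l2 + length ?d2\<rparr>" using c(3) 1(3) 2(3) by (simp add: step_nth)
  have "?n + 1 + k2 + 1 \<le> csz P (If e1 e2 c1 c2) * Suc t" using 2(1)
    by (simp add: distrib_right)
  moreover have "pc (m2\<lparr>pc := ?l2 + length ?d2\<rparr>) = pc m + length (ccom P (If e1 e2 c1 c2) (pc m))"
    by (simp add: Let_def add.assoc)
  moreover have "rel s' (m2\<lparr>pc := ?l2 + length ?d2\<rparr>)" using 2(4) by (simp add: rel_def)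
  ultimately show ?case using run_trans[OF run_trans[OF 1(1) 2(2)] 3] by blast
next
  case (IfF e1 s e2 c2 t s' c1)
  let ?n = "length (cexp e1 0) + length (cexp e2 1)"
  let ?d1 = "ccom P c1 (pc m + ?n + 2)"
  let ?l2 = "pc m + ?n + length ?d1 + 3"
  let ?d2 = "ccom P c2 ?l2"
  have c: "code_at p (pc m) (cexp e1 0 @ cexp e2 1 @ [JumpLess (rt 0) (rt 1) (pc m + ?n + 2)])"
     "code_at p (pc m + ?n + 1) [Jump ?l2]" "code_at p ?l2 ?d2"
    using IfF.prems(2) by (simp_all add: Let_def add.assoc add.commute add.left_commute eval_nat_numeral)
  obtain m1 where m1: "(step w p ^^ (?n + 1)) m = m1" "rel s m1"
    "pc m1 = (if ev e1 s < ev e2 s then pc m + ?n + 2 else pc m + length (cexp e1 0) + length (cexp e2 1) + 1)"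
    by (rule cond_run[OF IfF.prems(1) IfF(1,2) c(1)])
  have "pc m1 = pc m + ?n + 1" using m1(3) IfF(3) by simp
  note 1 = m1(1,2) this
  have 2: "(step w p ^^ 1) m1 = m1\<lparr>pc := ?l2\<rparr>" using c(2) 1(3) by (simp add: step_nth)
  have r2: "rel s (m1\<lparr>pc := ?l2\<rparr>)" using 1(2) by (auto simp: rel_def)
  from IfF.IH[OF r2] c(3) obtain k2 m2 where 3: "k2 \<le> csz P c2 * Suc t" "(step w p ^^ k2) (m1\<lparr>pc := ?l2\<rparr>) = m2"
    "pc m2 = ?l2 + length ?d2" "rel s' m2" by auto
  have "?n + 1 + 1 + k2 \<le> csz P (If e1 e2 c1 c2) * Suc t" using 3(1)
    by (simp add: distrib_right)
  moreover have "pc m2 = pc m + length (ccom P (If e1 e2 c1 c2) (pc m))"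
    using 3(3) by (simp add: Let_def add.assoc)
  ultimately show ?case using run_trans[OF run_trans[OF 1(1) 2] 3(2)] 3(4) by blast
next
  case (WhileT e1 s e2 c t1 s1 t2 s2)
  let ?n = "length (cexp e1 0) + length (cexp e2 1)"
  let ?d = "ccom P c (pc m + ?n + 2)"
  have c: "code_at p (pc m) (cexp e1 0 @ cexp e2 1 @ [JumpLess (rt 0) (rt 1) (pc m + ?n + 2)])"
     "code_at p (pc m + ?n + 2) ?d" "code_at p (pc m + ?n + 2 + length ?d) [Jump (pc m)]"
    using WhileT.prems(2) by (simp_all add: Let_def add.assoc add.commute add.left_commute)
  obtain m1 where m1: "(step w p ^^ (?n + 1)) m = m1" "rel s m1"
    "pc m1 = (if ev e1 s < ev e2 s then pc m + ?n + 2 else pc m + length (cexp e1 0) + length (cexp e2 1) + 1)"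
    by (rule cond_run[OF WhileT.prems(1) WhileT(1,2) c(1)])
  have "pc m1 = pc m + ?n + 2" using m1(3) WhileT(3) by simp
  note 1 = m1(1,2) this
  from WhileT.IH(1)[OF 1(2)] c(2) 1(3) obtain k2 m2 where 2: "k2 \<le> csz P c * Suc t1" "(step w p ^^ k2) m1 = m2"
    "pc m2 = pc m1 + length ?d" "rel s1 m2" by auto
  have 3: "(step w p ^^ 1) m2 = m2\<lparr>pc := pc m\<rparr>" using c(3) 1(3) 2(3) by (simp add: step_nth)
  have r3: "rel s1 (m2\<lparr>pc := pc m\<rparr>)" using 2(4) by (auto simp: rel_def)
  from WhileT.IH(2)[OF r3] WhileT.prems(2) obtain k4 m4 where
    4: "k4 \<le> csz P (While e1 e2 c) * Suc t2" "(step w p ^^ k4) (m2\<lparr>pc := pc m\<rparr>) = m4"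
    "pc m4 = pc m + length (ccom P (While e1 e2 c) (pc m))" "rel s2 m4" by auto
  have "?n + 1 + k2 + 1 \<le> csz P (While e1 e2 c) * Suc t1" using 2(1)
    by (simp add: distrib_right)
  then have "?n + 1 + k2 + 1 + k4 \<le> csz P (While e1 e2 c) * Suc (Suc (t1 + t2))" using 4(1)
    by (simp add: distrib_left distrib_right)
  then show ?case using run_trans[OF run_trans[OF run_trans[OF 1(1) 2(2)] 3] 4(2)] 4(3,4) by blast
next
  case (WhileF e1 s e2 c)
  let ?n = "length (cexp e1 0) + length (cexp e2 1)"
  let ?d = "ccom P c (pc m + ?n + 2)"
  have c: "code_at p (pc m) (cexp e1 0 @ cexp e2 1 @ [JumpLess (rt 0) (rt 1) (pc m + ?n + 2)])"
     "code_at p (pc m + ?n + 1) [Jump (pc m + ?n + length ?d + 3)]"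
    using WhileF.prems(2) by (simp_all add: Let_def add.assoc add.commute add.left_commute eval_nat_numeral)
  obtain m1 where m1: "(step w p ^^ (?n + 1)) m = m1" "rel s m1"
    "pc m1 = (if ev e1 s < ev e2 s then pc m + ?n + 2 else pc m + length (cexp e1 0) + length (cexp e2 1) + 1)"
    by (rule cond_run[OF WhileF.prems(1) WhileF(1,2) c(1)])
  have "pc m1 = pc m + ?n + 1" using m1(3) WhileF(3) by simp
  note 1 = m1(1,2) this
  have 2: "(step w p ^^ 1) m1 = m1\<lparr>pc := pc m + ?n + length ?d + 3\<rparr>" using c(2) 1(3) by (simp add: step_nth)
  have "pc (m1\<lparr>pc := pc m + ?n + length ?d + 3\<rparr>) = pc m + length (ccom P (While e1 e2 c) (pc m))"
    by (simp add: Let_def add.assoc)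
  moreover have "rel s (m1\<lparr>pc := pc m + ?n + length ?d + 3\<rparr>)" using 1(2) by (simp add: rel_def)
  moreover have "?n + 1 + 1 \<le> csz P (While e1 e2 c) * Suc 0" by simp
  ultimately show ?case using run_trans[OF 1(1) 2] by blast
next
  case (Sim s \<sigma>)
  have "code_at p (pc m) (sim_code P (pc m))" using Sim.prems(2) by simp
  from sim_correct[OF Sim.prems(1) this Sim(1-6)] obtain k m' where
    1: "k \<le> length (sim_code P (pc m)) + 6 * vr s vBud" "(step w p ^^ k) m = m'" "pc m' = pc m + length (sim_code P (pc m))"
    "rel (s\<lparr>vr := (vr s)(vFlag := (if halted P \<sigma> then 1 else 0)),
           ar := (ar s)(aMM := (ar s aMM)(vr s vCnt := mem \<sigma>))\<rparr>) m'" by blast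
  have "k \<le> csz P Sim * Suc (vr s vBud)" using 1(1) by (simp add: length_sim_code distrib_right distrib_left)
  then show ?case using 1(2-4) unfolding ccom.simps by blast
qed

end

section \<open>Complete programs and their input\<close>

definition prologue :: prog where
  "prologue = [Op Or 4 0 0, Op Or 7 1 1, Op Or 10 3 3, Imm 3 4, Op Div 13 0 3, Imm 3 1, Op Shl 0 3 13, Op Or 16 0 0]"

definition prog_of :: "prog \<Rightarrow> com \<Rightarrow> prog" where
  "prog_of P c = prologue @ ccom P c 8"

text \<open>The store set up by \<open>prologue\<close>: word size, dimension and input register
  \<open>3\<close>, which holds the exponent of \<epsilon>, become variables, and
  \<open>w div 4\<close> and \<open>R\<close> are computed. The input memory is row \<open>0\<close>
  of array \<open>0\<close>.\<close>

definition start :: "nat \<Rightarrow> nat \<Rightarrow> nat \<Rightarrow> (nat \<Rightarrow> nat) \<Rightarrow> store" where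
  "start w n e f = \<lparr>vr = (\<lambda>x. if x = 0 then w else if x = 1 then n else if x = 2 then e else if x = vWs then w div 4
       else if x = vInf then 2 ^ (w div 4) else 0),
     ar = (\<lambda>a i j. if a = 0 \<and> i = 0 then f j else 0)\<rparr>"

text \<open>Row \<open>0\<close> of array \<open>0\<close> occupies exactly the addresses below
  \<open>R\<close>, so input and output keep their places. The cells from \<open>R\<close> on have
  to be zero because all other arrays start out cleared.\<close>

lemma (in ram) prog_run:
  assumes s: "pc s = 0" "reg s 0 = w" "reg s 1 = n" "reg s 3 = e" "\<And>r. 4 \<le> r \<Longrightarrow> reg s r = 0"
    and mem: "\<And>a. R \<le> a \<Longrightarrow> mem s a = 0"
    and big: "big c (start w n e (mem s)) t st'"
  shows "\<exists>s'. halts_within w (prog_of P c) (real (8 + csz P c * Suc t)) s s' \<and> (\<forall>j<R. mem s' j = ar st' 0 0 j)"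
proof -
  let ?p = "prog_of P c"
  have W4: "4 < W" "1 < W" "R < W" "0 < R" using R_less_W R_ge by linarith+
  let ?m = "fold (exec w) prologue s"
  have m4: "4 mod 2 ^ w = (4::nat)" "1 mod 2 ^ w = (1::nat)" "2 ^ (w div 4) mod 2 ^ w = (2 ^ (w div 4) :: nat)"
    using W4 R_def ws_def W_def by simp_all
  have m: "pc ?m = 8" "reg ?m = (reg s)(4 := w, 7 := n, 10 := e, 3 := 1, 13 := w div 4, 0 := 2 ^ (w div 4), 16 := 2 ^ (w div 4))"
    "mem ?m = mem s"
    using s m4 by (auto simp: prologue_def fun_eq_iff)
  have "(step w ?p ^^ length prologue) s = ?m"
    by (rule straight_run) (auto simp: prologue_def prog_of_def s)
  moreover have len: "length prologue = 8" by (simp add: prologue_def)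
  ultimately have run1: "(step w ?p ^^ 8) s = ?m" by (simp only:)
  have Rw: "R = 2 ^ (w div 4)" by (simp add: R_def ws_def)
  have rel: "rel (start w n e (mem s)) ?m"
    unfolding rel_def
  proof (intro conjI allI impI)
    show "reg ?m 0 = R" using m by (simp add: Rw)
  next
    fix x
    show "reg ?m (rv x) = vr (start w n e (mem s)) x"
      using m(2) s(5)[of "rv x"] by (auto simp: start_def rv_def)
  next
    fix a i j assume h: "a < R" "i < R" "j < R"
    show "mem ?m ((a * R + i) * R + j) = ar (start w n e (mem s)) a i j"
    proof (cases "a = 0 \<and> i = 0")
      case False
      then have "0 < a * R + i" using W4(4) by auto
      then have "1 \<le> a * R + i" by linarith
      then have "1 * R \<le> (a * R + i) * R" by (rule mult_right_mono) simp
      then have "R \<le> (a * R + i) * R + j" by linarith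
      then show ?thesis using m(3) mem False by (auto simp: start_def)
    qed (use m in \<open>auto simp: start_def\<close>)
  qed
  have "code_at ?p (pc ?m) (ccom P c (pc ?m))"
    unfolding m(1) by (auto simp: prog_of_def code_at_def len nth_append)
  from ccom_correct[OF big rel this] obtain k m' where 2: "k \<le> csz P c * Suc t" "(step w ?p ^^ k) ?m = m'"
    "pc m' = pc ?m + length (ccom P c (pc ?m))" "rel st' m'" by blast
  have "halted ?p m'" using 2(3) unfolding m(1) by (simp add: halted_def prog_of_def len)
  moreover have "real (8 + k) \<le> real (8 + csz P c * Suc t)" using 2(1) by (intro of_nat_mono) simp
  ultimately have "halts_within w ?p (real (8 + csz P c * Suc t)) s m'"
    unfolding halts_within_def using run_trans[OF run1 2(2)] by blast
  moreover have "\<forall>j<R. mem m' j = ar st' 0 0 j"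
  proof (intro allI impI)
    fix j assume "j < R"
    then have "mem m' ((0 * R + 0) * R + j) = ar st' 0 0 j" using 2(4) W4(4) unfolding rel_def by blast
    then show "mem m' j = ar st' 0 0 j" by simp
  qed
  ultimately show ?thesis by blast
qed

lemma halts_within_mono: "halts_within w P T s s' \<Longrightarrow> T \<le> T' \<Longrightarrow> halts_within w P T' s s'"
  unfolding halts_within_def using order_trans by blast

text \<open>Without rounding \<open>4 * k\<close> would do; the additional
  \<open>4 * log 2 X \<ge> 4\<close> absorbs the remainder lost in \<open>w div 4\<close>.\<close>

lemma word_bound:
  fixes X :: real
  assumes "real (4 * k + 4) * log 2 X \<le> real w" "2 \<le> X"
  shows "X ^ k \<le> 2 ^ (w div 4)"
proof -
  have l: "1 \<le> log 2 X" using assms(2) by simp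
  have "real (4 * k + 4) * log 2 X = 4 * (real k * log 2 X) + 4 * log 2 X" by (simp add: algebra_simps)
  moreover have "real w \<le> 4 * real (w div 4) + 3"
  proof -
    have "w \<le> 4 * (w div 4) + 3" by presburger
    then show ?thesis by linarith
  qed
  ultimately have "real k * log 2 X \<le> real (w div 4)" using l assms(1) by linarith
  then have "2 powr (real k * log 2 X) \<le> 2 powr real (w div 4)" by simp
  moreover have "2 powr (real k * log 2 X) = X ^ k"
  proof -
    have "2 powr (real k * log 2 X) = (2 powr log 2 X) powr real k" by (simp add: powr_powr mult.commute)
    then show ?thesis using assms(2) by (simp add: powr_realpow)
  qed
  ultimately show ?thesis by (simp add: powr_realpow)
qed

lemma flat_eq: "j < m \<Longrightarrow> j' < m \<Longrightarrow> i * m + j = i' * m + j' \<longleftrightarrow> i = i' \<and> j = (j'::nat)"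
proof
  assume h: "j < m" "j' < m" "i * m + j = i' * m + j'"
  have "(i * m + j) div m = i" "(i' * m + j') div m = i'" "(i * m + j) mod m = j" "(i' * m + j') mod m = j'"
    using h(1,2) by auto
  then show "i = i' \<and> j = j'" using h(3) by auto
qed auto

lemma flat_less: "i < k \<Longrightarrow> j < m \<Longrightarrow> i * m + j < k * (m::nat)"
proof -
  assume h: "i < k" "j < m"
  have "i * m + j < Suc i * m" using h by simp
  also have "\<dots> \<le> k * m" using h by (intro mult_right_mono) auto
  finally show ?thesis .
qed

subsection \<open>Naive matrix multiplication\<close>

definition naive_mul :: com where
  "naive_mul = For 10 1 (For 11 1 (Assign 13 (N 0) ;;
     For 12 1 (Assign 13 (Bin Add (V 13)
        (Bin Mul (Rd 0 (N 0) (Bin Add (Bin Mul (V 10) (V 1)) (V 12)))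
                 (Rd 0 (N 0) (Bin Add (Bin Mul (V 1) (V 1)) (Bin Add (Bin Mul (V 12) (V 1)) (V 11))))))) ;;
     Wr 0 (N 0) (Bin Add (Bin Mul (N 2) (Bin Mul (V 1) (V 1))) (Bin Add (Bin Mul (V 10) (V 1)) (V 11))) (V 13)))"

lemma (in ram) naive_mul_correct:
  assumes n: "vr s 1 = n" "3 * n * n < R" and K: "n * (K * K) < R"
    and A: "\<And>i j. i < n \<Longrightarrow> j < n \<Longrightarrow> ar s 0 0 (i * n + j) = A i j \<and> A i j \<le> K"
    and B: "\<And>i j. i < n \<Longrightarrow> j < n \<Longrightarrow> ar s 0 0 (n * n + (i * n + j)) = B i j \<and> B i j \<le> K"
  shows "tri naive_mul s (n * (n * (n + 1) + 1))
    (\<lambda>s'. \<forall>i<n. \<forall>j<n. ar s' 0 0 (2 * (n * n) + (i * n + j)) = (\<Sum>k<n. A i k * B k j))"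
proof -
  have nW: "n < W" "2 * (n * n) < R" "R < W" "0 < R"
    using n(2) R_less_W R_ge le_square[of n] by linarith+
  have fl: "i * n + j < n * n" if "i < n" "j < n" for i j using flat_less that .
  have fl2: "i * n < W" "i * n + j < R" "i * n + j < W" "n * n + (i * n + j) < R" "n * n + (i * n + j) < W"
    "2 * (n * n) + (i * n + j) < R" "2 * (n * n) + (i * n + j) < W" "n * n < W" "2 * (n * n) < W"
    if "i < n" "j < n" for i j using fl[OF that] n(2) nW by linarith+
  have AB: "A i k * B k j \<le> K * K" if "i < n" "j < n" "k < n" for i j k
    using A[of i k] B[of k j] that by (intro mult_le_mono) auto
  have sm: "(\<Sum>k<k'. A i k * B k j) \<le> n * (K * K)" if "i < n" "j < n" "k' \<le> n" for i j k'
  proof -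
    have "(\<Sum>k<k'. A i k * B k j) \<le> (\<Sum>k<k'. K * K)" using AB that by (intro sum_mono) auto
    also have "\<dots> \<le> n * (K * K)" using that by simp
    finally show ?thesis .
  qed
  have KK: "K * K < W" if "i < n" for i
  proof -
    have "1 * (K * K) \<le> n * (K * K)" using that by (intro mult_right_mono) auto
    then show ?thesis using K nW by linarith
  qed
  define I where "I i j s' \<longleftrightarrow> (\<forall>x<2 * (n * n). ar s' 0 0 x = ar s 0 0 x) \<and>
     (\<forall>i'<n. \<forall>j'<n. i' < i \<or> (i' = i \<and> j' < j) \<longrightarrow> ar s' 0 0 (2 * (n * n) + (i' * n + j')) = (\<Sum>k<n. A i' k * B k j'))" for i j and s' :: store
  show ?thesis unfolding naive_mul_def
  proof (rule tri_For[where m = n and b = "n * (n + 1)" and I = "\<lambda>i s'. I i 0 s'"], goal_cases)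
    case (7 i s1)
    show ?case
    proof (rule tri_For[where m = n and b = "n" and I = "\<lambda>j s'. I i j s'"], goal_cases)
      case (7 j s2)
      then have v: "vr s2 10 = i" "vr s2 11 = j" "vr s2 1 = n" "vr s1 1 = n" using 7 \<open>vr s1 10 = i\<close> n by (auto simp: frame_def)
      note ij = \<open>i < n\<close> \<open>j < n\<close>
      have "tri (For 12 1 (Assign 13 (Bin Add (V 13)
        (Bin Mul (Rd 0 (N 0) (Bin Add (Bin Mul (V 10) (V 1)) (V 12)))
                 (Rd 0 (N 0) (Bin Add (Bin Mul (V 1) (V 1)) (Bin Add (Bin Mul (V 12) (V 1)) (V 11)))))))) 
         (s2\<lparr>vr := (vr s2)(13 := 0)\<rparr>) n (\<lambda>s'. vr s' 13 = (\<Sum>k<n. A i k * B k j))"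
      proof (rule tri_For[where m = n and b = 0 and I = "\<lambda>k s'. vr s' 13 = (\<Sum>k<k. A i k * B k j)"], goal_cases)
        case (7 k s3)
        have v3: "vr s3 10 = i" "vr s3 11 = j" "vr s3 1 = n" "ar s3 0 = ar s2 0" using 7 v by (auto simp: frame_def)
        have "ar s2 0 0 (i * n + k) = A i k" "ar s2 0 0 (n * n + (k * n + j)) = B k j"
          using \<open>I i j s2\<close> fl[OF ij(1) 7(1)] fl[OF 7(1) ij(2)] A[OF ij(1) 7(1)] B[OF 7(1) ij(2)] by (auto simp: I_def)
        moreover have "A i k * B k j < W" using KK[OF ij(1)] AB[OF ij 7(1)] by linarith
        moreover have "(\<Sum>k<k. A i k * B k j) + A i k * B k j < W"
          using sm[OF ij, of "Suc k"] K nW 7(1) by simp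
        ultimately show ?case using v3 7 fl2[OF ij(1) 7(1)] fl2[OF 7(1) ij(2)] nW by simp
      qed (use v n nW in auto)
      then have "tri (For 12 1 (Assign 13 (Bin Add (V 13)
        (Bin Mul (Rd 0 (N 0) (Bin Add (Bin Mul (V 10) (V 1)) (V 12)))
                 (Rd 0 (N 0) (Bin Add (Bin Mul (V 1) (V 1)) (Bin Add (Bin Mul (V 12) (V 1)) (V 11))))))) ;;
     Wr 0 (N 0) (Bin Add (Bin Mul (N 2) (Bin Mul (V 1) (V 1))) (Bin Add (Bin Mul (V 10) (V 1)) (V 11))) (V 13))
         (s2\<lparr>vr := (vr s2)(13 := 0)\<rparr>) n (\<lambda>s'. I i (Suc j) (s'\<lparr>vr := (vr s')(11 := Suc j)\<rparr>))"
      proof (rule tri_Seq[where Tb = 0], goal_cases)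
        case (1 s3)
        then have v3: "vr s3 10 = i" "vr s3 11 = j" "vr s3 1 = n" "ar s3 0 = ar s2 0" "vr s3 13 = (\<Sum>k<n. A i k * B k j)"
          using v by (auto simp: frame_def)
        show ?case using v3 fl2[OF ij] nW \<open>I i j s2\<close> R_less_W
          by (auto simp: I_def flat_eq less_Suc_eq ij)
      qed auto
      then show ?case using nW by simp
    qed (use 7 n nW in \<open>auto simp: I_def frame_def less_Suc_eq\<close>)
  qed (use n nW in \<open>auto simp: I_def\<close>)
qed

text \<open>The school method. It makes the set that defines \<open>\<omega>\<close> nonempty and
  allows exponents to be capped at \<open>3\<close>.\<close>

theorem matmul_in_time_3: "matmul_in_time 3"
  unfolding matmul_in_time_def
proof (rule exI[of _ "prog_of [] naive_mul"], rule exI[of _ "real (8 + csz [] naive_mul * 4)"], rule exI[of _ 100],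
    intro conjI allI impI)
  show "(0::real) < 100" by simp
  fix n w K A B s
  assume n: "1 \<le> (n::nat)" and AB: "\<forall>i<n. \<forall>j<n. A i j \<le> K \<and> B i j \<le> K"
    and w: "100 * log 2 (real n + real K + 1) \<le> real w" and inp: "matmul_input w n A B s"
  define X where "X = n + K + 1"
  have X: "2 \<le> X" "n \<le> X" "K \<le> X" using n by (auto simp: X_def)
  define R where "R = (2::nat) ^ (w div 4)"
  \<comment> \<open>The word size factor \<open>100\<close> equals
    \<open>4 * 24 + 4\<close>.\<close>
  have "real X ^ 24 \<le> 2 ^ (w div 4)"
    by (rule word_bound) (use w X in \<open>auto simp: X_def algebra_simps\<close>)
  then have XR: "X ^ 24 \<le> R" by (metis R_def of_nat_le_iff of_nat_numeral of_nat_power)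
  have "(2::nat) ^ 24 \<le> X ^ 24" using X by (intro power_mono) auto
  then have R1000: "1000 \<le> R" using XR by simp
  interpret ram w "[]" "2 ^ w" R "w div 4"
    by unfold_locales (use R1000 in \<open>auto simp: R_def\<close>)
  have X3: "X * X * X * X < R"
  proof -
    have "1 < X ^ 20" using X by (intro one_less_power) auto
    then have "X * X * X * X * 1 < X * X * X * X * X ^ 20" using X by (intro mult_strict_left_mono) auto
    also have "X * X * X * X * X ^ 20 = X ^ 24" by (simp add: eval_nat_numeral)
    finally show ?thesis using XR by simp
  qed
  have n3: "3 * n * n < R"
  proof -
    have "3 * (n * n) \<le> (X * X) * (X * X)"
      using X mult_le_mono[OF X(1) X(1)] by (intro mult_le_mono) auto
    then have "3 * n * n \<le> X * X * X * X" by (simp only: mult.assoc)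
    then show ?thesis using X3 by linarith
  qed
  have nK: "n * (K * K) < R"
  proof -
    have "n * (K * K) * 1 \<le> X * (X * X) * X" using X by (intro mult_le_mono) auto
    then show ?thesis using X3 by (simp add: mult.assoc)
  qed
  let ?st = "start w n 0 (mem s)"
  have "tri naive_mul ?st (n * (n * (n + 1) + 1))
    (\<lambda>s'. \<forall>i<n. \<forall>j<n. ar s' 0 0 (2 * (n * n) + (i * n + j)) = (\<Sum>k<n. A i k * B k j))"
    by (rule naive_mul_correct[OF _ n3 nK])
      (use inp AB in \<open>auto simp: start_def matmul_input_def add.assoc\<close>)
  then obtain t st' where st: "big naive_mul ?st t st'" "t \<le> n * (n * (n + 1) + 1)"
    "\<forall>i<n. \<forall>j<n. ar st' 0 0 (2 * (n * n) + (i * n + j)) = (\<Sum>k<n. A i k * B k j)" by (auto simp: tri_def)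
  have "\<exists>s'. halts_within w (prog_of [] naive_mul) (real (8 + csz [] naive_mul * Suc t)) s s' \<and> (\<forall>j<R. mem s' j = ar st' 0 0 j)"
    by (rule prog_run[OF _ _ _ _ _ _ st(1)]) (use inp n3 in \<open>auto simp: matmul_input_def\<close>)
  then obtain s' where s': "halts_within w (prog_of [] naive_mul) (real (8 + csz [] naive_mul * Suc t)) s s'"
    "\<forall>j<R. mem s' j = ar st' 0 0 j" by blast
  have t4: "Suc t \<le> 4 * n ^ 3"
  proof -
    have "1 \<le> n * n * n" "n \<le> n * n * n" "n * n \<le> n * n * n" using n by auto
    moreover have "n * (n * (n + 1) + 1) = n * n * n + n * n + n" by (simp add: algebra_simps)
    moreover have "n ^ 3 = n * n * n" by (simp add: eval_nat_numeral)
    ultimately show ?thesis using st(2) by linarith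
  qed
  have "8 + csz [] naive_mul * Suc t \<le> (8 + csz [] naive_mul * 4) * n ^ 3"
  proof -
    have "1 \<le> n ^ 3" using n by simp
    moreover have "csz [] naive_mul * Suc t \<le> csz [] naive_mul * 4 * n ^ 3"
      using mult_le_mono2[OF t4, of "csz [] naive_mul"] by (simp only: mult.assoc)
    ultimately show ?thesis unfolding distrib_right by linarith
  qed
  then have "real (8 + csz [] naive_mul * Suc t) \<le> real ((8 + csz [] naive_mul * 4) * n ^ 3)" by (rule of_nat_mono)
  also have "\<dots> = real (8 + csz [] naive_mul * 4) * real n powr 3"
    using n by (simp add: powr_realpow[of "real n" 3, simplified])
  finally have "halts_within w (prog_of [] naive_mul) (real (8 + csz [] naive_mul * 4) * real n powr 3) s s'"
    by (rule halts_within_mono[OF s'(1)])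
  moreover have "matmul_output n (\<lambda>i j. \<Sum>k<n. A i k * B k j) s'"
    unfolding matmul_output_def
  proof (intro allI impI)
    fix i j assume ij: "i < n" "j < n"
    then have "2 * (n * n) + (i * n + j) < R" using flat_less[OF ij] n3 by linarith
    then show "mem s' (2 * n * n + i * n + j) = (\<Sum>k<n. A i k * B k j)"
      using s'(2) st(3) ij by (simp add: add.assoc mult.assoc)
  qed
  ultimately show "\<exists>s'. halts_within w (prog_of [] naive_mul) (real (8 + csz [] naive_mul * 4) * real n powr 3) s s' \<and>
      matmul_output n (\<lambda>i j. \<Sum>k<n. A i k * B k j) s'" by blast
qed

section \<open>Lower bound for the exponent of matrix multiplication\<close>

lemma card_changed:
  "finite {a. mem ((step w P ^^ t) s) a \<noteq> mem s a} \<and> card {a. mem ((step w P ^^ t) s) a \<noteq> mem s a} \<le> t"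
proof (induction t)
  case (Suc t)
  let ?s = "(step w P ^^ t) s"
  have "\<exists>x. \<forall>a. a \<noteq> x \<longrightarrow> mem (step w P ?s) a = mem ?s a"
    by (cases "P ! pc ?s") (auto simp: step_def)
  then obtain x where "\<forall>a. a \<noteq> x \<longrightarrow> mem (step w P ?s) a = mem ?s a" by blast
  then have sub: "{a. mem ((step w P ^^ Suc t) s) a \<noteq> mem s a} \<subseteq> insert x {a. mem ?s a \<noteq> mem s a}" by auto
  have "card {a. mem ((step w P ^^ Suc t) s) a \<noteq> mem s a} \<le> card (insert x {a. mem ?s a \<noteq> mem s a})"
    using sub Suc by (intro card_mono) auto
  also have "\<dots> \<le> Suc t" using Suc card_insert_le_m1[of "Suc t" "{a. mem ?s a \<noteq> mem s a}" x] by simp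
  finally show ?case using finite_subset[OF sub] Suc by auto
qed auto

text \<open>One step changes at most one memory cell, and multiplying two all-ones matrices puts the
  value \<open>n\<close> into \<open>n * n\<close> cells that were zero. Hence
  \<open>n\<^sup>2 \<le> C * n powr \<tau>\<close> for every \<open>n \<ge> 1\<close>, which fails
  for large \<open>n\<close> if \<open>\<tau> < 2\<close>. This also bounds the set that defines
  \<open>\<omega>\<close> from below.\<close>

lemma matmul_in_time_ge_2:
  assumes "matmul_in_time \<tau>"
  shows "2 \<le> \<tau>"
proof (rule ccontr)
  assume "\<not> 2 \<le> \<tau>"
  then have \<tau>: "0 < 2 - \<tau>" by simp
  from assms obtain P C c where c: "\<And>n w K A B s.
          n \<ge> 1 \<Longrightarrow> (\<forall>i<n. \<forall>j<n. A i j \<le> K \<and> B i j \<le> K) \<Longrightarrow>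
          c * log 2 (real n + real K + 1) \<le> real w \<Longrightarrow>
          matmul_input w n A B s \<Longrightarrow>
          (\<exists>s'. halts_within w P (C * real n powr \<tau>) s s' \<and>
                matmul_output n (\<lambda>i j. \<Sum>k<n. A i k * B k j) s')"
    unfolding matmul_in_time_def by blast
  have n2: "real n * real n \<le> C * real n powr \<tau>" if n: "1 \<le> n" for n
  proof -
    obtain w :: nat where w: "c * log 2 (real n + real 1 + 1) \<le> real w" using real_arch_simple by blast
    define s where "s = \<lparr>pc = 0, reg = (\<lambda>r. if r = 0 then w else if r = 1 then n else 0),
      mem = (\<lambda>a. if a < 2 * n * n then 1 else 0)\<rparr>"
    have "matmul_input w n (\<lambda>_ _. 1) (\<lambda>_ _. 1) s"
      unfolding matmul_input_def s_def
    proof (intro conjI allI impI)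
      fix i j assume ij: "i < n" "j < n"
      have "i * n + j < n * n" using flat_less[OF ij] .
      then show "mem \<lparr>pc = 0, reg = (\<lambda>r. if r = 0 then w else if r = 1 then n else 0),
        mem = (\<lambda>a. if a < 2 * n * n then 1 else 0)\<rparr> (i * n + j) = 1"
       "mem \<lparr>pc = 0, reg = (\<lambda>r. if r = 0 then w else if r = 1 then n else 0),
        mem = (\<lambda>a. if a < 2 * n * n then 1 else 0)\<rparr> (n * n + i * n + j) = 1" by auto
    qed auto
    from c[OF n _ w this] obtain s' where s': "halts_within w P (C * real n powr \<tau>) s s'"
      "matmul_output n (\<lambda>i j. \<Sum>k<n. 1 * 1) s'" by auto
    then obtain t where t: "real t \<le> C * real n powr \<tau>" "(step w P ^^ t) s = s'" by (auto simp: halts_within_def)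
    have "{2 * n * n..<2 * n * n + n * n} \<subseteq> {a. mem s' a \<noteq> mem s a}"
    proof
      fix a assume a: "a \<in> {2 * n * n..<2 * n * n + n * n}"
      define b where "b = a - 2 * n * n"
      have b: "a = 2 * n * n + b" "b < n * n" using a by (auto simp: b_def)
      have "b div n < n" "b mod n < n" using b n by (auto simp: less_mult_imp_div_less)
      then have "mem s' (2 * n * n + b div n * n + b mod n) = (\<Sum>k<n. 1 * 1)"
        using s'(2) unfolding matmul_output_def by blast
      moreover have "2 * n * n + b div n * n + b mod n = a" unfolding b(1) add.assoc div_mult_mod_eq ..
      ultimately have "mem s' a = n" by simp
      then show "a \<in> {a. mem s' a \<noteq> mem s a}" using n b by (simp add: s_def)
    qed
    then have "card {2 * n * n..<2 * n * n + n * n} \<le> card {a. mem s' a \<noteq> mem s a}"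
      using card_changed[where w = w and P = P and t = t and s = s] t(2) by (intro card_mono) auto
    also have "\<dots> \<le> t" using card_changed[where w = w and P = P and t = t and s = s] t(2) by auto
    finally have "n * n \<le> t" by simp
    then have "real n * real n \<le> real t" by (simp flip: of_nat_mult)
    then show ?thesis using t(1) by simp
  qed
  \<comment> \<open>From this size on \<open>n powr (2 - \<tau>)\<close> is at least
    \<open>\<bar>C\<bar> + 1\<close> and hence exceeds \<open>C\<close>.\<close>
  define y where "y = (\<bar>C\<bar> + 1) powr (1 / (2 - \<tau>))"
  define n where "n = nat \<lceil>y\<rceil> + 1"
  have n: "1 \<le> n" "y \<le> real n" "0 < real n" unfolding n_def by linarith+
  have "y powr (2 - \<tau>) \<le> real n powr (2 - \<tau>)" using n \<tau> by (intro powr_mono2) (auto simp: y_def)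
  moreover have "y powr (2 - \<tau>) = \<bar>C\<bar> + 1" using \<tau> by (simp add: y_def powr_powr)
  moreover have "real n powr (2 - \<tau>) = real n * real n / real n powr \<tau>"
    using n by (simp add: powr_diff powr_realpow[of "real n" 2, simplified] power2_eq_square)
  moreover have "\<dots> \<le> C" using n2[OF n(1)] n by (simp add: divide_le_eq)
  ultimately show False by linarith
qed

abbreviation (input) plus_aexp (infixl "\<oplus>" 65) where "a \<oplus> b \<equiv> Bin Add a b"
abbreviation (input) minus_aexp (infixl "\<ominus>" 65) where "a \<ominus> b \<equiv> Bin Sub a b"
abbreviation (input) times_aexp (infixl "\<otimes>" 70) where "a \<otimes> b \<equiv> Bin Mul a b"
abbreviation (input) div_aexp (infixl "\<oslash>" 70) where "a \<oslash> b \<equiv> Bin Div a b"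
abbreviation (input) mod_aexp (infixl "\<odot>" 70) where "a \<odot> b \<equiv> Bin Mod a b"

text \<open>\<open>vn\<close> and \<open>vNN\<close> hold \<open>n\<close> and \<open>n * n\<close>.
  \<open>aQ\<close> is the matrix of keys, \<open>aK\<close> its flattened copy, \<open>aP\<close>
  the list of entries being sorted and \<open>aT\<close> the target of a merge pass.
  \<open>aRS\<close>, \<open>aRP\<close>, \<open>aRN\<close> are sorted rows, positions in rows and
  fill levels; \<open>aCS\<close>, \<open>aCP\<close>, \<open>aCN\<close> are the same for
  columns.\<close>

abbreviation (input) "vn \<equiv> 1 :: nat"
abbreviation (input) "vNN \<equiv> 9 :: nat"
abbreviation (input) "aQ \<equiv> 5 :: nat"
abbreviation (input) "aP \<equiv> 6 :: nat"
abbreviation (input) "aT \<equiv> 7 :: nat"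
abbreviation (input) "aK \<equiv> 8 :: nat"
abbreviation (input) "aRS \<equiv> 9 :: nat"
abbreviation (input) "aCS \<equiv> 10 :: nat"
abbreviation (input) "aRP \<equiv> 11 :: nat"
abbreviation (input) "aCP \<equiv> 12 :: nat"
abbreviation (input) "aRN \<equiv> 13 :: nat"
abbreviation (input) "aCN \<equiv> 14 :: nat"

lemma store_upd_comm [simp]: "s\<lparr>ar := a, vr := v\<rparr> = s\<lparr>vr := v, ar := a\<rparr>"
  by simp

section \<open>Sorting the entries of a matrix\<close>

definition block_sorted :: "(nat \<Rightarrow> nat) \<Rightarrow> nat \<Rightarrow> nat \<Rightarrow> (nat \<Rightarrow> nat) \<Rightarrow> bool" where
  "block_sorted k h m p \<longleftrightarrow> (\<forall>x y. x \<le> y \<longrightarrow> y < m \<longrightarrow> x div h = y div h \<longrightarrow> k (p x) \<le> k (p y))"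

text \<open>A merge of the sorted runs \<open>[lo, mid)\<close> and \<open>[mid, hi)\<close> of
  \<open>p\<close> into \<open>t\<close> in progress: \<open>x0\<close> cells are written,
  \<open>a\<close> and \<open>b\<close> are the heads of the runs. The image equation records which
  entries have moved; the last conjunct says that everything written in this merge is at most
  everything still waiting.\<close>

definition merging :: "(nat \<Rightarrow> nat) \<Rightarrow> (nat \<Rightarrow> nat) \<Rightarrow> nat \<Rightarrow> nat \<Rightarrow> nat \<Rightarrow> nat \<Rightarrow> nat \<Rightarrow> nat \<Rightarrow> nat \<Rightarrow> nat \<Rightarrow> (nat \<Rightarrow> nat) \<Rightarrow> bool" where
  "merging k p h m x0 lo a b mid hi t \<longleftrightarrow> lo mod (2 * h) = 0 \<and> lo \<le> x0 \<and> mid = min (lo + h) m \<and> hi = min (lo + 2 * h) m \<and>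
     lo \<le> a \<and> a \<le> mid \<and> mid \<le> b \<and> b \<le> hi \<and> a + b = x0 + mid \<and> t ` {..<x0} = p ` ({..<a} \<union> {mid..<b}) \<and>
     block_sorted k (2 * h) x0 t \<and>
     (\<forall>x y. lo \<le> x \<longrightarrow> x < x0 \<longrightarrow> (a \<le> y \<and> y < mid \<or> b \<le> y \<and> y < hi) \<longrightarrow> k (t x) \<le> k (p y))"

lemma merging_init:
  assumes "x0 mod (2 * h) = 0" "x0 < m" "t ` {..<x0} = p ` {..<x0}" "block_sorted k (2 * h) x0 t"
  shows "merging k p h m x0 x0 x0 (min (x0 + h) m) (min (x0 + h) m) (min (x0 + 2 * h) m) t"
  using assms by (auto simp: merging_def)

lemma upd_image: "(t(x0 := v)) ` {..<Suc x0} = insert v (t ` {..<(x0::nat)})"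
  by (auto simp: lessThan_Suc image_iff)

lemma div_block: "lo mod h = 0 \<Longrightarrow> lo \<le> x \<Longrightarrow> x < lo + h \<Longrightarrow> x div h = lo div (h::nat)"
proof -
  assume h: "lo mod h = 0" "lo \<le> x" "x < lo + h"
  define r where "r = x - lo"
  have r: "x = lo + r" "r < h" using h by (auto simp: r_def)
  have "lo = lo div h * h" using h(1) by (simp add: mod_0_imp_dvd)
  then have "x = lo div h * h + r" using r by simp
  also have "\<dots> div h = lo div h" using r(2) by simp
  finally show ?thesis .
qed

lemma block_sorted_upd:
  assumes "block_sorted k H x0 t" "lo mod H = 0" "lo \<le> x0" "x0 < lo + H" "\<And>x. lo \<le> x \<Longrightarrow> x < x0 \<Longrightarrow> k (t x) \<le> k v"
  shows "block_sorted k H (Suc x0) (t(x0 := v))"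
  unfolding block_sorted_def
proof (intro allI impI)
  fix x y assume h: "x \<le> y" "y < Suc x0" "x div H = y div H"
  show "k ((t(x0 := v)) x) \<le> k ((t(x0 := v)) y)"
  proof (cases "y = x0")
    case True
    have "x0 div H = lo div H" by (rule div_block[OF assms(2-4)])
    have "lo \<le> x"
    proof -
      have "lo = lo div H * H" using assms(2) by (simp add: mod_0_imp_dvd)
      also have "\<dots> = x div H * H" using h(3) True \<open>x0 div H = lo div H\<close> by simp
      also have "\<dots> \<le> x" by simp
      finally show ?thesis .
    qed
    then show ?thesis using True h assms(5)[of x] by auto
  qed (use h assms(1) in \<open>auto simp: block_sorted_def\<close>)
qed

text \<open>Taking the left head is safe: it is minimal in its own run, and the rest of the right
  run is at least \<open>p b\<close>, hence at least \<open>p a\<close>. \<open>merging_B\<close> is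
  the mirror image.\<close>

lemma merging_A:
  assumes m: "merging k p h m x0 lo a b mid hi t" and a: "a < mid" "b < hi \<longrightarrow> k (p a) \<le> k (p b)" and p: "block_sorted k h m p"
  shows "merging k p h m (Suc x0) lo (Suc a) b mid hi (t(x0 := p a))"
proof -
  have h: "lo mod (2 * h) = 0" "lo \<le> x0" "mid = min (lo + h) m" "hi = min (lo + 2 * h) m"
     "lo \<le> a" "a \<le> mid" "mid \<le> b" "b \<le> hi" "a + b = x0 + mid" "t ` {..<x0} = p ` ({..<a} \<union> {mid..<b})"
     "block_sorted k (2 * h) x0 t"
     and less: "\<And>x y. lo \<le> x \<Longrightarrow> x < x0 \<Longrightarrow> (a \<le> y \<and> y < mid \<or> b \<le> y \<and> y < hi) \<Longrightarrow> k (t x) \<le> k (p y)"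
    using m unfolding merging_def by auto
  have x0: "x0 < lo + 2 * h" using h a by linarith
  have loh: "lo mod h = 0" "(lo + h) mod h = 0" using h(1) by (metis mod_mult_self2_is_0 mod_mod_cancel dvd_triv_right mod_0 mod_add_self2)+
  have im: "(t(x0 := p a)) ` {..<Suc x0} = p ` ({..<Suc a} \<union> {mid..<b})"
    unfolding upd_image h(10) by (auto simp: less_Suc_eq)
  have so: "block_sorted k (2 * h) (Suc x0) (t(x0 := p a))"
    using block_sorted_upd[OF h(11,1,2) x0] less a by auto
  have pa: "k (p a) \<le> k (p y)" if "Suc a \<le> y \<and> y < mid \<or> b \<le> y \<and> y < hi" for y
    using that
  proof
    assume y: "Suc a \<le> y \<and> y < mid"
    have "a div h = lo div h" "y div h = lo div h" using y h by (auto intro!: div_block loh)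
    then show ?thesis using p y h unfolding block_sorted_def by auto
  next
    assume y: "b \<le> y \<and> y < hi"
    have mm: "mid = lo + h" using y h by auto
    have "b div h = (lo + h) div h" by (rule div_block[OF loh(2)]) (use y h mm in linarith)+
    moreover have "y div h = (lo + h) div h" by (rule div_block[OF loh(2)]) (use y h mm in linarith)+
    ultimately have "k (p b) \<le> k (p y)" using p y h unfolding block_sorted_def by auto
    then show ?thesis using a y by auto
  qed
  show ?thesis unfolding merging_def
    using h a im so less pa by (auto simp: less_Suc_eq)
qed

lemma merging_B:
  assumes m: "merging k p h m x0 lo a b mid hi t" and b: "b < hi" "a < mid \<longrightarrow> k (p b) \<le> k (p a)" and p: "block_sorted k h m p"
  shows "merging k p h m (Suc x0) lo a (Suc b) mid hi (t(x0 := p b))"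
proof -
  have h: "lo mod (2 * h) = 0" "lo \<le> x0" "mid = min (lo + h) m" "hi = min (lo + 2 * h) m"
     "lo \<le> a" "a \<le> mid" "mid \<le> b" "b \<le> hi" "a + b = x0 + mid" "t ` {..<x0} = p ` ({..<a} \<union> {mid..<b})"
     "block_sorted k (2 * h) x0 t"
     and less: "\<And>x y. lo \<le> x \<Longrightarrow> x < x0 \<Longrightarrow> (a \<le> y \<and> y < mid \<or> b \<le> y \<and> y < hi) \<Longrightarrow> k (t x) \<le> k (p y)"
    using m unfolding merging_def by auto
  have x0: "x0 < lo + 2 * h" using h b by linarith
  have loh: "lo mod h = 0" "(lo + h) mod h = 0" using h(1) by (metis mod_mult_self2_is_0 mod_mod_cancel dvd_triv_right mod_0 mod_add_self2)+
  have im: "(t(x0 := p b)) ` {..<Suc x0} = p ` ({..<a} \<union> {mid..<Suc b})"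
    unfolding upd_image h(10) using h(7) by (auto simp: less_Suc_eq)
  have so: "block_sorted k (2 * h) (Suc x0) (t(x0 := p b))"
    using block_sorted_upd[OF h(11,1,2) x0] less b by auto
  have mm: "mid = lo + h" using b h by auto
  have pb: "k (p b) \<le> k (p y)" if "a \<le> y \<and> y < mid \<or> Suc b \<le> y \<and> y < hi" for y
    using that
  proof
    assume y: "a \<le> y \<and> y < mid"
    have "a div h = lo div h" "y div h = lo div h" using y h by (auto intro!: div_block loh)
    then have "k (p a) \<le> k (p y)" using p y h unfolding block_sorted_def by auto
    then show ?thesis using b y by auto
  next
    assume y: "Suc b \<le> y \<and> y < hi"
    have "b div h = (lo + h) div h" by (rule div_block[OF loh(2)]) (use y h mm in linarith)+
    moreover have "y div h = (lo + h) div h" by (rule div_block[OF loh(2)]) (use y h mm in linarith)+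
    ultimately show ?thesis using p y h unfolding block_sorted_def by auto
  qed
  show ?thesis unfolding merging_def
    using h b im so less pb by (auto simp: less_Suc_eq)
qed

text \<open>A single loop over the target positions; a new pair of runs begins at every multiple of
  \<open>2 * h\<close>. Variables \<open>31\<close> and \<open>32\<close> are the heads,
  \<open>33\<close> and \<open>34\<close> the ends of the two runs, and \<open>35\<close> is
  \<open>1\<close> if the right head is to be taken.\<close>

definition pass :: com where
  "pass = For 30 vNN (
     If (V 30 \<odot> V 24) (N 1)
       (Assign 31 (V 30) ;; Assign 33 (V 30 \<oplus> V 23) ;; If (V vNN) (V 33) (Assign 33 (V vNN)) Skip ;; Assign 32 (V 33) ;;
        Assign 34 (V 30 \<oplus> V 24) ;; If (V vNN) (V 34) (Assign 34 (V vNN)) Skip)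
       Skip ;;
     Assign 35 (N 0) ;;
     If (V 31) (V 33)
       (If (V 32) (V 34)
          (If (Rd aK (N 0) (Rd aP (N 0) (V 32))) (Rd aK (N 0) (Rd aP (N 0) (V 31))) (Assign 35 (N 1)) Skip)
          Skip)
       (Assign 35 (N 1)) ;;
     If (V 35) (N 1)
       (Wr aT (N 0) (V 30) (Rd aP (N 0) (V 31)) ;; Assign 31 (V 31 \<oplus> N 1))
       (Wr aT (N 0) (V 30) (Rd aP (N 0) (V 32)) ;; Assign 32 (V 32 \<oplus> N 1)))"

context ram
begin

lemma tri_Assign_Seq: "tri (Assign x e ;; c) s T Q \<longleftrightarrow> ok e s \<and> tri c (s\<lparr>vr := (vr s)(x := ev e s)\<rparr>) T Q"
  by simp

lemma pass_correct:
  assumes s: "vr s vNN = m" "vr s 23 = h" "vr s 24 = 2 * h" "1 \<le> h" "h < m" "3 * m < R"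
    and p: "ar s aP 0 ` {..<m} = {..<m}" "block_sorted (ar s aK 0) h m (ar s aP 0)"
  shows "tri pass s m (\<lambda>s'. ar s' aT 0 ` {..<m} = {..<m} \<and> block_sorted (ar s aK 0) (2 * h) m (ar s' aT 0))"
proof -
  define k where "k = ar s aK 0"
  define q where "q = ar s aP 0"
  \<comment> \<open>Either no merge is active and \<open>x\<close> is a boundary of runs or the end,
    or a merge is active and has cells left to write.\<close>
  define J where "J x s' \<longleftrightarrow> (ar s' aT 0 ` {..<x} = q ` {..<x} \<and> block_sorted k (2 * h) x (ar s' aT 0) \<and> (x mod (2 * h) = 0 \<or> x = m)) \<or>
     (\<exists>lo. x < vr s' 34 \<and> merging k q h m x lo (vr s' 31) (vr s' 32) (vr s' 33) (vr s' 34) (ar s' aT 0))" for x and s' :: store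
  have RW: "R < W" "3 < R" using R_less_W R_ge by linarith+
  have qm: "q x < m" if "x < m" for x using p(1) that unfolding q_def by blast
  have bs: "block_sorted k h m q" using p(2) by (simp add: k_def q_def)
  have fin: "J (Suc x) s'" if "merging k q h m (Suc x) lo (vr s' 31) (vr s' 32) (vr s' 33) (vr s' 34) (ar s' aT 0)" "Suc x \<le> vr s' 34" for x lo s'
  proof (cases "Suc x = vr s' 34")
    case True
    have h: "lo mod (2 * h) = 0" "vr s' 33 = min (lo + h) m" "vr s' 34 = min (lo + 2 * h) m"
      "lo \<le> vr s' 31" "vr s' 31 \<le> vr s' 33" "vr s' 33 \<le> vr s' 32" "vr s' 32 \<le> vr s' 34" "vr s' 31 + vr s' 32 = Suc x + vr s' 33"
      "ar s' aT 0 ` {..<Suc x} = q ` ({..<vr s' 31} \<union> {vr s' 33..<vr s' 32})" "block_sorted k (2 * h) (Suc x) (ar s' aT 0)"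
      using that unfolding merging_def by auto
    have "vr s' 31 = vr s' 33" "vr s' 32 = Suc x" using h True by linarith+
    then have "{..<vr s' 31} \<union> {vr s' 33..<vr s' 32} = {..<Suc x}" using h by auto
    moreover have "Suc x mod (2 * h) = 0 \<or> Suc x = m" using True h(1,3) by (auto simp: min_def)
    ultimately show ?thesis using h(9,10) unfolding J_def by simp
  next
    case False
    then show ?thesis using that unfolding J_def by auto
  qed
  have "tri pass s m (\<lambda>s'. J m s')" unfolding pass_def
  proof (rule tri_For[where m = m and b = 0 and I = J], goal_cases)
    case (7 x s1)
    have v: "vr s1 vNN = m" "vr s1 23 = h" "vr s1 24 = 2 * h" "ar s1 aK = ar s aK" "ar s1 aP = ar s aP"
      using 7 s by (auto simp: frame_def)
    have nx: "x \<noteq> m" using 7 by simp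
    define s2 where "s2 = (if x mod (2 * h) = 0 then s1\<lparr>vr := (vr s1)(31 := x, 33 := min (x + h) m, 32 := min (x + h) m, 34 := min (x + 2 * h) m)\<rparr> else s1)"
    have "\<exists>lo. x < vr s2 34 \<and> merging k q h m x lo (vr s2 31) (vr s2 32) (vr s2 33) (vr s2 34) (ar s2 aT 0)"
    proof (cases "x mod (2 * h) = 0")
      case True
      have "ar s1 aT 0 ` {..<x} = q ` {..<x} \<and> block_sorted k (2 * h) x (ar s1 aT 0)"
        using 7(4) unfolding J_def
      proof
        assume "\<exists>lo. x < vr s1 34 \<and> merging k q h m x lo (vr s1 31) (vr s1 32) (vr s1 33) (vr s1 34) (ar s1 aT 0)"
        then obtain lo where lo: "x < vr s1 34" "merging k q h m x lo (vr s1 31) (vr s1 32) (vr s1 33) (vr s1 34) (ar s1 aT 0)" by blast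
        then have l: "lo mod (2 * h) = 0" "lo \<le> x" "x < lo + 2 * h" by (auto simp: merging_def)
        then have "x div (2 * h) = lo div (2 * h)" by (rule div_block)
        \<comment> \<open>A multiple of \<open>2 * h\<close> inside an active merge can only be its
          start, where nothing of it has been written yet.\<close>
        then have "x = lo" using True l(1) by (metis div_mult_mod_eq)
        then have e: "vr s1 31 = x" "vr s1 32 = vr s1 33" using lo(2) unfolding merging_def by auto
        show ?thesis using lo(2) unfolding merging_def e by auto
      qed auto
      then show ?thesis using True merging_init[OF True 7(1)] 7(1) s(4) by (intro exI[of _ x]) (auto simp: s2_def)
    next
      case False
      then show ?thesis using 7(4) nx by (auto simp: J_def s2_def)
    qed
    then obtain lo where lo: "x < vr s2 34" "merging k q h m x lo (vr s2 31) (vr s2 32) (vr s2 33) (vr s2 34) (ar s2 aT 0)" by blast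
    have v2: "vr s2 vNN = m" "vr s2 23 = h" "vr s2 24 = 2 * h" "ar s2 aK 0 = k" "ar s2 aP 0 = q" "vr s2 30 = x"
      using v 7 by (auto simp: s2_def k_def q_def)
    have ab: "vr s2 31 \<le> vr s2 33" "vr s2 33 \<le> m" "vr s2 32 \<le> vr s2 34" "vr s2 34 \<le> m" "vr s2 33 \<le> vr s2 32"
       "vr s2 31 + vr s2 32 = x + vr s2 33"
      using lo(2) unfolding merging_def by auto
    have pre: "tri (If (V 30 \<odot> V 24) (N 1)
       (Assign 31 (V 30) ;; Assign 33 (V 30 \<oplus> V 23) ;; If (V vNN) (V 33) (Assign 33 (V vNN)) Skip ;; Assign 32 (V 33) ;;
        Assign 34 (V 30 \<oplus> V 24) ;; If (V vNN) (V 34) (Assign 34 (V vNN)) Skip)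
       Skip) s1 0 (\<lambda>s'. s' = s2)"
      using 7 v s RW by (auto simp: s2_def min_def fun_upd_twist)
    show ?case
    proof (rule tri_Seq[OF pre, where Tb = 0], goal_cases)
      case (1 s3)
      note [simp] = 1(1)
      show ?case
      proof (cases "vr s2 31 < vr s2 33 \<and> (vr s2 32 < vr s2 34 \<longrightarrow> k (q (vr s2 31)) \<le> k (q (vr s2 32)))")
        case True
        have "J (Suc x) (s2\<lparr>vr := (vr s2)(35 := 0, 31 := Suc (vr s2 31), 30 := Suc x), ar := upd3 (ar s2) aT 0 x (q (vr s2 31))\<rparr>)"
          using merging_A[OF lo(2) _ _ bs] True lo(1) by (intro fin[where lo = lo]) (auto simp: fun_upd_def)
        then show ?thesis using True ab v2 s RW qm[of "vr s2 31"] qm[of "vr s2 32"] 7(1) by (auto simp: not_less)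
      next
        case False
        have b: "vr s2 32 < vr s2 34" using False ab lo(1) by linarith
        have "J (Suc x) (s2\<lparr>vr := (vr s2)(35 := 1, 32 := Suc (vr s2 32), 30 := Suc x), ar := upd3 (ar s2) aT 0 x (q (vr s2 32))\<rparr>)"
          using merging_B[OF lo(2) b _ bs] False lo(1) by (intro fin[where lo = lo]) (auto simp: fun_upd_def)
        then show ?thesis using False b ab v2 s RW qm[of "vr s2 31"] qm[of "vr s2 32"] 7(1) by (auto simp: not_less)
      qed
    qed auto
  qed (use s RW in \<open>auto simp: J_def block_sorted_def\<close>)
  then show ?thesis
  proof (rule tri_weaken)
    fix s' assume "J m s'"
    then show "ar s' aT 0 ` {..<m} = {..<m} \<and> block_sorted (ar s aK 0) (2 * h) m (ar s' aT 0)"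
      using p(1) unfolding J_def merging_def by (auto simp: k_def q_def)
  qed auto
qed

end

definition sort_entries :: com where
  "sort_entries = For 30 vNN (Wr aK (N 0) (V 30) (Rd aQ (V 30 \<oslash> V vn) (V 30 \<odot> V vn)) ;; Wr aP (N 0) (V 30) (V 30)) ;;
     Assign 23 (N 1) ;;
     While (V 23) (V vNN) (
       Assign 24 (V 23 \<oplus> V 23) ;; pass ;; For 30 vNN (Wr aP (N 0) (V 30) (Rd aT (N 0) (V 30))) ;; Assign 23 (V 24))"

context ram
begin

text \<open>The run length doubles with every pass, so \<open>F\<close> bounds the number of
  passes.\<close>

lemma sort_entries_correct:
  assumes s: "vr s vn = n" "vr s vNN = n * n" "4 * (n * n) < R" and F: "n * n \<le> 2 ^ F"
  shows "tri sort_entries s (n * n + Suc F * Suc (2 * (n * n)))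
    (\<lambda>s'. ar s' aP 0 ` {..<n * n} = {..<n * n} \<and>
      (\<forall>x y. x \<le> y \<longrightarrow> y < n * n \<longrightarrow> ar s aQ (ar s' aP 0 x div n) (ar s' aP 0 x mod n) \<le> ar s aQ (ar s' aP 0 y div n) (ar s' aP 0 y mod n)))"
proof -
  let ?m = "n * n"
  define k where "k x = ar s aQ (x div n) (x mod n)" for x
  have RW: "R < W" "3 < R" using R_less_W R_ge by linarith+
  have init: "tri (For 30 vNN (Wr aK (N 0) (V 30) (Rd aQ (V 30 \<oslash> V vn) (V 30 \<odot> V vn)) ;; Wr aP (N 0) (V 30) (V 30))) s ?m
     (\<lambda>s'. \<forall>x<?m. ar s' aK 0 x = k x \<and> ar s' aP 0 x = x)"
  proof (rule tri_For[where m = ?m and b = 0 and I = "\<lambda>y s'. \<forall>x<y. ar s' aK 0 x = k x \<and> ar s' aP 0 x = x"], goal_cases)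
    case (7 x s1)
    have v: "vr s1 vn = n" "ar s1 aQ = ar s aQ" using 7 s by (auto simp: frame_def)
    have "n > 0" using 7(1) by (cases n) auto
    then have "x div n < n" "x mod n < n" "n \<le> ?m" using 7(1) by (auto simp: less_mult_imp_div_less)
    then have "x div n < R" "x mod n < R" "x < R" "0 < W" using s 7(1) RW by linarith+
    then show ?case using 7 v RW by (auto simp: k_def less_Suc_eq)
  qed (use s RW in auto)
  let ?I = "\<lambda>f s'. 1 \<le> vr s' 23 \<and> ?m \<le> vr s' 23 * 2 ^ f \<and> vr s' 23 < 2 * ?m + 2 \<and> (\<forall>x<?m. ar s' aK 0 x = k x) \<and>
     ar s' aP 0 ` {..<?m} = {..<?m} \<and> block_sorted (ar s' aK 0) (vr s' 23) ?m (ar s' aP 0)"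
  let ?Q = "\<lambda>s'. ar s' aP 0 ` {..<?m} = {..<?m} \<and> (\<forall>x y. x \<le> y \<longrightarrow> y < ?m \<longrightarrow> k (ar s' aP 0 x) \<le> k (ar s' aP 0 y))"
  have loop: "tri (While (V 23) (V vNN) (Assign 24 (V 23 \<oplus> V 23) ;; pass ;; For 30 vNN (Wr aP (N 0) (V 30) (Rd aT (N 0) (V 30))) ;; Assign 23 (V 24)))
     s1 (Suc F * Suc (2 * ?m)) ?Q" if I: "?I F s1" and v1: "vr s1 vNN = ?m" for s1
  proof (rule tri_While[where I = ?I and b = "2 * ?m", OF I], goal_cases)
    case (2 f s2)
    then have v2: "vr s2 vNN = ?m" "vr s2 23 < ?m" using v1 by (auto simp: frame_def pass_def)
    define s3 where "s3 = s2\<lparr>vr := (vr s2)(24 := 2 * vr s2 23)\<rparr>"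
    have "tri (pass ;; For 30 vNN (Wr aP (N 0) (V 30) (Rd aT (N 0) (V 30))) ;; Assign 23 (V 24)) s3 (2 * ?m) (\<lambda>s4. \<exists>f'<f. ?I f' s4)"
    proof (rule tri_Seq[where Ta = ?m and Tb = ?m])
      show "tri pass s3 ?m (\<lambda>s'. ar s' aT 0 ` {..<?m} = {..<?m} \<and> block_sorted (ar s3 aK 0) (2 * vr s3 23) ?m (ar s' aT 0))"
        using 2 v2 s by (intro pass_correct) (auto simp: s3_def)
    next
      fix s4 assume 4: "ar s4 aT 0 ` {..<?m} = {..<?m} \<and> block_sorted (ar s3 aK 0) (2 * vr s3 23) ?m (ar s4 aT 0)"
        and fr: "frame (wv pass) (wa pass) s3 s4"
      have v4: "vr s4 vNN = ?m" "vr s4 24 = 2 * vr s2 23" "ar s4 aK = ar s2 aK"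
        using fr v2 by (auto simp: frame_def s3_def pass_def)
      have 4: "ar s4 aT 0 ` {..<?m} = {..<?m}" "block_sorted (ar s2 aK 0) (2 * vr s2 23) ?m (ar s4 aT 0)" using 4 by (auto simp: s3_def)
      show "tri (For 30 vNN (Wr aP (N 0) (V 30) (Rd aT (N 0) (V 30))) ;; Assign 23 (V 24)) s4 ?m (\<lambda>s4. \<exists>f'<f. ?I f' s4)"
      proof (rule tri_Seq[where Ta = ?m and Tb = 0])
        show "tri (For 30 vNN (Wr aP (N 0) (V 30) (Rd aT (N 0) (V 30)))) s4 ?m (\<lambda>s'. \<forall>x<?m. ar s' aP 0 x = ar s4 aT 0 x)"
        proof (rule tri_For[where m = ?m and b = 0 and I = "\<lambda>y s'. \<forall>x<y. ar s' aP 0 x = ar s4 aT 0 x"], goal_cases)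
          case (7 x s5)
          have "ar s5 aT = ar s4 aT" using 7 by (auto simp: frame_def)
          then show ?case using 7 s RW by (auto simp: less_Suc_eq)
        qed (use v4 s RW in auto)
      next
        fix s5 assume 5: "\<forall>x<?m. ar s5 aP 0 x = ar s4 aT 0 x"
          and fr5: "frame (wv (For 30 vNN (Wr aP (N 0) (V 30) (Rd aT (N 0) (V 30))))) (wa (For 30 vNN (Wr aP (N 0) (V 30) (Rd aT (N 0) (V 30))))) s4 s5"
        have v5: "vr s5 24 = 2 * vr s2 23" "ar s5 aK = ar s2 aK" using fr5 v4 by (auto simp: frame_def)
        have im: "ar s5 aP 0 ` {..<?m} = {..<?m}" using 4(1) 5 by (metis (no_types, lifting) image_cong lessThan_iff)
        have so: "block_sorted (ar s2 aK 0) (2 * vr s2 23) ?m (ar s5 aP 0)" using 4(2) 5 unfolding block_sorted_def by auto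
        have "f \<noteq> 0" using 2(1) v2(2) by (cases f) auto
        then obtain f' where "f = Suc f'" using not0_implies_Suc by blast
        then show "tri (Assign 23 (V 24)) s5 0 (\<lambda>s4. \<exists>f'<f. ?I f' s4)"
          using 2(1) v2(2) v5 im so by (auto intro!: exI[of _ f'])
      qed simp
    qed simp
    then have t: "tri (pass ;; For 30 vNN (Wr aP (N 0) (V 30) (Rd aT (N 0) (V 30))) ;; Assign 23 (V 24)) s3 (2 * ?m) (\<lambda>s4. (\<exists>f'<f. ?I f' s4) \<or> X s4)" for X
      by (rule tri_weaken) (rule order_refl, rule disjI1)
    have o: "ok (V 23 \<oplus> V 23) s2" using v2 s RW by simp
    show ?case unfolding tri_Assign_Seq ev.simps opv.simps mult_2[symmetric] s3_def[symmetric] by (intro conjI o t)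
  next
    case (3 f s2)
    then have v2: "vr s2 vNN = ?m" "\<not> vr s2 23 < ?m" using v1 by (auto simp: frame_def pass_def)
    have im: "ar s2 aP 0 x < ?m" if "x < ?m" for x using 3(1) that by blast
    have "k (ar s2 aP 0 x) \<le> k (ar s2 aP 0 y)" if h: "x \<le> y" "y < ?m" for x y
    proof -
      have "x div vr s2 23 = 0" "y div vr s2 23 = 0" using h v2 by auto
      then have "ar s2 aK 0 (ar s2 aP 0 x) \<le> ar s2 aK 0 (ar s2 aP 0 y)"
        using 3(1) h unfolding block_sorted_def by auto
      then show ?thesis using im h 3(1) by auto
    qed
    then show ?case using 3(1) by blast
  qed (use v1 in \<open>auto simp: frame_def pass_def\<close>)
  have "tri sort_entries s (?m + Suc F * Suc (2 * ?m)) ?Q"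
    unfolding sort_entries_def
  proof (rule tri_Seq[OF init, where Tb = "Suc F * Suc (2 * ?m)"], goal_cases)
    case (1 s1)
    have v1: "vr s1 vNN = ?m" using 1 s by (auto simp: frame_def)
    let ?s = "s1\<lparr>vr := (vr s1)(23 := 1)\<rparr>"
    have "?I F ?s" using 1 F by (auto simp: block_sorted_def)
    from loop[OF this] show ?case using v1 RW by simp
  qed auto
  then show ?thesis unfolding k_def .
qed

end

section \<open>Ranks within rows and columns\<close>

definition cnt :: "(nat \<Rightarrow> nat) \<Rightarrow> nat \<Rightarrow> nat \<Rightarrow> nat" where
  "cnt f i x = card {y. y < x \<and> f y = i}"

lemma cnt_0 [simp]: "cnt f i 0 = 0" by (simp add: cnt_def)

lemma cnt_Suc: "cnt f i (Suc x) = cnt f i x + (if f x = i then 1 else 0)"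
proof -
  have "{y. y < Suc x \<and> f y = i} = (if f x = i then insert x {y. y < x \<and> f y = i} else {y. y < x \<and> f y = i})"
    by (auto simp: less_Suc_eq)
  then show ?thesis by (simp add: cnt_def)
qed

lemma cnt_mono: "x \<le> y \<Longrightarrow> cnt f i x \<le> cnt f i y"
  unfolding cnt_def by (intro card_mono) auto

lemma cnt_strict: "x < y \<Longrightarrow> f x = i \<Longrightarrow> cnt f i x < cnt f i y"
  using cnt_mono[of "Suc x" y f i] by (simp add: cnt_Suc)

lemma cnt_attained: "p < cnt f i m \<Longrightarrow> \<exists>x<m. f x = i \<and> cnt f i x = p"
proof (induction m)
  case (Suc m)
  show ?case
  proof (cases "p < cnt f i m")
    case True
    then show ?thesis using Suc.IH less_SucI by blast
  next
    case False
    then have "f m = i \<and> cnt f i m = p" using Suc.prems by (auto simp: cnt_Suc split: if_splits)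
    then show ?thesis by blast
  qed
qed simp

lemma sum_cnt: "(\<And>y. y < x \<Longrightarrow> f y < n) \<Longrightarrow> (\<Sum>i<n. cnt f i x) = x"
proof (induction x)
  case (Suc x)
  have "(\<Sum>i<n. if f x = i then 1 else 0) = (1::nat)" using Suc.prems[of x] by simp
  then show ?case using Suc by (simp add: cnt_Suc sum.distrib)
qed simp

text \<open>\<open>P\<close> permutes the numbers below \<open>n * n\<close>, so the count equals
  the number of \<open>z < n * n\<close> with a prescribed quotient, or a prescribed remainder,
  modulo \<open>n\<close>.\<close>

lemma cnt_perm:
  assumes P: "P ` {..<n * n} = {..<n * (n::nat)}" and i: "i < n"
  shows "cnt (\<lambda>y. P y div n) i (n * n) = n" "cnt (\<lambda>y. P y mod n) i (n * n) = n"
proof -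
  have inj: "inj_on P {..<n * n}" using P by (intro eq_card_imp_inj_on) auto
  have gen: "card {y. y < n * n \<and> g (P y) = i} = card {z. z < n * n \<and> g z = i}" for g
  proof -
    have "P ` {y. y < n * n \<and> g (P y) = i} = {z. z < n * n \<and> g z = i}"
    proof (intro equalityI subsetI)
      fix z assume "z \<in> {z. z < n * n \<and> g z = i}"
      then have "z \<in> P ` {..<n * n}" "g z = i" using P by auto
      then show "z \<in> P ` {y. y < n * n \<and> g (P y) = i}" by auto
    qed (use P in auto)
    moreover have "inj_on P {y. y < n * n \<and> g (P y) = i}" using inj by (rule inj_on_subset) auto
    ultimately show ?thesis using card_image by fastforce
  qed
  have "{z. z < n * n \<and> z div n = i} = {i * n..<i * n + n}"
  proof (intro equalityI subsetI)
    fix z assume z: "z \<in> {z. z < n * n \<and> z div n = i}"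
    then have "z = i * n + z mod n" using div_mult_mod_eq[of z n] by auto
    moreover have "z mod n < n" using i by simp
    ultimately show "z \<in> {i * n..<i * n + n}" by auto
  next
    fix z assume z: "z \<in> {i * n..<i * n + n}"
    then obtain j where j: "z = i * n + j" "j < n" by (metis atLeastLessThan_iff le_iff_add nat_add_left_cancel_less)
    then show "z \<in> {z. z < n * n \<and> z div n = i}" using flat_less[OF i j(2)] by auto
  qed
  then show "cnt (\<lambda>y. P y div n) i (n * n) = n" using gen[of "\<lambda>z. z div n"] by (simp add: cnt_def)
  have "{z. z < n * n \<and> z mod n = i} = (\<lambda>j. j * n + i) ` {..<n}"
  proof (intro equalityI subsetI)
    fix z assume z: "z \<in> {z. z < n * n \<and> z mod n = i}"
    then have "z = z div n * n + i" "z div n < n" using div_mult_mod_eq[of z n] by (auto simp: less_mult_imp_div_less)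
    then show "z \<in> (\<lambda>j. j * n + i) ` {..<n}" by blast
  qed (use i flat_less in auto)
  moreover have "inj_on (\<lambda>j. j * n + i) {..<n}" using i by (auto simp: inj_on_def)
  ultimately have "card {z. z < n * n \<and> z mod n = i} = n" by (simp add: card_image)
  then show "cnt (\<lambda>y. P y mod n) i (n * n) = n" using gen[of "\<lambda>z. z mod n"] by (simp add: cnt_def)
qed

text \<open>
  \<open>P\<close> lists the entries \<open>i * n + k\<close> of \<open>Q\<close> in increasing order; \<open>RP i k\<close> and \<open>CP i k\<close> are the positions
  of entry \<open>(i, k)\<close> within its row and its column, and \<open>RS i\<close>, \<open>CS k\<close> are the inverse maps.
\<close>

definition ranked :: "nat \<Rightarrow> (nat \<Rightarrow> nat \<Rightarrow> nat) \<Rightarrow> (nat \<Rightarrow> nat) \<Rightarrow> (nat \<Rightarrow> nat \<Rightarrow> nat) \<Rightarrow> (nat \<Rightarrow> nat \<Rightarrow> nat) \<Rightarrow>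
    (nat \<Rightarrow> nat \<Rightarrow> nat) \<Rightarrow> (nat \<Rightarrow> nat \<Rightarrow> nat) \<Rightarrow> bool" where
  "ranked n Q P RS CS RP CP \<longleftrightarrow> (\<forall>x<n * n. P x < n * n) \<and> (\<forall>i<n. \<forall>k<n. \<exists>x<n * n. P x = i * n + k) \<and>
     (\<forall>x<n * n. RP (P x div n) (P x mod n) = cnt (\<lambda>y. P y div n) (P x div n) x) \<and>
     (\<forall>x<n * n. CP (P x div n) (P x mod n) = cnt (\<lambda>y. P y mod n) (P x mod n) x) \<and>
     (\<forall>i<n. \<forall>k<n. RP i k < n \<and> RS i (RP i k) = k) \<and> (\<forall>i<n. \<forall>p<n. RS i p < n \<and> RP i (RS i p) = p) \<and>
     (\<forall>i<n. \<forall>k<n. CP i k < n \<and> CS k (CP i k) = i) \<and> (\<forall>k<n. \<forall>p<n. CS k p < n \<and> CP (CS k p) k = p) \<and>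
     (\<forall>i<n. \<forall>k<n. \<forall>k'<n. RP i k \<le> RP i k' \<longrightarrow> Q i k \<le> Q i k') \<and>
     (\<forall>k<n. \<forall>i<n. \<forall>i'<n. CP i k \<le> CP i' k \<longrightarrow> Q i k \<le> Q i' k)"

text \<open>As \<open>P\<close> lists all entries in increasing order, the number of earlier entries
  of the same row or column is a valid position in that row or column.\<close>

lemma rankedI:
  assumes P: "P ` {..<n * n} = {..<n * (n::nat)}"
    and so: "\<And>x y. x \<le> y \<Longrightarrow> y < n * n \<Longrightarrow> Q (P x div n) (P x mod n) \<le> Q (P y div n) (P y mod n)"
    and RS: "\<And>x. x < n * n \<Longrightarrow> RS (P x div n) (cnt (\<lambda>y. P y div n) (P x div n) x) = P x mod n"
    and RP: "\<And>x. x < n * n \<Longrightarrow> RP (P x div n) (P x mod n) = cnt (\<lambda>y. P y div n) (P x div n) x"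
    and CS: "\<And>x. x < n * n \<Longrightarrow> CS (P x mod n) (cnt (\<lambda>y. P y mod n) (P x mod n) x) = P x div n"
    and CP: "\<And>x. x < n * n \<Longrightarrow> CP (P x div n) (P x mod n) = cnt (\<lambda>y. P y mod n) (P x mod n) x"
  shows "ranked n Q P RS CS RP CP"
proof -
  have less: "P x < n * n" if "x < n * n" for x using P that by blast
  have ex: "\<exists>x<n * n. P x = i * n + k \<and> P x div n = i \<and> P x mod n = k" if "i < n" "k < n" for i k
  proof -
    have "i * n + k \<in> P ` {..<n * n}" using flat_less[OF that] P by simp
    then obtain x where x: "x < n * n" "P x = i * n + k" by (metis imageE lessThan_iff)
    have "(i * n + k) div n = i" "(i * n + k) mod n = k" using that by simp_all
    then show ?thesis using x by auto
  qed
  have c: "cnt (\<lambda>y. P y div n) i (n * n) = n" "cnt (\<lambda>y. P y mod n) i (n * n) = n" if "i < n" for i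
    using cnt_perm[OF P that] .
  have R1: "RP i k < n \<and> RS i (RP i k) = k \<and> CP i k < n \<and> CS k (CP i k) = i" if ik: "i < n" "k < n" for i k
  proof -
    obtain x where x: "x < n * n" "P x div n = i" "P x mod n = k" using ex[OF ik] by auto
    have "cnt (\<lambda>y. P y div n) i x < n" using cnt_strict[OF x(1), of "\<lambda>y. P y div n" i] x(2) c(1)[OF ik(1)] by simp
    moreover have "cnt (\<lambda>y. P y mod n) k x < n" using cnt_strict[OF x(1), of "\<lambda>y. P y mod n" k] x(3) c(2)[OF ik(2)] by simp
    ultimately show ?thesis using RS[OF x(1)] RP[OF x(1)] CS[OF x(1)] CP[OF x(1)] x by auto
  qed
  have n0: "P x div n < n" "P x mod n < n" if "x < n * n" for x
    using less[OF that] that by (auto simp: less_mult_imp_div_less) (metis mod_less_divisor mult_0 not_gr_zero not_less_zero)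
  have R2: "RS i p < n \<and> RP i (RS i p) = p" if ip: "i < n" "p < n" for i p
  proof -
    obtain x where x: "x < n * n" "P x div n = i" "cnt (\<lambda>y. P y div n) i x = p"
      using cnt_attained[of p "\<lambda>y. P y div n" i "n * n"] c(1)[OF ip(1)] ip(2) by auto
    then show ?thesis using RS[OF x(1)] RP[OF x(1)] n0[OF x(1)] by auto
  qed
  have C2: "CS k p < n \<and> CP (CS k p) k = p" if ip: "k < n" "p < n" for k p
  proof -
    obtain x where x: "x < n * n" "P x mod n = k" "cnt (\<lambda>y. P y mod n) k x = p"
      using cnt_attained[of p "\<lambda>y. P y mod n" k "n * n"] c(2)[OF ip(1)] ip(2) by auto
    then show ?thesis using CS[OF x(1)] CP[OF x(1)] n0[OF x(1)] by auto
  qed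
  have R3: "Q i k \<le> Q i k'" if h: "i < n" "k < n" "k' < n" "RP i k \<le> RP i k'" for i k k'
  proof -
    obtain x where x: "x < n * n" "P x div n = i" "P x mod n = k" using ex[OF h(1,2)] by auto
    obtain x' where x': "x' < n * n" "P x' div n = i" "P x' mod n = k'" using ex[OF h(1,3)] by auto
    have "\<not> x' < x" using cnt_strict[of x' x "\<lambda>y. P y div n" i] x' RP[OF x(1)] RP[OF x'(1)] x h(4) by auto
    then show ?thesis using so[of x x'] x x' by auto
  qed
  have C3: "Q i k \<le> Q i' k" if h: "k < n" "i < n" "i' < n" "CP i k \<le> CP i' k" for i i' k
  proof -
    obtain x where x: "x < n * n" "P x div n = i" "P x mod n = k" using ex[OF h(2,1)] by auto
    obtain x' where x': "x' < n * n" "P x' div n = i'" "P x' mod n = k" using ex[OF h(3,1)] by auto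
    have "\<not> x' < x" using cnt_strict[of x' x "\<lambda>y. P y mod n" k] x' CP[OF x(1)] CP[OF x'(1)] x h(4) by auto
    then show ?thesis using so[of x x'] x x' by auto
  qed
  have ex': "\<exists>x<n * n. P x = i * n + k" if "i < n" "k < n" for i k using ex[OF that] by blast
  show ?thesis unfolding ranked_def
    by (intro conjI allI impI) (simp_all add: less ex' RP CP R1 R2 C2 R3 C3)
qed

text \<open>One bucket pass over the globally sorted list sorts all rows and all columns at once;
  \<open>aRN\<close> and \<open>aCN\<close> are the fill levels of the buckets.\<close>

definition distribute :: com where
  "distribute = For 30 vn (Wr aRN (N 0) (V 30) (N 0) ;; Wr aCN (N 0) (V 30) (N 0)) ;;
     For 30 vNN (
       Assign 31 (Rd aP (N 0) (V 30)) ;; Assign 32 (V 31 \<oslash> V vn) ;; Assign 33 (V 31 \<odot> V vn) ;;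
       Assign 34 (Rd aRN (N 0) (V 32)) ;; Assign 35 (Rd aCN (N 0) (V 33)) ;;
       Wr aRS (V 32) (V 34) (V 33) ;; Wr aRP (V 32) (V 33) (V 34) ;; Wr aRN (N 0) (V 32) (V 34 \<oplus> N 1) ;;
       Wr aCS (V 33) (V 35) (V 32) ;; Wr aCP (V 32) (V 33) (V 35) ;; Wr aCN (N 0) (V 33) (V 35 \<oplus> N 1))"

lemma (in ram) distribute_correct:
  assumes s: "vr s vn = n" "vr s vNN = n * n" "4 * (n * n) < R"
    and P: "ar s aP 0 ` {..<n * n} = {..<n * n}"
    and so: "\<forall>x y. x \<le> y \<longrightarrow> y < n * n \<longrightarrow> ar s aQ (ar s aP 0 x div n) (ar s aP 0 x mod n) \<le> ar s aQ (ar s aP 0 y div n) (ar s aP 0 y mod n)"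
  shows "tri distribute s (n + n * n) (\<lambda>s'. ranked n (ar s aQ) (ar s aP 0) (ar s' aRS) (ar s' aCS) (ar s' aRP) (ar s' aCP))"
proof -
  define p where "p = ar s aP 0"
  define \<rho> where "\<rho> y = p y div n" for y
  define \<gamma> where "\<gamma> y = p y mod n" for y
  have \<rho>f: "\<rho> = (\<lambda>y. ar s aP 0 y div n)" and \<gamma>f: "\<gamma> = (\<lambda>y. ar s aP 0 y mod n)" by (auto simp: \<rho>_def \<gamma>_def p_def)
  have RW: "R < W" "3 < R" using R_less_W R_ge by linarith+
  have nn: "n \<le> n * n" by (rule le_square)
  have nR: "n < R" "n < W" using nn s RW by linarith+
  have inj: "inj_on p {..<n * n}" using P unfolding p_def by (intro eq_card_imp_inj_on) auto
  have pl: "p y < n * n" if "y < n * n" for y using P that unfolding p_def by blast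
  have n0: "\<rho> y < n" "\<gamma> y < n" if "y < n * n" for y
    using pl[OF that] that unfolding \<rho>_def \<gamma>_def by (auto simp: less_mult_imp_div_less) (metis mod_less_divisor mult_0 not_gr_zero not_less_zero)
  have pair: "(\<rho> y, \<gamma> y) = (\<rho> x, \<gamma> x) \<longleftrightarrow> x = y" if "x < n * n" "y < n * n" for x y
  proof
    assume "(\<rho> y, \<gamma> y) = (\<rho> x, \<gamma> x)"
    then have "p x = p y" using div_mult_mod_eq[of "p x" n] div_mult_mod_eq[of "p y" n] unfolding \<rho>_def \<gamma>_def by simp
    then show "x = y" using inj that by (auto dest: inj_onD)
  qed auto
  have cn: "cnt \<rho> (\<rho> x) x < n" "cnt \<gamma> (\<gamma> x) x < n" if "x < n * n" for x
    using cnt_strict[OF that, of \<rho> "\<rho> x"] cnt_strict[OF that, of \<gamma> "\<gamma> x"] cnt_perm[OF P[folded p_def]] n0[OF that]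
    unfolding \<rho>_def \<gamma>_def by auto
  have clear: "tri (For 30 vn (Wr aRN (N 0) (V 30) (N 0) ;; Wr aCN (N 0) (V 30) (N 0))) s n
     (\<lambda>s'. \<forall>i<n. ar s' aRN 0 i = 0 \<and> ar s' aCN 0 i = 0)"
    by (rule tri_For[where m = n and b = 0 and I = "\<lambda>i s'. \<forall>i'<i. ar s' aRN 0 i' = 0 \<and> ar s' aCN 0 i' = 0"])
      (use s RW nR in \<open>auto simp: less_Suc_eq\<close>)
  define J where "J x s' \<longleftrightarrow> (\<forall>i<n. ar s' aRN 0 i = cnt \<rho> i x \<and> ar s' aCN 0 i = cnt \<gamma> i x) \<and>
     (\<forall>y<x. ar s' aRS (\<rho> y) (cnt \<rho> (\<rho> y) y) = \<gamma> y \<and> ar s' aRP (\<rho> y) (\<gamma> y) = cnt \<rho> (\<rho> y) y \<and>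
            ar s' aCS (\<gamma> y) (cnt \<gamma> (\<gamma> y) y) = \<rho> y \<and> ar s' aCP (\<rho> y) (\<gamma> y) = cnt \<gamma> (\<gamma> y) y)" for x and s' :: store
  have "tri distribute s (n + n * n) (\<lambda>s'. J (n * n) s')" unfolding distribute_def
  proof (rule tri_Seq[OF clear, where Tb = "n * n"], goal_cases)
    case (1 s1)
    have v1: "vr s1 vn = n" "vr s1 vNN = n * n" "ar s1 aP = ar s aP" using 1 s by (auto simp: frame_def)
    show ?case
    proof (rule tri_For[where m = "n * n" and b = 0 and I = J], goal_cases)
      case (7 x s2)
      have v2: "vr s2 vn = n" "ar s2 aP 0 = p" "vr s2 30 = x" using 7 v1 by (auto simp: frame_def p_def)
      have b: "\<rho> x < R" "\<gamma> x < R" "cnt \<rho> (\<rho> x) x < R" "cnt \<gamma> (\<gamma> x) x < R" "x < R" "n < R"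
        using n0[OF 7(1)] cn[OF 7(1)] nn s 7(1) by linarith+
      have d1: "\<rho> y = \<rho> x \<and> cnt \<rho> (\<rho> y) y = cnt \<rho> (\<rho> x) x \<longleftrightarrow> False" if "y < x" for y
        using cnt_strict[OF that, of \<rho> "\<rho> x"] by auto
      have d2: "\<gamma> y = \<gamma> x \<and> cnt \<gamma> (\<gamma> y) y = cnt \<gamma> (\<gamma> x) x \<longleftrightarrow> False" if "y < x" for y
        using cnt_strict[OF that, of \<gamma> "\<gamma> x"] by auto
      have d3: "\<rho> y = \<rho> x \<and> \<gamma> y = \<gamma> x \<longleftrightarrow> False" if "y < x" for y
        using pair[OF 7(1), of y] that 7(1) by auto
      let ?s3 = "s2\<lparr>vr := (vr s2)(31 := p x, 32 := \<rho> x, 33 := \<gamma> x, 34 := cnt \<rho> (\<rho> x) x, 35 := cnt \<gamma> (\<gamma> x) x, 30 := Suc x),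
         ar := upd3 (upd3 (upd3 (upd3 (upd3 (upd3 (ar s2) aRS (\<rho> x) (cnt \<rho> (\<rho> x) x) (\<gamma> x)) aRP (\<rho> x) (\<gamma> x) (cnt \<rho> (\<rho> x) x))
           aRN 0 (\<rho> x) (Suc (cnt \<rho> (\<rho> x) x))) aCS (\<gamma> x) (cnt \<gamma> (\<gamma> x) x) (\<rho> x)) aCP (\<rho> x) (\<gamma> x) (cnt \<gamma> (\<gamma> x) x)) aCN 0 (\<gamma> x) (Suc (cnt \<gamma> (\<gamma> x) x))\<rparr>"
      have J: "J (Suc x) ?s3"
        using 7(4) d1 d2 d3 unfolding J_def by (auto simp: less_Suc_eq cnt_Suc)
      have rn: "ar s2 aRN 0 (\<rho> x) = cnt \<rho> (\<rho> x) x" "ar s2 aCN 0 (\<gamma> x) = cnt \<gamma> (\<gamma> x) x"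
        using 7(4) n0[OF 7(1)] unfolding J_def by auto
      show ?case using J v2 b rn RW by (simp add: \<rho>_def[of x] \<gamma>_def[of x])
    qed (use 1 v1 s RW in \<open>auto simp: J_def\<close>)
  qed auto
  then show ?thesis
  proof (rule tri_weaken)
    fix s' assume J: "J (n * n) s'"
    show "ranked n (ar s aQ) (ar s aP 0) (ar s' aRS) (ar s' aCS) (ar s' aRP) (ar s' aCP)"
      using J P so unfolding J_def \<rho>f \<gamma>f by (intro rankedI) auto
  qed auto
qed

section \<open>Dominance products\<close>

text \<open>\<open>vq\<close> is the block length, \<open>vnb\<close> the number of blocks per row,
  \<open>vl\<close> the threshold, \<open>vok\<close> the success flag, \<open>vg\<close> the group
  length, \<open>vgz\<close> the number of all row blocks; \<open>vnp\<close> and \<open>vnc\<close>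
  count the row and column blocks of the current group. \<open>aZ\<close> holds the marks and
  \<open>aRes\<close> the result. \<open>aCR\<close>, \<open>aIR\<close>, \<open>aLP\<close>
  translate between rows and indices of the product, \<open>aCC\<close>, \<open>aIC\<close>,
  \<open>aLK\<close>, \<open>aLV\<close> do so for columns.\<close>

abbreviation (input) "vq \<equiv> 14 :: nat"
abbreviation (input) "vnb \<equiv> 15 :: nat"
abbreviation (input) "vl \<equiv> 16 :: nat"
abbreviation (input) "vok \<equiv> 18 :: nat"
abbreviation (input) "vg \<equiv> 19 :: nat"
abbreviation (input) "vnp \<equiv> 20 :: nat"
abbreviation (input) "vnc \<equiv> 21 :: nat"
abbreviation (input) "vgz \<equiv> 22 :: nat"
abbreviation (input) "aZ \<equiv> 15 :: nat"
abbreviation (input) "aRes \<equiv> 16 :: nat"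
abbreviation (input) "aCR \<equiv> 17 :: nat"
abbreviation (input) "aIR \<equiv> 18 :: nat"
abbreviation (input) "aLP \<equiv> 19 :: nat"
abbreviation (input) "aCC \<equiv> 20 :: nat"
abbreviation (input) "aIC \<equiv> 21 :: nat"
abbreviation (input) "aLK \<equiv> 22 :: nat"
abbreviation (input) "aLV \<equiv> 23 :: nat"

text \<open>\<open>f\<close> maps a rank to its row or column. The value is \<open>1\<close> plus
  the number of the block that received the latest entry of row \<open>i\<close> since rank
  \<open>x0\<close>, and \<open>0\<close> if there was none.\<close>

definition cur :: "(nat \<Rightarrow> nat) \<Rightarrow> nat \<Rightarrow> nat \<Rightarrow> nat \<Rightarrow> nat \<Rightarrow> nat" where
  "cur f q x0 x i = (if cnt f i x = cnt f i x0 then 0 else (cnt f i x - 1) div q + 1)"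

text \<open>The number of blocks of row \<open>i\<close> touched by the ranks from \<open>x0\<close>
  to \<open>x - 1\<close>. These entries are consecutive in the sorted row, so the touched blocks
  form an interval.\<close>

definition ids :: "(nat \<Rightarrow> nat) \<Rightarrow> nat \<Rightarrow> nat \<Rightarrow> nat \<Rightarrow> nat \<Rightarrow> nat" where
  "ids f q x0 x i = (if cnt f i x = cnt f i x0 then 0 else (cnt f i x - 1) div q + 1 - cnt f i x0 div q)"

lemma cur_Suc: "x0 \<le> x \<Longrightarrow> cur f q x0 (Suc x) i = (if i = f x then cnt f i x div q + 1 else cur f q x0 x i)"
  using cnt_mono[of x0 x f i] by (auto simp: cur_def cnt_Suc)

lemma cur_le: "x0 \<le> x \<Longrightarrow> cur f q x0 x i \<le> cnt f i x div q + 1"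
  by (auto simp: cur_def div_le_mono)

lemma div_Suc_cases: "0 < q \<Longrightarrow> 0 < c \<Longrightarrow> c div q = (c - 1) div q \<or> c div q = (c - 1) div q + (1::nat)"
  by (cases c) (auto simp: div_Suc)

text \<open>Consecutive entries of a row stay in their block or enter the next one, so a new block
  appears exactly when \<open>cur\<close> increases.\<close>

lemma ids_Suc:
  assumes "x0 \<le> x" "0 < q"
  shows "ids f q x0 (Suc x) i = ids f q x0 x i + (if i = f x \<and> cur f q x0 x i < cnt f i x div q + 1 then 1 else 0)"
proof (cases "i = f x")
  case True
  let ?c = "cnt f i x" and ?d = "cnt f i x0"
  have le: "?d \<le> ?c" by (rule cnt_mono[OF assms(1)])
  have S: "cnt f i (Suc x) = Suc ?c" using True by (simp add: cnt_Suc)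
  show ?thesis
  proof (cases "?c = ?d")
    case True
    then show ?thesis using S \<open>i = f x\<close> by (simp add: ids_def cur_def)
  next
    case False
    then have c: "?d \<le> ?c - 1" "0 < ?c" using le by auto
    have "?d div q \<le> (?c - 1) div q" using c(1) by (rule div_le_mono)
    then show ?thesis using S False le \<open>i = f x\<close> div_Suc_cases[OF assms(2) c(2)]
      by (auto simp: ids_def cur_def)
  qed
next
  case False
  then show ?thesis by (simp add: ids_def cnt_Suc)
qed

lemma sum_ids_Suc:
  assumes "x0 \<le> x" "0 < q" "f x < n"
  shows "(\<Sum>i<n. ids f q x0 (Suc x) i) = (\<Sum>i<n. ids f q x0 x i) + (if cur f q x0 x (f x) < cnt f (f x) x div q + 1 then 1 else 0)"
proof -
  have "(\<Sum>i<n. if i = f x \<and> cur f q x0 x i < cnt f i x div q + 1 then 1 else 0) =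
    (\<Sum>i<n. if i = f x then (if cur f q x0 x (f x) < cnt f (f x) x div q + 1 then 1 else 0) else (0::nat))"
    by (intro sum.cong) auto
  then show ?thesis using assms by (simp add: ids_Suc sum.distrib)
qed

text \<open>A row that receives \<open>c\<close> entries of the group touches at most
  \<open>c / q + 2\<close> blocks. Summing over \<open>n\<close> rows and at most
  \<open>n * q\<close> entries gives \<open>3 * n\<close>, which is why the products have this
  dimension.\<close>

lemma sum_ids_le:
  assumes "x0 \<le> x" "x \<le> x0 + n * q" "0 < q" "\<And>y. y < x \<Longrightarrow> f y < n"
  shows "(\<Sum>i<n. ids f q x0 x i) \<le> 3 * n"
proof -
  have "ids f q x0 x i * q + cnt f i x0 \<le> cnt f i x + 2 * q" for i
  proof (cases "cnt f i x = cnt f i x0")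
    case False
    let ?c = "cnt f i x" and ?d = "cnt f i x0"
    have le: "?d \<le> ?c" by (rule cnt_mono[OF assms(1)])
    have "ids f q x0 x i * q = ((?c - 1) div q) * q + q - ?d div q * q"
      using False by (simp add: ids_def diff_mult_distrib)
    moreover have "((?c - 1) div q) * q \<le> ?c - 1" by simp
    moreover have "?d < ?d div q * q + q"
      using div_mult_mod_eq[of ?d q] mod_less_divisor[OF assms(3), of ?d] by linarith
    moreover have "?d div q * q \<le> ?d" by simp
    \<comment> \<open>This rules out truncation in the subtraction of \<open>ids\<close>.\<close>
    moreover have "?d div q * q \<le> (?c - 1) div q * q + q" 
      using div_le_mono[of ?d "?c" q] div_Suc_cases[OF assms(3), of ?c] le False
      by (cases "?c = 0") (auto intro: order_trans[OF mult_le_mono1])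
    ultimately show ?thesis using le False by linarith
  qed (simp add: ids_def)
  then have "(\<Sum>i<n. ids f q x0 x i * q + cnt f i x0) \<le> (\<Sum>i<n. cnt f i x + 2 * q)" by (intro sum_mono) auto
  then have "(\<Sum>i<n. ids f q x0 x i) * q + x0 \<le> x + n * (2 * q)"
    using sum_cnt[of x f n] sum_cnt[of x0 f n] assms by (simp add: sum.distrib sum_distrib_right)
  then have "(\<Sum>i<n. ids f q x0 x i) * q \<le> 3 * n * q"
  proof -
    have "n * (2 * q) = 2 * (n * q)" "3 * n * q = 3 * (n * q)" by simp_all
    then show ?thesis using \<open>_ \<le> x + n * (2 * q)\<close> assms(2) by linarith
  qed
  then show ?thesis using assms(3) by simp
qed

text \<open>\<open>Q\<close> is the matrix of keys, \<open>l\<close> the threshold, \<open>q\<close>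
  the block length. \<open>Lq\<close> bounds the running time of the foreign program in dimension
  \<open>3 * n\<close>; it occurs in the analysis only, while the budget of the program is
  \<open>n * q * q\<close>.\<close>

locale dom = ram w P W R ws for w P W R ws +
  fixes n q l nb Lq :: nat and Q :: "nat \<Rightarrow> nat \<Rightarrow> nat" and ord :: "nat \<Rightarrow> nat" and RS CS RP CP :: "nat \<Rightarrow> nat \<Rightarrow> nat"
  assumes rk: "ranked n Q ord RS CS RP CP" and n1: "1 \<le> n" and q1: "1 \<le> q" and nb_def: "nb = n div q + 1"
    and nR: "100 * (n * n) + 100 < R" and qR: "4 * (n * q * q) < R"
    and QR: "\<And>i k. i < n \<Longrightarrow> k < n \<Longrightarrow> Q i k \<le> R" and lR: "l \<le> R"
    and mm: "\<And>A B \<sigma>. (\<forall>i<3 * n. \<forall>j<3 * n. A i j \<le> 1 \<and> B i j \<le> 1) \<Longrightarrow> matmul_input ws (3 * n) A B \<sigma> \<Longrightarrow>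
      \<exists>t\<le>Lq. halted P ((step ws P ^^ t) \<sigma>) \<and> matmul_output (3 * n) (\<lambda>i j. \<Sum>k<3 * n. A i k * B k j) ((step ws P ^^ t) \<sigma>)"
begin

definition ctx :: "store \<Rightarrow> bool" where
  "ctx s \<longleftrightarrow> vr s vn = n \<and> vr s vNN = n * n \<and> vr s vq = q \<and> vr s vnb = nb \<and> vr s vl = l \<and> vr s vInf = R \<and>
     vr s vg = n * q \<and> vr s vgz = n * nb \<and> vr s vDim = 3 * n \<and> vr s vWs = ws \<and> vr s vBud = n * q * q \<and>
     ar s aQ = Q \<and> ar s aP 0 = ord \<and> ar s aRS = RS \<and> ar s aCS = CS \<and> ar s aRP = RP \<and> ar s aCP = CP"

lemma ctx_frame: "ctx s \<Longrightarrow> frame X A s s' \<Longrightarrow> X \<inter> {1, 3, 4, 5, 7, 9, 14, 15, 16, 19, 22} = {} \<Longrightarrow> A \<inter> {5, 6, 9, 10, 11, 12} = {} \<Longrightarrow> ctx s'"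
  unfolding ctx_def frame_def by auto

lemma ctx_D: "ctx s \<Longrightarrow> vr s (Suc 0) = n" "ctx s \<Longrightarrow> vr s vn = n" "ctx s \<Longrightarrow> vr s vNN = n * n" "ctx s \<Longrightarrow> vr s vq = q" "ctx s \<Longrightarrow> vr s vnb = nb" "ctx s \<Longrightarrow> vr s vl = l"
  "ctx s \<Longrightarrow> vr s vInf = R" "ctx s \<Longrightarrow> vr s vg = n * q" "ctx s \<Longrightarrow> vr s vgz = n * nb" "ctx s \<Longrightarrow> vr s vDim = 3 * n" "ctx s \<Longrightarrow> vr s vWs = ws"
  "ctx s \<Longrightarrow> vr s vBud = n * q * q" "ctx s \<Longrightarrow> ar s aQ = Q" "ctx s \<Longrightarrow> ar s aP 0 = ord" "ctx s \<Longrightarrow> ar s aRS = RS" "ctx s \<Longrightarrow> ar s aCS = CS"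
  "ctx s \<Longrightarrow> ar s aRP = RP" "ctx s \<Longrightarrow> ar s aCP = CP"
  unfolding ctx_def by auto

lemma RW: "R < W" "3 < R" "3 * R < W" "1 < W" "0 < W" using R_less_W R_ge by linarith+

lemma nle: "n \<le> n * n" "n < R" "n < W" "n * n < R" "n * n < W"
  using le_square[of n] nR RW by linarith+

lemma qle: "q < R" "q < W" "n * q < R" "n * q < W" "n * q * q < W" "n * q * q < R"
proof -
  have "1 * q * 1 \<le> n * q * q" "n * q * 1 \<le> n * q * q" using n1 q1 by (intro mult_le_mono; simp)+
  then show "q < R" "q < W" "n * q < R" "n * q < W" "n * q * q < W" "n * q * q < R" using qR RW by linarith+
qed

lemma nble: "0 < nb" "nb \<le> n + 1" "nb < R" "nb < W" "nb * q \<le> n + q" "n * nb < R" "n * nb < W"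
proof -
  have "n div q \<le> n" by simp
  then show 1: "0 < nb" "nb \<le> n + 1" "nb < R" "nb < W" unfolding nb_def using nle nR RW by linarith+
  have "n div q * q \<le> n" by simp
  then show "nb * q \<le> n + q" by (simp add: nb_def)
  have "n * nb \<le> n * (n + 1)" using 1(2) by (rule mult_le_mono2)
  moreover have "n * (n + 1) = n * n + n" by simp
  ultimately show "n * nb < R" "n * nb < W" using nR RW nle by linarith+
qed

lemma blk: "p < n \<Longrightarrow> p div q < nb" by (simp add: nb_def div_le_mono less_Suc_eq_le)

lemma blk_less: "b < nb \<Longrightarrow> y < q \<Longrightarrow> b * q + y < R \<and> b * q + y < W \<and> b * q < W"
proof -
  assume "b < nb" "y < q"
  then have "b * q + y < nb * q" by (rule flat_less)
  moreover have "4 * q < R"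
  proof -
    have "1 * q * 1 \<le> n * q * q" using n1 q1 by (intro mult_le_mono; simp)
    then show ?thesis using qR by linarith
  qed
  ultimately show ?thesis using nble(5) nle nR RW by (intro conjI; linarith)
qed

lemma gidx: "i < n \<Longrightarrow> b < nb \<Longrightarrow> i * nb + b < n * nb \<and> i * nb + b < R \<and> i * nb + b < W \<and> i * nb < W"
  using flat_less[of i n b nb] nble by (intro conjI; linarith)

definition valid :: "nat \<Rightarrow> nat \<Rightarrow> nat \<Rightarrow> bool" where "valid i k j \<longleftrightarrow> Q k j + l \<le> Q i k"
definition rb :: "nat \<Rightarrow> nat \<Rightarrow> nat" where "rb i k = RP i k div q"
definition cb :: "nat \<Rightarrow> nat \<Rightarrow> nat" where "cb i k = CP i k div q"
text \<open>Columns are sorted, so this is the least entry of block \<open>b\<close> of column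
  \<open>k\<close>: the test value that decides whether a block passes a threshold as a
  whole.\<close>

definition first :: "nat \<Rightarrow> nat \<Rightarrow> nat" where "first k b = Q (CS k (b * q)) k"

lemma QlW: "i < n \<Longrightarrow> k < n \<Longrightarrow> Q i k + l < W \<and> Q i k < W"
  using QR[of i k] lR RW by (intro conjI; linarith)

lemma ordD: "x < n * n \<Longrightarrow> ord x < n * n" "i < n \<Longrightarrow> k < n \<Longrightarrow> \<exists>x<n * n. ord x = i * n + k"
  "x < n * n \<Longrightarrow> RP (ord x div n) (ord x mod n) = cnt (\<lambda>y. ord y div n) (ord x div n) x"
  "x < n * n \<Longrightarrow> CP (ord x div n) (ord x mod n) = cnt (\<lambda>y. ord y mod n) (ord x mod n) x"
  using rk unfolding ranked_def by (elim conjE, simp)+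

lemma ord_dm: "x < n * n \<Longrightarrow> ord x div n < n" "x < n * n \<Longrightarrow> ord x mod n < n"
  using ordD(1)[of x] n1 by (auto simp: less_mult_imp_div_less)

lemma RPD: "i < n \<Longrightarrow> k < n \<Longrightarrow> RP i k < n" "i < n \<Longrightarrow> k < n \<Longrightarrow> RS i (RP i k) = k"
  "i < n \<Longrightarrow> p < n \<Longrightarrow> RS i p < n" "i < n \<Longrightarrow> p < n \<Longrightarrow> RP i (RS i p) = p"
  "i < n \<Longrightarrow> k < n \<Longrightarrow> CP i k < n" "i < n \<Longrightarrow> k < n \<Longrightarrow> CS k (CP i k) = i"
  "k < n \<Longrightarrow> p < n \<Longrightarrow> CS k p < n" "k < n \<Longrightarrow> p < n \<Longrightarrow> CP (CS k p) k = p"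
  using rk unfolding ranked_def by (elim conjE, simp)+

lemma sortedD: "i < n \<Longrightarrow> k < n \<Longrightarrow> k' < n \<Longrightarrow> RP i k \<le> RP i k' \<Longrightarrow> Q i k \<le> Q i k'"
  "k < n \<Longrightarrow> i < n \<Longrightarrow> i' < n \<Longrightarrow> CP i k \<le> CP i' k \<Longrightarrow> Q i k \<le> Q i' k"
  using rk unfolding ranked_def by (elim conjE, simp)+

lemma rbcb: "i < n \<Longrightarrow> k < n \<Longrightarrow> rb i k < nb" "i < n \<Longrightarrow> k < n \<Longrightarrow> cb i k < nb" "i < n \<Longrightarrow> k < n \<Longrightarrow> cb i k * q < n"
  "i < n \<Longrightarrow> k < n \<Longrightarrow> cb i k * q \<le> CP i k"
  using RPD(1,5)[of i k] blk by (auto simp: rb_def cb_def intro: le_less_trans[of _ "CP i k"])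

lemma first_le: "i < n \<Longrightarrow> k < n \<Longrightarrow> first k (cb i k) \<le> Q i k"
  unfolding first_def using rbcb(3,4)[of i k] RPD(7,8)[of k "cb i k * q"] by (intro sortedD(2)) auto

text \<open>\<open>Z g j\<close> is nonzero for a row block \<open>g = i * nb + b\<close> only if the block contains a valid entry.\<close>

definition sound :: "(nat \<Rightarrow> nat \<Rightarrow> nat) \<Rightarrow> bool" where
  "sound Z \<longleftrightarrow> (\<forall>g<n * nb. \<forall>j<n. Z g j \<noteq> 0 \<longrightarrow> (\<exists>k<n. rb (g div nb) k = g mod nb \<and> valid (g div nb) k j))"

lemma soundI_upd: "sound Z \<Longrightarrow> i < n \<Longrightarrow> k < n \<Longrightarrow> valid i k j \<Longrightarrow> g = i * nb + rb i k \<Longrightarrow>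
   sound (\<lambda>i' j'. if i' = g \<and> j' = j then v else Z i' j')"
  unfolding sound_def using rbcb(1)[of i k] by auto

end

section \<open>Marks from the column block that contains the threshold\<close>

definition clear_marks :: com where
  "clear_marks = For 30 vgz (For 31 vn (Wr aZ (V 30) (V 31) (N 0)))"

text \<open>Finds the last block of column \<open>k\<close> that starts below
  \<open>Q k j + l\<close>; the value \<open>nb\<close> means that there is none. This block is then
  scanned entry by entry in \<open>inner_marks2\<close>.\<close>

definition inner_marks1 :: com where
  "inner_marks1 = For 34 vnb (If (V 34 \<otimes> V vq) (V vn) (If (Rd aQ (Rd aCS (V 30) (V 34 \<otimes> V vq)) (V 30)) (V 32) (Assign 33 (V 34)) Skip) Skip)"

definition inner_marks2 :: com where
  "inner_marks2 = For 35 vq (Assign 36 (V 33 \<otimes> V vq \<oplus> V 35) ;;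
     If (V 36) (V vn) (Assign 37 (Rd aCS (V 30) (V 36)) ;;
       If (Rd aQ (V 37) (V 30)) (V 32) Skip (Wr aZ (V 37 \<otimes> V vnb \<oplus> Rd aRP (V 37) (V 30) \<oslash> V vq) (V 31) (N 1))) Skip)"

definition inner_marks :: com where
  "inner_marks = For 30 vn (For 31 vn (Assign 32 (Rd aQ (V 30) (V 31) \<oplus> V vl) ;; Assign 33 (V vnb) ;;
     inner_marks1 ;; If (V 33) (V vnb) inner_marks2 Skip))"

context dom
begin

lemma clear_marks_correct:
  assumes c: "ctx s"
  shows "tri clear_marks s (n * nb * (n + 1)) (\<lambda>s'. \<forall>g<n * nb. \<forall>j<n. ar s' aZ g j = 0)"
  unfolding clear_marks_def
proof (rule tri_For[where m = "n * nb" and b = n and I = "\<lambda>g s'. \<forall>g'<g. \<forall>j<n. ar s' aZ g' j = 0"], goal_cases)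
  case (7 g s1)
  have c1: "ctx s1" by (rule ctx_frame[OF c 7(5)]) auto
  show ?case
  proof (rule tri_For[where m = n and b = 0 and I = "\<lambda>j s'. (\<forall>g'<g. \<forall>j<n. ar s' aZ g' j = 0) \<and> (\<forall>j'<j. ar s' aZ g j' = 0)"], goal_cases)
    case (7 j s2)
    have "vr s2 30 = g" using 7 \<open>vr s1 30 = g\<close> by (auto simp: frame_def)
    then show ?case using 7 \<open>g < n * nb\<close> nble nle RW by (auto simp: less_Suc_eq)
  qed (use 7 c1 nle in \<open>auto simp: ctx_D less_Suc_eq\<close>)
qed (use c nble in \<open>auto simp: ctx_D\<close>)

definition lastblk :: "nat \<Rightarrow> nat \<Rightarrow> nat \<Rightarrow> nat \<Rightarrow> bool" where
  "lastblk k v b best \<longleftrightarrow> (best < nb \<longrightarrow> best < b \<and> best * q < n \<and> first k best < v) \<and> best \<le> nb \<and>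
     (\<forall>b'<b. (best = nb \<or> best < b') \<longrightarrow> b' * q < n \<longrightarrow> v \<le> first k b')"

lemma inner_marks1_correct:
  assumes c: "ctx s" and k: "vr s 30 = k" "k < n" and v: "vr s 32 = v" and b: "vr s 33 = nb"
  shows "tri inner_marks1 s nb (\<lambda>s'. lastblk k v nb (vr s' 33))"
  unfolding inner_marks1_def
proof (rule tri_For[where m = nb and b = 0 and I = "\<lambda>b s'. lastblk k v b (vr s' 33)"], goal_cases)
  case (7 b s1)
  have c1: "ctx s1" by (rule ctx_frame[OF c 7(5)]) auto
  have v1: "vr s1 30 = k" "vr s1 32 = v" using 7 k v by (auto simp: frame_def)
  have bq: "b * q < W" "b * q < R" using blk_less[OF 7(1), of 0] q1 by auto
  have C: "CS k (b * q) < n" if "b * q < n" using RPD(7)[OF k(2) that] .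
  have CR: "CS k (b * q) < R" if "b * q < n" using C[OF that] nle by linarith
  have kR: "k < R" using k(2) nle by linarith
  show ?case using 7 v1 c1 bq CR kR unfolding lastblk_def by (auto simp: ctx_D less_Suc_eq first_def)
qed (use c nble b in \<open>auto simp: ctx_D lastblk_def\<close>)

text \<open>Marks are never removed within an attempt, so what has been marked once stays
  marked.\<close>

definition grows :: "(nat \<Rightarrow> nat \<Rightarrow> nat) \<Rightarrow> (nat \<Rightarrow> nat \<Rightarrow> nat) \<Rightarrow> bool" where
  "grows Z Z' \<longleftrightarrow> (\<forall>g j. Z g j \<noteq> 0 \<longrightarrow> Z' g j \<noteq> 0)"

lemma inner_marks2_correct:
  assumes c: "ctx s" and k: "vr s 30 = k" "k < n" and j: "vr s 31 = j" "j < n" and v: "vr s 32 = Q k j + l"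
    and b: "vr s 33 = best" "best < nb" and so: "sound (ar s aZ)"
  shows "tri inner_marks2 s q (\<lambda>s'. sound (ar s' aZ) \<and> grows (ar s aZ) (ar s' aZ) \<and>
    (\<forall>i<n. valid i k j \<longrightarrow> cb i k = best \<longrightarrow> ar s' aZ (i * nb + rb i k) j \<noteq> 0))"
proof -
  have kR: "k < R" "j < R" using k(2) j(2) nle by linarith+
  have "tri inner_marks2 s q (\<lambda>s'. sound (ar s' aZ) \<and> grows (ar s aZ) (ar s' aZ) \<and>
     (\<forall>y<q. best * q + y < n \<longrightarrow> valid (CS k (best * q + y)) k j \<longrightarrow> ar s' aZ (CS k (best * q + y) * nb + rb (CS k (best * q + y)) k) j \<noteq> 0))"
    unfolding inner_marks2_def
  proof (rule tri_For[where m = q and b = 0 and I = "\<lambda>y s'. sound (ar s' aZ) \<and> grows (ar s aZ) (ar s' aZ) \<and>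
     (\<forall>y'<y. best * q + y' < n \<longrightarrow> valid (CS k (best * q + y')) k j \<longrightarrow> ar s' aZ (CS k (best * q + y') * nb + rb (CS k (best * q + y')) k) j \<noteq> 0)"], goal_cases)
    case (7 y s1)
    have c1: "ctx s1" by (rule ctx_frame[OF c 7(5)]) auto
    have v1: "vr s1 30 = k" "vr s1 31 = j" "vr s1 32 = Q k j + l" "vr s1 33 = best" using 7 k j v b by (auto simp: frame_def)
    let ?p = "best * q + y"
    have bq: "?p < W" "?p < R" "best * q < W" using blk_less[OF b(2) 7(1)] by auto
    show ?case
    proof (cases "?p < n")
      case True
      have i: "CS k ?p < n" using RPD(7)[OF k(2) True] .
      have iR: "CS k ?p < R" using i nle by linarith
      have g: "CS k ?p * nb + rb (CS k ?p) k < R" "CS k ?p * nb + rb (CS k ?p) k < W" "CS k ?p * nb < W"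
        using gidx[OF i rbcb(1)[OF i k(2)]] by auto
      show ?thesis
      proof (cases "valid (CS k ?p) k j")
        case v: True
        let ?g = "CS k ?p * nb + rb (CS k ?p) k"
        have "sound (\<lambda>i' j'. if i' = ?g \<and> j' = j then Suc 0 else ar s1 aZ i' j')"
          using soundI_upd[OF _ i k(2) v refl] 7(4) by blast
        then show ?thesis using 7 c1 v1 bq iR kR g True v RW
          by (auto simp: ctx_D less_Suc_eq valid_def rb_def grows_def)
      next
        case False
        then show ?thesis using 7 c1 v1 bq iR kR True RW
          by (auto simp: ctx_D less_Suc_eq valid_def)
      qed
    next
      case False
      then show ?thesis using 7 c1 v1 bq RW by (auto simp: ctx_D less_Suc_eq)
    qed
  qed (use c qle b so in \<open>auto simp: ctx_D grows_def\<close>)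
  then show ?thesis
  proof (rule tri_weaken)
    fix s' assume h: "sound (ar s' aZ) \<and> grows (ar s aZ) (ar s' aZ) \<and>
     (\<forall>y<q. best * q + y < n \<longrightarrow> valid (CS k (best * q + y)) k j \<longrightarrow> ar s' aZ (CS k (best * q + y) * nb + rb (CS k (best * q + y)) k) j \<noteq> 0)"
    have "ar s' aZ (i * nb + rb i k) j \<noteq> 0" if i: "i < n" "valid i k j" "cb i k = best" for i
    proof -
      \<comment> \<open>The scan meets the entry at the offset given by the remainder of its column
        position.\<close>
      have e: "best * q + CP i k mod q = CP i k" using i(3) by (auto simp: cb_def)
      have "CP i k mod q < q" using q1 by simp
      then show ?thesis using h e i RPD(5,6)[OF i(1) k(2)] by metis
    qed
    then show "sound (ar s' aZ) \<and> grows (ar s aZ) (ar s' aZ) \<and>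
      (\<forall>i<n. valid i k j \<longrightarrow> cb i k = best \<longrightarrow> ar s' aZ (i * nb + rb i k) j \<noteq> 0)" using h by blast
  qed simp
qed

text \<open>If a later block of the column also started below the threshold, then by sortedness the
  entry \<open>(i, k)\<close> would lie below the threshold too, contradicting validity. So for
  given \<open>k\<close> and \<open>j\<close> there is only one block to scan.\<close>

lemma lastblk_cb:
  assumes "lastblk k (Q k j + l) nb best" "k < n" "i < n" "valid i k j" "first k (cb i k) < Q k j + l"
  shows "best < nb \<and> cb i k = best"
proof -
  have c: "cb i k < nb" "cb i k * q < n" using rbcb assms by auto
  have "best < nb \<and> cb i k \<le> best" using assms(1,5) c unfolding lastblk_def by (meson le_neq_implies_less not_le)
  moreover have "\<not> cb i k < best"
  proof
    assume "cb i k < best"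
    then have b: "best < nb" "best * q < n" "first k best < Q k j + l" using assms(1) \<open>best < nb \<and> cb i k \<le> best\<close> unfolding lastblk_def by auto
    have "CP i k < (cb i k + 1) * q" using q1 by (simp add: cb_def dividend_less_div_times)
    also have "\<dots> \<le> best * q" using \<open>cb i k < best\<close> by (intro mult_right_mono) auto
    finally have "CP i k \<le> CP (CS k (best * q)) k" using RPD(8)[OF assms(2) b(2)] by simp
    then have "Q i k \<le> first k best" unfolding first_def using RPD(7)[OF assms(2) b(2)] assms by (intro sortedD(2)) auto
    then show False using assms(4) b(3) by (simp add: valid_def)
  qed
  ultimately show ?thesis by auto
qed

text \<open>This concerns valid entries whose column block starts below the threshold; the other
  valid entries are left to the matrix products.\<close>

definition marked :: "(nat \<Rightarrow> nat \<Rightarrow> nat) \<Rightarrow> nat \<Rightarrow> nat \<Rightarrow> bool" where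
  "marked Z k j \<longleftrightarrow> (\<forall>i<n. valid i k j \<longrightarrow> first k (cb i k) < Q k j + l \<longrightarrow> Z (i * nb + rb i k) j \<noteq> 0)"

lemma marked_grows: "marked Z k j \<Longrightarrow> grows Z Z' \<Longrightarrow> marked Z' k j"
  unfolding marked_def grows_def by auto

lemma inner_marks_correct:
  assumes c: "ctx s" and z: "\<forall>g<n * nb. \<forall>j<n. ar s aZ g j = 0"
  shows "tri inner_marks s (n * (n * (nb + q + 1) + 1)) (\<lambda>s'. sound (ar s' aZ) \<and> (\<forall>k<n. \<forall>j<n. marked (ar s' aZ) k j))"
  unfolding inner_marks_def
proof (rule tri_For[where m = n and b = "n * (nb + q + 1)" and I = "\<lambda>k s'. sound (ar s' aZ) \<and> (\<forall>k'<k. \<forall>j<n. marked (ar s' aZ) k' j)"], goal_cases)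
  case (7 k s1)
  have c1: "ctx s1" by (rule ctx_frame[OF c 7(5)]) (auto simp: inner_marks1_def inner_marks2_def)
  note k = 7(1,2)
  show ?case
  proof (rule tri_For[where m = n and b = "nb + q" and I = "\<lambda>j s'. sound (ar s' aZ) \<and> (\<forall>k'<k. \<forall>j<n. marked (ar s' aZ) k' j) \<and> (\<forall>j'<j. marked (ar s' aZ) k j')"], goal_cases)
    case (7 j s2)
    have c2: "ctx s2" by (rule ctx_frame[OF c1 7(5)]) (auto simp: inner_marks1_def inner_marks2_def)
    have k2: "vr s2 30 = k" using 7(5) k by (auto simp: frame_def inner_marks1_def inner_marks2_def)
    have kR: "k < R" "j < R" using k(1) 7(1) nle by linarith+
    define s3 where "s3 = s2\<lparr>vr := (vr s2)(32 := Q k j + l, 33 := nb)\<rparr>"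
    have c3: "ctx s3" using c2 by (simp add: ctx_def s3_def)
    have v3: "vr s3 30 = k" "vr s3 31 = j" "vr s3 32 = Q k j + l" "vr s3 33 = nb" "ar s3 aZ = ar s2 aZ"
      using k2 7(2) by (auto simp: s3_def)
    have "tri (inner_marks1 ;; If (V 33) (V vnb) inner_marks2 Skip) s3 (nb + q)
       (\<lambda>s'. sound (ar s' aZ) \<and> grows (ar s2 aZ) (ar s' aZ) \<and> marked (ar s' aZ) k j)"
    proof (rule tri_Seq[OF inner_marks1_correct[OF c3 v3(1) k(1) v3(3,4)], where Tb = q], goal_cases)
      case (1 s4)
      have c4: "ctx s4" by (rule ctx_frame[OF c3 1(2)]) (auto simp: inner_marks1_def)
      have v4: "vr s4 30 = k" "vr s4 31 = j" "vr s4 32 = Q k j + l" "ar s4 aZ = ar s2 aZ"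
        using v3 1(2) by (auto simp: frame_def inner_marks1_def)
      have so: "sound (ar s4 aZ)" using v4 7(4) by simp
      show ?case
      proof (cases "vr s4 33 < nb")
        case True
        have "tri inner_marks2 s4 q (\<lambda>s'. sound (ar s' aZ) \<and> grows (ar s2 aZ) (ar s' aZ) \<and> marked (ar s' aZ) k j)"
        proof (rule tri_weaken[OF inner_marks2_correct[OF c4 v4(1) k(1) v4(2) 7(1) v4(3) refl True so]])
          fix s' assume h: "sound (ar s' aZ) \<and> grows (ar s4 aZ) (ar s' aZ) \<and>
            (\<forall>i<n. valid i k j \<longrightarrow> cb i k = vr s4 33 \<longrightarrow> ar s' aZ (i * nb + rb i k) j \<noteq> 0)"
          then show "sound (ar s' aZ) \<and> grows (ar s2 aZ) (ar s' aZ) \<and> marked (ar s' aZ) k j"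
            using lastblk_cb[OF 1(1) k(1)] v4(4) unfolding marked_def by auto
        qed simp
        then show ?thesis using True c4 by (simp add: ctx_D)
      next
        case False
        then have "marked (ar s4 aZ) k j" using lastblk_cb[OF 1(1) k(1)] unfolding marked_def by blast
        then show ?thesis using False c4 so v4(4) by (simp add: ctx_D grows_def)
      qed
    qed simp
    then have "tri (inner_marks1 ;; If (V 33) (V vnb) inner_marks2 Skip) s3 (nb + q)
      (\<lambda>s'. sound (ar s' aZ) \<and> (\<forall>k'<k. \<forall>j<n. marked (ar s' aZ) k' j) \<and> (\<forall>j'<Suc j. marked (ar s' aZ) k j'))"
      by (rule tri_weaken) (use 7(4) in \<open>auto simp: less_Suc_eq intro: marked_grows\<close>)
    then show ?case using c2 k2 7(2) kR QlW[OF k(1) 7(1)] by (simp add: ctx_D s3_def)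
  qed (use 7 c1 nle in \<open>auto simp: ctx_D less_Suc_eq inner_marks1_def inner_marks2_def\<close>)
qed (use c nle z in \<open>auto simp: ctx_D inner_marks1_def inner_marks2_def sound_def\<close>)

end

section \<open>One Boolean product for each group of consecutive ranks\<close>

definition row_id :: com where
  "row_id = Assign 36 (Rd aRP (V 34) (V 35) \<oslash> V vq) ;;
     If (Rd aCR (N 0) (V 34)) (V 36 \<oplus> N 1)
       (Wr aCR (N 0) (V 34) (V 36 \<oplus> N 1) ;; Wr aIR (N 0) (V 34) (V vnp) ;;
        Wr aLP (N 0) (V vnp) (V 34 \<otimes> V vnb \<oplus> V 36) ;; Assign vnp (V vnp \<oplus> N 1)) Skip"

definition col_id :: com where
  "col_id = Assign 37 (Rd aCP (V 34) (V 35) \<oslash> V vq) ;;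
     If (Rd aCC (N 0) (V 35)) (V 37 \<oplus> N 1)
       (Wr aCC (N 0) (V 35) (V 37 \<oplus> N 1) ;; Wr aIC (N 0) (V 35) (V vnc) ;; Wr aLK (N 0) (V vnc) (V 35) ;;
        Wr aLV (N 0) (V vnc) (Rd aQ (Rd aCS (V 35) (V 37 \<otimes> V vq)) (V 35)) ;; Assign vnc (V vnc \<oplus> N 1)) Skip"

text \<open>Left factor: cell \<open>(p, c)\<close> becomes \<open>1\<close> if an entry of the
  group lies in row block number \<open>p\<close> and column block number \<open>c\<close>. Numbers
  are handed out when a block is met for the first time in the group.\<close>

definition group_entry :: com where
  "group_entry = (Assign 33 (Rd aP (N 0) (V 32)) ;; Assign 34 (V 33 \<oslash> V vn) ;; Assign 35 (V 33 \<odot> V vn)) ;; row_id ;; col_id ;;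
     Wr aMM (V vCnt) (Rd aIR (N 0) (V 34) \<otimes> V vDim \<oplus> Rd aIC (N 0) (V 35)) (N 1)"

definition group_clear :: com where
  "group_clear = For 30 vn (Wr aCR (N 0) (V 30) (N 0) ;; Wr aCC (N 0) (V 30) (N 0))"

definition group_fill :: com where
  "group_fill = For 31 vg (Assign 32 (V 40 \<otimes> V vg \<oplus> V 31) ;; If (V 32) (V vNN) group_entry Skip)"

text \<open>Right factor: cell \<open>(c, j)\<close> becomes \<open>1\<close> if even the first
  entry of column block \<open>c\<close>, lying in column \<open>k\<close>, is at least
  \<open>Q k j + l\<close>. A nonzero cell \<open>(p, j)\<close> of the product then exhibits a
  valid entry in row block \<open>p\<close>.\<close>

definition group_right :: com where
  "group_right = For 38 vnc (For 39 vn (If (Rd aLV (N 0) (V 38)) (Rd aQ (Rd aLK (N 0) (V 38)) (V 39) \<oplus> V vl) Skip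
     (Wr aMM (V vCnt) (V vDim \<otimes> V vDim \<oplus> (V 38 \<otimes> V vDim \<oplus> V 39)) (N 1))))"

definition group_out :: com where
  "group_out = For 41 vnp (For 39 vn (If (N 0) (Rd aMM (V vCnt) (N 2 \<otimes> (V vDim \<otimes> V vDim) \<oplus> (V 41 \<otimes> V vDim \<oplus> V 39)))
     (Wr aZ (Rd aLP (N 0) (V 41)) (V 39) (N 1)) Skip))"

text \<open>Every product takes the fresh memory row \<open>vCnt\<close>, since a run leaves unknown
  contents behind while the input convention asks for zeros. An exhausted budget clears
  \<open>vok\<close>; marks are copied in any case, because the attempt is then repeated from
  cleared marks.\<close>

definition group :: com where
  "group = Assign vnp (N 0) ;; Assign vnc (N 0) ;; group_clear ;; group_fill ;; group_right ;; Sim ;;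
     If (V vFlag) (N 1) (Assign vok (N 0)) Skip ;; group_out ;; Assign vCnt (V vCnt \<oplus> N 1)"

lemmas group_defs = row_id_def col_id_def group_entry_def group_clear_def group_fill_def group_right_def group_out_def group_def

text \<open>A halted machine stays put, so the output seen when the budget ends is the one present
  at the time of halting.\<close>

lemma halted_unique:
  assumes "halted P ((step w P ^^ a) s)" "halted P ((step w P ^^ b) s)"
  shows "(step w P ^^ a) s = (step w P ^^ b) s"
proof -
  have "(step w P ^^ b) s = (step w P ^^ a) s" if "a \<le> b" "halted P ((step w P ^^ a) s)" for a b
  proof -
    have "(step w P ^^ b) s = (step w P ^^ (b - a)) ((step w P ^^ a) s)"
      using that(1) by (metis funpow_add le_add_diff_inverse2 o_apply)
    then show ?thesis using halted_stay[OF that(2)] by simp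
  qed
  then show ?thesis using assms by (metis nat_le_linear)
qed

lemma (in ram) tri_Sim:
  assumes "vr s vBud < W" "vr s vCnt < R" "vr s vWs = ws" "vr s vDim < R" "\<forall>j. ar s aMM (vr s vCnt) j < R" "vr s vBud \<le> T"
    and "\<And>\<sigma>. \<sigma> = (step ws P ^^ vr s vBud) (sim_start s) \<Longrightarrow> Q (s\<lparr>vr := (vr s)(vFlag := (if halted P \<sigma> then 1 else 0)),
                              ar := (ar s)(aMM := (ar s aMM)(vr s vCnt := mem \<sigma>))\<rparr>)"
  shows "tri Sim s T Q"
  using big.Sim[OF assms(1-5) refl] assms(6) assms(7)[OF refl] by (rule triI)

context dom
begin

abbreviation "m \<equiv> 3 * n"

lemma midx: "p < m \<Longrightarrow> c < m \<Longrightarrow> p * m + c < m * m \<and> p * m + c < R \<and> p * m + c < W \<and> p * m < W"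
proof -
  assume "p < m" "c < m"
  then have "p * m + c < m * m" by (rule flat_less)
  moreover have "m * m = 9 * (n * n)" by simp
  ultimately show ?thesis using nR RW by (intro conjI; linarith)
qed

lemma midx2: "p < m \<Longrightarrow> c < m \<Longrightarrow> m * m + (p * m + c) < 2 * (m * m) \<and> m * m + (p * m + c) < R \<and> m * m + (p * m + c) < W \<and>
   2 * (m * m) + (p * m + c) < R \<and> 2 * (m * m) + (p * m + c) < W \<and> m * m < W \<and> 2 * (m * m) < W"
proof -
  assume "p < m" "c < m"
  then have "p * m + c < m * m" by (rule flat_less)
  moreover have "m * m = 9 * (n * n)" by simp
  ultimately show ?thesis using nR RW by (intro conjI; linarith)
qed

lemma mle: "m < R" "m < W" using nle nR RW by linarith+

definition rho :: "nat \<Rightarrow> nat" where "rho y = ord y div n"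
definition gam :: "nat \<Rightarrow> nat" where "gam y = ord y mod n"

lemma rg: "y < n * n \<Longrightarrow> rho y < n" "y < n * n \<Longrightarrow> gam y < n"
  "y < n * n \<Longrightarrow> RP (rho y) (gam y) = cnt rho (rho y) y" "y < n * n \<Longrightarrow> CP (rho y) (gam y) = cnt gam (gam y) y"
  using ord_dm[of y] ordD(3,4)[of y] unfolding rho_def[abs_def] gam_def[abs_def] by auto

text \<open>\<open>aCR\<close> holds \<open>cur\<close>, \<open>aIR\<close> the product index of the
  current block of each row, \<open>aLP\<close> the block that belongs to a product index. Equating
  \<open>vnp\<close> with the sum of \<open>ids\<close> is what bounds it by
  \<open>3 * n\<close>.\<close>

definition rowinv :: "nat \<Rightarrow> nat \<Rightarrow> store \<Rightarrow> bool" where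
  "rowinv x0 x s \<longleftrightarrow> (\<forall>i<n. ar s aCR 0 i = cur rho q x0 x i) \<and> vr s vnp = (\<Sum>i<n. ids rho q x0 x i) \<and>
     (\<forall>i<n. ar s aCR 0 i \<noteq> 0 \<longrightarrow> ar s aIR 0 i < vr s vnp \<and> ar s aLP 0 (ar s aIR 0 i) = i * nb + (ar s aCR 0 i - 1)) \<and>
     (\<forall>p<vr s vnp. ar s aLP 0 p < n * nb)"

definition colinv :: "nat \<Rightarrow> nat \<Rightarrow> store \<Rightarrow> bool" where
  "colinv x0 x s \<longleftrightarrow> (\<forall>k<n. ar s aCC 0 k = cur gam q x0 x k) \<and> vr s vnc = (\<Sum>k<n. ids gam q x0 x k) \<and>
     (\<forall>k<n. ar s aCC 0 k \<noteq> 0 \<longrightarrow> ar s aIC 0 k < vr s vnc \<and> ar s aLK 0 (ar s aIC 0 k) = k \<and>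
        ar s aLV 0 (ar s aIC 0 k) = first k (ar s aCC 0 k - 1)) \<and>
     (\<forall>c<vr s vnc. ar s aLK 0 c < n)"

lemma np_le:
  assumes "x0 \<le> x" "x \<le> x0 + n * q" "x \<le> n * n"
  shows "rowinv x0 x s \<Longrightarrow> vr s vnp \<le> m" "colinv x0 x s \<Longrightarrow> vr s vnc \<le> m"
  using sum_ids_le[of x0 x n q rho] sum_ids_le[of x0 x n q gam] assms q1 rg unfolding rowinv_def colinv_def by auto

lemma row_id_correct:
  assumes c: "ctx s" and x: "x0 \<le> x" "x < x0 + n * q" "x < n * n" and v: "vr s 34 = rho x" "vr s 35 = gam x" and I: "rowinv x0 x s"
  shows "tri row_id s 0 (\<lambda>s'. rowinv x0 (Suc x) s' \<and> vr s vnp \<le> vr s' vnp \<and> (\<forall>p<vr s vnp. ar s' aLP 0 p = ar s aLP 0 p) \<and>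
     ar s' aIR 0 (rho x) < vr s' vnp \<and> ar s' aLP 0 (ar s' aIR 0 (rho x)) = rho x * nb + rb (rho x) (gam x))"
proof -
  let ?i = "rho x" and ?k = "gam x"
  have ik: "?i < n" "?k < n" using rg x by auto
  have ikR: "?i < R" "?k < R" using ik nle by linarith+
  have b: "RP ?i ?k div q = rb ?i ?k" "cnt rho ?i x div q = rb ?i ?k" using rg(3)[OF x(3)] by (auto simp: rb_def)
  have bn: "rb ?i ?k < nb" "rb ?i ?k + 1 < W" using rbcb(1)[OF ik] nble RW by linarith+
  have g: "?i * nb + rb ?i ?k < W" "?i * nb < W" "?i * nb + rb ?i ?k < n * nb" using gidx[OF ik(1) bn(1)] by auto
  have q0: "0 < q" using q1 by simp
  have np': "(\<Sum>i<n. ids rho q x0 (Suc x) i) \<le> m"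
    by (rule sum_ids_le) (use x q0 rg in auto)
  have S: "(\<Sum>i<n. ids rho q x0 (Suc x) i) = vr s vnp + (if cur rho q x0 x ?i < rb ?i ?k + 1 then 1 else 0)"
    using sum_ids_Suc[OF x(1) q0, of rho n] ik(1) b(2) I unfolding rowinv_def by simp
  have cr: "ar s aCR 0 ?i = cur rho q x0 x ?i" using I ik unfolding rowinv_def by auto
  show ?thesis
  proof (cases "cur rho q x0 x ?i < rb ?i ?k + 1")
    case True
    have npm: "vr s vnp < m" using S np' True by simp
    have npR: "vr s vnp < R" "vr s vnp + 1 < W" using npm mle by linarith+
    let ?s = "s\<lparr>vr := (vr s)(36 := rb ?i ?k, vnp := Suc (vr s vnp)),
      ar := upd3 (upd3 (upd3 (ar s) aCR 0 ?i (Suc (rb ?i ?k))) aIR 0 ?i (vr s vnp)) aLP 0 (vr s vnp) (?i * nb + rb ?i ?k)\<rparr>"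
    have "rowinv x0 (Suc x) ?s"
      using I S True g(3) unfolding rowinv_def
      by (auto simp: cur_Suc[OF x(1)] b(2) less_Suc_eq simp del: not_gr_zero) 
    then show ?thesis using True cr v c ikR b npR bn g RW unfolding row_id_def by (simp add: ctx_D)
  next
    case False
    have e: "cur rho q x0 x ?i = rb ?i ?k + 1" using cur_le[OF x(1), of rho q ?i] b(2) False by simp
    let ?s = "s\<lparr>vr := (vr s)(36 := rb ?i ?k)\<rparr>"
    have "rowinv x0 (Suc x) ?s"
      using I S False e unfolding rowinv_def by (auto simp: cur_Suc[OF x(1)] b(2))
    moreover have "ar s aIR 0 ?i < vr s vnp \<and> ar s aLP 0 (ar s aIR 0 ?i) = ?i * nb + rb ?i ?k"
      using I ik e cr unfolding rowinv_def by auto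
    ultimately show ?thesis using False cr v c ikR b bn g RW unfolding row_id_def by (simp add: ctx_D)
  qed
qed

lemma col_id_correct:
  assumes c: "ctx s" and x: "x0 \<le> x" "x < x0 + n * q" "x < n * n" and v: "vr s 34 = rho x" "vr s 35 = gam x" and I: "colinv x0 x s"
  shows "tri col_id s 0 (\<lambda>s'. colinv x0 (Suc x) s' \<and> vr s vnc \<le> vr s' vnc \<and>
     (\<forall>c<vr s vnc. ar s' aLK 0 c = ar s aLK 0 c \<and> ar s' aLV 0 c = ar s aLV 0 c) \<and>
     ar s' aIC 0 (gam x) < vr s' vnc \<and> ar s' aLK 0 (ar s' aIC 0 (gam x)) = gam x \<and>
     ar s' aLV 0 (ar s' aIC 0 (gam x)) = first (gam x) (cb (rho x) (gam x)))"
proof -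
  let ?i = "rho x" and ?k = "gam x"
  have ik: "?i < n" "?k < n" using rg x by auto
  have ikR: "?i < R" "?k < R" using ik nle by linarith+
  have b: "CP ?i ?k div q = cb ?i ?k" "cnt gam ?k x div q = cb ?i ?k" using rg(4)[OF x(3)] by (auto simp: cb_def)
  have bn: "cb ?i ?k < nb" "cb ?i ?k + 1 < W" using rbcb(2)[OF ik] nble RW by linarith+
  have bq: "cb ?i ?k * q < n" using rbcb(3)[OF ik] .
  have bqR: "cb ?i ?k * q < R" "cb ?i ?k * q < W" using bq nle by linarith+
  have C: "CS ?k (cb ?i ?k * q) < n" using RPD(7)[OF ik(2) bq] .
  have CR: "CS ?k (cb ?i ?k * q) < R" using C nle by linarith
  have q0: "0 < q" using q1 by simp
  have np': "(\<Sum>i<n. ids gam q x0 (Suc x) i) \<le> m"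
    by (rule sum_ids_le) (use x q0 rg in auto)
  have S: "(\<Sum>i<n. ids gam q x0 (Suc x) i) = vr s vnc + (if cur gam q x0 x ?k < cb ?i ?k + 1 then 1 else 0)"
    using sum_ids_Suc[OF x(1) q0, of gam n] ik(2) b(2) I unfolding colinv_def by simp
  have cr: "ar s aCC 0 ?k = cur gam q x0 x ?k" using I ik unfolding colinv_def by auto
  show ?thesis
  proof (cases "cur gam q x0 x ?k < cb ?i ?k + 1")
    case True
    have npm: "vr s vnc < m" using S np' True by simp
    have npR: "vr s vnc < R" "vr s vnc + 1 < W" using npm mle by linarith+
    let ?s = "s\<lparr>vr := (vr s)(37 := cb ?i ?k, vnc := Suc (vr s vnc)),
      ar := upd3 (upd3 (upd3 (upd3 (ar s) aCC 0 ?k (Suc (cb ?i ?k))) aIC 0 ?k (vr s vnc)) aLK 0 (vr s vnc) ?k) aLV 0 (vr s vnc) (first ?k (cb ?i ?k))\<rparr>"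
    have "colinv x0 (Suc x) ?s"
      using I S True ik unfolding colinv_def
      by (auto simp: cur_Suc[OF x(1)] b(2) less_Suc_eq simp del: not_gr_zero)
    then show ?thesis using True cr v c ikR b npR bn bqR CR RW unfolding col_id_def by (simp add: ctx_D first_def)
  next
    case False
    have e: "cur gam q x0 x ?k = cb ?i ?k + 1" using cur_le[OF x(1), of gam q ?k] b(2) False by simp
    let ?s = "s\<lparr>vr := (vr s)(37 := cb ?i ?k)\<rparr>"
    have "colinv x0 (Suc x) ?s"
      using I S False e unfolding colinv_def by (auto simp: cur_Suc[OF x(1)] b(2))
    moreover have "ar s aIC 0 ?k < vr s vnc \<and> ar s aLK 0 (ar s aIC 0 ?k) = ?k \<and> ar s aLV 0 (ar s aIC 0 ?k) = first ?k (cb ?i ?k)"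
      using I ik e cr unfolding colinv_def by auto
    ultimately show ?thesis using False cr v c ikR b bn RW unfolding col_id_def by (simp add: ctx_D)
  qed
qed

definition ent :: "store \<Rightarrow> nat \<Rightarrow> nat \<Rightarrow> nat \<Rightarrow> nat \<Rightarrow> bool" where
  "ent s p c i k \<longleftrightarrow> ar s aLP 0 p = i * nb + rb i k \<and> ar s aLK 0 c = k \<and> ar s aLV 0 c = first k (cb i k)"

text \<open>The first clause serves soundness and the second completeness of the left factor. The
  remaining clauses prepare the input convention of the foreign program: zeros behind the left
  factor, cells of at most \<open>1\<close>, untouched later rows.\<close>

definition matinv :: "nat \<Rightarrow> nat \<Rightarrow> store \<Rightarrow> bool" where
  "matinv x0 x s \<longleftrightarrow> 
     (\<forall>p<m. \<forall>c<m. ar s aMM (vr s vCnt) (p * m + c) \<noteq> 0 \<longrightarrow> p < vr s vnp \<and> c < vr s vnc \<and> (\<exists>i<n. \<exists>k<n. ent s p c i k)) \<and>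
     (\<forall>y. x0 \<le> y \<and> y < x \<longrightarrow> (\<exists>p<vr s vnp. \<exists>c<vr s vnc. ar s aMM (vr s vCnt) (p * m + c) \<noteq> 0 \<and> ent s p c (rho y) (gam y))) \<and>
     (\<forall>z\<ge>m * m. ar s aMM (vr s vCnt) z = 0) \<and> (\<forall>z. ar s aMM (vr s vCnt) z \<le> 1) \<and>
     (\<forall>r>vr s vCnt. \<forall>z. ar s aMM r z = 0)"

definition entinv :: "nat \<Rightarrow> nat \<Rightarrow> store \<Rightarrow> bool" where
  "entinv x0 x s \<longleftrightarrow> rowinv x0 x s \<and> colinv x0 x s \<and> matinv x0 x s"

lemma entinv_vr: "z \<noteq> vCnt \<Longrightarrow> z \<noteq> vnp \<Longrightarrow> z \<noteq> vnc \<Longrightarrow> entinv a b (s\<lparr>vr := (vr s)(z := v)\<rparr>) \<longleftrightarrow> entinv a b s"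
  unfolding entinv_def rowinv_def colinv_def matinv_def ent_def by simp

lemma matinv_upd:
  assumes I: "matinv x0 x s" and np: "vr s vnp \<le> vr s' vnp" "vr s vnc \<le> vr s' vnc" "vr s' vnp \<le> m" "vr s' vnc \<le> m"
    and LP: "\<forall>p<vr s vnp. ar s' aLP 0 p = ar s aLP 0 p"
    and LK: "\<forall>c<vr s vnc. ar s' aLK 0 c = ar s aLK 0 c \<and> ar s' aLV 0 c = ar s aLV 0 c"
    and pc: "p < vr s' vnp" "c < vr s' vnc" "ent s' p c (rho x) (gam x)" and rx: "rho x < n" "gam x < n"
    and MM: "ar s' aMM = (\<lambda>i' j'. if i' = vr s vCnt \<and> j' = p * m + c then Suc 0 else ar s aMM i' j')" and cn: "vr s' vCnt = vr s vCnt"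
  shows "matinv x0 (Suc x) s'"
proof -
  let ?c = "vr s vCnt"
  have M: "ar s' aMM ?c z = (if z = p * m + c then 1 else ar s aMM ?c z)" for z using MM by simp
  have pm: "p < m" "c < m" using pc np by auto
  have ent: "ent s' p' c' i k" if "ent s p' c' i k" "p' < vr s vnp" "c' < vr s vnc" for p' c' i k
    using that LP LK by (simp add: ent_def)
  have 1: "p' < vr s' vnp \<and> c' < vr s' vnc \<and> (\<exists>i<n. \<exists>k<n. ent s' p' c' i k)"
    if h: "p' < m" "c' < m" "ar s' aMM ?c (p' * m + c') \<noteq> 0" for p' c'
  proof (cases "p' = p \<and> c' = c")
    case True
    then show ?thesis using pc rx by auto
  next
    case False
    then have "ar s aMM ?c (p' * m + c') \<noteq> 0" using h M flat_eq[of c' m c p' p] pm by auto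
    then have "p' < vr s vnp" "c' < vr s vnc" "\<exists>i<n. \<exists>k<n. ent s p' c' i k" using I h unfolding matinv_def by auto
    then show ?thesis using ent np by (meson order_less_le_trans)
  qed
  have 2: "\<exists>p<vr s' vnp. \<exists>c<vr s' vnc. ar s' aMM ?c (p * m + c) \<noteq> 0 \<and> ent s' p c (rho y) (gam y)" if y: "x0 \<le> y" "y < Suc x" for y
  proof (cases "y = x")
    case True
    then show ?thesis using pc M by (intro exI[of _ p] conjI exI[of _ c]) auto
  next
    case False
    then obtain p' c' where "p' < vr s vnp" "c' < vr s vnc" "ar s aMM ?c (p' * m + c') \<noteq> 0" "ent s p' c' (rho y) (gam y)"
      using I y unfolding matinv_def by (metis less_SucE)
    then show ?thesis using ent np M by (intro exI[of _ p'] conjI exI[of _ c']) auto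
  qed
  have lt: "p * m + c < m * m" using flat_less[OF pm] .
  have 3: "\<forall>z\<ge>m * m. ar s' aMM ?c z = 0" "\<forall>z. ar s' aMM ?c z \<le> 1" "\<forall>r>?c. \<forall>z. ar s' aMM r z = 0"
    using I lt unfolding MM matinv_def by auto
  show ?thesis unfolding matinv_def cn using 1 2 3 by blast
qed

lemma group_entry_correct:
  assumes c: "ctx s" and x: "x0 \<le> x" "x < x0 + n * q" "x < n * n" and v: "vr s 32 = x" and I: "entinv x0 x s" and cn: "vr s vCnt < R"
  shows "tri group_entry s 0 (\<lambda>s'. entinv x0 (Suc x) s')"
proof -
  have xR: "x < R" "0 < W" using x nle RW by linarith+
  define s1 where "s1 = s\<lparr>vr := (vr s)(33 := ord x, 34 := rho x, 35 := gam x)\<rparr>"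
  have c1: "ctx s1" using c by (simp add: ctx_def s1_def)
  have v1: "vr s1 34 = rho x" "vr s1 35 = gam x" by (auto simp: s1_def)
  have I1: "rowinv x0 x s1" "colinv x0 x s1" "matinv x0 x s1" using I by (auto simp: entinv_def rowinv_def colinv_def matinv_def ent_def s1_def)
  have ik: "rho x < n" "gam x < n" using rg x by auto
  have ikR: "rho x < R" "gam x < R" using ik nle by linarith+
  have "tri (row_id ;; col_id ;; Wr aMM (V vCnt) (Rd aIR (N 0) (V 34) \<otimes> V vDim \<oplus> Rd aIC (N 0) (V 35)) (N 1)) s1 0 (\<lambda>s'. entinv x0 (Suc x) s')"
  proof (rule tri_Seq[OF row_id_correct[OF c1 x v1 I1(1)], where Tb = 0], goal_cases)
    case (1 s2)
    have c2: "ctx s2" by (rule ctx_frame[OF c1 1(2)]) (auto simp: row_id_def)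
    have v2: "vr s2 34 = rho x" "vr s2 35 = gam x" using 1(2) v1 by (auto simp: frame_def row_id_def)
    have f2: "vr s2 vCnt = vr s vCnt" "vr s2 vnc = vr s vnc" "ar s2 aMM = ar s aMM" "ar s2 aLK = ar s aLK" "ar s2 aLV = ar s aLV"
      "ar s2 aCC = ar s aCC" "ar s2 aIC = ar s aIC" using 1(2) by (auto simp: frame_def row_id_def s1_def)
    have I2: "colinv x0 x s2" using I1(2) f2 by (auto simp: colinv_def s1_def)
    show ?case
    proof (rule tri_Seq[OF col_id_correct[OF c2 x v2 I2], where Tb = 0], goal_cases)
      case (1 s3)
      have c3: "ctx s3" by (rule ctx_frame[OF c2 1(2)]) (auto simp: col_id_def)
      have v3: "vr s3 34 = rho x" "vr s3 35 = gam x" using 1(2) v2 by (auto simp: frame_def col_id_def)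
      have f3: "vr s3 vCnt = vr s2 vCnt" "vr s3 vnp = vr s2 vnp" "ar s3 aMM = ar s2 aMM" "ar s3 aLP = ar s2 aLP"
        "ar s3 aCR = ar s2 aCR" "ar s3 aIR = ar s2 aIR" using 1(2) by (auto simp: frame_def col_id_def)
      have r3: "rowinv x0 (Suc x) s3" using \<open>rowinv x0 (Suc x) s2 \<and> _\<close> f3 by (auto simp: rowinv_def)
      have np: "vr s3 vnp \<le> m" "vr s3 vnc \<le> m" using np_le[of x0 "Suc x" s3] r3 1(1) x by auto
      let ?p = "ar s3 aIR 0 (rho x)" and ?c = "ar s3 aIC 0 (gam x)"
      have pc: "?p < vr s3 vnp" "?c < vr s3 vnc" "ent s3 ?p ?c (rho x) (gam x)"
        using \<open>rowinv x0 (Suc x) s2 \<and> _\<close> 1(1) f3 by (auto simp: ent_def)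
      have pm: "?p < m" "?c < m" using pc np by auto
      let ?s4 = "s3\<lparr>ar := upd3 (ar s3) aMM (vr s3 vCnt) (?p * m + ?c) (Suc 0)\<rparr>"
      have e: "ar ?s4 aMM = (\<lambda>i' j'. if i' = vr s1 vCnt \<and> j' = ?p * m + ?c then Suc 0 else ar s1 aMM i' j')"
        using f2 f3 by (simp add: s1_def fun_eq_iff)
      have "matinv x0 (Suc x) ?s4"
        by (rule matinv_upd[OF I1(3) _ _ _ _ _ _ _ _ _ _ _ e])
          (use \<open>rowinv x0 (Suc x) s2 \<and> _\<close> 1(1) f2 f3 np pc ik in \<open>auto simp: s1_def ent_def\<close>)
      moreover have "rowinv x0 (Suc x) ?s4" "colinv x0 (Suc x) ?s4" using r3 1(1) by (auto simp: rowinv_def colinv_def)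
      ultimately have "entinv x0 (Suc x) ?s4" by (simp add: entinv_def)
      then show ?case using v3 c3 ikR midx[OF pm] cn f2 f3 RW by (simp add: ctx_D)
    qed simp
  qed simp
  then show ?thesis using c v xR unfolding group_entry_def by (simp add: ctx_D s1_def rho_def gam_def)
qed

lemma group_fill_correct:
  assumes c: "ctx s" and r: "vr s 40 = r" "r < nb" and I: "entinv (r * (n * q)) (r * (n * q)) s" and cn: "vr s vCnt < R"
  shows "tri group_fill s (n * q) (\<lambda>s'. entinv (r * (n * q)) (min ((r + 1) * (n * q)) (n * n)) s')"
proof -
  let ?x0 = "r * (n * q)"
  have x0: "?x0 \<le> n * n"
  proof -
    have "r \<le> n div q" using r by (simp add: nb_def)
    then have "r * q \<le> n div q * q" by (rule mult_right_mono) simp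
    also have "\<dots> \<le> n" by simp
    finally have "n * (r * q) \<le> n * n" by (rule mult_le_mono2)
    then show ?thesis by (simp add: algebra_simps)
  qed
  have "tri group_fill s (n * q) (\<lambda>s'. entinv ?x0 (min (?x0 + n * q) (n * n)) s')"
    unfolding group_fill_def
  proof (rule tri_For[where m = "n * q" and b = 0 and I = "\<lambda>y s'. entinv ?x0 (min (?x0 + y) (n * n)) s'"], goal_cases)
    case (7 y s1)
    have c1: "ctx s1" by (rule ctx_frame[OF c 7(5)]) (auto simp: group_entry_def row_id_def col_id_def)
    have v1: "vr s1 40 = r" "vr s1 vCnt = vr s vCnt" using 7(5) r by (auto simp: frame_def group_entry_def row_id_def col_id_def)
    have xW: "?x0 + y < W" "?x0 < W" using x0 7(1) nle qle nR qR RW by linarith+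
    note ent = entinv_vr
    let ?s2 = "s1\<lparr>vr := (vr s1)(32 := ?x0 + y)\<rparr>"
    show ?case
    proof (cases "?x0 + y < n * n")
      case True
      have "tri group_entry ?s2 0 (\<lambda>s'. entinv ?x0 (Suc (?x0 + y)) s')"
        by (rule group_entry_correct) (use c1 True 7 v1 cn ent in \<open>auto simp: ctx_def\<close>)
      then have "tri group_entry ?s2 0 (\<lambda>s'. entinv ?x0 (min (?x0 + Suc y) (n * n)) (s'\<lparr>vr := (vr s')(31 := Suc y)\<rparr>))"
        by (rule tri_weaken) (use True ent in auto)
      then show ?thesis using c1 v1 7(2) True xW by (simp add: ctx_D)
    next
      case False
      then have "min (?x0 + Suc y) (n * n) = min (?x0 + y) (n * n)" by simp
      then show ?thesis using c1 v1 7(2,4) False xW ent by (simp add: ctx_D)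
    qed
  next
    case 6
    have "min (?x0 + 0) (n * n) = ?x0" using x0 by simp
    then show ?case using I by (simp add: entinv_vr)
  qed (use c qle in \<open>auto simp: ctx_D group_entry_def row_id_def col_id_def\<close>)
  moreover have "?x0 + n * q = (r + 1) * (n * q)" by simp
  ultimately show ?thesis by metis
qed

definition cond :: "store \<Rightarrow> nat \<Rightarrow> nat \<Rightarrow> bool" where
  "cond s c j \<longleftrightarrow> Q (ar s aLK 0 c) j + l \<le> ar s aLV 0 c"

text \<open>The cells lexicographically below \<open>(c, j)\<close> have been filled; columns from
  \<open>n\<close> on of the right factor stay zero.\<close>

definition righted :: "store \<Rightarrow> nat \<Rightarrow> nat \<Rightarrow> store \<Rightarrow> bool" where
  "righted s c j s' \<longleftrightarrow> (\<forall>z<m * m. ar s' aMM (vr s vCnt) z = ar s aMM (vr s vCnt) z) \<and>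
     (\<forall>c'<m. \<forall>j'<m. ar s' aMM (vr s vCnt) (m * m + (c' * m + j')) = (if (c' < c \<or> c' = c \<and> j' < j) \<and> j' < n \<and> cond s c' j' then 1 else 0)) \<and>
     (\<forall>z\<ge>2 * (m * m). ar s' aMM (vr s vCnt) z = 0) \<and> (\<forall>r>vr s vCnt. \<forall>z. ar s' aMM r z = 0)"

lemma righted_upd:
  assumes "righted s c j s'" "c < m" "j < n"
    and "ar s'' aMM = (if cond s c j then (\<lambda>i' j'. if i' = vr s vCnt \<and> j' = m * m + (c * m + j) then Suc 0 else ar s' aMM i' j') else ar s' aMM)"
  shows "righted s c (Suc j) s''"
proof -
  have j: "j < m" using assms(3) by simp
  have ix: "m * m + (c * m + j) < 2 * (m * m)" using midx2[OF assms(2) j] by auto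
  show ?thesis
  proof (cases "cond s c j")
    case True
    then have e: "ar s'' aMM i z = (if i = vr s vCnt \<and> z = m * m + (c * m + j) then 1 else ar s' aMM i z)" for i z
      using assms(4) by simp
    have "ar s'' aMM (vr s vCnt) (m * m + (c' * m + j')) = (if (c' < c \<or> c' = c \<and> j' < Suc j) \<and> j' < n \<and> cond s c' j' then 1 else 0)"
      if "c' < m" "j' < m" for c' j'
    proof (cases "c' = c \<and> j' = j")
      case t: True
      then show ?thesis using e True assms(3) by simp
    next
      case False
      have "m * m + (c' * m + j') = m * m + (c * m + j) \<longleftrightarrow> False" using flat_eq[OF that(2) j] False by simp
      then show ?thesis using e assms(1) that False unfolding righted_def by (auto simp: less_Suc_eq)
    qed
    moreover have "ar s'' aMM (vr s vCnt) z = ar s aMM (vr s vCnt) z" if "z < m * m" for z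
      using e assms(1) that unfolding righted_def by simp
    moreover have "ar s'' aMM (vr s vCnt) z = 0" if "2 * (m * m) \<le> z" for z
      using e assms(1) that ix unfolding righted_def by simp
    moreover have "ar s'' aMM i z = 0" if "vr s vCnt < i" for i z
      using e assms(1) that unfolding righted_def by simp
    ultimately show ?thesis unfolding righted_def by blast
  next
    case False
    then have "ar s'' aMM = ar s' aMM" using assms(4) by simp
    then show ?thesis using assms(1) False unfolding righted_def by (auto simp: less_Suc_eq)
  qed
qed

lemma righted_next: "righted s c n s' \<longleftrightarrow> righted s (Suc c) 0 s'"
  unfolding righted_def by (intro conj_cong refl all_cong1 imp_cong) (auto simp: less_Suc_eq)

lemma group_right_correct:
  assumes c: "ctx s" and cn: "vr s vCnt < R" and nc: "vr s vnc \<le> m" and lk: "\<forall>c<vr s vnc. ar s aLK 0 c < n"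
    and z: "\<forall>z\<ge>m * m. ar s aMM (vr s vCnt) z = 0" "\<forall>r>vr s vCnt. \<forall>z. ar s aMM r z = 0"
  shows "tri group_right s (m * (n + 1)) (\<lambda>s'. righted s (vr s vnc) 0 s')"
proof -
  define nc where "nc = vr s vnc"
  have ncm: "nc \<le> m" using nc by (simp add: nc_def)
  have "tri group_right s (nc * (n + 1)) (\<lambda>s'. righted s nc 0 s')"
    unfolding group_right_def
  proof (rule tri_For[where m = nc and b = n and I = "\<lambda>c s'. righted s c 0 s'"], goal_cases)
    case (7 c s1)
    have c1: "ctx s1" by (rule ctx_frame[OF \<open>ctx s\<close> 7(5)]) auto
    have f1: "vr s1 vCnt = vr s vCnt" "ar s1 aLK = ar s aLK" "ar s1 aLV = ar s aLV" using 7(5) by (auto simp: frame_def)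
    have cm: "c < m" using 7(1) ncm by simp
    note c7 = 7(1,2)
    show ?case
    proof (rule tri_For[where m = n and b = 0 and I = "\<lambda>j s'. righted s c j s'"], goal_cases)
      case (7 j s2)
      have c2: "ctx s2" by (rule ctx_frame[OF c1 7(5)]) auto
      have f2: "vr s2 vCnt = vr s vCnt" "ar s2 aLK = ar s aLK" "ar s2 aLV = ar s aLV" "vr s2 38 = c" using 7(5) f1 c7 by (auto simp: frame_def)
      have jm: "j < m" using 7(1) by simp
      have k: "ar s aLK 0 c < n" using lk c7 by (simp add: nc_def)
      have kR: "ar s aLK 0 c < R" "j < R" "c < R" using k 7(1) cm nle mle by linarith+
      let ?s3 = "if cond s c j then s2\<lparr>vr := (vr s2)(39 := Suc j), ar := upd3 (ar s2) aMM (vr s vCnt) (m * m + (c * m + j)) (Suc 0)\<rparr> else s2\<lparr>vr := (vr s2)(39 := Suc j)\<rparr>"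
      have "righted s c (Suc j) ?s3"
        by (rule righted_upd[OF 7(4) cm 7(1)]) simp
      then show ?case using c2 f2 7(2) kR QlW[OF k 7(1)] midx2[OF cm jm] midx[OF cm jm] cn RW
        by (auto simp: ctx_D cond_def split: if_splits)
    next
      case (8 s2)
      have "righted s (Suc c) 0 s2" using 8(2) righted_next by simp
      then show ?case by (simp add: righted_def)
    qed (use 7 c1 nle in \<open>auto simp: ctx_D righted_def\<close>)
  qed (use c ncm mle z in \<open>auto simp: ctx_D nc_def righted_def\<close>)
  then show ?thesis unfolding nc_def by (rule tri_weaken) (use nc mult_le_mono1[OF nc, of "n + 1"] in auto)
qed

lemma soundI_upd2:
  assumes "sound Z" "\<exists>k<n. rb (g div nb) k = g mod nb \<and> valid (g div nb) k j"
  shows "sound (\<lambda>i' j'. if i' = g \<and> j' = j then v else Z i' j')"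
  unfolding sound_def
proof (intro allI impI)
  fix g' j' assume h: "g' < n * nb" "j' < n" "(if g' = g \<and> j' = j then v else Z g' j') \<noteq> 0"
  show "\<exists>k<n. rb (g' div nb) k = g' mod nb \<and> valid (g' div nb) k j'"
  proof (cases "g' = g \<and> j' = j")
    case False
    then have "Z g' j' \<noteq> 0" using h(3) by (simp split: if_splits)
    then show ?thesis using assms(1) h(1,2) unfolding sound_def by blast
  qed (use assms(2) in simp)
qed

text \<open>Soundness of the new marks is claimed only if every nonzero product cell is justified,
  since nothing is known about these cells after an interrupted run.\<close>

lemma group_out_correct:
  assumes c: "ctx s" and cn: "vr s vCnt < R" and np: "vr s vnp \<le> m" and lp: "\<forall>p<vr s vnp. ar s aLP 0 p < n * nb"
    and W: "\<And>p j. Wp p j = ar s aMM (vr s vCnt) (2 * (m * m) + (p * m + j))"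
  shows "tri group_out s (m * (n + 1)) (\<lambda>s'. grows (ar s aZ) (ar s' aZ) \<and>
    (\<forall>p<vr s vnp. \<forall>j<n. Wp p j \<noteq> 0 \<longrightarrow> ar s' aZ (ar s aLP 0 p) j \<noteq> 0) \<and>
    ((\<forall>p<vr s vnp. \<forall>j<n. Wp p j \<noteq> 0 \<longrightarrow> (\<exists>k<n. rb (ar s aLP 0 p div nb) k = ar s aLP 0 p mod nb \<and> valid (ar s aLP 0 p div nb) k j)) \<longrightarrow>
       sound (ar s aZ) \<longrightarrow> sound (ar s' aZ)))"
proof -
  define np where "np = vr s vnp"
  have npm: "np \<le> m" using np by (simp add: np_def)
  define Good where "Good \<longleftrightarrow> (\<forall>p<np. \<forall>j<n. Wp p j \<noteq> 0 \<longrightarrow> (\<exists>k<n. rb (ar s aLP 0 p div nb) k = ar s aLP 0 p mod nb \<and> valid (ar s aLP 0 p div nb) k j)) \<and> sound (ar s aZ)"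
  define J where "J p j s' \<longleftrightarrow> grows (ar s aZ) (ar s' aZ) \<and> (Good \<longrightarrow> sound (ar s' aZ)) \<and>
    (\<forall>p'<np. \<forall>j'<n. p' < p \<or> p' = p \<and> j' < j \<longrightarrow> Wp p' j' \<noteq> 0 \<longrightarrow> ar s' aZ (ar s aLP 0 p') j' \<noteq> 0)" for p j and s' :: store
  have Jn: "J p n s' \<longleftrightarrow> J (Suc p) 0 s'" for p s' unfolding J_def by (auto simp: less_Suc_eq)
  have Jv: "J p j (s'\<lparr>vr := f\<rparr>) \<longleftrightarrow> J p j s'" for p j s' f unfolding J_def by simp
  have "tri group_out s (np * (n + 1)) (\<lambda>s'. J np 0 s')"
    unfolding group_out_def
  proof (rule tri_For[where m = np and b = n and I = "\<lambda>p s'. J p 0 s'"], goal_cases)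
    case (7 p s1)
    have c1: "ctx s1" by (rule ctx_frame[OF c 7(5)]) auto
    have f1: "vr s1 vCnt = vr s vCnt" "ar s1 aLP = ar s aLP" "ar s1 aMM = ar s aMM" using 7(5) by (auto simp: frame_def)
    have pm: "p < m" using 7(1) npm by simp
    note p7 = 7(1,2)
    show ?case
    proof (rule tri_For[where m = n and b = 0 and I = "\<lambda>j s'. J p j s'"], goal_cases)
      case (7 j s2)
      have c2: "ctx s2" by (rule ctx_frame[OF c1 7(5)]) auto
      have f2: "vr s2 vCnt = vr s vCnt" "ar s2 aLP = ar s aLP" "ar s2 aMM = ar s aMM" "vr s2 41 = p" using 7(5) f1 p7 by (auto simp: frame_def)
      have jm: "j < m" using 7(1) by simp
      have g: "ar s aLP 0 p < n * nb" using lp p7 by (simp add: np_def)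
      have gR: "ar s aLP 0 p < R" "j < R" "p < R" using g nble 7(1) nle mle pm by linarith+
      show ?case
      proof (cases "Wp p j = 0")
        case True
        then have "J p (Suc j) s2" using 7(4) unfolding J_def by (auto simp: less_Suc_eq)
        then show ?thesis using c2 f2 7(2) gR midx2[OF pm jm] midx[OF pm jm] cn RW True W[of p j]
          by (simp add: ctx_D Jv)
      next
        case False
        let ?g = "ar s aLP 0 p"
        let ?s3 = "s2\<lparr>ar := upd3 (ar s2) aZ ?g j (Suc 0)\<rparr>"
        have "sound (\<lambda>i' j'. if i' = ?g \<and> j' = j then Suc 0 else ar s2 aZ i' j')" if Good
        proof (rule soundI_upd2)
          show "sound (ar s2 aZ)" using 7(4) that unfolding J_def by blast
          show "\<exists>k<n. rb (?g div nb) k = ?g mod nb \<and> valid (?g div nb) k j"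
            using that False p7(1) 7(1) unfolding Good_def by blast
        qed
        then have "J p (Suc j) ?s3" using 7(4) unfolding J_def grows_def by (auto simp: less_Suc_eq)
        then have "J p (Suc j) (?s3\<lparr>vr := (vr ?s3)(39 := Suc j)\<rparr>)" using Jv by blast
        then show ?thesis using c2 f2 7(2) gR midx2[OF pm jm] midx[OF pm jm] cn RW False W[of p j]
          by (simp add: ctx_D)
      qed
    qed (use 7 c1 nle Jn Jv in \<open>auto simp: ctx_D\<close>)
  qed (use c npm mle in \<open>auto simp: ctx_D np_def J_def grows_def Good_def\<close>)
  then show ?thesis
  proof (rule tri_weaken)
    show "np * (n + 1) \<le> m * (n + 1)" by (rule mult_le_mono1[OF npm])
    fix s' assume J: "J np 0 s'"
    show "grows (ar s aZ) (ar s' aZ) \<and>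
    (\<forall>p<vr s vnp. \<forall>j<n. Wp p j \<noteq> 0 \<longrightarrow> ar s' aZ (ar s aLP 0 p) j \<noteq> 0) \<and>
    ((\<forall>p<vr s vnp. \<forall>j<n. Wp p j \<noteq> 0 \<longrightarrow> (\<exists>k<n. rb (ar s aLP 0 p div nb) k = ar s aLP 0 p mod nb \<and> valid (ar s aLP 0 p div nb) k j)) \<longrightarrow>
       sound (ar s aZ) \<longrightarrow> sound (ar s' aZ))"
      unfolding np_def[symmetric]
    proof (intro conjI impI)
      show "grows (ar s aZ) (ar s' aZ)" using J unfolding J_def by blast
      show "\<forall>p<np. \<forall>j<n. Wp p j \<noteq> 0 \<longrightarrow> ar s' aZ (ar s aLP 0 p) j \<noteq> 0" using J unfolding J_def by blast
    next
      assume "\<forall>p<np. \<forall>j<n. Wp p j \<noteq> 0 \<longrightarrow> (\<exists>k<n. rb (ar s aLP 0 p div nb) k = ar s aLP 0 p mod nb \<and> valid (ar s aLP 0 p div nb) k j)" "sound (ar s aZ)"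
      then have Good unfolding Good_def by (rule conjI)
      then show "sound (ar s' aZ)" using J unfolding J_def by blast
    qed
  qed
qed

end

text \<open>The summands belong to clearing the numberings, the left factor, the right factor, the
  simulated run and the transfer of the marks.\<close>

definition group_ticks :: "nat \<Rightarrow> nat \<Rightarrow> nat" where
  "group_ticks n q = n + n * q + 3 * n * (n + 1) + n * q * q + 3 * n * (n + 1)"

definition attempt_ticks :: "nat \<Rightarrow> nat \<Rightarrow> nat" where
  "attempt_ticks n q = (let nb = n div q + 1 in
     n * nb * (n + 1) + n * (n * (nb + q + 1) + 1) + nb * Suc (group_ticks n q) + n * (n * (nb + q + 1) + 1))"

context dom
begin

text \<open>The counterpart of \<open>marked\<close>: the column block of the entry of rank
  \<open>y\<close> passes the threshold as a whole, so the product of its group takes care of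
  it.\<close>

definition lowmarked :: "(nat \<Rightarrow> nat \<Rightarrow> nat) \<Rightarrow> nat \<Rightarrow> bool" where
  "lowmarked Z y \<longleftrightarrow> (\<forall>j<n. Q (gam y) j + l \<le> first (gam y) (cb (rho y) (gam y)) \<longrightarrow> Z (rho y * nb + rb (rho y) (gam y)) j \<noteq> 0)"

lemma lowmarked_grows: "lowmarked Z y \<Longrightarrow> grows Z Z' \<Longrightarrow> lowmarked Z' y"
  unfolding lowmarked_def grows_def by blast

lemma cur_refl: "cur f q x x i = 0" and ids_refl: "ids f q x x i = 0"
  by (auto simp: cur_def ids_def)

lemma group_clear_correct:
  assumes c: "ctx s" and v: "vr s vnp = 0" "vr s vnc = 0" and z: "\<forall>i\<ge>vr s vCnt. \<forall>z. ar s aMM i z = 0"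
  shows "tri group_clear s n (\<lambda>s'. entinv x0 x0 s')"
proof -
  have "tri group_clear s n (\<lambda>s'. \<forall>i<n. ar s' aCR 0 i = 0 \<and> ar s' aCC 0 i = 0)" unfolding group_clear_def
    by (rule tri_For[where m = n and b = 0 and I = "\<lambda>i s'. \<forall>i'<i. ar s' aCR 0 i' = 0 \<and> ar s' aCC 0 i' = 0"])
      (use c nle RW in \<open>auto simp: ctx_D less_Suc_eq\<close>)
  then show ?thesis
  proof (rule tri_weaken)
    fix s' assume h: "\<forall>i<n. ar s' aCR 0 i = 0 \<and> ar s' aCC 0 i = 0" and fr: "frame (wv group_clear) (wa group_clear) s s'"
    have "vr s' vnp = 0" "vr s' vnc = 0" "vr s' vCnt = vr s vCnt" "ar s' aMM = ar s aMM" using fr v by (auto simp: frame_def group_clear_def)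
    then show "entinv x0 x0 s'" using h z unfolding entinv_def rowinv_def colinv_def matinv_def by (auto simp: cur_refl ids_refl)
  qed simp
qed

text \<open>Soundness: a nonzero product cell has a middle index \<open>c\<close>, whose column
  block passes the threshold as a whole and shares an entry with row block \<open>p\<close>; this
  entry is valid. Completeness: the number of the column block of the entry itself serves as middle
  index.\<close>

lemma group_product:
  assumes c: "ctx s" and I: "entinv x0 x s" and np: "vr s vnp \<le> m" "vr s vnc \<le> m"
    and rt: "righted s (vr s vnc) 0 s'" and fr: "frame (wv group_right) (wa group_right) s s'"
  shows "\<forall>z. ar s' aMM (vr s' vCnt) z < R"
    "\<exists>t\<le>Lq. halted P ((step ws P ^^ t) (sim_start s'))"
    "halted P ((step ws P ^^ b) (sim_start s')) \<Longrightarrow> p < vr s vnp \<Longrightarrow> j < n \<Longrightarrow> mem ((step ws P ^^ b) (sim_start s')) (2 * (m * m) + (p * m + j)) \<noteq> 0 \<Longrightarrow>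
       \<exists>k<n. rb (ar s aLP 0 p div nb) k = ar s aLP 0 p mod nb \<and> valid (ar s aLP 0 p div nb) k j"
    "halted P ((step ws P ^^ b) (sim_start s')) \<Longrightarrow> x0 \<le> y \<Longrightarrow> y < x \<Longrightarrow> j < n \<Longrightarrow> Q (gam y) j + l \<le> first (gam y) (cb (rho y) (gam y)) \<Longrightarrow>
       \<exists>p<vr s vnp. ar s aLP 0 p = rho y * nb + rb (rho y) (gam y) \<and> mem ((step ws P ^^ b) (sim_start s')) (2 * (m * m) + (p * m + j)) \<noteq> 0"
proof -
  let ?M = "ar s' aMM (vr s vCnt)"
  define A where "A i j = ?M (i * m + j)" for i j
  define B where "B i j = ?M (m * m + (i * m + j))" for i j
  have f: "vr s' vCnt = vr s vCnt" "vr s' vDim = m" "vr s' vWs = ws" using fr c by (auto simp: frame_def group_right_def ctx_D)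
  have mI: "matinv x0 x s" using I by (simp add: entinv_def)
  have M0: "?M z = ar s aMM (vr s vCnt) z" if "z < m * m" for z using rt that unfolding righted_def by simp
  have Aeq: "A i j = ar s aMM (vr s vCnt) (i * m + j)" if "i < m" "j < m" for i j
    using M0 flat_less[OF that] by (simp add: A_def)
  have Beq: "B i j = (if i < vr s vnc \<and> j < n \<and> cond s i j then 1 else 0)" if "i < m" "j < m" for i j
    using rt that unfolding righted_def B_def by simp
  have A1: "A i j \<le> 1" if "i < m" "j < m" for i j using Aeq[OF that] mI unfolding matinv_def by simp
  have B1: "B i j \<le> 1" if "i < m" "j < m" for i j using Beq[OF that] by simp
  have M1: "?M z \<le> 1" for z
  proof -
    consider "z < m * m" | "m * m \<le> z" "z < 2 * (m * m)" | "2 * (m * m) \<le> z" by linarith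
    then show ?thesis
    proof cases
      case 1
      then show ?thesis using M0 mI unfolding matinv_def by simp
    next
      case 2
      define z' where "z' = z - m * m"
      have z': "z = m * m + z'" "z' < m * m" using 2 by (auto simp: z'_def)
      have "z' div m < m" "z' mod m < m" using z'(2) n1 by (auto simp: less_mult_imp_div_less)
      then have "B (z' div m) (z' mod m) \<le> 1" by (rule B1)
      then show ?thesis unfolding B_def div_mult_mod_eq z'(1) .
    next
      case 3
      then show ?thesis using rt unfolding righted_def by simp
    qed
  qed
  show "\<forall>z. ar s' aMM (vr s' vCnt) z < R" unfolding f using M1 RW(2) by (meson le_less_trans less_trans one_less_numeral_iff semiring_norm(77))
  have inp: "matmul_input ws m A B (sim_start s')"
    unfolding matmul_input_def sim_start_def f using rt
    by (auto simp: A_def B_def righted_def add.assoc mult.assoc)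
  have AB: "\<forall>i<m. \<forall>j<m. A i j \<le> 1 \<and> B i j \<le> 1" using A1 B1 by blast
  from mm[OF AB inp] obtain t where t: "t \<le> Lq" "halted P ((step ws P ^^ t) (sim_start s'))"
    "matmul_output m (\<lambda>i j. \<Sum>k<m. A i k * B k j) ((step ws P ^^ t) (sim_start s'))" by blast
  then show "\<exists>t\<le>Lq. halted P ((step ws P ^^ t) (sim_start s'))" by blast
  have out: "mem ((step ws P ^^ b) (sim_start s')) (2 * (m * m) + (p * m + j)) = (\<Sum>k<m. A p k * B k j)"
    if "halted P ((step ws P ^^ b) (sim_start s'))" "p < m" "j < m" for p j
  proof -
    have "mem ((step ws P ^^ t) (sim_start s')) (2 * m * m + p * m + j) = (\<Sum>k<m. A p k * B k j)"
      using t(3) that(2,3) unfolding matmul_output_def by blast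
    then show ?thesis unfolding halted_unique[OF that(1) t(2)] by (simp only: add.assoc mult.assoc)
  qed
  {
    assume h: "halted P ((step ws P ^^ b) (sim_start s'))" "p < vr s vnp" "j < n" "mem ((step ws P ^^ b) (sim_start s')) (2 * (m * m) + (p * m + j)) \<noteq> 0"
    have pj: "p < m" "j < m" using h np by auto
    then have "(\<Sum>k<m. A p k * B k j) \<noteq> 0" using out h by simp
    then obtain c where "c \<in> {..<m}" "A p c * B c j \<noteq> 0" by (rule sum.not_neutral_contains_not_neutral)
    then have c: "c < m" "A p c \<noteq> 0" "B c j \<noteq> 0" by auto
    have "\<exists>i<n. \<exists>k<n. ent s p c i k" using mI c Aeq[OF pj(1) c(1)] pj unfolding matinv_def by auto
    then obtain i k where ik: "i < n" "k < n" "ent s p c i k" by blast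
    have "cond s c j" using Beq[OF c(1) pj(2)] c(3) by (auto split: if_splits)
    then have "Q k j + l \<le> first k (cb i k)" using ik(3) by (simp add: cond_def ent_def)
    then have "valid i k j" using first_le[OF ik(1,2)] by (simp add: valid_def)
    then show "\<exists>k<n. rb (ar s aLP 0 p div nb) k = ar s aLP 0 p mod nb \<and> valid (ar s aLP 0 p div nb) k j"
      using ik rbcb(1)[OF ik(1,2)] by (intro exI[of _ k]) (simp add: ent_def)
  }
  {
    assume h: "halted P ((step ws P ^^ b) (sim_start s'))" "x0 \<le> y" "y < x" "j < n" "Q (gam y) j + l \<le> first (gam y) (cb (rho y) (gam y))"
    have "\<exists>p<vr s vnp. \<exists>c<vr s vnc. ar s aMM (vr s vCnt) (p * m + c) \<noteq> 0 \<and> ent s p c (rho y) (gam y)"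
      using mI h unfolding matinv_def by simp
    then obtain p c where pc: "p < vr s vnp" "c < vr s vnc" "ar s aMM (vr s vCnt) (p * m + c) \<noteq> 0" "ent s p c (rho y) (gam y)" by blast
    have pm: "p < m" "c < m" "j < m" using pc np h by auto
    have "cond s c j" using pc(4) h(5) by (simp add: cond_def ent_def)
    then have "B c j = 1" using Beq[OF pm(2,3)] pc(2) h(4) by simp
    moreover have "A p c \<noteq> 0" using Aeq[OF pm(1,2)] pc(3) by simp
    ultimately have "(\<Sum>k<m. A p k * B k j) \<noteq> 0" using pm(2) by auto
    then show "\<exists>p<vr s vnp. ar s aLP 0 p = rho y * nb + rb (rho y) (gam y) \<and> mem ((step ws P ^^ b) (sim_start s')) (2 * (m * m) + (p * m + j)) \<noteq> 0"
      using pc pm out[OF h(1) pm(1,3)] by (intro exI[of _ p]) (simp add: ent_def)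
  }
qed

abbreviation "tgroup \<equiv> group_ticks n q"
lemmas tgroup_def = group_ticks_def

lemma group_correct:
  assumes c: "ctx s" and r: "vr s 40 = r" "r < nb" and cn: "vr s vCnt < R" and z: "\<forall>i\<ge>vr s vCnt. \<forall>z. ar s aMM i z = 0"
  shows "tri group s tgroup (\<lambda>s'. vr s' vCnt = Suc (vr s vCnt) \<and> (\<forall>i\<ge>vr s' vCnt. \<forall>z. ar s' aMM i z = 0) \<and>
    (vr s' vok = vr s vok \<or> vr s' vok = 0) \<and> (Lq \<le> n * q * q \<longrightarrow> vr s' vok = vr s vok) \<and> grows (ar s aZ) (ar s' aZ) \<and>
    (vr s' vok \<noteq> 0 \<longrightarrow> (sound (ar s aZ) \<longrightarrow> sound (ar s' aZ)) \<and>
       (\<forall>y. r * (n * q) \<le> y \<and> y < min ((r + 1) * (n * q)) (n * n) \<longrightarrow> lowmarked (ar s' aZ) y)))" (is "tri _ _ _ ?Q")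
proof -
  let ?x0 = "r * (n * q)" and ?x1 = "min ((r + 1) * (n * q)) (n * n)"
  define s1 where "s1 = s\<lparr>vr := (vr s)(vnp := 0, vnc := 0)\<rparr>"
  have c1: "ctx s1" using c by (simp add: ctx_def s1_def)
  have z1: "\<forall>i\<ge>vr s1 vCnt. \<forall>z. ar s1 aMM i z = 0" "vr s1 vnp = 0" "vr s1 vnc = 0" using z by (auto simp: s1_def)
  have "tri (group_clear ;; group_fill ;; group_right ;; Sim ;;
     If (V vFlag) (N 1) (Assign vok (N 0)) Skip ;; group_out ;; Assign vCnt (V vCnt \<oplus> N 1)) s1 tgroup ?Q"
  proof (rule tri_Seq[OF group_clear_correct[OF c1 z1(2,3,1), of ?x0], where Tb = "tgroup - n"], goal_cases)
    case (1 s2)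
    have c2: "ctx s2" by (rule ctx_frame[OF c1 1(2)]) (auto simp: group_clear_def)
    have f2: "vr s2 40 = r" "vr s2 vCnt = vr s vCnt" "vr s2 vok = vr s vok" "ar s2 aZ = ar s aZ"
      using 1(2) r by (auto simp: frame_def group_clear_def s1_def)
    have cn2: "vr s2 vCnt < R" using f2 cn by simp
    show ?case
    proof (rule tri_Seq[OF group_fill_correct[OF c2 f2(1) r(2) 1(1) cn2], where Tb = "tgroup - n - n * q"], goal_cases)
      case (1 s3)
      have c3: "ctx s3" by (rule ctx_frame[OF c2 1(2)]) (auto simp: group_defs)
      have f3: "vr s3 vCnt = vr s vCnt" "vr s3 vok = vr s vok" "ar s3 aZ = ar s aZ"
        using 1(2) f2 by (auto simp: frame_def group_defs)
      have x01: "?x0 \<le> ?x1"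
      proof -
        have "r * q \<le> n div q * q" using r by (intro mult_right_mono) (auto simp: nb_def)
        also have "\<dots> \<le> n" by simp
        finally have "n * (r * q) \<le> n * n" by (rule mult_le_mono2)
        moreover have "n * (r * q) = ?x0" by simp
        ultimately show ?thesis by simp
      qed
      have np: "vr s3 vnp \<le> m" "vr s3 vnc \<le> m" using np_le[of ?x0 ?x1 s3] x01 1(1) by (auto simp: entinv_def)
      have lk: "\<forall>c<vr s3 vnc. ar s3 aLK 0 c < n" and lp: "\<forall>p<vr s3 vnp. ar s3 aLP 0 p < n * nb"
        and zz: "\<forall>z\<ge>m * m. ar s3 aMM (vr s3 vCnt) z = 0" "\<forall>r>vr s3 vCnt. \<forall>z. ar s3 aMM r z = 0"
        using 1(1) unfolding entinv_def rowinv_def colinv_def matinv_def by blast+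
      have cn3: "vr s3 vCnt < R" using f3 cn by simp
      note ent3 = 1(1)
      show ?case
      proof (rule tri_Seq[OF group_right_correct[OF c3 cn3 np(2) lk zz], where Tb = "n * q * q + m * (n + 1)"], goal_cases)
        case (1 s4)
        have c4: "ctx s4" by (rule ctx_frame[OF c3 1(2)]) (auto simp: group_defs)
        have f4: "vr s4 vCnt = vr s vCnt" "vr s4 vok = vr s vok" "ar s4 aZ = ar s aZ" "vr s4 vnp = vr s3 vnp" "ar s4 aLP = ar s3 aLP"
          using 1(2) f3 by (auto simp: frame_def group_defs)
        note gp = group_product[OF c3 ent3 np 1(1,2)]
        have z4: "\<forall>i\<ge>Suc (vr s vCnt). \<forall>z. ar s4 aMM i z = 0" using 1(1) f3 unfolding righted_def by auto
        define \<sigma> where "\<sigma> = (step ws P ^^ (n * q * q)) (sim_start s4)"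
        define s5 where "s5 = s4\<lparr>vr := (vr s4)(vFlag := (if halted P \<sigma> then 1 else 0)), ar := (ar s4)(aMM := (ar s4 aMM)(vr s4 vCnt := mem \<sigma>))\<rparr>"
        have sim: "tri Sim s4 (n * q * q) (\<lambda>s'. s' = s5)"
          by (rule tri_Sim) (use c4 f4 cn qle mle gp(1) in \<open>auto simp: ctx_D s5_def \<sigma>_def\<close>)
        show ?case
        proof (rule tri_Seq[OF sim, where Tb = "m * (n + 1)"], goal_cases)
          case (1 s5')
          have [simp]: "s5' = s5" using 1 by simp
          define s6 where "s6 = (if halted P \<sigma> then s5 else s5\<lparr>vr := (vr s5)(vok := 0)\<rparr>)"
          have c6: "ctx s6" using c4 by (auto simp: ctx_def s6_def s5_def)
          have f6: "vr s6 vCnt = vr s vCnt" "vr s6 vok = (if halted P \<sigma> then vr s vok else 0)" "ar s6 aZ = ar s aZ" "vr s6 vnp = vr s3 vnp" "ar s6 aLP = ar s3 aLP"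
            "ar s6 aMM (vr s6 vCnt) = mem \<sigma>" "\<forall>i\<ge>Suc (vr s vCnt). \<forall>z. ar s6 aMM i z = 0"
            using f4 z4 by (auto simp: s6_def s5_def)
          have lp6: "\<forall>p<vr s6 vnp. ar s6 aLP 0 p < n * nb" using lp f6 by simp
          \<comment> \<open>With a sufficient budget the run halts after at most \<open>Lq\<close>
            steps and stays halted until the budget is used up.\<close>
          have hq: "halted P \<sigma>" if "Lq \<le> n * q * q"
          proof -
            obtain t where t: "t \<le> Lq" "halted P ((step ws P ^^ t) (sim_start s4))" using gp(2) by blast
            have "\<sigma> = (step ws P ^^ (n * q * q - t)) ((step ws P ^^ t) (sim_start s4))"
              unfolding \<sigma>_def using t(1) that by (metis funpow_add le_add_diff_inverse2 le_trans o_apply)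
            then show ?thesis using halted_stay[OF t(2)] t(2) by simp
          qed
          have cn6: "vr s6 vCnt < R" and np6: "vr s6 vnp \<le> m" using f6 cn np by auto
          have W6: "\<And>p j. mem \<sigma> (2 * (m * m) + (p * m + j)) = ar s6 aMM (vr s6 vCnt) (2 * (m * m) + (p * m + j))" using f6 by simp
          have "tri (group_out ;; Assign vCnt (V vCnt \<oplus> N 1)) s6 (m * (n + 1)) ?Q"
          proof (rule tri_Seq[OF group_out_correct[OF c6 cn6 np6 lp6 W6], where Tb = 0], goal_cases)
            case (1 s7)
            have f7: "vr s7 vCnt = vr s vCnt" "vr s7 vok = vr s6 vok" "ar s7 aMM = ar s6 aMM"
              using 1(2) f6(1) by (auto simp: frame_def group_defs)
            have gr: "grows (ar s aZ) (ar s7 aZ)" using 1(1) f6 by simp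
            have so: "sound (ar s7 aZ)" if "vr s7 vok \<noteq> 0" "sound (ar s aZ)"
            proof -
              have h: "halted P \<sigma>" using that f7 f6 by (auto split: if_splits)
              show ?thesis using 1(1) gp(3)[OF h[unfolded \<sigma>_def], folded \<sigma>_def] f6 that by auto
            qed
            have lm: "lowmarked (ar s7 aZ) y" if y: "vr s7 vok \<noteq> 0" "?x0 \<le> y" "y < ?x1" for y
              unfolding lowmarked_def
            proof (intro allI impI)
              fix j assume j: "j < n" "Q (gam y) j + l \<le> first (gam y) (cb (rho y) (gam y))"
              have h: "halted P \<sigma>" using y f7 f6 by (auto split: if_splits)
              obtain p where "p < vr s3 vnp" "ar s3 aLP 0 p = rho y * nb + rb (rho y) (gam y)" "mem \<sigma> (2 * (m * m) + (p * m + j)) \<noteq> 0"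
                using gp(4)[OF h[unfolded \<sigma>_def] y(2,3) j] unfolding \<sigma>_def by blast
              then show "ar s7 aZ (rho y * nb + rb (rho y) (gam y)) j \<noteq> 0" using 1(1) f6(4,5) j(1) by metis
            qed
            have W1: "vr s vCnt + 1 < W" using cn RW by linarith
            have q1: "vr s7 vok = vr s vok \<or> vr s7 vok = 0" "Lq \<le> n * q * q \<longrightarrow> vr s7 vok = vr s vok" using f7 f6 hq by auto
            have fr: "\<forall>i\<ge>Suc (vr s vCnt). \<forall>z. ar s7 aMM i z = 0" using f7 f6 by simp
            show ?case using f7(1) W1 gr so lm q1 fr RW by simp
          qed simp
          then show ?case using RW by (simp add: s6_def s5_def split: if_splits)
        qed simp
      qed (auto simp: tgroup_def)
    qed (auto simp: tgroup_def)
  qed (auto simp: tgroup_def)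
  then show ?thesis unfolding group_def using RW by (simp add: s1_def)
qed

end

section \<open>All groups of an attempt and the final search\<close>

definition groups :: com where
  "groups = For 40 vnb group"

definition search1 :: com where
  "search1 = For 34 vnb (If (V 33) (V vnb) Skip (If (N 0) (Rd aZ (V 30 \<otimes> V vnb \<oplus> V 34) (V 31)) (Assign 33 (V 34)) Skip))"

definition search2 :: com where
  "search2 = For 35 vq (Assign 36 (V 33 \<otimes> V vq \<oplus> V 35) ;;
     If (V 36) (V vn) (Assign 37 (Rd aRS (V 30) (V 36)) ;;
       If (Rd aQ (V 30) (V 37)) (Rd aQ (V 37) (V 31) \<oplus> V vl) Skip
         (If (Rd aQ (V 30) (V 37)) (V 38) (Assign 38 (Rd aQ (V 30) (V 37))) Skip)) Skip)"

definition search :: com where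
  "search = For 30 vn (For 31 vn (Assign 33 (V vnb) ;; Assign 38 (V vInf) ;; search1 ;;
     If (V 33) (V vnb) search2 Skip ;; Wr aRes (V 30) (V 31) (V 38)))"

definition attempt :: com where
  "attempt = clear_marks ;; inner_marks ;; Assign vok (N 1) ;; groups ;; search"

context dom
begin

text \<open>The value \<open>R\<close> stands for the minimum of the empty set; it may also occur as
  a key.\<close>

definition domres :: "nat \<Rightarrow> nat \<Rightarrow> nat \<Rightarrow> bool" where
  "domres i j x \<longleftrightarrow> (x = R \<or> (\<exists>k<n. valid i k j \<and> x = Q i k)) \<and> (\<forall>k<n. valid i k j \<longrightarrow> x \<le> Q i k)"

lemma groups_correct:
  assumes c: "ctx s" and cn: "vr s vCnt + nb \<le> R" and z: "\<forall>i\<ge>vr s vCnt. \<forall>z. ar s aMM i z = 0"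
    and ok: "vr s vok = 1" and so: "sound (ar s aZ)"
  shows "tri groups s (nb * Suc tgroup) (\<lambda>s'. vr s' vCnt = vr s vCnt + nb \<and> (\<forall>i\<ge>vr s' vCnt. \<forall>z. ar s' aMM i z = 0) \<and>
    vr s' vok \<le> 1 \<and> (Lq \<le> n * q * q \<longrightarrow> vr s' vok = 1) \<and> grows (ar s aZ) (ar s' aZ) \<and>
    (vr s' vok \<noteq> 0 \<longrightarrow> sound (ar s' aZ) \<and> (\<forall>y<n * n. lowmarked (ar s' aZ) y)))"
proof -
  define J where "J r s' \<longleftrightarrow> vr s' vCnt = vr s vCnt + r \<and> (\<forall>i\<ge>vr s' vCnt. \<forall>z. ar s' aMM i z = 0) \<and>
    vr s' vok \<le> 1 \<and> (Lq \<le> n * q * q \<longrightarrow> vr s' vok = 1) \<and> grows (ar s aZ) (ar s' aZ) \<and>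
    (vr s' vok \<noteq> 0 \<longrightarrow> sound (ar s' aZ) \<and> (\<forall>y<min (r * (n * q)) (n * n). lowmarked (ar s' aZ) y))" for r and s' :: store
  have "tri groups s (nb * Suc tgroup) (\<lambda>s'. J nb s')"
    unfolding groups_def
  proof (rule tri_For[where m = nb and b = tgroup and I = J], goal_cases)
    case (7 r s1)
    have c1: "ctx s1" by (rule ctx_frame[OF c 7(5)]) (auto simp: group_defs)
    have J1: "vr s1 vCnt = vr s vCnt + r" "\<forall>i\<ge>vr s1 vCnt. \<forall>z. ar s1 aMM i z = 0" "vr s1 vok \<le> 1" "Lq \<le> n * q * q \<longrightarrow> vr s1 vok = 1"
      "grows (ar s aZ) (ar s1 aZ)" "vr s1 vok \<noteq> 0 \<longrightarrow> sound (ar s1 aZ) \<and> (\<forall>y<min (r * (n * q)) (n * n). lowmarked (ar s1 aZ) y)"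
      using 7(4) unfolding J_def by auto
    have cn1: "vr s1 vCnt < R" using J1(1) cn 7(1) by simp
    show ?case
    proof (rule tri_weaken[OF group_correct[OF c1 7(2,1) cn1 J1(2)]], simp)
      fix s2 :: store
      assume h: "vr s2 vCnt = Suc (vr s1 vCnt) \<and> (\<forall>i\<ge>vr s2 vCnt. \<forall>z. ar s2 aMM i z = 0) \<and>
        (vr s2 vok = vr s1 vok \<or> vr s2 vok = 0) \<and> (Lq \<le> n * q * q \<longrightarrow> vr s2 vok = vr s1 vok) \<and> grows (ar s1 aZ) (ar s2 aZ) \<and>
        (vr s2 vok \<noteq> 0 \<longrightarrow> (sound (ar s1 aZ) \<longrightarrow> sound (ar s2 aZ)) \<and>
         (\<forall>y. r * (n * q) \<le> y \<and> y < min ((r + 1) * (n * q)) (n * n) \<longrightarrow> lowmarked (ar s2 aZ) y))"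
      have gr: "grows (ar s1 aZ) (ar s2 aZ)" using h by blast
      have gr2: "grows (ar s aZ) (ar s2 aZ)" using gr J1(5) by (simp add: grows_def)
      have lm: "sound (ar s2 aZ) \<and> lowmarked (ar s2 aZ) y" if o: "vr s2 vok \<noteq> 0" and y: "y < min (Suc r * (n * q)) (n * n)" for y
      proof (cases "y < r * (n * q)")
        case True
        then show ?thesis using h J1(6) o y lowmarked_grows[OF _ gr] by auto
      next
        case False
        then show ?thesis using h J1(6) o y by auto
      qed
      have so2: "sound (ar s2 aZ)" if o: "vr s2 vok \<noteq> 0" using h J1(6) o by auto
      show "J (Suc r) (s2\<lparr>vr := (vr s2)(40 := Suc r)\<rparr>)"
        unfolding J_def using h J1 gr2 lm so2 by auto
    qed
  qed (use c nble z ok so in \<open>auto simp: ctx_D group_defs J_def grows_def\<close>)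
  then show ?thesis
  proof (rule tri_weaken)
    fix s' assume J: "J nb s'"
    \<comment> \<open>The extra block in \<open>nb = n div q + 1\<close> lets \<open>nb\<close>
      groups of \<open>n * q\<close> ranks cover all \<open>n * n\<close> ranks.\<close>
    have "n < nb * q" using q1 by (simp add: nb_def dividend_less_div_times)
    then have "n * n \<le> n * (nb * q)" by (intro mult_le_mono2) simp
    moreover have "n * (nb * q) = nb * (n * q)" by (rule mult.left_commute)
    ultimately have "min (nb * (n * q)) (n * n) = n * n" by (simp only: min_absorb2)
    then show "vr s' vCnt = vr s vCnt + nb \<and> (\<forall>i\<ge>vr s' vCnt. \<forall>z. ar s' aMM i z = 0) \<and>
      vr s' vok \<le> 1 \<and> (Lq \<le> n * q * q \<longrightarrow> vr s' vok = 1) \<and> grows (ar s aZ) (ar s' aZ) \<and>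
      (vr s' vok \<noteq> 0 \<longrightarrow> sound (ar s' aZ) \<and> (\<forall>y<n * n. lowmarked (ar s' aZ) y))" using J unfolding J_def by auto
  qed simp
qed

lemma search1_correct:
  assumes c: "ctx s" and i: "vr s 30 = i" "i < n" and j: "vr s 31 = j" "j < n" and b: "vr s 33 = nb"
  shows "tri search1 s nb (\<lambda>s'. vr s' 33 \<le> nb \<and> (vr s' 33 < nb \<longrightarrow> ar s aZ (i * nb + vr s' 33) j \<noteq> 0) \<and>
    (\<forall>b<vr s' 33. b < nb \<longrightarrow> ar s aZ (i * nb + b) j = 0))"
  unfolding search1_def
proof (rule tri_For[where m = nb and b = 0 and I = "\<lambda>b s'. vr s' 33 \<le> nb \<and> (vr s' 33 < nb \<longrightarrow> vr s' 33 < b \<and> ar s aZ (i * nb + vr s' 33) j \<noteq> 0) \<and>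
    (\<forall>b'<vr s' 33. b' < b \<longrightarrow> ar s aZ (i * nb + b') j = 0)"], goal_cases)
  case (7 b s1)
  have c1: "ctx s1" by (rule ctx_frame[OF c 7(5)]) auto
  have v1: "vr s1 30 = i" "vr s1 31 = j" "ar s1 aZ = ar s aZ" using 7 i j by (auto simp: frame_def)
  have jR: "j < R" using j nle by linarith
  show ?case using 7 v1 c1 jR gidx[OF i(2) 7(1)] RW by (auto simp: ctx_D less_Suc_eq)
qed (use c nble b in \<open>auto simp: ctx_D\<close>)

lemma search2_correct:
  assumes c: "ctx s" and i: "vr s 30 = i" "i < n" and j: "vr s 31 = j" "j < n" and b: "vr s 33 = b" "b < nb" and r: "vr s 38 = R"
  shows "tri search2 s q (\<lambda>s'. (vr s' 38 = R \<or> (\<exists>k<n. valid i k j \<and> vr s' 38 = Q i k)) \<and>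
    (\<forall>k<n. rb i k = b \<longrightarrow> valid i k j \<longrightarrow> vr s' 38 \<le> Q i k))"
proof -
  have ijR: "i < R" "j < R" using i j nle by linarith+
  have "tri search2 s q (\<lambda>s'. (vr s' 38 = R \<or> (\<exists>k<n. valid i k j \<and> vr s' 38 = Q i k)) \<and>
    (\<forall>y<q. b * q + y < n \<longrightarrow> valid i (RS i (b * q + y)) j \<longrightarrow> vr s' 38 \<le> Q i (RS i (b * q + y))))"
    unfolding search2_def
  proof (rule tri_For[where m = q and b = 0 and I = "\<lambda>y s'. (vr s' 38 = R \<or> (\<exists>k<n. valid i k j \<and> vr s' 38 = Q i k)) \<and>
    (\<forall>y'<y. b * q + y' < n \<longrightarrow> valid i (RS i (b * q + y')) j \<longrightarrow> vr s' 38 \<le> Q i (RS i (b * q + y')))"], goal_cases)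
    case (7 y s1)
    have c1: "ctx s1" by (rule ctx_frame[OF c 7(5)]) auto
    have v1: "vr s1 30 = i" "vr s1 31 = j" "vr s1 33 = b" using 7 i j b by (auto simp: frame_def)
    let ?p = "b * q + y"
    have bq: "?p < W" "?p < R" "b * q < W" using blk_less[OF b(2) 7(1)] by auto
    show ?case
    proof (cases "?p < n")
      case True
      have k: "RS i ?p < n" using RPD(3)[OF i(2) True] .
      have kR: "RS i ?p < R" using k nle by linarith
      have kW: "Q (RS i ?p) j + l < W" using QlW[OF k j(2)] by simp
      show ?thesis
      proof (cases "valid i (RS i ?p) j \<and> Q i (RS i ?p) < vr s1 38")
        case t: True
        then have "\<exists>k<n. valid i k j \<and> Q i (RS i ?p) = Q i k" using k by blast
        then show ?thesis using t 7 c1 v1 bq kR ijR kW True RW k by (auto simp: ctx_D less_Suc_eq valid_def)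
      next
        case False
        then show ?thesis using 7 c1 v1 bq kR ijR kW True RW k by (auto simp: ctx_D less_Suc_eq valid_def)
      qed
    next
      case False
      then show ?thesis using 7 c1 v1 bq RW by (auto simp: ctx_D less_Suc_eq)
    qed
  qed (use c qle b r in \<open>auto simp: ctx_D\<close>)
  then show ?thesis
  proof (rule tri_weaken)
    fix s' assume h: "(vr s' 38 = R \<or> (\<exists>k<n. valid i k j \<and> vr s' 38 = Q i k)) \<and>
      (\<forall>y<q. b * q + y < n \<longrightarrow> valid i (RS i (b * q + y)) j \<longrightarrow> vr s' 38 \<le> Q i (RS i (b * q + y)))"
    have "vr s' 38 \<le> Q i k" if k: "k < n" "rb i k = b" "valid i k j" for k
    proof -
      have e: "b * q + RP i k mod q = RP i k" using k(2) by (auto simp: rb_def)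
      have "RP i k mod q < q" using q1 by simp
      then show ?thesis using h e k RPD(1,2)[OF i(2) k(1)] by metis
    qed
    then show "(vr s' 38 = R \<or> (\<exists>k<n. valid i k j \<and> vr s' 38 = Q i k)) \<and>
      (\<forall>k<n. rb i k = b \<longrightarrow> valid i k j \<longrightarrow> vr s' 38 \<le> Q i k)" using h by blast
  qed simp
qed

definition covers :: "(nat \<Rightarrow> nat \<Rightarrow> nat) \<Rightarrow> bool" where
  "covers Z \<longleftrightarrow> (\<forall>i<n. \<forall>k<n. \<forall>j<n. valid i k j \<longrightarrow> Z (i * nb + rb i k) j \<noteq> 0)"

text \<open>The column block of a valid entry either starts below the threshold, and the entry was
  marked by scanning, or passes the threshold as a whole, and the product of the group marked
  it.\<close>

lemma coversI:
  assumes "\<forall>k<n. \<forall>j<n. marked Z k j" "\<forall>y<n * n. lowmarked Z y"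
  shows "covers Z"
  unfolding covers_def
proof (intro allI impI)
  fix i k j assume h: "i < n" "k < n" "j < n" "valid i k j"
  obtain y where y: "y < n * n" "ord y = i * n + k" using ordD(2)[OF h(1,2)] by blast
  have rg: "rho y = i" "gam y = k" unfolding rho_def gam_def y(2) using h(2) by simp_all
  show "Z (i * nb + rb i k) j \<noteq> 0"
  proof (cases "first k (cb i k) < Q k j + l")
    case True
    then show ?thesis using assms(1) h unfolding marked_def by blast
  next
    case False
    then have "Q (gam y) j + l \<le> first (gam y) (cb (rho y) (gam y))" using rg by simp
    then have "Z (rho y * nb + rb (rho y) (gam y)) j \<noteq> 0" using assms(2) y(1) h(3) unfolding lowmarked_def by blast
    then show ?thesis using rg by simp
  qed
qed

text \<open>Rows are sorted, so later blocks have no smaller entries. By soundness the first marked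
  block contains a valid entry, by coverage no valid entry precedes it; scanning this single block
  yields the minimum.\<close>

lemma domresI:
  assumes so: "sound Z" and co: "covers Z" and ij: "i < n" "j < n"
    and b: "b \<le> nb" "b < nb \<longrightarrow> Z (i * nb + b) j \<noteq> 0" "\<forall>b'<b. b' < nb \<longrightarrow> Z (i * nb + b') j = 0"
    and x: "x = R \<or> (\<exists>k<n. valid i k j \<and> x = Q i k)" "b < nb \<longrightarrow> (\<forall>k<n. rb i k = b \<longrightarrow> valid i k j \<longrightarrow> x \<le> Q i k)"
  shows "domres i j x"
proof -
  have "x \<le> Q i k" if k: "k < n" "valid i k j" for k
  proof -
    have rk: "rb i k < nb" using rbcb(1)[OF ij(1) k(1)] .
    have "Z (i * nb + rb i k) j \<noteq> 0" using co ij k unfolding covers_def by blast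
    then have "\<not> rb i k < b" using b(3) rk by auto
    then have bb: "b \<le> rb i k" "b < nb" using rk by auto
    have "Z (i * nb + b) j \<noteq> 0" using b(2) bb(2) by blast
    moreover have "i * nb + b < n * nb" using gidx[OF ij(1) bb(2)] by blast
    ultimately have "\<exists>k'<n. rb ((i * nb + b) div nb) k' = (i * nb + b) mod nb \<and> valid ((i * nb + b) div nb) k' j"
      using so ij(2) unfolding sound_def by blast
    then obtain k' where k': "k' < n" "rb i k' = b" "valid i k' j" using bb(2) by auto
    have "x \<le> Q i k'" using x(2) bb(2) k' by blast
    show ?thesis
    proof (cases "rb i k = b")
      case True
      then show ?thesis using x(2) bb(2) k by blast
    next
      case False
      then have "RP i k' div q < RP i k div q" using bb(1) k'(2) by (simp add: rb_def)
      then have "RP i k' \<le> RP i k" by (metis div_le_mono leI less_imp_le not_le)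
      then have "Q i k' \<le> Q i k" using sortedD(1)[OF ij(1) k'(1) k(1)] by blast
      then show ?thesis using \<open>x \<le> Q i k'\<close> by linarith
    qed
  qed
  then show ?thesis using x(1) unfolding domres_def by blast
qed

lemma search_correct:
  assumes c: "ctx s"
  shows "tri search s (n * (n * (nb + q + 1) + 1)) (\<lambda>s'. sound (ar s aZ) \<longrightarrow> covers (ar s aZ) \<longrightarrow> (\<forall>i<n. \<forall>j<n. domres i j (ar s' aRes i j)))"
proof -
  define G where "G \<longleftrightarrow> sound (ar s aZ) \<and> covers (ar s aZ)"
  have "tri search s (n * (n * (nb + q + 1) + 1)) (\<lambda>s'. G \<longrightarrow> (\<forall>i<n. \<forall>j<n. domres i j (ar s' aRes i j)))"
    unfolding search_def
  proof (rule tri_For[where m = n and b = "n * (nb + q + 1)" and I = "\<lambda>i s'. G \<longrightarrow> (\<forall>i'<i. \<forall>j<n. domres i' j (ar s' aRes i' j))"], goal_cases)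
    case (7 i s1)
    have c1: "ctx s1" by (rule ctx_frame[OF c 7(5)]) (auto simp: search1_def search2_def)
    have f1: "ar s1 aZ = ar s aZ" using 7(5) by (auto simp: frame_def search1_def search2_def)
    note i = 7(1,2)
    show ?case
    proof (rule tri_For[where m = n and b = "nb + q" and I = "\<lambda>j s'. G \<longrightarrow> (\<forall>i'<i. \<forall>j<n. domres i' j (ar s' aRes i' j)) \<and> (\<forall>j'<j. domres i j' (ar s' aRes i j'))"], goal_cases)
      case (7 j s2)
      have c2: "ctx s2" by (rule ctx_frame[OF c1 7(5)]) (auto simp: search1_def search2_def)
      have f2: "ar s2 aZ = ar s aZ" "vr s2 30 = i" using 7(5) f1 i by (auto simp: frame_def search1_def search2_def)
      have ijR: "i < R" "j < R" using i(1) 7(1) nle by linarith+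
      define s3 where "s3 = s2\<lparr>vr := (vr s2)(33 := nb, 38 := R)\<rparr>"
      have c3: "ctx s3" using c2 by (simp add: ctx_def s3_def)
      have v3: "vr s3 30 = i" "vr s3 31 = j" "vr s3 33 = nb" "vr s3 38 = R" "ar s3 aZ = ar s aZ" "ar s3 aRes = ar s2 aRes"
        using f2 7(2) by (auto simp: s3_def)
      let ?Q = "\<lambda>s'. G \<longrightarrow> (\<forall>i'<i. \<forall>j<n. domres i' j (ar s' aRes i' j)) \<and> (\<forall>j'<Suc j. domres i j' (ar s' aRes i j'))"
      have "tri (search1 ;; If (V 33) (V vnb) search2 Skip ;; Wr aRes (V 30) (V 31) (V 38)) s3 (nb + q) ?Q"
      proof (rule tri_Seq[OF search1_correct[OF c3 v3(1) i(1) v3(2) 7(1) v3(3)], where Tb = q], goal_cases)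
        case (1 s4)
        have c4: "ctx s4" by (rule ctx_frame[OF c3 1(2)]) (auto simp: search1_def)
        have v4: "vr s4 30 = i" "vr s4 31 = j" "vr s4 38 = R" "ar s4 aRes = ar s2 aRes"
          using v3 1(2) by (auto simp: frame_def search1_def)
        let ?b = "vr s4 33"
        have b4: "?b \<le> nb" "?b < nb \<longrightarrow> ar s aZ (i * nb + ?b) j \<noteq> 0" "\<forall>b'<?b. b' < nb \<longrightarrow> ar s aZ (i * nb + b') j = 0"
          using 1(1) v3(5) by auto
        have s2: "tri (If (V 33) (V vnb) search2 Skip) s4 q (\<lambda>s'. (vr s' 38 = R \<or> (\<exists>k<n. valid i k j \<and> vr s' 38 = Q i k)) \<and>
            (?b < nb \<longrightarrow> (\<forall>k<n. rb i k = ?b \<longrightarrow> valid i k j \<longrightarrow> vr s' 38 \<le> Q i k)))"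
        proof (cases "?b < nb")
          case True
          show ?thesis using search2_correct[OF c4 v4(1) i(1) v4(2) 7(1) refl True v4(3)] True c4 by (simp add: ctx_D)
        qed (use c4 v4 in \<open>simp add: ctx_D\<close>)
        show ?case
        proof (rule tri_Seq[OF s2, where Tb = 0], goal_cases)
          case (1 s5)
          have v5: "vr s5 30 = i" "vr s5 31 = j" "ar s5 aRes = ar s2 aRes"
            using v4 1(2) by (auto simp: frame_def search2_def)
          have "domres i j (vr s5 38)" if G
            using domresI[where Z = "ar s aZ", OF _ _ i(1) 7(1) b4] 1(1) that unfolding G_def by blast
          then show ?case using v5 ijR 7(4) by (auto simp: less_Suc_eq)
        qed simp
      qed simp
      then show ?case using c2 f2 7(2) by (simp add: ctx_D s3_def)
    qed (use 7 c1 nle in \<open>auto simp: ctx_D less_Suc_eq search1_def search2_def\<close>)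
  qed (use c nle in \<open>auto simp: ctx_D search1_def search2_def\<close>)
  then show ?thesis by (rule tri_weaken) (auto simp: G_def)
qed

abbreviation "tattempt \<equiv> attempt_ticks n q"

lemma attempt_correct:
  assumes c: "ctx s" and cn: "vr s vCnt + nb \<le> R" and z: "\<forall>i\<ge>vr s vCnt. \<forall>z. ar s aMM i z = 0"
  shows "tri attempt s tattempt (\<lambda>s'. vr s' vCnt = vr s vCnt + nb \<and> (\<forall>i\<ge>vr s' vCnt. \<forall>z. ar s' aMM i z = 0) \<and>
    vr s' vok \<le> 1 \<and> (Lq \<le> n * q * q \<longrightarrow> vr s' vok = 1) \<and> (vr s' vok \<noteq> 0 \<longrightarrow> (\<forall>i<n. \<forall>j<n. domres i j (ar s' aRes i j))))"
  unfolding attempt_def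
proof (rule tri_Seq[OF clear_marks_correct[OF c], where Tb = "n * (n * (nb + q + 1) + 1) + nb * Suc tgroup + n * (n * (nb + q + 1) + 1)"], goal_cases)
  case (1 s1)
  have c1: "ctx s1" by (rule ctx_frame[OF c 1(2)]) (auto simp: clear_marks_def)
  have f1: "vr s1 vCnt = vr s vCnt" "ar s1 aMM = ar s aMM" using 1(2) by (auto simp: frame_def clear_marks_def)
  show ?case
  proof (rule tri_Seq[OF inner_marks_correct[OF c1 1(1)], where Tb = "nb * Suc tgroup + n * (n * (nb + q + 1) + 1)"], goal_cases)
    case (1 s2)
    have c2: "ctx s2" by (rule ctx_frame[OF c1 1(2)]) (auto simp: inner_marks_def inner_marks1_def inner_marks2_def)
    have f2: "vr s2 vCnt = vr s vCnt" "ar s2 aMM = ar s aMM" using 1(2) f1 by (auto simp: frame_def inner_marks_def inner_marks1_def inner_marks2_def)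
    define s3 where "s3 = s2\<lparr>vr := (vr s2)(vok := 1)\<rparr>"
    have c3: "ctx s3" using c2 by (simp add: ctx_def s3_def)
    have f3: "vr s3 vCnt = vr s vCnt" "ar s3 aMM = ar s aMM" "vr s3 vok = 1" "ar s3 aZ = ar s2 aZ" using f2 by (auto simp: s3_def)
    have so: "sound (ar s3 aZ)" and mk: "\<forall>k<n. \<forall>j<n. marked (ar s3 aZ) k j" using 1(1) f3 by auto
    have z3: "\<forall>i\<ge>vr s3 vCnt. \<forall>z. ar s3 aMM i z = 0" and cn3: "vr s3 vCnt + nb \<le> R" using z cn f3 by auto
    have "tri (groups ;; search) s3 (nb * Suc tgroup + n * (n * (nb + q + 1) + 1)) (\<lambda>s'. vr s' vCnt = vr s vCnt + nb \<and> (\<forall>i\<ge>vr s' vCnt. \<forall>z. ar s' aMM i z = 0) \<and>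
      vr s' vok \<le> 1 \<and> (Lq \<le> n * q * q \<longrightarrow> vr s' vok = 1) \<and> (vr s' vok \<noteq> 0 \<longrightarrow> (\<forall>i<n. \<forall>j<n. domres i j (ar s' aRes i j))))"
    proof (rule tri_Seq[OF groups_correct[OF c3 cn3 z3 f3(3) so], where Tb = "n * (n * (nb + q + 1) + 1)"], goal_cases)
      case (1 s4)
      have c4: "ctx s4" by (rule ctx_frame[OF c3 1(2)]) (auto simp: groups_def group_defs)
      have co: "covers (ar s4 aZ)" "sound (ar s4 aZ)" if o: "vr s4 vok \<noteq> 0"
      proof -
        have "\<forall>k<n. \<forall>j<n. marked (ar s4 aZ) k j" using mk 1(1) marked_grows by blast
        then show "covers (ar s4 aZ)" "sound (ar s4 aZ)" using 1(1) o coversI by blast+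
      qed
      show ?case
      proof (rule tri_weaken[OF search_correct[OF c4]], simp, goal_cases)
        case (1 s5)
        have "vr s5 vCnt = vr s4 vCnt" "vr s5 vok = vr s4 vok" "ar s5 aMM = ar s4 aMM" using 1(2) by (auto simp: frame_def search_def search1_def search2_def)
        then show ?case using 1(1) co \<open>vr s4 vCnt = vr s3 vCnt + nb \<and> _\<close> f3 by auto
      qed
    qed simp
    then show ?case using RW by (simp add: s3_def)
  qed simp
qed (simp add: attempt_ticks_def nb_def Let_def)

end

section \<open>One step of repeated squaring\<close>

abbreviation (input) "vU \<equiv> 10 :: nat"
abbreviation (input) "vSl \<equiv> 12 :: nat"
abbreviation (input) "vLam \<equiv> 17 :: nat"
abbreviation (input) "aD \<equiv> 3 :: nat"
abbreviation (input) "aN \<equiv> 4 :: nat"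
abbreviation (input) "aTab \<equiv> 24 :: nat"
abbreviation (input) "aLt \<equiv> 25 :: nat"

section \<open>Doubling the block length until all products halt\<close>

definition dom_params :: com where
  "dom_params = Assign vnb (V vn \<oslash> V vq \<oplus> N 1) ;; Assign vg (V vn \<otimes> V vq) ;; Assign vgz (V vn \<otimes> V vnb) ;; Assign vBud (V vn \<otimes> V vq \<otimes> V vq)"

text \<open>The block length is not reset, so a later call starts from the length with which the
  previous one succeeded.\<close>

definition dominance :: com where
  "dominance = Assign vok (N 0) ;; While (V vok) (N 1) (dom_params ;; attempt ;; If (V vok) (N 1) (Assign vq (V vq \<oplus> V vq)) Skip)"

definition is_dom :: "nat \<Rightarrow> nat \<Rightarrow> nat \<Rightarrow> (nat \<Rightarrow> nat \<Rightarrow> nat) \<Rightarrow> nat \<Rightarrow> nat \<Rightarrow> nat \<Rightarrow> bool" where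
  "is_dom R n l Q i j x \<longleftrightarrow> (x = R \<or> (\<exists>k<n. Q k j + l \<le> Q i k \<and> x = Q i k)) \<and> (\<forall>k<n. Q k j + l \<le> Q i k \<longrightarrow> x \<le> Q i k)"

lemmas attempt_defs = attempt_def clear_marks_def inner_marks_def inner_marks1_def inner_marks2_def groups_def group_defs
  search_def search1_def search2_def

text \<open>Doubling \<open>q\<close> multiplies the budget \<open>n * q * q\<close> by
  \<open>4\<close>, hence \<open>Lq \<le> 4 ^ F\<close> bounds the number of doublings. Doubling
  happens only while the budget is below \<open>Lq\<close>, so \<open>AT\<close> has to bound
  attempts only for \<open>n * q * q \<le> 4 * Lq\<close>.\<close>

locale apsp = ram w P W R ws for w P W R ws +
  fixes n Lq F AT :: nat
  assumes n1: "1 \<le> n" and nR: "100 * (n * n) + 100 < R" and LqR: "16 * Lq < R" and nLq: "n * n \<le> Lq" and LqF: "Lq \<le> 4 ^ F"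
    and AT: "\<And>q. 1 \<le> q \<Longrightarrow> n \<le> q * q \<Longrightarrow> n * q * q \<le> 4 * Lq \<Longrightarrow> attempt_ticks n q \<le> AT"
    and mm: "\<And>A B \<sigma>. (\<forall>i<3 * n. \<forall>j<3 * n. A i j \<le> 1 \<and> B i j \<le> 1) \<Longrightarrow> matmul_input ws (3 * n) A B \<sigma> \<Longrightarrow>
      \<exists>t\<le>Lq. halted P ((step ws P ^^ t) \<sigma>) \<and> matmul_output (3 * n) (\<lambda>i j. \<Sum>k<3 * n. A i k * B k j) ((step ws P ^^ t) \<sigma>)"
begin

lemma RW: "R < W" "3 < R" "3 * R < W" "1 < W" "0 < W" using R_less_W R_ge by linarith+

lemma nle: "n \<le> n * n" "n < R" "n < W" "n * n < R" "n * n < W"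
  using le_square[of n] nR RW by linarith+

text \<open>Besides constants it records that the block length stays in the range for which
  \<open>AT\<close> is valid, and that all memory rows from \<open>vCnt\<close> on are still
  zero.\<close>

definition env :: "store \<Rightarrow> bool" where
  "env s \<longleftrightarrow> vr s vn = n \<and> vr s vNN = n * n \<and> vr s vInf = R \<and> vr s vDim = 3 * n \<and> vr s vWs = ws \<and>
     1 \<le> vr s vq \<and> n \<le> vr s vq * vr s vq \<and> n * vr s vq * vr s vq \<le> 4 * Lq \<and> (\<forall>i\<ge>vr s vCnt. \<forall>z. ar s aMM i z = 0)"

lemma env_D: "env s \<Longrightarrow> vr s (Suc 0) = n" "env s \<Longrightarrow> vr s vNN = n * n" "env s \<Longrightarrow> vr s vInf = R"
  unfolding env_def by auto

lemma env_frame: "env s \<Longrightarrow> frame X A s s' \<Longrightarrow> X \<inter> {1, 3, 4, 5, 6, 9, 14} = {} \<Longrightarrow> A \<inter> {2} = {} \<Longrightarrow> env s'"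
  unfolding env_def frame_def by auto

lemma env_vr: "env s \<Longrightarrow> x \<notin> {1, 3, 4, 5, 6, 9, 14} \<Longrightarrow> env (s\<lparr>vr := (vr s)(x := v)\<rparr>)"
  unfolding env_def by auto

text \<open>Memory rows consumed by one dominance product: at most \<open>Suc F\<close> attempts
  with at most \<open>n + 1\<close> groups each.\<close>

definition cstep :: nat where "cstep = Suc F * (n + 1)"

lemma dominance_correct:
  assumes e: "env s" and rk: "ranked n (ar s aQ) (ar s aP 0) (ar s aRS) (ar s aCS) (ar s aRP) (ar s aCP)"
    and QR: "\<And>i k. i < n \<Longrightarrow> k < n \<Longrightarrow> ar s aQ i k \<le> R" and lR: "vr s vl \<le> R" and cn: "vr s vCnt + cstep \<le> R"
  shows "tri dominance s (Suc F * Suc AT) (\<lambda>s'. env s' \<and> vr s' vCnt \<le> vr s vCnt + cstep \<and>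
    (\<forall>i<n. \<forall>j<n. is_dom R n (vr s vl) (ar s aQ) i j (ar s' aRes i j)))"
proof -
  let ?s0 = "s\<lparr>vr := (vr s)(vok := 0)\<rparr>"
  let ?c = "dom_params ;; attempt ;; If (V vok) (N 1) (Assign vq (V vq \<oplus> V vq)) Skip"
  \<comment> \<open>After \<open>f\<close> further doublings the budget certainly reaches
    \<open>Lq\<close>; the same \<open>f\<close> pays for the memory rows still to be
    consumed.\<close>
  define J where "J f s' \<longleftrightarrow> env s' \<and> vr s' vok = 0 \<and> Lq \<le> n * vr s' vq * vr s' vq * 4 ^ f \<and> f \<le> F \<and>
     vr s' vCnt + f * (n + 1) \<le> vr s vCnt + F * (n + 1)" for f and s' :: store
  define D where "D s' \<longleftrightarrow> env s' \<and> vr s' vok = 1 \<and> vr s' vCnt \<le> vr s vCnt + cstep \<and>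
    (\<forall>i<n. \<forall>j<n. is_dom R n (vr s vl) (ar s aQ) i j (ar s' aRes i j))" for s' :: store
  have q0: "1 \<le> vr s vq" "1 \<le> n * vr s vq * vr s vq" using e n1 by (auto simp: env_def)
  have "Lq \<le> 1 * 4 ^ F" using LqF by simp
  also have "\<dots> \<le> n * vr s vq * vr s vq * 4 ^ F" using q0(2) by (rule mult_right_mono) simp
  finally have J0: "J F ?s0" using e unfolding J_def env_def by auto
  have "tri (While (V vok) (N 1) ?c) ?s0 (Suc F * Suc AT) D"
  proof (rule tri_While[where I = J and b = AT, OF J0], goal_cases)
    case (1 f s1)
    then show ?case using RW by simp
  next
    case (2 f s1)
    define q where "q = vr s1 vq"
    have J1: "env s1" "vr s1 vok = 0" "Lq \<le> n * q * q * 4 ^ f" "f \<le> F" "vr s1 vCnt + f * (n + 1) \<le> vr s vCnt + F * (n + 1)"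
      using 2(1) by (auto simp: J_def q_def)
    have q: "1 \<le> q" "n \<le> q * q" "n * q * q \<le> 4 * Lq" using J1(1) by (auto simp: env_def q_def)
    have fr: "ar s1 aQ = ar s aQ" "ar s1 aP = ar s aP" "ar s1 aRS = ar s aRS" "ar s1 aCS = ar s aCS" "ar s1 aRP = ar s aRP" "ar s1 aCP = ar s aCP" "vr s1 vl = vr s vl"
      using 2(2) by (auto simp: frame_def dom_params_def attempt_defs)
    define nb where "nb = n div q + 1"
    have qR: "4 * (n * q * q) < R" using q(3) LqR by linarith
    interpret dom w P W R ws n q "vr s vl" nb Lq "ar s aQ" "ar s aP 0" "ar s aRS" "ar s aCS" "ar s aRP" "ar s aCP"
      by unfold_locales (use rk n1 q nb_def nR qR QR lR mm in auto)
    define s2 where "s2 = s1\<lparr>vr := (vr s1)(vnb := nb, vg := n * q, vgz := n * nb, vBud := n * q * q)\<rparr>"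
    have c2: "ctx s2" unfolding ctx_def using J1(1) fr by (simp add: s2_def env_def q_def)
    have e2: "env s2" using J1(1) by (auto simp: env_def s2_def)
    have stp: "tri dom_params s1 0 (\<lambda>s'. s' = s2)"
      using J1(1) RW qle nble unfolding dom_params_def by (simp add: env_D s2_def q_def nb_def fun_upd_twist)
    have nbn: "nb \<le> n + 1" by (simp add: nb_def)
    have "f * (n + 1) \<le> F * (n + 1)" using J1(4) by (rule mult_right_mono) simp
    then have cn2: "vr s2 vCnt + nb \<le> R" using J1(5) cn nbn by (simp add: s2_def cstep_def)
    have z2: "\<forall>i\<ge>vr s2 vCnt. \<forall>z. ar s2 aMM i z = 0" using e2 by (simp add: env_def)
    show ?case
    proof (rule tri_Seq[OF stp, where Tb = AT], goal_cases)
      case (1 s2')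
      have [simp]: "s2' = s2" using 1 by simp
      show ?case
      proof (rule tri_Seq[where Ta = AT and Tb = 0])
        show "tri attempt s2' AT (\<lambda>s'. vr s' vCnt = vr s2 vCnt + nb \<and> (\<forall>i\<ge>vr s' vCnt. \<forall>z. ar s' aMM i z = 0) \<and>
            vr s' vok \<le> 1 \<and> (Lq \<le> n * q * q \<longrightarrow> vr s' vok = 1) \<and> (vr s' vok \<noteq> 0 \<longrightarrow> (\<forall>i<n. \<forall>j<n. domres i j (ar s' aRes i j))))"
          unfolding \<open>s2' = s2\<close> by (rule tri_mono[OF attempt_correct[OF c2 cn2 z2] AT[OF q]])
      next
        fix s3 assume h: "vr s3 vCnt = vr s2 vCnt + nb \<and> (\<forall>i\<ge>vr s3 vCnt. \<forall>z. ar s3 aMM i z = 0) \<and>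
            vr s3 vok \<le> 1 \<and> (Lq \<le> n * q * q \<longrightarrow> vr s3 vok = 1) \<and> (vr s3 vok \<noteq> 0 \<longrightarrow> (\<forall>i<n. \<forall>j<n. domres i j (ar s3 aRes i j)))"
          and fr3: "frame (wv attempt) (wa attempt) s2' s3"
        have f3: "vr s3 vn = n" "vr s3 vNN = n * n" "vr s3 vInf = R" "vr s3 vDim = 3 * n" "vr s3 vWs = ws" "vr s3 vq = q"
          using fr3 e2 by (auto simp: frame_def attempt_defs env_def s2_def q_def)
        have e3: "env s3" using f3 h q unfolding env_def by auto
        have cn3: "vr s3 vCnt + f * (n + 1) \<le> vr s vCnt + cstep" using h J1(5) nbn by (simp add: s2_def cstep_def)
        show "tri (If (V vok) (N 1) (Assign vq (V vq \<oplus> V vq)) Skip) s3 0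
          (\<lambda>s2. (\<exists>f'<f. J f' s2) \<or> (D s2 \<and> ok (V vok) s2 \<and> ok (N 1) s2 \<and> \<not> ev (V vok) s2 < ev (N 1) s2))"
        proof (cases "vr s3 vok = 0")
          case True
          \<comment> \<open>A failed attempt proves that the budget was too small, and this bounds
            the doubled block length.\<close>
          have lq: "n * q * q < Lq" using h True by (metis not_le zero_neq_one)
          have "f \<noteq> 0" using J1(3) lq by (cases f) auto
          then obtain f' where f': "f = Suc f'" using not0_implies_Suc by blast
          let ?s4 = "s3\<lparr>vr := (vr s3)(vq := q + q)\<rparr>"
          have n4: "n * (q + q) * (q + q) = 4 * (n * q * q)" by (simp add: algebra_simps)
          have "q * q \<le> (q + q) * (q + q)" by (intro mult_le_mono) auto
          then have nq: "n \<le> (q + q) * (q + q)" using q(2) by linarith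
          have nq4: "n * (q + q) * (q + q) \<le> 4 * Lq" unfolding n4 using lq by linarith
          have "env ?s4" using e3 nq4 q(1) nq unfolding env_def by simp
          moreover have "Lq \<le> n * (q + q) * (q + q) * 4 ^ f'" using J1(3) unfolding n4 f' by simp
          moreover have "vr s3 vCnt + f' * (n + 1) \<le> vr s vCnt + F * (n + 1)" using h J1(5) nbn f' by (simp add: s2_def)
          ultimately have "J f' ?s4" using True f' J1(4) by (simp add: J_def)
          then have "\<exists>f'<f. J f' ?s4" using f' by blast
          moreover have "q + q < W" using qle RW by linarith
          ultimately show ?thesis using True f3 RW by simp
        next
          case False
          have "\<forall>i<n. \<forall>j<n. is_dom R n (vr s vl) (ar s aQ) i j (ar s3 aRes i j)"
            using h False unfolding domres_def valid_def is_dom_def by blast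
          then have "D s3" unfolding D_def using e3 h False cn3 by auto
          then show ?thesis using False h RW by simp
        qed
      qed simp
    qed simp
  next
    case (3 f s1)
    then show ?case by (simp add: J_def)
  qed simp
  then show ?thesis unfolding dominance_def
    by (simp add: tri_Assign_Seq RW del: tri_Seq_sl) (rule tri_weaken, assumption, auto simp: D_def)
qed

end

section \<open>Minimum over all ratios and both orders of the summands\<close>

definition copyq :: "bool \<Rightarrow> com" where
  "copyq tr = For 30 vn (For 31 vn (Wr aQ (V 30) (V 31) (if tr then Rd aD (V 31) (V 30) else Rd aD (V 30) (V 31))))"

definition combine :: "bool \<Rightarrow> com" where
  "combine tr = For 30 vn (For 31 vn (
     If (Rd aRes (if tr then V 31 else V 30) (if tr then V 30 else V 31) \<oplus> V vLam) (Rd aN (V 30) (V 31))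
       (Wr aN (V 30) (V 31) (Rd aRes (if tr then V 31 else V 30) (if tr then V 30 else V 31) \<oplus> V vLam)) Skip))"

definition copya :: "nat \<Rightarrow> nat \<Rightarrow> com" where
  "copya a b = For 30 vn (For 31 vn (Wr a (V 30) (V 31) (Rd b (V 30) (V 31))))"

text \<open>The matrix is sorted once, because only the threshold and the increment vary with the
  ratio \<open>t\<close>. Transposing it if \<open>tr\<close> holds exchanges the roles of
  \<open>D i k\<close> and \<open>D k j\<close>.\<close>

definition half :: "bool \<Rightarrow> com" where
  "half tr = copyq tr ;; sort_entries ;; distribute ;; For 50 vU (
     Assign vl (Rd aLt (N 0) (V 50 \<oplus> N 1)) ;; Assign vLam (Rd aTab (N 0) (V 50 \<oplus> N 1) \<oplus> V vSl) ;; dominance ;; combine tr)"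

definition square :: com where
  "square = copya aN aD ;; half False ;; half True ;; copya aD aN"

lemma wv_copyq [simp]: "wv (copyq tr) = {30, 31}" "wa (copyq tr) = {aQ}" and wv_combine [simp]: "wv (combine tr) = {30, 31}" "wa (combine tr) = {aN}"
  and wv_copya [simp]: "wv (copya a b) = {30, 31}" "wa (copya a b) = {a}"
  by (auto simp: copyq_def combine_def copya_def)

lemma wv_sort [simp]: "wv sort_entries = {23, 24, 30, 31, 32, 33, 34, 35}" "wa sort_entries = {aK, aP, aT}"
  and wv_dist [simp]: "wv distribute = {30, 31, 32, 33, 34, 35}" "wa distribute = {aRN, aCN, aRS, aRP, aCS, aCP}"
  by (auto simp: sort_entries_def pass_def distribute_def)

lemma wv_dominance [simp]: "wv dominance = {6, 7, 8, 14, 15, 18, 19, 20, 21, 22, 30, 31, 32, 33, 34, 35, 36, 37, 38, 39, 40, 41}"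
  "wa dominance = {2, 15, 16, 17, 18, 19, 20, 21, 22, 23}"
  unfolding dominance_def dom_params_def attempt_defs by (simp, blast)+

text \<open>\<open>tr\<close> tells which summand of \<open>D i k + D k j\<close> is assumed to be the larger one.\<close>

definition small :: "bool \<Rightarrow> (nat \<Rightarrow> nat \<Rightarrow> nat) \<Rightarrow> nat \<Rightarrow> nat \<Rightarrow> nat \<Rightarrow> nat" where
  "small tr D i j k = (if tr then D i k else D k j)"
definition large :: "bool \<Rightarrow> (nat \<Rightarrow> nat \<Rightarrow> nat) \<Rightarrow> nat \<Rightarrow> nat \<Rightarrow> nat \<Rightarrow> nat" where
  "large tr D i j k = (if tr then D k j else D i k)"

text \<open>The second clause yields completeness of the squaring, the third its soundness: a key is
  either old or an actual candidate.\<close>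

definition upto :: "nat \<Rightarrow> bool \<Rightarrow> (nat \<Rightarrow> nat \<Rightarrow> nat) \<Rightarrow> (nat \<Rightarrow> nat) \<Rightarrow> (nat \<Rightarrow> nat) \<Rightarrow> nat \<Rightarrow> (nat \<Rightarrow> nat \<Rightarrow> nat) \<Rightarrow> (nat \<Rightarrow> nat \<Rightarrow> nat) \<Rightarrow> bool" where
  "upto n tr D lt La T X Y \<longleftrightarrow> (\<forall>i<n. \<forall>j<n. Y i j \<le> X i j \<and>
     (\<forall>t<T. \<forall>k<n. small tr D i j k + lt (Suc t) \<le> large tr D i j k \<longrightarrow> Y i j \<le> large tr D i j k + La (Suc t)) \<and>
     (Y i j = X i j \<or> (\<exists>t<T. \<exists>k<n. small tr D i j k + lt (Suc t) \<le> large tr D i j k \<and> Y i j = large tr D i j k + La (Suc t))))"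

lemma upto_Suc:
  assumes u: "upto n tr D lt La T X Y" and XR: "\<And>i j. i < n \<Longrightarrow> j < n \<Longrightarrow> X i j \<le> R"
    and d: "\<And>i j. i < n \<Longrightarrow> j < n \<Longrightarrow> is_dom R n (lt (Suc T)) Q i j (rs i j)"
    and Q: "\<And>i j. i < n \<Longrightarrow> j < n \<Longrightarrow> Q i j = (if tr then D j i else D i j)"
    and Y': "\<And>i j. i < n \<Longrightarrow> j < n \<Longrightarrow> Y' i j = min (Y i j) (rs (if tr then j else i) (if tr then i else j) + La (Suc T))"
  shows "upto n tr D lt La (Suc T) X Y'"
  unfolding upto_def
proof (intro allI impI conjI)
  fix i j assume ij: "i < n" "j < n"
  define x where "x = rs (if tr then j else i) (if tr then i else j)"
  have x: "x = R \<or> (\<exists>k<n. small tr D i j k + lt (Suc T) \<le> large tr D i j k \<and> x = large tr D i j k)"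
    "\<And>k. k < n \<Longrightarrow> small tr D i j k + lt (Suc T) \<le> large tr D i j k \<Longrightarrow> x \<le> large tr D i j k"
  proof -
    let ?i = "if tr then j else i" and ?j = "if tr then i else j"
    have q: "Q ?i k = large tr D i j k" "Q k ?j = small tr D i j k" if "k < n" for k
      using Q that ij by (auto simp: large_def small_def)
    have "is_dom R n (lt (Suc T)) Q ?i ?j x" using d[of ?i ?j] ij by (auto simp: x_def)
    then have a: "x = R \<or> (\<exists>k<n. Q k ?j + lt (Suc T) \<le> Q ?i k \<and> x = Q ?i k)" and b: "\<And>k. k < n \<Longrightarrow> Q k ?j + lt (Suc T) \<le> Q ?i k \<Longrightarrow> x \<le> Q ?i k"
      unfolding is_dom_def by blast+
    show "x = R \<or> (\<exists>k<n. small tr D i j k + lt (Suc T) \<le> large tr D i j k \<and> x = large tr D i j k)" using a q by metis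
    show "x \<le> large tr D i j k" if "k < n" "small tr D i j k + lt (Suc T) \<le> large tr D i j k" for k using b[OF that(1)] q[OF that(1)] that(2) by simp
  qed
  have y: "Y' i j = min (Y i j) (x + La (Suc T))" using Y'[OF ij] by (simp add: x_def)
  have u': "Y i j \<le> X i j" "\<And>t k. t < T \<Longrightarrow> k < n \<Longrightarrow> small tr D i j k + lt (Suc t) \<le> large tr D i j k \<Longrightarrow> Y i j \<le> large tr D i j k + La (Suc t)"
    "Y i j = X i j \<or> (\<exists>t<T. \<exists>k<n. small tr D i j k + lt (Suc t) \<le> large tr D i j k \<and> Y i j = large tr D i j k + La (Suc t))"
    using u ij unfolding upto_def by auto
  show "Y' i j \<le> X i j" using y u'(1) by simp
  show "Y' i j \<le> large tr D i j k + La (Suc t)" if h: "t < Suc T" "k < n" "small tr D i j k + lt (Suc t) \<le> large tr D i j k" for t k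
  proof (cases "t = T")
    case True
    then show ?thesis using x(2)[OF h(2)] h(3) y by auto
  next
    case False
    then have "Y i j \<le> large tr D i j k + La (Suc t)" using u'(2) h by auto
    then show ?thesis using y by simp
  qed
  show "Y' i j = X i j \<or> (\<exists>t<Suc T. \<exists>k<n. small tr D i j k + lt (Suc t) \<le> large tr D i j k \<and> Y' i j = large tr D i j k + La (Suc t))"
  proof (cases "Y i j \<le> x + La (Suc T)")
    case True
    then have "Y' i j = Y i j" using y by simp
    then show ?thesis using u'(3) less_SucI by metis
  next
    case False
    \<comment> \<open>A strict decrease excludes the default \<open>x = R\<close>, because the old
      key is at most \<open>R\<close>.\<close>
    then have "Y' i j = x + La (Suc T)" "x \<noteq> R" using y u'(1) XR[OF ij] by auto
    then show ?thesis using x(1) lessI by metis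
  qed
qed

context apsp
begin

lemma copy_loop:
  assumes e: "vr s vn = n" and a: "a < 1000" "a \<noteq> b" "b < 1000"
  shows "tri (copya a b) s (n * (n + 1)) (\<lambda>s'. \<forall>i<n. \<forall>j<n. ar s' a i j = ar s b i j)"
  unfolding copya_def
proof (rule tri_For[where m = n and b = n and I = "\<lambda>i s'. \<forall>i'<i. \<forall>j<n. ar s' a i' j = ar s b i' j"], goal_cases)
  case (7 i s1)
  have f1: "vr s1 vn = n" "ar s1 b = ar s b" using 7(5) e a by (auto simp: frame_def)
  note i = 7(1,2)
  show ?case
  proof (rule tri_For[where m = n and b = 0 and I = "\<lambda>j s'. (\<forall>i'<i. \<forall>j<n. ar s' a i' j = ar s b i' j) \<and> (\<forall>j'<j. ar s' a i j' = ar s b i j')"], goal_cases)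
    case (7 j s2)
    have "vr s2 30 = i" "ar s2 b = ar s b" using 7(5) i f1 a by (auto simp: frame_def)
    moreover have "i < R" "j < R" using i 7(1) nle by linarith+
    ultimately show ?case using 7 a by (auto simp: less_Suc_eq)
  qed (use 7 f1 nle in \<open>auto simp: less_Suc_eq\<close>)
qed (use e nle in auto)

lemma copyq_correct:
  assumes e: "vr s vn = n"
  shows "tri (copyq tr) s (n * (n + 1)) (\<lambda>s'. \<forall>i<n. \<forall>j<n. ar s' aQ i j = (if tr then ar s aD j i else ar s aD i j))"
  unfolding copyq_def
proof (rule tri_For[where m = n and b = n and I = "\<lambda>i s'. \<forall>i'<i. \<forall>j<n. ar s' aQ i' j = (if tr then ar s aD j i' else ar s aD i' j)"], goal_cases)
  case (7 i s1)
  have f1: "vr s1 vn = n" "ar s1 aD = ar s aD" using 7(5) e by (auto simp: frame_def)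
  note i = 7(1,2)
  show ?case
  proof (rule tri_For[where m = n and b = 0 and I = "\<lambda>j s'. (\<forall>i'<i. \<forall>j<n. ar s' aQ i' j = (if tr then ar s aD j i' else ar s aD i' j)) \<and>
      (\<forall>j'<j. ar s' aQ i j' = (if tr then ar s aD j' i else ar s aD i j'))"], goal_cases)
    case (7 j s2)
    have "vr s2 30 = i" "ar s2 aD = ar s aD" using 7(5) i f1 by (auto simp: frame_def)
    moreover have "i < R" "j < R" using i 7(1) nle by linarith+
    ultimately show ?case using 7 by (auto simp: less_Suc_eq)
  qed (use 7 f1 nle in \<open>auto simp: less_Suc_eq\<close>)
qed (use e nle in auto)

lemma combine_correct:
  assumes e: "vr s vn = n" and La: "vr s vLam = La" "La \<le> R" and Re: "\<And>i j. i < n \<Longrightarrow> j < n \<Longrightarrow> ar s aRes i j \<le> R"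
  shows "tri (combine tr) s (n * (n + 1)) (\<lambda>s'. \<forall>i<n. \<forall>j<n. ar s' aN i j = min (ar s aN i j) (ar s aRes (if tr then j else i) (if tr then i else j) + La))"
proof -
  define f where "f i j = min (ar s aN i j) (ar s aRes (if tr then j else i) (if tr then i else j) + La)" for i j
  define J where "J i j s' \<longleftrightarrow> (\<forall>i'<n. \<forall>j'<n. ar s' aN i' j' = (if i' < i \<or> i' = i \<and> j' < j then f i' j' else ar s aN i' j'))" for i j and s' :: store
  have Jn: "J i n s' \<longleftrightarrow> J (Suc i) 0 s'" for i s' unfolding J_def by (auto simp: less_Suc_eq)
  have Jv: "J i j (s'\<lparr>vr := g\<rparr>) \<longleftrightarrow> J i j s'" for i j s' g unfolding J_def by simp
  have "tri (combine tr) s (n * (n + 1)) (\<lambda>s'. J n 0 s')"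
    unfolding combine_def
  proof (rule tri_For[where m = n and b = n and I = "\<lambda>i s'. J i 0 s'"], goal_cases)
    case (7 i s1)
    have f1: "vr s1 vn = n" "ar s1 aRes = ar s aRes" "vr s1 vLam = La" using 7(5) e La by (auto simp: frame_def)
    note i = 7(1,2)
    show ?case
    proof (rule tri_For[where m = n and b = 0 and I = "\<lambda>j s'. J i j s'"], goal_cases)
      case (7 j s2)
      have v: "vr s2 30 = i" "ar s2 aRes = ar s aRes" "vr s2 vLam = La" using 7(5) i f1 by (auto simp: frame_def)
      have R: "i < R" "j < R" using i 7(1) nle by linarith+
      define x where "x = ar s aRes (if tr then j else i) (if tr then i else j) + La"
      have xW: "x < W" using Re[of "if tr then j else i" "if tr then i else j"] i 7(1) La(2) RW by (auto simp: x_def split: if_splits)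
      have Nij: "ar s2 aN i j = ar s aN i j" using 7(1,4) i unfolding J_def by auto
      have fx: "f i j = min (ar s aN i j) x" by (simp add: f_def x_def)
      let ?s3 = "if x < ar s aN i j then s2\<lparr>ar := upd3 (ar s2) aN i j x\<rparr> else s2"
      have "J i (Suc j) ?s3" using 7(4) fx unfolding J_def by (auto simp: less_Suc_eq min_def)
      then have "J i (Suc j) (?s3\<lparr>vr := (vr s2)(31 := Suc j)\<rparr>)" using Jv by blast
      then show ?case using v 7(2) R xW Nij by (cases tr) (auto simp: x_def split: if_splits)
    qed (use 7 f1 nle Jn Jv in auto)
  qed (use e nle in \<open>auto simp: J_def\<close>)
  then show ?thesis by (rule tri_weaken) (auto simp: J_def f_def)
qed

definition tdom :: nat where "tdom = Suc F * Suc AT"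

definition thalf :: "nat \<Rightarrow> nat \<Rightarrow> nat" where
  "thalf G U = n * (n + 1) + (n * n + Suc G * Suc (2 * (n * n))) + (n + n * n) + U * Suc (tdom + n * (n + 1))"

lemma half_correct:
  assumes e: "env s" and G: "n * n \<le> 2 ^ G" and U: "vr s vU = U" "U < R" "vr s vCnt + U * cstep \<le> R"
    and D: "\<And>i j. i < n \<Longrightarrow> j < n \<Longrightarrow> ar s aD i j \<le> R" and X: "\<And>i j. i < n \<Longrightarrow> j < n \<Longrightarrow> ar s aN i j \<le> R"
    and lt: "\<And>t. t \<le> U \<Longrightarrow> ar s aLt 0 t \<le> R" and La: "\<And>t. t \<le> U \<Longrightarrow> ar s aTab 0 t + vr s vSl \<le> R"
  shows "tri (half tr) s (thalf G U) (\<lambda>s'. env s' \<and> vr s' vCnt \<le> vr s vCnt + U * cstep \<and>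
     upto n tr (ar s aD) (ar s aLt 0) (\<lambda>t. ar s aTab 0 t + vr s vSl) U (ar s aN) (ar s' aN))"
proof -
  have n4: "4 * (n * n) < R" using nR by linarith
  have vn: "vr s vn = n" using e by (simp add: env_def)
  let ?loop = "For 50 vU (Assign vl (Rd aLt (N 0) (V 50 \<oplus> N 1)) ;; Assign vLam (Rd aTab (N 0) (V 50 \<oplus> N 1) \<oplus> V vSl) ;; dominance ;; combine tr)"
  show ?thesis unfolding half_def
  proof (rule tri_Seq[OF copyq_correct[OF vn, of tr], where Tb = "(n * n + Suc G * Suc (2 * (n * n))) + (n + n * n) + U * Suc (tdom + n * (n + 1))"], goal_cases)
    case (1 s1)
    have e1: "env s1" by (rule env_frame[OF e 1(2)]) auto
    have f1: "ar s1 aD = ar s aD" "ar s1 aN = ar s aN" "ar s1 aLt = ar s aLt" "ar s1 aTab = ar s aTab" "vr s1 vSl = vr s vSl" "vr s1 vU = U" "vr s1 vCnt = vr s vCnt"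
      using 1(2) U by (auto simp: frame_def)
    define Q where "Q = ar s1 aQ"
    have Q: "\<And>i j. i < n \<Longrightarrow> j < n \<Longrightarrow> Q i j = (if tr then ar s aD j i else ar s aD i j)" using 1(1) by (auto simp: Q_def)
    have QR: "\<And>i j. i < n \<Longrightarrow> j < n \<Longrightarrow> Q i j \<le> R" using Q D by auto
    have v1: "vr s1 vn = n" "vr s1 vNN = n * n" using e1 by (auto simp: env_def)
    show ?case
    proof (rule tri_Seq[OF sort_entries_correct[OF v1 n4 G], where Tb = "(n + n * n) + U * Suc (tdom + n * (n + 1))"], goal_cases)
      case (1 s2)
      have e2: "env s2" by (rule env_frame[OF e1 1(2)]) auto
      have f2: "ar s2 aD = ar s aD" "ar s2 aN = ar s aN" "ar s2 aLt = ar s aLt" "ar s2 aTab = ar s aTab" "vr s2 vSl = vr s vSl" "vr s2 vU = U" "vr s2 vCnt = vr s vCnt" "ar s2 aQ = Q"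
        using 1(2) f1 by (auto simp: frame_def Q_def)
      have v2: "vr s2 vn = n" "vr s2 vNN = n * n" using e2 by (auto simp: env_def)
      have P2: "ar s2 aP 0 ` {..<n * n} = {..<n * n}" using 1(1) by blast
      have so2: "\<forall>x y. x \<le> y \<longrightarrow> y < n * n \<longrightarrow> ar s2 aQ (ar s2 aP 0 x div n) (ar s2 aP 0 x mod n) \<le> ar s2 aQ (ar s2 aP 0 y div n) (ar s2 aP 0 y mod n)"
        using 1(1) unfolding f2(8) Q_def by blast
      show ?case
      proof (rule tri_Seq[OF distribute_correct[OF v2 n4 P2 so2], where Tb = "U * Suc (tdom + n * (n + 1))"], goal_cases)
        case (1 s3)
        have e3: "env s3" by (rule env_frame[OF e2 1(2)]) auto
        have f3: "ar s3 aD = ar s aD" "ar s3 aN = ar s aN" "ar s3 aLt = ar s aLt" "ar s3 aTab = ar s aTab" "vr s3 vSl = vr s vSl" "vr s3 vU = U" "vr s3 vCnt = vr s vCnt" "ar s3 aQ = Q"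
          using 1(2) f2 by (auto simp: frame_def)
        have rk: "ranked n Q (ar s3 aP 0) (ar s3 aRS) (ar s3 aCS) (ar s3 aRP) (ar s3 aCP)"
          using 1 f2(8) by (auto simp: frame_def)
        define J where "J t s' \<longleftrightarrow> env s' \<and> vr s' vCnt \<le> vr s vCnt + t * cstep \<and>
          upto n tr (ar s aD) (ar s aLt 0) (\<lambda>t. ar s aTab 0 t + vr s vSl) t (ar s aN) (ar s' aN)" for t and s' :: store
        show ?case
        proof (rule tri_For[where m = U and b = "tdom + n * (n + 1)" and I = J], goal_cases)
          case (7 t s4)
          have f4: "ar s4 aD = ar s aD" "ar s4 aLt = ar s aLt" "ar s4 aTab = ar s aTab" "vr s4 vSl = vr s vSl" "ar s4 aQ = Q"
            and rk4: "ranked n (ar s4 aQ) (ar s4 aP 0) (ar s4 aRS) (ar s4 aCS) (ar s4 aRP) (ar s4 aCP)"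
            using 7(5) f3 rk by (auto simp: frame_def)
          have J4: "env s4" "vr s4 vCnt \<le> vr s vCnt + t * cstep"
            "upto n tr (ar s aD) (ar s aLt 0) (\<lambda>t. ar s aTab 0 t + vr s vSl) t (ar s aN) (ar s4 aN)" using 7(4) by (auto simp: J_def)
          define s5 where "s5 = s4\<lparr>vr := (vr s4)(vl := ar s aLt 0 (Suc t), vLam := ar s aTab 0 (Suc t) + vr s vSl)\<rparr>"
          have e5: "env s5" using J4(1) by (auto simp: env_def s5_def)
          have tU: "Suc t \<le> U" using 7(1) by simp
          have tR: "t + 1 < R" "t + 1 < W" using tU U RW by linarith+
          have LR: "ar s aTab 0 (Suc t) + vr s vSl \<le> R" "ar s aLt 0 (Suc t) \<le> R" using La[OF tU] lt[OF tU] .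
          have "Suc t * cstep \<le> U * cstep" using tU by (rule mult_right_mono) simp
          then have c5: "vr s5 vCnt + cstep \<le> R" using J4(2) U(3) by (simp add: s5_def)
          have rk5: "ranked n (ar s5 aQ) (ar s5 aP 0) (ar s5 aRS) (ar s5 aCS) (ar s5 aRP) (ar s5 aCP)" using rk4 by (simp add: s5_def)
          have QR5: "\<And>i k. i < n \<Longrightarrow> k < n \<Longrightarrow> ar s5 aQ i k \<le> R" using QR f4 by (simp add: s5_def)
          have lR5: "vr s5 vl \<le> R" using LR by (simp add: s5_def)
          have dc: "tri dominance s5 tdom (\<lambda>s'. env s' \<and> vr s' vCnt \<le> vr s5 vCnt + cstep \<and>
             (\<forall>i<n. \<forall>j<n. is_dom R n (vr s5 vl) (ar s5 aQ) i j (ar s' aRes i j)))"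
            unfolding tdom_def by (rule dominance_correct[OF e5 rk5 QR5 lR5 c5])
          have "tri (dominance ;; combine tr) s5 (tdom + n * (n + 1)) (\<lambda>s2. J (Suc t) (s2\<lparr>vr := (vr s2)(50 := Suc t)\<rparr>))"
          proof (rule tri_Seq[OF dc, where Tb = "n * (n + 1)"], goal_cases)
            case (1 s6)
            have f6: "ar s6 aN = ar s4 aN" "vr s6 vLam = ar s aTab 0 (Suc t) + vr s vSl" "vr s5 vl = ar s aLt 0 (Suc t)" "ar s5 aQ = Q"
              using 1(2) f4 by (auto simp: frame_def s5_def)
            have e6: "env s6" "vr s6 vn = n" "vr s6 vCnt \<le> vr s vCnt + Suc t * cstep" using 1(1) J4(2) by (auto simp: env_def s5_def)
            have d6: "\<And>i j. i < n \<Longrightarrow> j < n \<Longrightarrow> is_dom R n (ar s aLt 0 (Suc t)) Q i j (ar s6 aRes i j)" using 1(1) f6 by auto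
            have R6: "\<And>i j. i < n \<Longrightarrow> j < n \<Longrightarrow> ar s6 aRes i j \<le> R" using d6 QR unfolding is_dom_def by (metis order_refl)
            show ?case
            proof (rule tri_weaken[OF combine_correct[OF e6(2) f6(2) LR(1) R6, of tr]], goal_cases)
              case (4 s7)
              have e7: "env s7" by (rule env_frame[OF e6(1) 4(2)]) auto
              have f7: "vr s7 vCnt = vr s6 vCnt" using 4(2) by (auto simp: frame_def)
              have "upto n tr (ar s aD) (ar s aLt 0) (\<lambda>t. ar s aTab 0 t + vr s vSl) (Suc t) (ar s aN) (ar s7 aN)"
                by (rule upto_Suc[OF J4(3) X d6 Q]) (use 4(1) f6(1) in auto)
              then show ?case using e7 e6(3) f7 by (auto simp: J_def env_def)
            qed auto
          qed simp
          then show ?case using 7(2) f4 tR LR RW by (simp add: s5_def)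
        next
          case 6
          then show ?case using e3 f3 by (auto simp: J_def env_def upto_def)
        next
          case 8
          then show ?case by (auto simp: J_def)
        qed (use f3 U RW in auto)
      qed simp
    qed simp
  qed (auto simp: thalf_def)
qed

end

definition squared :: "nat \<Rightarrow> (nat \<Rightarrow> nat \<Rightarrow> nat) \<Rightarrow> (nat \<Rightarrow> nat) \<Rightarrow> (nat \<Rightarrow> nat) \<Rightarrow> nat \<Rightarrow> (nat \<Rightarrow> nat \<Rightarrow> nat) \<Rightarrow> bool" where
  "squared n D lt La U D' \<longleftrightarrow> (\<forall>i<n. \<forall>j<n. D' i j \<le> D i j \<and>
     (\<forall>tr. \<forall>t<U. \<forall>k<n. small tr D i j k + lt (Suc t) \<le> large tr D i j k \<longrightarrow> D' i j \<le> large tr D i j k + La (Suc t)) \<and>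
     (D' i j = D i j \<or> (\<exists>tr. \<exists>t<U. \<exists>k<n. small tr D i j k + lt (Suc t) \<le> large tr D i j k \<and> D' i j = large tr D i j k + La (Suc t))))"

lemma squaredI:
  assumes "upto n False D lt La U X Y" "upto n True D lt La U Y Z"
    "\<And>i j. i < n \<Longrightarrow> j < n \<Longrightarrow> X i j = D i j" "\<And>i j. i < n \<Longrightarrow> j < n \<Longrightarrow> D' i j = Z i j"
  shows "squared n D lt La U D'"
  unfolding squared_def
proof (intro allI impI conjI)
  fix i j assume ij: "i < n" "j < n"
  have a: "Y i j \<le> X i j" "\<And>t k. t < U \<Longrightarrow> k < n \<Longrightarrow> small False D i j k + lt (Suc t) \<le> large False D i j k \<Longrightarrow> Y i j \<le> large False D i j k + La (Suc t)"
    "Y i j = X i j \<or> (\<exists>t<U. \<exists>k<n. small False D i j k + lt (Suc t) \<le> large False D i j k \<and> Y i j = large False D i j k + La (Suc t))"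
    using assms(1) ij unfolding upto_def by auto
  have b: "Z i j \<le> Y i j" "\<And>t k. t < U \<Longrightarrow> k < n \<Longrightarrow> small True D i j k + lt (Suc t) \<le> large True D i j k \<Longrightarrow> Z i j \<le> large True D i j k + La (Suc t)"
    "Z i j = Y i j \<or> (\<exists>t<U. \<exists>k<n. small True D i j k + lt (Suc t) \<le> large True D i j k \<and> Z i j = large True D i j k + La (Suc t))"
    using assms(2) ij unfolding upto_def by auto
  show "D' i j \<le> D i j" using a(1) b(1) assms(3,4)[OF ij] by simp
  show "D' i j \<le> large tr D i j k + La (Suc t)" if h: "t < U" "k < n" "small tr D i j k + lt (Suc t) \<le> large tr D i j k" for tr t k
    using a(2)[OF h(1,2)] b(1) b(2)[OF h(1,2)] h(3) assms(4)[OF ij] by (cases tr) auto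
  show "D' i j = D i j \<or> (\<exists>tr. \<exists>t<U. \<exists>k<n. small tr D i j k + lt (Suc t) \<le> large tr D i j k \<and> D' i j = large tr D i j k + La (Suc t))"
    using a(3) b(3) assms(3,4)[OF ij] by metis
qed

lemma wv_half [simp]: "wv (half tr) = {6, 7, 8, 14, 15, 16, 17, 18, 19, 20, 21, 22, 23, 24, 30, 31, 32, 33, 34, 35, 36, 37, 38, 39, 40, 41, 50}"
  "wa (half tr) = {2, 4, 5, 6, 7, 8, 9, 10, 11, 12, 13, 14, 15, 16, 17, 18, 19, 20, 21, 22, 23}"
  unfolding half_def by auto

lemma wv_square [simp]: "wv square = {6, 7, 8, 14, 15, 16, 17, 18, 19, 20, 21, 22, 23, 24, 30, 31, 32, 33, 34, 35, 36, 37, 38, 39, 40, 41, 50}"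
  "wa square = {2, 3, 4, 5, 6, 7, 8, 9, 10, 11, 12, 13, 14, 15, 16, 17, 18, 19, 20, 21, 22, 23}"
  unfolding square_def by auto

context apsp
begin

lemma square_correct:
  assumes e: "env s" and G: "n * n \<le> 2 ^ G" and U: "vr s vU = U" "U < R" "vr s vCnt + 2 * (U * cstep) \<le> R"
    and D: "\<And>i j. i < n \<Longrightarrow> j < n \<Longrightarrow> ar s aD i j \<le> R"
    and lt: "\<And>t. t \<le> U \<Longrightarrow> ar s aLt 0 t \<le> R" and La: "\<And>t. t \<le> U \<Longrightarrow> ar s aTab 0 t + vr s vSl \<le> R"
  shows "tri square s (2 * (n * (n + 1)) + 2 * thalf G U) (\<lambda>s'. env s' \<and> vr s' vCnt \<le> vr s vCnt + 2 * (U * cstep) \<and>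
     squared n (ar s aD) (ar s aLt 0) (\<lambda>t. ar s aTab 0 t + vr s vSl) U (ar s' aD))"
proof -
  have vn: "vr s vn = n" using e by (simp add: env_def)
  have c0: "tri (copya aN aD) s (n * (n + 1)) (\<lambda>s'. \<forall>i<n. \<forall>j<n. ar s' aN i j = ar s aD i j)" by (rule copy_loop[OF vn]) auto
  show ?thesis unfolding square_def
  proof (rule tri_Seq[OF c0, where Tb = "n * (n + 1) + 2 * thalf G U"], goal_cases)
    case (1 s1)
    have e1: "env s1" by (rule env_frame[OF e 1(2)]) auto
    have f1: "ar s1 aD = ar s aD" "ar s1 aLt = ar s aLt" "ar s1 aTab = ar s aTab" "vr s1 vSl = vr s vSl" "vr s1 vU = U" "vr s1 vCnt = vr s vCnt"
      using 1(2) U by (auto simp: frame_def)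
    have X1: "\<And>i j. i < n \<Longrightarrow> j < n \<Longrightarrow> ar s1 aN i j = ar s aD i j" using 1(1) by blast
    have h1: "tri (half False) s1 (thalf G U) (\<lambda>s'. env s' \<and> vr s' vCnt \<le> vr s1 vCnt + U * cstep \<and>
     upto n False (ar s1 aD) (ar s1 aLt 0) (\<lambda>t. ar s1 aTab 0 t + vr s1 vSl) U (ar s1 aN) (ar s' aN))"
      by (rule half_correct[OF e1 G f1(5) U(2)]) (use U(3) f1 D lt La X1 in auto)
    show ?case
    proof (rule tri_Seq[OF h1, where Tb = "n * (n + 1) + thalf G U"], goal_cases)
      case (1 s2)
      have e2: "env s2" and c2: "vr s2 vCnt \<le> vr s vCnt + U * cstep" using 1(1) f1 by auto
      have u2: "upto n False (ar s aD) (ar s aLt 0) (\<lambda>t. ar s aTab 0 t + vr s vSl) U (ar s1 aN) (ar s2 aN)" using 1(1) f1 by auto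
      have f2: "ar s2 aD = ar s aD" "ar s2 aLt = ar s aLt" "ar s2 aTab = ar s aTab" "vr s2 vSl = vr s vSl" "vr s2 vU = U"
        using 1(2) f1 by (auto simp: frame_def)
      have X2: "ar s2 aN i j \<le> R" if "i < n" "j < n" for i j using u2 X1[OF that] D[OF that] that unfolding upto_def by fastforce
      have h2: "tri (half True) s2 (thalf G U) (\<lambda>s'. env s' \<and> vr s' vCnt \<le> vr s2 vCnt + U * cstep \<and>
        upto n True (ar s2 aD) (ar s2 aLt 0) (\<lambda>t. ar s2 aTab 0 t + vr s2 vSl) U (ar s2 aN) (ar s' aN))"
        by (rule half_correct[OF e2 G f2(5) U(2)]) (use U(3) c2 f2 D lt La X2 in auto)
      show ?case
      proof (rule tri_Seq[OF h2, where Tb = "n * (n + 1)"], goal_cases)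
        case (1 s3)
        have e3: "env s3" and c3: "vr s3 vCnt \<le> vr s vCnt + 2 * (U * cstep)" using 1(1) c2 by auto
        have u3: "upto n True (ar s aD) (ar s aLt 0) (\<lambda>t. ar s aTab 0 t + vr s vSl) U (ar s2 aN) (ar s3 aN)" using 1(1) f2 by auto
        have v3: "vr s3 vn = n" using e3 by (simp add: env_def)
        have cp: "tri (copya aD aN) s3 (n * (n + 1)) (\<lambda>s'. \<forall>i<n. \<forall>j<n. ar s' aD i j = ar s3 aN i j)" by (rule copy_loop[OF v3]) auto
        show ?case
        proof (rule tri_weaken[OF cp], goal_cases)
          case (2 s4)
          have "env s4" by (rule env_frame[OF e3 2(2)]) auto
          moreover have "vr s4 vCnt = vr s3 vCnt" using 2(2) by (auto simp: frame_def)
          moreover have "squared n (ar s aD) (ar s aLt 0) (\<lambda>t. ar s aTab 0 t + vr s vSl) U (ar s4 aD)"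
            by (rule squaredI[OF u2 u3 X1]) (use 2(1) in auto)
          ultimately show ?case using c3 by simp
        qed simp
      qed simp
    qed simp
  qed simp
qed

end

section \<open>The main program\<close>

abbreviation (input) "vS \<equiv> 11 :: nat"
abbreviation (input) "vL \<equiv> 13 :: nat"

text \<open>\<open>stab U u\<close> is an integer approximation of \<open>U\<^sup>2 ln (1 + u / U)\<close>, so \<open>stab U U\<close> is the length of one octave.\<close>

definition stab :: "nat \<Rightarrow> nat \<Rightarrow> nat" where
  "stab U u = (\<Sum>v<u. (U * U) div (U + v))"

text \<open>The number of doublings that bring \<open>j\<close> into the octave from
  \<open>U\<close> to \<open>2 * U\<close>.\<close>

definition lvl :: "nat \<Rightarrow> nat \<Rightarrow> nat" where
  "lvl U j = (LEAST s. U \<le> j * 2 ^ s)"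

text \<open>An integer approximation of \<open>U\<^sup>2 ln (U / j)\<close>: a number of octaves,
  minus the table value for the normalised \<open>j * 2 ^ lvl U j\<close>, which lies between
  \<open>U\<close> and \<open>2 * U\<close>.\<close>

definition ltab :: "nat \<Rightarrow> nat \<Rightarrow> nat" where
  "ltab U j = lvl U j * stab U U - stab U (j * 2 ^ lvl U j - U)"

lemma stab_le: "stab U u \<le> u * U"
proof -
  have "(U * U) div (U + v) \<le> U" for v by (cases "U = 0") (auto intro: order_trans[OF div_le_mono2[of U "U + v" "U * U"]])
  then have "stab U u \<le> (\<Sum>v<u. U)" unfolding stab_def by (intro sum_mono)
  then show ?thesis by simp
qed

lemma stab_mono: "u \<le> u' \<Longrightarrow> stab U u \<le> stab U u'"
  unfolding stab_def by (intro sum_mono2) auto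

lemma lvl_props:
  assumes "1 \<le> j" "j \<le> U"
  shows "U \<le> j * 2 ^ lvl U j" "j * 2 ^ lvl U j < 2 * U" "lvl U j \<le> U" "\<And>s. s < lvl U j \<Longrightarrow> j * 2 ^ s < U"
proof -
  have "U \<le> 1 * 2 ^ U" by simp
  also have "\<dots> \<le> j * 2 ^ U" using assms(1) by (intro mult_right_mono) auto
  finally have ex: "U \<le> j * 2 ^ U" .
  show 1: "U \<le> j * 2 ^ lvl U j" unfolding lvl_def by (rule LeastI[of "\<lambda>s. U \<le> j * 2 ^ s", OF ex])
  show 2: "lvl U j \<le> U" unfolding lvl_def by (rule Least_le[of "\<lambda>s. U \<le> j * 2 ^ s", OF ex])
  show 3: "j * 2 ^ s < U" if "s < lvl U j" for s using not_less_Least[of s "\<lambda>s. U \<le> j * 2 ^ s"] that by (simp add: lvl_def)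
  show "j * 2 ^ lvl U j < 2 * U"
  proof (cases "lvl U j")
    case 0
    then show ?thesis using assms by simp
  next
    case (Suc s)
    then have "j * 2 ^ s < U" using 3 by simp
    then show ?thesis using Suc by simp
  qed
qed

section \<open>Parameters, tables, encoding and decoding\<close>

definition init1 :: com where
  "init1 = Assign vNN (V vn \<otimes> V vn) ;; Assign vDim (N 3 \<otimes> V vn) ;; Assign 51 (N 1) ;; Assign vL (N 0) ;;
     While (V 51) (V vn) (Assign 51 (V 51 \<oplus> V 51) ;; Assign vL (V vL \<oplus> N 1))"

text \<open>A power of two that is at least \<open>L + 2\<close>. It is used in place of
  \<open>L + 2\<close> itself so that \<open>U\<close> divides the power of two
  \<open>2 ^ (w - 1)\<close>.\<close>

definition init2 :: com where
  "init2 = Assign 53 (N 1) ;; Assign 52 (V vL \<oplus> N 2) ;; While (V 53) (V 52) (Assign 53 (V 53 \<oplus> V 53))"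

definition init3 :: com where
  "init3 = Assign vq (N 1) ;; While (V vq \<otimes> V vq) (V vn) (Assign vq (V vq \<oplus> V vq))"

text \<open>\<open>U = 64 * 2 ^ a * 2 ^ e\<close>, where \<open>2 ^ a\<close> comes from
  \<open>init2\<close> and \<open>2 ^ e\<close> stands for the accuracy. Variable \<open>54\<close>
  is the mantissa unit \<open>2 ^ (w - 1) div U\<close>; \<open>56\<close> and \<open>vSl\<close>
  hold the corrections \<open>2 * U\<close> and \<open>4 * U\<close> for table errors.\<close>

definition init4 :: com where
  "init4 = Assign vU (Bin Shl (N 64 \<otimes> V 53) (V 2)) ;; Assign 55 (V vU \<otimes> V vU) ;; Assign 56 (V vU \<oplus> V vU) ;;
     Assign vSl (V 56 \<oplus> V 56) ;; Assign 54 (Bin Shl (N 1) (V 0 \<ominus> N 1) \<oslash> V vU) ;;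
     Wr aTab (N 0) (N 0) (N 0)"

definition log_table :: com where
  "log_table = For 57 vU (Wr aTab (N 0) (V 57 \<oplus> N 1) (Rd aTab (N 0) (V 57) \<oplus> V 55 \<oslash> (V vU \<oplus> V 57)))"

definition ratio_table :: com where
  "ratio_table = For 58 vU (Assign 57 (V 58 \<oplus> N 1) ;; Assign 59 (N 0) ;;
     While (V 57) (V vU) (Assign 57 (V 57 \<oplus> V 57) ;; Assign 59 (V 59 \<oplus> N 1)) ;;
     Wr aLt (N 0) (V 58 \<oplus> N 1) (V 59 \<otimes> V vS \<ominus> Rd aTab (N 0) (V 57 \<ominus> V vU)))"

definition init :: com where
  "init = init1 ;; init2 ;; init3 ;; init4 ;; log_table ;; Assign vS (Rd aTab (N 0) (V vU)) ;; ratio_table ;; Wr aLt (N 0) (N 0) (N 0)"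

text \<open>Finite weights are rounded up: the table index is one above the truncated mantissa, and
  \<open>2 * U\<close> compensates the error of the table. Infinite weights get the key
  \<open>R\<close>.\<close>

definition encode :: com where
  "encode = For 30 vn (For 31 vn (Assign 60 (N 2 \<otimes> (V 30 \<otimes> V vn \<oplus> V 31)) ;;
     Assign 61 (Rd 0 (N 0) (V 60)) ;; Assign 62 (Rd 0 (N 0) (V 60 \<oplus> N 1)) ;;
     If (V 61) (N 1) (Wr aD (V 30) (V 31) (V vInf))
       (Wr aD (V 30) (V 31) (V 62 \<otimes> V vS \<oplus> Rd aTab (N 0) (V 61 \<oslash> V 54 \<ominus> V vU \<oplus> N 1) \<oplus> V 56))))"

definition decode1 :: com where
  "decode1 = Assign 64 (N 0) ;; While (Rd aTab (N 0) (V 64)) (V 63) (Assign 64 (V 64 \<oplus> N 1))"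

text \<open>The diagonal is set to \<open>0\<close> directly, since keys only represent walks with
  at least one edge. Elsewhere the number of octaves in the key plus \<open>2 * U\<close> gives the
  exponent, and a linear search in the table gives the mantissa, at a cost of
  \<open>O(n\<^sup>2 U)\<close> in total.\<close>

definition decode :: com where
  "decode = For 30 vn (For 31 vn (Assign 60 (N 2 \<otimes> (V 30 \<otimes> V vn \<oplus> V 31)) ;;
     Assign 65 (N 0) ;; If (V 30) (V 31) (Assign 65 (N 1)) Skip ;; If (V 31) (V 30) (Assign 65 (N 1)) Skip ;;
     Assign 66 (N 0) ;; Assign 67 (N 0) ;;
     If (V 65) (N 1) Skip (
       If (Rd aD (V 30) (V 31)) (V vInf)
         (Assign 61 (Rd aD (V 30) (V 31) \<oplus> V 56) ;; Assign 67 (V 61 \<oslash> V vS) ;; Assign 63 (V 61 \<odot> V vS) ;; decode1 ;;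
          If (V 64) (V vU) (Assign 66 ((V vU \<oplus> V 64) \<otimes> V 54)) (Assign 66 (V vU \<otimes> V 54) ;; Assign 67 (V 67 \<oplus> N 1)))
         (Assign 67 (N 1))) ;;
     Wr 0 (N 0) (V 60) (V 66) ;; Wr 0 (N 0) (V 60 \<oplus> N 1) (V 67)))"

definition main :: com where
  "main = init ;; encode ;; For 68 vL square ;; decode"

context ram
begin

lemma init1_correct:
  assumes n: "vr s vn = n" "1 \<le> n" "100 * (n * n) + 100 < R"
  shows "tri init1 s (Suc n) (\<lambda>s'. vr s' vNN = n * n \<and> vr s' vDim = 3 * n \<and> n \<le> 2 ^ vr s' vL \<and> (vr s' vL = 0 \<or> 2 ^ (vr s' vL - 1) < n))"
proof -
  have RW: "R < W" "3 < R" "3 * R < W" "1 < W" "0 < W" using R_less_W R_ge by linarith+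
  have nle: "n \<le> n * n" "n < W" "n * n < W" "3 * n < W" using le_square[of n] n RW by linarith+
  let ?s = "s\<lparr>vr := (vr s)(vNN := n * n, vDim := 3 * n, 51 := 1, vL := 0)\<rparr>"
  have "tri (While (V 51) (V vn) (Assign 51 (V 51 \<oplus> V 51) ;; Assign vL (V vL \<oplus> N 1))) ?s (Suc n * Suc 0)
    (\<lambda>s'. vr s' vNN = n * n \<and> vr s' vDim = 3 * n \<and> n \<le> 2 ^ vr s' vL \<and> (vr s' vL = 0 \<or> 2 ^ (vr s' vL - 1) < n))"
  proof (rule tri_While[where I = "\<lambda>f s'. vr s' 51 = 2 ^ vr s' vL \<and> (vr s' vL = 0 \<or> 2 ^ (vr s' vL - 1) < n) \<and> n \<le> 2 ^ (vr s' vL + f)" and F = n and b = 0], goal_cases)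
    case 1
    have "n \<le> 2 ^ n" by simp
    then show ?case by simp
  next
    case (3 f s1)
    have v: "vr s1 vn = n" using 3(2) n by (auto simp: frame_def)
    have l: "2 ^ vr s1 vL < n" using 3 v by simp
    then have "f \<noteq> 0" using 3(1) by (cases f) auto
    then obtain f' where f': "f = Suc f'" using not0_implies_Suc by blast
    have "vr s1 vL < n" using l less_exp[of "vr s1 vL"] by linarith
    then have W1: "vr s1 vL + 1 < W" "vr s1 51 + vr s1 51 < W" using nle RW l 3(1) n by linarith+
    have "\<exists>f''<f. vr s1 51 + vr s1 51 = 2 ^ Suc (vr s1 vL) \<and> (Suc (vr s1 vL) = 0 \<or> 2 ^ (Suc (vr s1 vL) - 1) < n) \<and> n \<le> 2 ^ (Suc (vr s1 vL) + f'')"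
      using 3(1) l f' by (intro exI[of _ f']) auto
    then show ?case using W1 RW by simp
  next
    case (4 f s1)
    then show ?case using n by (auto simp: frame_def)
  qed (auto simp: RW)
  then show ?thesis using n nle RW unfolding init1_def by simp
qed

lemma init2_correct:
  assumes L: "vr s vL = L" "L + 2 < R"
  shows "tri init2 s (L + 3) (\<lambda>s'. \<exists>a. vr s' 53 = 2 ^ a \<and> L + 2 \<le> 2 ^ a \<and> 2 ^ a < 2 * (L + 2))"
proof -
  have RW: "R < W" "3 < R" "3 * R < W" "1 < W" "0 < W" using R_less_W R_ge by linarith+
  let ?s = "s\<lparr>vr := (vr s)(53 := 1, 52 := L + 2)\<rparr>"
  have "tri (While (V 53) (V 52) (Assign 53 (V 53 \<oplus> V 53))) ?s (Suc (L + 2) * Suc 0)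
    (\<lambda>s'. \<exists>a. vr s' 53 = 2 ^ a \<and> L + 2 \<le> 2 ^ a \<and> 2 ^ a < 2 * (L + 2))"
  proof (rule tri_While[where I = "\<lambda>f s'. \<exists>a. vr s' 53 = 2 ^ a \<and> L + 2 \<le> 2 ^ (a + f) \<and> 2 ^ a < 2 * (L + 2)" and F = "L + 2" and b = 0], goal_cases)
    case 1
    have "L + 2 \<le> 2 ^ (0 + (L + 2))" using less_exp[of "L + 2"] by simp
    then show ?case by (intro exI[of _ 0]) simp
  next
    case (3 f s1)
    obtain a where a: "vr s1 53 = 2 ^ a" "L + 2 \<le> 2 ^ (a + f)" using 3(1) by blast
    have v: "vr s1 52 = L + 2" using 3(2) by (auto simp: frame_def)
    have l: "2 ^ a < L + 2" using 3 v a by simp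
    then have "f \<noteq> 0" using a(2) by (cases f) auto
    then obtain f' where f': "f = Suc f'" using not0_implies_Suc by blast
    have "\<exists>a'. (2::nat) ^ a + 2 ^ a = 2 ^ a' \<and> L + 2 \<le> 2 ^ (a' + f') \<and> 2 ^ a' < 2 * (L + 2)"
      using a(2) l f' by (intro exI[of _ "Suc a"]) simp
    moreover have "(2::nat) ^ a + 2 ^ a < W" using l L(2) RW by linarith
    ultimately show ?case using a(1) f' by auto
  next
    case (4 f s1)
    then show ?case by (auto simp: frame_def)
  qed (auto simp: RW)
  then have t: "tri (While (V 53) (V 52) (Assign 53 (V 53 \<oplus> V 53))) ?s (L + 3)
    (\<lambda>s'. \<exists>a. vr s' 53 = 2 ^ a \<and> L + 2 \<le> 2 ^ a \<and> 2 ^ a < 2 * (L + 2))" by (rule tri_mono) simp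
  have "L + 2 < W" using L RW by linarith
  then show ?thesis using t L RW unfolding init2_def by (simp add: numeral_2_eq_2)
qed

lemma init3_correct:
  assumes n: "vr s vn = n" "1 \<le> n" "100 * (n * n) + 100 < R"
  shows "tri init3 s (Suc n) (\<lambda>s'. 1 \<le> vr s' vq \<and> n \<le> vr s' vq * vr s' vq \<and> vr s' vq * vr s' vq \<le> 4 * n)"
proof -
  have RW: "R < W" "3 < R" "3 * R < W" "1 < W" "0 < W" using R_less_W R_ge by linarith+
  have nle: "n \<le> n * n" "n < W" "4 * n < W" using le_square[of n] n RW by linarith+
  let ?s = "s\<lparr>vr := (vr s)(vq := 1)\<rparr>"
  have "tri (While (V vq \<otimes> V vq) (V vn) (Assign vq (V vq \<oplus> V vq))) ?s (Suc n * Suc 0)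
    (\<lambda>s'. 1 \<le> vr s' vq \<and> n \<le> vr s' vq * vr s' vq \<and> vr s' vq * vr s' vq \<le> 4 * n)"
  proof (rule tri_While[where I = "\<lambda>f s'. 1 \<le> vr s' vq \<and> n \<le> vr s' vq * vr s' vq * 4 ^ f \<and> vr s' vq * vr s' vq \<le> 4 * n" and F = n and b = 0], goal_cases)
    case 1
    have "n \<le> 2 ^ n" by simp
    also have "\<dots> \<le> 4 ^ n" by (rule power_mono) auto
    finally show ?case using n by simp
  next
    case (2 f s1)
    then show ?case using nle by auto
  next
    case (3 f s1)
    have v: "vr s1 vn = n" using 3(2) n by (auto simp: frame_def)
    have l: "vr s1 vq * vr s1 vq < n" using 3 v by simp
    then have "f \<noteq> 0" using 3(1) by (cases f) auto
    then obtain f' where f': "f = Suc f'" using not0_implies_Suc by blast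
    let ?q = "vr s1 vq"
    have qq: "(?q + ?q) * (?q + ?q) = 4 * (?q * ?q)" by (simp add: algebra_simps)
    have "?q \<le> ?q * ?q" by (rule le_square)
    then have qW: "?q + ?q < W" using l nle by linarith
    have "1 \<le> ?q + ?q \<and> n \<le> (?q + ?q) * (?q + ?q) * 4 ^ f' \<and> (?q + ?q) * (?q + ?q) \<le> 4 * n"
      unfolding qq using 3(1) l f' by auto
    then show ?case using qW f' by auto
  next
    case (4 f s1)
    then have "vr s1 vn = n" using n by (auto simp: frame_def)
    then show ?case using 4 by simp
  qed simp
  then show ?thesis using RW unfolding init3_def by simp
qed

lemma log_table_correct:
  assumes U: "vr s vU = U" "100 * (U * U * U) < R" "1 \<le> U" "vr s 55 = U * U" and z: "ar s aTab 0 0 = 0"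
  shows "tri log_table s U (\<lambda>s'. \<forall>u\<le>U. ar s' aTab 0 u = stab U u)"
  unfolding log_table_def
proof (rule tri_For[where m = U and b = 0 and I = "\<lambda>v s'. \<forall>u\<le>v. ar s' aTab 0 u = stab U u"], goal_cases)
  case (7 v s1)
  have RW: "R < W" "3 < R" using R_less_W R_ge by linarith+
  have "U * 1 * 1 \<le> U * U * U" "U * U * 1 \<le> U * U * U" using U(3) by (intro mult_le_mono; simp)+
  then have b: "U < R" "U * U < R" "3 * U < R" "3 * (U * U) < R" using U by linarith+
  have f: "vr s1 55 = U * U" using 7(5) U by (auto simp: frame_def)
  have "stab U v \<le> v * U" by (rule stab_le)
  also have "\<dots> \<le> U * U" using 7(1) by (intro mult_right_mono) auto
  finally have s: "stab U v \<le> U * U" .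
  have "U * U div (U + v) \<le> U * U" by (rule div_le_dividend)
  then have s2: "stab U v + U * U div (U + v) < W" using s b RW by linarith
  have r: "v < R" "v + 1 < R" "v + 1 < W" "U + v < W" using b 7(1) RW by linarith+
  show ?case using 7 f s2 r RW by (auto simp: le_Suc_eq stab_def)
next
  case 5
  have "U * 1 * 1 \<le> U * U * U" using U(3) by (intro mult_le_mono) auto
  then show ?case using U R_less_W by linarith
qed (use U z in \<open>auto simp: stab_def\<close>)

lemma ratio_table_correct:
  assumes U: "vr s vU = U" "100 * (U * U * U) < R" "1 \<le> U" "vr s vS = stab U U" "U \<le> 2 ^ F" and z: "\<forall>u\<le>U. ar s aTab 0 u = stab U u"
  shows "tri ratio_table s (U * (F + 2)) (\<lambda>s'. \<forall>j. 1 \<le> j \<longrightarrow> j \<le> U \<longrightarrow> ar s' aLt 0 j = ltab U j)"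
  unfolding ratio_table_def
proof (rule tri_For[where m = U and b = "F + 1" and I = "\<lambda>t s'. \<forall>j. 1 \<le> j \<longrightarrow> j \<le> t \<longrightarrow> ar s' aLt 0 j = ltab U j"], goal_cases)
  case (7 t s1)
  have RW: "R < W" "3 < R" "1 < W" "0 < W" using R_less_W R_ge by linarith+
  have "U * 1 * 1 \<le> U * U * U" "U * U * 1 \<le> U * U * U" using U(3) by (intro mult_le_mono; simp)+
  then have b: "U < R" "U * U < R" "3 * U < R" "3 * (U * U) < R" using U by linarith+
  define j where "j = Suc t"
  have j: "1 \<le> j" "j \<le> U" using 7(1) by (auto simp: j_def)
  note lp = lvl_props[OF j]
  define s2 where "s2 = s1\<lparr>vr := (vr s1)(57 := j, 59 := 0)\<rparr>"
  have f1: "vr s1 vU = U" "vr s1 vS = stab U U" "ar s1 aTab = ar s aTab" using 7(5) U by (auto simp: frame_def)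
  have "tri (While (V 57) (V vU) (Assign 57 (V 57 \<oplus> V 57) ;; Assign 59 (V 59 \<oplus> N 1)) ;;
     Wr aLt (N 0) (V 58 \<oplus> N 1) (V 59 \<otimes> V vS \<ominus> Rd aTab (N 0) (V 57 \<ominus> V vU))) s2 (F + 1)
     (\<lambda>s2. \<forall>j. 1 \<le> j \<longrightarrow> j \<le> Suc t \<longrightarrow> ar (s2\<lparr>vr := (vr s2)(58 := Suc t)\<rparr>) aLt 0 j = ltab U j)"
  proof (rule tri_Seq[where Ta = "Suc F * Suc 0" and Tb = 0])
    show "tri (While (V 57) (V vU) (Assign 57 (V 57 \<oplus> V 57) ;; Assign 59 (V 59 \<oplus> N 1))) s2 (Suc F * Suc 0)
      (\<lambda>s'. vr s' 57 = j * 2 ^ lvl U j \<and> vr s' 59 = lvl U j)"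
    proof (rule tri_While[where I = "\<lambda>f s'. vr s' 57 = j * 2 ^ vr s' 59 \<and> vr s' 59 \<le> lvl U j \<and> U \<le> j * 2 ^ (vr s' 59 + f)" and F = F and b = 0], goal_cases)
      case 1
      have "U \<le> 1 * 2 ^ F" using U(5) by simp
      also have "\<dots> \<le> j * 2 ^ F" using j(1) by (intro mult_right_mono) auto
      finally show ?case by (simp add: s2_def)
    next
      case (3 f s3)
      have v: "vr s3 vU = U" using 3(2) f1 by (auto simp: frame_def s2_def)
      have l: "j * 2 ^ vr s3 59 < U" using 3 v by simp
      have "vr s3 59 \<noteq> lvl U j" using l lp(1) by auto
      then have lt: "vr s3 59 < lvl U j" using 3(1) by simp
      have "f \<noteq> 0" using 3(1) l by (cases f) auto
      then obtain f' where f': "f = Suc f'" using not0_implies_Suc by blast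
      have W1: "vr s3 57 + vr s3 57 < W" "vr s3 59 + 1 < W" using l 3(1) b RW lt lp(3) by linarith+
      have "Suc (vr s3 59) \<le> lvl U j \<and> U \<le> j * 2 ^ (Suc (vr s3 59) + f')" using lt 3(1) f' by simp
      then show ?case using 3(1) W1 f' RW by (auto intro!: exI[of _ f'])
    next
      case (4 f s3)
      have v: "vr s3 vU = U" using 4(2) f1 by (auto simp: frame_def s2_def)
      have "U \<le> j * 2 ^ vr s3 59" using 4 v by simp
      then have "\<not> vr s3 59 < lvl U j" using lp(4) by (meson not_le)
      then show ?case using 4(1) by auto
    qed (auto simp: s2_def)
  next
    fix s3 assume h: "vr s3 57 = j * 2 ^ lvl U j \<and> vr s3 59 = lvl U j"
      and fr: "frame (wv (While (V 57) (V vU) (Assign 57 (V 57 \<oplus> V 57) ;; Assign 59 (V 59 \<oplus> N 1)))) (wa (While (V 57) (V vU) (Assign 57 (V 57 \<oplus> V 57) ;; Assign 59 (V 59 \<oplus> N 1)))) s2 s3"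
    have f3: "vr s3 vU = U" "vr s3 vS = stab U U" "ar s3 aTab = ar s aTab" "vr s3 58 = t" "ar s3 aLt = ar s1 aLt"
      using fr f1 7(2) by (auto simp: frame_def s2_def)
    let ?z = "j * 2 ^ lvl U j"
    have z': "U \<le> ?z" "?z - U < U" using lp(1,2) by auto
    have T: "ar s aTab 0 (?z - U) = stab U (?z - U)" using z z'(2) by simp
    \<comment> \<open>The subtraction in \<open>ltab\<close> is exact: for \<open>j = U\<close> both
      sides vanish, otherwise there is at least one whole octave.\<close>
    have le: "stab U (?z - U) \<le> lvl U j * stab U U"
    proof (cases "lvl U j")
      case 0
      then have "?z - U = 0" using j lp(1) by simp
      then show ?thesis by (simp add: stab_def)
    next
      case (Suc x)
      have "stab U (?z - U) \<le> stab U U" using z'(2) by (intro stab_mono) simp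
      then show ?thesis using Suc by simp
    qed
    have "lvl U j * stab U U \<le> U * (U * U)" using lp(3) stab_le[of U U] by (rule mult_le_mono)
    then have mW: "lvl U j * stab U U < W" using U(2) RW by (simp add: mult.assoc)
    have tR: "t + 1 < R" "t + 1 < W" "?z - U < R" using b 7(1) RW z' by linarith+
    show "tri (Wr aLt (N 0) (V 58 \<oplus> N 1) (V 59 \<otimes> V vS \<ominus> Rd aTab (N 0) (V 57 \<ominus> V vU))) s3 0
      (\<lambda>s2. \<forall>j. 1 \<le> j \<longrightarrow> j \<le> Suc t \<longrightarrow> ar (s2\<lparr>vr := (vr s2)(58 := Suc t)\<rparr>) aLt 0 j = ltab U j)"
      using h f3 z' T le mW tR RW 7(4) by (auto simp: ltab_def j_def le_Suc_eq)
  qed simp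
  moreover have "t + 1 < W" using b 7(1) RW by linarith
  ultimately show ?case using 7(2) RW by (simp add: s2_def j_def)
next
  case 5
  have "U * 1 * 1 \<le> U * U * U" using U(3) by (intro mult_le_mono) auto
  then show ?case using U R_less_W by linarith
qed (use U in auto)

end

fun squares :: "nat \<Rightarrow> (nat \<Rightarrow> nat) \<Rightarrow> (nat \<Rightarrow> nat) \<Rightarrow> nat \<Rightarrow> nat \<Rightarrow> (nat \<Rightarrow> nat \<Rightarrow> nat) \<Rightarrow> (nat \<Rightarrow> nat \<Rightarrow> nat) \<Rightarrow> bool" where
  "squares n lt La U 0 D D' \<longleftrightarrow> (\<forall>i<n. \<forall>j<n. D' i j = D i j)"
| "squares n lt La U (Suc l) D D' \<longleftrightarrow> (\<exists>E. squares n lt La U l D E \<and> squared n E lt La U D')"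

lemma squared_cong:
  assumes "\<And>t. 1 \<le> t \<Longrightarrow> t \<le> U \<Longrightarrow> lt t = lt' t \<and> La t = La' t"
  shows "squared n D lt La U D' = squared n D lt' La' U D'"
proof -
  have "lt (Suc t) = lt' (Suc t)" "La (Suc t) = La' (Suc t)" if "t < U" for t using assms[of "Suc t"] that by auto
  then show ?thesis unfolding squared_def by (simp cong: conj_cong)
qed

definition encoded :: "nat \<Rightarrow> nat \<Rightarrow> nat \<Rightarrow> nat \<Rightarrow> nat \<Rightarrow> nat" where
  "encoded R U E m x = (if m = 0 then R else x * stab U U + stab U (m div E - U + 1) + 2 * U)"

definition decoded :: "nat \<Rightarrow> nat \<Rightarrow> nat \<Rightarrow> nat \<Rightarrow> nat \<Rightarrow> nat \<Rightarrow> bool" where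
  "decoded R U E d m x \<longleftrightarrow> (if R \<le> d then m = 0 \<and> x = 1 else
     (\<exists>u\<le>U. (d + 2 * U) mod stab U U \<le> stab U u \<and> (\<forall>u'<u. stab U u' < (d + 2 * U) mod stab U U) \<and>
       (if u < U then m = (U + u) * E \<and> x = (d + 2 * U) div stab U U else m = U * E \<and> x = (d + 2 * U) div stab U U + 1)))"

lemma wv_init [simp]: "wv init1 = {9, 5, 51, 13}" "wa init1 = {}" "wv init2 = {53, 52}" "wa init2 = {}" "wv init3 = {14}" "wa init3 = {}"
  "wv init4 = {10, 55, 56, 12, 54}" "wa init4 = {24}" "wv log_table = {57}" "wa log_table = {24}"
  "wv ratio_table = {58, 57, 59}" "wa ratio_table = {25}" "wv encode = {30, 31, 60, 61, 62}" "wa encode = {3}"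
  "wv decode1 = {64}" "wa decode1 = {}" "wv decode = {30, 31, 60, 65, 66, 67, 61, 63, 64}" "wa decode = {0}"
  by (auto simp: init1_def init2_def init3_def init4_def log_table_def ratio_table_def encode_def decode1_def decode_def)

text \<open>\<open>cR\<close> provides fresh memory rows for the products of all squarings;
  \<open>fin\<close> says that finite weights have normalised mantissas and keys of at most
  \<open>R\<close>.\<close>

locale solver = apsp w P W R ws n Lq F AT for w P W R ws n Lq F AT +
  fixes L a e U E G Fu :: nat and f :: "nat \<Rightarrow> nat"
  assumes L: "n \<le> 2 ^ L" "L = 0 \<or> 2 ^ (L - 1) < n" and a: "L + 2 \<le> 2 ^ a" "2 ^ a < 2 * (L + 2)"
    and U_def: "U = 64 * 2 ^ a * 2 ^ e" and E_def: "E = 2 ^ (w - 1) div U" and UR: "100 * (U * U * U) < R"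
    and G: "n * n \<le> 2 ^ G" and Fu: "U \<le> 2 ^ Fu" and cR: "2 * (L * (U * cstep)) \<le> R"
    and fin: "\<And>i j. i < n \<Longrightarrow> j < n \<Longrightarrow> f (2 * (i * n + j)) \<noteq> 0 \<Longrightarrow> 2 ^ (w - 1) \<le> f (2 * (i * n + j)) \<and> f (2 * (i * n + j)) < 2 ^ w \<and>
       (f (2 * (i * n + j) + 1) + 1) * (U * U) + 2 * U \<le> R"
begin

lemma U1: "1 \<le> U" "64 \<le> U" using U_def one_le_power[of 2 a] one_le_power[of 2 e] by (auto simp: mult_le_mono[of 64 64 1, simplified])

lemma UU: "U \<le> U * U" "U * U \<le> U * U * U" "100 * U < R" "100 * (U * U) < R"
proof -
  have "U * 1 \<le> U * U" "U * U * 1 \<le> U * U * U" using U1 by (intro mult_le_mono; simp)+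
  then show "U \<le> U * U" "U * U \<le> U * U * U" "100 * U < R" "100 * (U * U) < R" using UR by linarith+
qed

lemma SU: "stab U u \<le> U * U" if "u \<le> U"
  using stab_le[of U u] mult_le_mono1[OF that, of U] by linarith

lemma S_pos: "U \<le> stab U U"
proof -
  have "stab U 1 \<le> stab U U" using U1 by (intro stab_mono)
  then show ?thesis using U1 by (simp add: stab_def)
qed

lemma w1: "1 \<le> w" using W_def RW by (cases w) auto

text \<open>\<open>U\<close> is a power of two and small compared with \<open>2 ^ w\<close>, so the
  division that defines \<open>E\<close> leaves no remainder.\<close>

lemma UE: "U * E = 2 ^ (w - 1)" "1 \<le> E"
proof -
  have U2: "U = 2 ^ (6 + a + e)" by (simp add: U_def power_add)
  have "2 ^ (6 + a + e) * 2 \<le> (2::nat) ^ w" using UU(3) RW unfolding U2 W_def by linarith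
  then have "(2::nat) ^ Suc (6 + a + e) \<le> 2 ^ w" by (simp only: power_Suc mult.commute)
  then have "Suc (6 + a + e) \<le> w" by (rule power_le_imp_le_exp[rotated]) simp
  then have le: "6 + a + e \<le> w - 1" by linarith
  then have "U dvd 2 ^ (w - 1)" unfolding U2 by (rule le_imp_power_dvd)
  then show 1: "U * E = 2 ^ (w - 1)" by (simp add: E_def)
  show "1 \<le> E" using 1 by (cases E) auto
qed

definition tabs :: "store \<Rightarrow> bool" where
  "tabs s \<longleftrightarrow> vr s vU = U \<and> vr s vS = stab U U \<and> vr s 56 = 2 * U \<and> vr s vSl = 4 * U \<and> vr s 54 = E \<and> vr s vL = L \<and>
     (\<forall>u\<le>U. ar s aTab 0 u = stab U u) \<and> (\<forall>j. 1 \<le> j \<longrightarrow> j \<le> U \<longrightarrow> ar s aLt 0 j = ltab U j) \<and> ar s aLt 0 0 = 0"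

lemma tabs_frame: "tabs s \<Longrightarrow> frame X A s s' \<Longrightarrow> X \<inter> {10, 11, 12, 13, 54, 56} = {} \<Longrightarrow> A \<inter> {24, 25} = {} \<Longrightarrow> tabs s'"
  unfolding tabs_def frame_def by auto

text \<open>Identifies the number computed by the program with the parameter \<open>L\<close>;
  \<open>a_unique\<close> does the same for \<open>a\<close>.\<close>

lemma L_unique: "n \<le> 2 ^ L' \<Longrightarrow> L' = 0 \<or> 2 ^ (L' - 1) < n \<Longrightarrow> L' = L"
proof -
  have *: "x \<le> y" if "x = 0 \<or> 2 ^ (x - 1) < n" "n \<le> 2 ^ y" for x y :: nat
  proof (cases "x = 0")
    case False
    then have "(2::nat) ^ (x - 1) < 2 ^ y" using that by linarith
    then have "x - 1 < y" by simp
    then show ?thesis by linarith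
  qed simp
  assume "n \<le> 2 ^ L'" "L' = 0 \<or> 2 ^ (L' - 1) < n"
  then show ?thesis using *[of L' L] *[of L L'] L by auto
qed

lemma a_unique: "L + 2 \<le> 2 ^ b \<Longrightarrow> 2 ^ b < 2 * (L + 2) \<Longrightarrow> b = a"
proof -
  have *: "x \<le> y" if "2 ^ x < 2 * (L + 2)" "L + 2 \<le> 2 ^ y" for x y :: nat
  proof -
    have "(2::nat) ^ x < 2 ^ Suc y" using that by simp
    then have "x < Suc y" using power_less_imp_less_exp[of 2 x "Suc y"] by simp
    then show ?thesis by simp
  qed
  assume "L + 2 \<le> 2 ^ b" "2 ^ b < 2 * (L + 2)"
  then show ?thesis using *[of b a] *[of a b] a by auto
qed

lemma L_less: "L + 2 < R"
proof -
  have "(1::nat) \<le> 2 ^ e" by simp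
  then have "64 * 2 ^ a * 1 \<le> U" unfolding U_def by (intro mult_le_mono order_refl)
  then have "L \<le> U" using a(1) by linarith
  then show ?thesis using UU(3) U1 by linarith
qed

definition tinit :: nat where "tinit = Suc n + (L + 3) + Suc n + U + U * (Fu + 2)"

lemma init_correct:
  shows "tri init (start w n e f) tinit (\<lambda>s'. env s' \<and> tabs s' \<and> vr s' vCnt = 0 \<and> ar s' 0 0 = f)"
proof -
  let ?s = "start w n e f"
  have v0: "vr ?s vn = n" by (simp add: start_def)
  show ?thesis unfolding init_def
  proof (rule tri_Seq[OF init1_correct[OF v0 n1 nR], where Tb = "(L + 3) + Suc n + U + U * (Fu + 2)"], goal_cases)
    case (1 s1)
    have f1: "vr s1 0 = w" "vr s1 vn = n" "vr s1 2 = e" "vr s1 vWs = ws" "vr s1 vInf = R" "vr s1 vCnt = 0" "ar s1 = ar ?s"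
      using 1(2) by (auto simp: frame_def start_def ws_def R_def fun_eq_iff)
    have L1: "vr s1 vL = L" using 1(1) L_unique by blast
    have v1: "vr s1 vNN = n * n" "vr s1 vDim = 3 * n" using 1(1) by auto
    show ?case
    proof (rule tri_Seq[OF init2_correct[OF L1 L_less], where Tb = "Suc n + U + U * (Fu + 2)"], goal_cases)
      case (1 s2)
      have v2: "vr s2 53 = 2 ^ a" using 1(1) a_unique by blast
      have f2: "vr s2 0 = w" "vr s2 vn = n" "vr s2 2 = e" "vr s2 vWs = ws" "vr s2 vInf = R" "vr s2 vCnt = 0" "ar s2 = ar ?s" "vr s2 vNN = n * n" "vr s2 vDim = 3 * n" "vr s2 vL = L"
        using 1(2) f1 v1 L1 by (auto simp: frame_def fun_eq_iff)
      show ?case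
      proof (rule tri_Seq[OF init3_correct[OF f2(2) n1 nR], where Tb = "U + U * (Fu + 2)"], goal_cases)
        case (1 s3)
        have f3: "vr s3 0 = w" "vr s3 vn = n" "vr s3 2 = e" "vr s3 vWs = ws" "vr s3 vInf = R" "vr s3 vCnt = 0" "ar s3 = ar ?s" "vr s3 vNN = n * n" "vr s3 vDim = 3 * n" "vr s3 vL = L" "vr s3 53 = 2 ^ a"
          using 1(2) f2 v2 by (auto simp: frame_def fun_eq_iff)
        have q3: "1 \<le> vr s3 vq" "n \<le> vr s3 vq * vr s3 vq" "vr s3 vq * vr s3 vq \<le> 4 * n" using 1(1) by auto
        have "n * (vr s3 vq * vr s3 vq) \<le> n * (4 * n)" using q3(3) by (rule mult_le_mono2)
        moreover have "n * vr s3 vq * vr s3 vq = n * (vr s3 vq * vr s3 vq)" "n * (4 * n) = 4 * (n * n)" by simp_all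
        ultimately have q4: "n * vr s3 vq * vr s3 vq \<le> 4 * Lq" using nLq by linarith
        define s4 where "s4 = s3\<lparr>vr := (vr s3)(vU := U, 55 := U * U, 56 := U + U, vSl := (U + U) + (U + U), 54 := E),
          ar := upd3 (ar s3) aTab 0 0 0\<rparr>"
        have aW: "64 * 2 ^ a * 2 ^ e < W" "64 * 2 ^ a < W" "64 < W"
        proof -
          have "1 \<le> (2::nat) ^ e" "1 \<le> (2::nat) ^ a" by auto
          then have "64 * 2 ^ a * 1 \<le> 64 * 2 ^ a * (2::nat) ^ e" "64 * 1 \<le> 64 * (2::nat) ^ a" by (intro mult_le_mono; simp)+
          then show "64 * 2 ^ a * 2 ^ e < W" "64 * 2 ^ a < W" "64 < W" using UU(3) RW unfolding U_def by linarith+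
        qed
        have pw: "2 ^ (w - 1) < W" unfolding W_def using w1 by simp
        have UW: "U < W" "U * U < W" "U + U < W" "(U + U) + (U + U) < W" using UU RW by linarith+
        have Ed: "2 ^ (w - Suc 0) div U = E" by (simp add: E_def)
        have i4: "tri init4 s3 0 (\<lambda>s'. s' = s4)" unfolding init4_def
          using f3 aW pw UW RW w1 by (simp add: s4_def U_def[symmetric] Ed)
        show ?case
        proof (rule tri_Seq[OF i4, where Tb = "U + U * (Fu + 2)"], goal_cases)
          case (1 s4')
          have [simp]: "s4' = s4" using 1 by simp
          have g4: "vr s4 vU = U" "vr s4 55 = U * U" "ar s4 aTab 0 0 = 0" by (auto simp: s4_def)
          show ?case unfolding \<open>s4' = s4\<close>
          proof (rule tri_Seq[OF log_table_correct[OF g4(1) UR U1(1) g4(2,3)], where Tb = "U * (Fu + 2)"], goal_cases)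
            case (1 s5)
            have f5: "vr s5 vU = U" "vr s5 56 = 2 * U" "vr s5 vSl = 4 * U" "vr s5 54 = E" "vr s5 vL = L" "vr s5 vn = n" "vr s5 vNN = n * n" "vr s5 vDim = 3 * n"
              "vr s5 vWs = ws" "vr s5 vInf = R" "vr s5 vCnt = 0" "vr s5 vq = vr s3 vq" "ar s5 aMM = ar ?s aMM" "ar s5 0 0 = f"
              using 1(2) f3 by (auto simp: frame_def s4_def start_def)
            define s6 where "s6 = s5\<lparr>vr := (vr s5)(vS := stab U U)\<rparr>"
            have f6: "vr s6 vU = U" "vr s6 vS = stab U U" "\<forall>u\<le>U. ar s6 aTab 0 u = stab U u" using f5 1(1) by (auto simp: s6_def)
            have "tri (ratio_table ;; Wr aLt (N 0) (N 0) (N 0)) s6 (U * (Fu + 2)) (\<lambda>s'. env s' \<and> tabs s' \<and> vr s' vCnt = 0 \<and> ar s' 0 0 = f)"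
            proof (rule tri_Seq[OF ratio_table_correct[OF f6(1) UR U1(1) f6(2) Fu f6(3)], where Tb = 0])
              fix s7 assume h: "\<forall>j. 1 \<le> j \<longrightarrow> j \<le> U \<longrightarrow> ar s7 aLt 0 j = ltab U j" and fr: "frame (wv ratio_table) (wa ratio_table) s6 s7"
              have f7: "vr s7 vU = U" "vr s7 56 = 2 * U" "vr s7 vSl = 4 * U" "vr s7 54 = E" "vr s7 vL = L" "vr s7 vn = n" "vr s7 vNN = n * n" "vr s7 vDim = 3 * n"
                "vr s7 vWs = ws" "vr s7 vInf = R" "vr s7 vCnt = 0" "vr s7 vq = vr s3 vq" "ar s7 aMM = ar ?s aMM" "ar s7 0 0 = f" "vr s7 vS = stab U U" "\<forall>u\<le>U. ar s7 aTab 0 u = stab U u"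
                using fr f5 f6 by (auto simp: frame_def s6_def)
              have "env (s7\<lparr>ar := upd3 (ar s7) aLt 0 0 0\<rparr>)" unfolding env_def using f7 q3 q4 by (simp add: start_def)
              moreover have "tabs (s7\<lparr>ar := upd3 (ar s7) aLt 0 0 0\<rparr>)" unfolding tabs_def using f7 h by simp
              ultimately show "tri (Wr aLt (N 0) (N 0) (N 0)) s7 0 (\<lambda>s'. env s' \<and> tabs s' \<and> vr s' vCnt = 0 \<and> ar s' 0 0 = f)"
                using f7 RW by simp
            qed simp
            then show ?case using f5 1(1) UU RW by (simp add: s6_def)
          qed simp
        qed simp
      qed simp
    qed simp
  qed (simp add: tinit_def)
qed

lemma io_less: "i < n \<Longrightarrow> j < n \<Longrightarrow> 2 * (i * n + j) + 1 < R \<and> 2 * (i * n + j) + 1 < W \<and> i * n + j < W \<and> i * n < W \<and> i < R \<and> j < R"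
proof -
  assume ij: "i < n" "j < n"
  have "i * n + j < n * n" by (rule flat_less[OF ij])
  moreover have "2 * x + 1 < R \<and> x < R" if "x < y" "100 * y + 100 < R" for x y :: nat using that by linarith
  ultimately have "2 * (i * n + j) + 1 < R" "i * n + j < R" using nR by blast+
  moreover have "i * n \<le> i * n + j" by simp
  ultimately have "2 * (i * n + j) + 1 < R" "2 * (i * n + j) + 1 < W" "i * n + j < W" "i * n < W" using RW by linarith+
  moreover have "i < R" "j < R" using nle ij by linarith+
  ultimately show ?thesis by blast
qed

definition D0 :: "nat \<Rightarrow> nat \<Rightarrow> nat" where
  "D0 i j = encoded R U E (f (2 * (i * n + j))) (f (2 * (i * n + j) + 1))"

lemma mant_div:
  assumes "2 ^ (w - 1) \<le> m" "m < 2 ^ w"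
  shows "U \<le> m div E" "m div E - U + 1 \<le> U"
proof -
  have "E \<noteq> 0" using UE(2) by simp
  then have "U = (U * E) div E" by (rule nonzero_mult_div_cancel_right[symmetric])
  also have "\<dots> \<le> m div E" using assms(1) UE(1) by (intro div_le_mono) simp
  finally show 1: "U \<le> m div E" .
  have "2 ^ w = (2 * U) * E" using UE(1) w1 by (cases w) (auto simp: mult.assoc)
  then have "m div E < 2 * U" using assms(2) by (simp add: less_mult_imp_div_less)
  then show "m div E - U + 1 \<le> U" using 1 by linarith
qed

lemma D0_le:
  assumes ij: "i < n" "j < n"
  shows "D0 i j \<le> R"
proof (cases "f (2 * (i * n + j)) = 0")
  case False
  let ?m = "f (2 * (i * n + j))" and ?x = "f (2 * (i * n + j) + 1)"
  have h: "2 ^ (w - 1) \<le> ?m" "?m < 2 ^ w" "(?x + 1) * (U * U) + 2 * U \<le> R" using fin[OF ij False] by auto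
  have "?x * stab U U \<le> ?x * (U * U)" using SU[of U] by (intro mult_le_mono2) simp
  moreover have "stab U (?m div E - U + 1) \<le> U * U" using mant_div[OF h(1,2)] by (intro SU)
  moreover have "(?x + 1) * (U * U) = ?x * (U * U) + U * U" by simp
  ultimately show ?thesis using h(3) unfolding D0_def encoded_def if_not_P[OF False] by linarith
qed (simp add: D0_def encoded_def)

lemma encode_correct:
  assumes e: "env s" and t: "tabs s" and f: "ar s 0 0 = f"
  shows "tri encode s (n * (n + 1)) (\<lambda>s'. \<forall>i<n. \<forall>j<n. ar s' aD i j = D0 i j)"
  unfolding encode_def
proof (rule tri_For[where m = n and b = n and I = "\<lambda>i s'. \<forall>i'<i. \<forall>j<n. ar s' aD i' j = D0 i' j"], goal_cases)
  case (7 i s1)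
  have f1: "vr s1 vn = n" using 7(5) e by (auto simp: frame_def env_def)
  note i = 7(1,2)
  have fr1: "frame {30, 31, 60, 61, 62} {3} s s1" using 7(5) by (rule frame_mono) auto
  show ?case
  proof (rule tri_For[where m = n and b = 0 and I = "\<lambda>j s'. (\<forall>i'<i. \<forall>j<n. ar s' aD i' j = D0 i' j) \<and> (\<forall>j'<j. ar s' aD i j' = D0 i j')"], goal_cases)
    case (7 j s2)
    have "frame {30, 31, 60, 61, 62} {3} s1 s2" using 7(5) by (rule frame_mono) auto
    then have fr2: "frame {30, 31, 60, 61, 62} {3} s s2" using frame_trans[OF fr1] by fastforce
    have t2: "tabs s2" by (rule tabs_frame[OF t fr2]) auto
    have e2: "env s2" by (rule env_frame[OF e fr2]) auto
    have f2: "ar s2 0 0 = f" using fr2 f by (auto simp: frame_def)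
    have i2: "vr s2 30 = i" using 7(5) i by (auto simp: frame_def)
    have tt: "vr s2 vU = U" "vr s2 vS = stab U U" "vr s2 56 = 2 * U" "vr s2 54 = E" "\<And>u. u \<le> U \<Longrightarrow> ar s2 aTab 0 u = stab U u"
      using t2 by (auto simp: tabs_def)
    let ?m = "f (2 * (i * n + j))" and ?x = "f (2 * (i * n + j) + 1)"
    note io = io_less[OF i(1) 7(1)]
    show ?case
    proof (cases "?m = 0")
      case True
      then have "D0 i j = R" by (simp add: D0_def encoded_def)
      then show ?thesis using True 7 i2 f2 io RW e2 by (auto simp: env_D less_Suc_eq)
    next
      case False
      have h: "2 ^ (w - 1) \<le> ?m" "?m < 2 ^ w" using fin[OF i(1) 7(1) False] by auto
      note md = mant_div[OF h]
      have d: "D0 i j = ?x * stab U U + stab U (?m div E - U + 1) + 2 * U" using False by (simp add: D0_def encoded_def)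
      have dW: "?x * stab U U < W" "?x * stab U U + stab U (?m div E - U + 1) < W" "?x * stab U U + stab U (?m div E - U + 1) + 2 * U < W"
        using D0_le[OF i(1) 7(1)] RW unfolding d by linarith+
      have mR: "?m div E - U + 1 < R" "?m div E - U + 1 < W" using md(2) UU(3) RW by linarith+
      show ?thesis using False 7 i2 f2 io RW e2 tt md dW mR d tt(5)[OF md(2)] by (auto simp: env_D less_Suc_eq)
    qed
  qed (use 7 f1 nle in \<open>auto simp: less_Suc_eq\<close>)
qed (use e nle in \<open>auto simp: env_D\<close>)

text \<open>The search stops at index \<open>U\<close> at the latest, as the remainder is smaller
  than a full octave \<open>stab U U\<close>.\<close>

lemma decode1_correct:
  assumes t: "tabs s" and m: "vr s 63 = y" "y < stab U U"
  shows "tri decode1 s (Suc U) (\<lambda>s'. vr s' 64 \<le> U \<and> y \<le> stab U (vr s' 64) \<and> (\<forall>u'<vr s' 64. stab U u' < y))"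
proof -
  let ?s = "s\<lparr>vr := (vr s)(64 := 0)\<rparr>"
  have tb: "ar s aTab 0 u = stab U u" if "u \<le> U" for u using t that by (simp add: tabs_def)
  have "tri (While (Rd aTab (N 0) (V 64)) (V 63) (Assign 64 (V 64 \<oplus> N 1))) ?s (Suc U * Suc 0)
    (\<lambda>s'. vr s' 64 \<le> U \<and> y \<le> stab U (vr s' 64) \<and> (\<forall>u'<vr s' 64. stab U u' < y))"
  proof (rule tri_While[where I = "\<lambda>f s'. vr s' 64 + f = U \<and> (\<forall>u'<vr s' 64. stab U u' < y)" and F = U and b = 0], goal_cases)
    case (2 f s1)
    then have "vr s1 64 < R" using UU(3) by linarith
    then show ?case using RW by simp
  next
    case (3 f s1)
    have v: "vr s1 63 = y" "ar s1 aTab = ar s aTab" using 3(2) m by (auto simp: frame_def)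
    have "vr s1 64 \<le> U" using 3(1) by linarith
    then have l: "stab U (vr s1 64) < y" using 3 v tb by simp
    then have "f \<noteq> 0" using 3(1) m(2) by (cases f) auto
    then obtain f' where f': "f = Suc f'" using not0_implies_Suc by blast
    have "vr s1 64 + 1 < W" using 3(1) UU(3) RW by linarith
    moreover have "\<exists>f''<f. Suc (vr s1 64) + f'' = U \<and> (\<forall>u'<Suc (vr s1 64). stab U u' < y)"
      using 3(1) f' l by (intro exI[of _ f']) (auto simp: less_Suc_eq)
    ultimately show ?case using RW by simp
  next
    case (4 f s1)
    have v: "vr s1 63 = y" "ar s1 aTab = ar s aTab" using 4(2) m by (auto simp: frame_def)
    have "vr s1 64 \<le> U" using 4(1) by linarith
    then show ?case using 4 v tb by simp
  qed auto
  then show ?thesis unfolding decode1_def using RW by simp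
qed

lemma flat_eq_io: "j < n \<Longrightarrow> j' < n \<Longrightarrow> 2 * (i * n + j) = 2 * (i' * n + j') \<longleftrightarrow> i = i' \<and> j = j'"
  "2 * (i * n + j) \<noteq> 2 * (i' * n + j') + 1" "2 * (i * n + j) + 1 \<noteq> 2 * (i' * n + j')"
proof -
  show "j < n \<Longrightarrow> j' < n \<Longrightarrow> 2 * (i * n + j) = 2 * (i' * n + j') \<longleftrightarrow> i = i' \<and> j = j'"
    using flat_eq[of j n j' i i'] by (metis mult_left_cancel zero_neq_numeral)
  show "2 * (i * n + j) \<noteq> 2 * (i' * n + j') + 1" "2 * (i * n + j) + 1 \<noteq> 2 * (i' * n + j')" by presburger+
qed

definition written :: "nat \<Rightarrow> nat \<Rightarrow> nat \<Rightarrow> nat \<Rightarrow> nat \<Rightarrow> bool" where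
  "written d i j m x \<longleftrightarrow> (if i = j then m = 0 \<and> x = 0 else decoded R U E d m x)"

definition decode_entry :: com where
  "decode_entry = If (V 65) (N 1) Skip (
       If (Rd aD (V 30) (V 31)) (V vInf)
         (Assign 61 (Rd aD (V 30) (V 31) \<oplus> V 56) ;; Assign 67 (V 61 \<oslash> V vS) ;; Assign 63 (V 61 \<odot> V vS) ;; decode1 ;;
          If (V 64) (V vU) (Assign 66 ((V vU \<oplus> V 64) \<otimes> V 54)) (Assign 66 (V vU \<otimes> V 54) ;; Assign 67 (V 67 \<oplus> N 1)))
         (Assign 67 (N 1)))"

lemma decode_entry_correct:
  assumes e: "env s" and t: "tabs s" and v: "vr s 30 = i" "vr s 31 = j" "i < R" "j < R" "vr s 65 = (if i = j then 0 else 1)" "vr s 66 = 0" "vr s 67 = 0"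
    and d: "ar s aD i j \<le> R"
  shows "tri decode_entry s (Suc U) (\<lambda>s'. written (ar s aD i j) i j (vr s' 66) (vr s' 67))"
proof -
  have tt: "vr s vU = U" "vr s vS = stab U U" "vr s 56 = 2 * U" "vr s 54 = E" using t by (auto simp: tabs_def)
  let ?d = "ar s aD i j"
  show ?thesis
  proof (cases "i = j \<or> ?d = R")
    case True
    then show ?thesis using v e RW d unfolding decode_entry_def by (auto simp: written_def decoded_def env_D)
  next
    case False
    then have dl: "?d < R" "i \<noteq> j" using d by auto
    let ?x = "?d + 2 * U" and ?S = "stab U U"
    define s1 where "s1 = s\<lparr>vr := (vr s)(61 := ?x, 67 := ?x div ?S, 63 := ?x mod ?S)\<rparr>"
    have S0: "0 < ?S" using S_pos U1 by linarith
    have t1: "tabs s1" using t by (auto simp: tabs_def s1_def)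
    have y1: "vr s1 63 = ?x mod ?S" "?x mod ?S < ?S" using S0 by (auto simp: s1_def)
    have "tri (decode1 ;; If (V 64) (V vU) (Assign 66 ((V vU \<oplus> V 64) \<otimes> V 54)) (Assign 66 (V vU \<otimes> V 54) ;; Assign 67 (V 67 \<oplus> N 1))) s1 (Suc U)
      (\<lambda>s'. written ?d i j (vr s' 66) (vr s' 67))"
    proof (rule tri_Seq[OF decode1_correct[OF t1 y1], where Tb = 0], goal_cases)
      case (1 s2)
      have f2: "vr s2 vU = U" "vr s2 54 = E" "vr s2 67 = ?x div ?S" using 1(2) tt by (auto simp: frame_def s1_def)
      let ?u = "vr s2 64"
      have u: "?u \<le> U" "?x mod ?S \<le> stab U ?u" "\<forall>u'<?u. stab U u' < ?x mod ?S" using 1(1) by auto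
      have xW: "?x div ?S + 1 < W" using div_le_dividend[of ?x ?S] dl(1) UU(3) RW by linarith
      have E2: "2 * U * E = 2 ^ w" using UE(1) w1 by (cases w) (auto simp: mult.assoc)
      have UEW: "U * E < W" using UE(1) w1 W_def by simp
      show ?case
      proof (cases "?u < U")
        case True
        have "(U + ?u) * E < 2 * U * E" using True UE(2) by (intro mult_strict_right_mono) auto
        then have m: "(U + ?u) * E < W" using E2 W_def by simp
        have "U + ?u < W" using True UU(3) RW by linarith
        moreover have "written ?d i j ((U + ?u) * E) (?x div ?S)"
          unfolding written_def decoded_def using dl u True by (auto intro!: exI[of _ ?u])
        ultimately show ?thesis using True f2 m by simp
      next
        case False
        then have "written ?d i j (U * E) (?x div ?S + 1)"
          unfolding written_def decoded_def using dl u by (auto intro!: exI[of _ ?u])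
        then show ?thesis using False f2 UEW xW RW by simp
      qed
    qed simp
    then show ?thesis using tt v dl e RW UU(3) unfolding decode_entry_def by (simp add: s1_def env_D)
  qed
qed

lemma decode_correct:
  assumes e: "env s" and t: "tabs s" and d: "\<And>i j. i < n \<Longrightarrow> j < n \<Longrightarrow> ar s aD i j \<le> R"
  shows "tri decode s (n * (n * (U + 2) + 1)) (\<lambda>s'. \<forall>i<n. \<forall>j<n. written (ar s aD i j) i j (ar s' 0 0 (2 * (i * n + j))) (ar s' 0 0 (2 * (i * n + j) + 1)))"
proof -
  define J where "J i j s' \<longleftrightarrow> (\<forall>i'<n. \<forall>j'<n. i' < i \<or> i' = i \<and> j' < j \<longrightarrow>
    written (ar s aD i' j') i' j' (ar s' 0 0 (2 * (i' * n + j'))) (ar s' 0 0 (2 * (i' * n + j') + 1)))" for i j and s' :: store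
  have Jn: "J i n s' \<longleftrightarrow> J (Suc i) 0 s'" for i s' unfolding J_def by (auto simp: less_Suc_eq)
  have Jv: "J i j (s'\<lparr>vr := g\<rparr>) \<longleftrightarrow> J i j s'" for i j s' g unfolding J_def by simp
  let ?X = "{30, 31, 60, 65, 66, 67, 61, 63, 64}"
  have "tri decode s (n * (n * (U + 2) + 1)) (\<lambda>s'. J n 0 s')"
    unfolding decode_def decode_entry_def[symmetric]
  proof (rule tri_For[where m = n and b = "n * (U + 2)" and I = "\<lambda>i s'. J i 0 s'"], goal_cases)
    case (7 i s1)
    have fr1: "frame ?X {0} s s1" using 7(5) by (rule frame_mono) (auto simp: decode_entry_def)
    have f1: "vr s1 vn = n" using fr1 e by (auto simp: frame_def env_def)
    note i = 7(1,2)
    show ?case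
    proof (rule tri_For[where m = n and b = "U + 1" and I = "\<lambda>j s'. J i j s'"], goal_cases)
      case (7 j s2)
      have "frame ?X {0} s1 s2" using 7(5) by (rule frame_mono) (auto simp: decode_entry_def)
      then have fr2: "frame ?X {0} s s2" using frame_trans[OF fr1] by fastforce
      have i2: "vr s2 30 = i" "vr s2 vn = n" using 7(5) i f1 by (auto simp: frame_def decode_entry_def)
      note io = io_less[OF i(1) 7(1)]
      define s3 where "s3 = s2\<lparr>vr := (vr s2)(60 := 2 * (i * n + j), 65 := (if i = j then 0 else 1), 66 := 0, 67 := 0)\<rparr>"
      have fr3: "frame ?X {0} s s3" using fr2 by (auto simp: frame_def s3_def)
      have t3: "tabs s3" by (rule tabs_frame[OF t fr3]) auto
      have e3: "env s3" by (rule env_frame[OF e fr3]) auto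
      have D3: "ar s3 aD = ar s aD" "ar s3 0 = ar s2 0" using fr3 by (auto simp: frame_def s3_def)
      have v3: "vr s3 30 = i" "vr s3 31 = j" "vr s3 65 = (if i = j then 0 else 1)" "vr s3 66 = 0" "vr s3 67 = 0" "vr s3 60 = 2 * (i * n + j)"
        using i2 7(2) by (auto simp: s3_def)
      have d3: "ar s3 aD i j \<le> R" using D3 d[OF i(1) 7(1)] by simp
      have iR: "i < R" "j < R" using io by auto
      have "tri (decode_entry ;; Wr 0 (N 0) (V 60) (V 66) ;; Wr 0 (N 0) (V 60 \<oplus> N 1) (V 67)) s3 (U + 1)
        (\<lambda>s'. J i (Suc j) (s'\<lparr>vr := (vr s')(31 := Suc j)\<rparr>))"
      proof (rule tri_Seq[OF decode_entry_correct[OF e3 t3 v3(1,2) iR v3(3,4,5) d3], where Tb = 0], goal_cases)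
        case (1 s4)
        have f4: "vr s4 60 = 2 * (i * n + j)" "ar s4 0 = ar s2 0" using 1(2) v3 D3 by (auto simp: frame_def decode_entry_def)
        let ?s5 = "s4\<lparr>ar := upd3 (upd3 (ar s4) 0 0 (2 * (i * n + j)) (vr s4 66)) 0 0 (2 * (i * n + j) + 1) (vr s4 67)\<rparr>"
        have "J i (Suc j) ?s5" unfolding J_def
        proof (intro allI impI)
          fix i' j' assume h: "i' < n" "j' < n" "i' < i \<or> i' = i \<and> j' < Suc j"
          show "written (ar s aD i' j') i' j' (ar ?s5 0 0 (2 * (i' * n + j'))) (ar ?s5 0 0 (2 * (i' * n + j') + 1))"
          proof (cases "i' = i \<and> j' = j")
            case True
            then show ?thesis using 1(1) D3(1) by simp
          next
            case False
            have "2 * (i' * n + j') \<noteq> 2 * (i * n + j)" "2 * (i' * n + j') + 1 \<noteq> 2 * (i * n + j)" "2 * (i' * n + j') \<noteq> 2 * (i * n + j) + 1"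
              using flat_eq_io(1)[OF h(2) 7(1), of i' i] flat_eq_io(2,3)[of i' j' i j] False by auto
            then have "ar ?s5 0 0 (2 * (i' * n + j')) = ar s2 0 0 (2 * (i' * n + j'))" "ar ?s5 0 0 (2 * (i' * n + j') + 1) = ar s2 0 0 (2 * (i' * n + j') + 1)"
              using f4(2) by simp_all
            then show ?thesis using 7(4) h False unfolding J_def by (auto simp: less_Suc_eq)
          qed
        qed
        then have "J i (Suc j) (?s5\<lparr>vr := (vr s4)(31 := Suc j)\<rparr>)" using Jv by blast
        then show ?case using f4 io RW by simp
      qed simp
      then show ?case using i2 7(2) io RW by (auto simp: s3_def fun_upd_twist)
    qed (use 7 f1 nle Jn Jv in \<open>auto simp: decode_entry_def\<close>)
  qed (use e nle in \<open>auto simp: J_def decode_entry_def env_D\<close>)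
  then show ?thesis by (rule tri_weaken) (auto simp: J_def)
qed

definition tmain :: nat where
  "tmain = tinit + n * (n + 1) + L * Suc (2 * (n * (n + 1)) + 2 * thalf G U) + n * (n * (U + 2) + 1)"

lemma main_correct:
  "tri main (start w n e f) tmain (\<lambda>s'. \<exists>D. squares n (ltab U) (\<lambda>t. stab U t + 4 * U) U L D0 D \<and>
     (\<forall>i<n. \<forall>j<n. written (D i j) i j (ar s' 0 0 (2 * (i * n + j))) (ar s' 0 0 (2 * (i * n + j) + 1))))"
  unfolding main_def
proof (rule tri_Seq[OF init_correct, where Tb = "n * (n + 1) + L * Suc (2 * (n * (n + 1)) + 2 * thalf G U) + n * (n * (U + 2) + 1)"], goal_cases)
  case (1 s1)
  then have e1: "env s1" and t1: "tabs s1" and c1: "vr s1 vCnt = 0" and f1: "ar s1 0 0 = f" by auto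
  show ?case
  proof (rule tri_Seq[OF encode_correct[OF e1 t1 f1], where Tb = "L * Suc (2 * (n * (n + 1)) + 2 * thalf G U) + n * (n * (U + 2) + 1)"], goal_cases)
    case (1 s2)
    have e2: "env s2" by (rule env_frame[OF e1 1(2)]) auto
    have t2: "tabs s2" by (rule tabs_frame[OF t1 1(2)]) auto
    have c2: "vr s2 vCnt = 0" using 1(2) c1 by (auto simp: frame_def)
    have D2: "\<And>i j. i < n \<Longrightarrow> j < n \<Longrightarrow> ar s2 aD i j = D0 i j" using 1(1) by blast
    let ?sq = "squares n (ltab U) (\<lambda>t. stab U t + 4 * U) U"
    define J where "J l s' \<longleftrightarrow> env s' \<and> tabs s' \<and> vr s' vCnt \<le> 2 * (l * (U * cstep)) \<and> ?sq l D0 (ar s' aD) \<and> (\<forall>i<n. \<forall>j<n. ar s' aD i j \<le> R)" for l and s' :: store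
    have loop: "tri (For 68 vL square) s2 (L * Suc (2 * (n * (n + 1)) + 2 * thalf G U)) (\<lambda>s'. J L s')"
    proof (rule tri_For[where m = L and b = "2 * (n * (n + 1)) + 2 * thalf G U" and I = J], goal_cases)
      case (7 l s3)
      have J3: "env s3" "tabs s3" "vr s3 vCnt \<le> 2 * (l * (U * cstep))" "?sq l D0 (ar s3 aD)" "\<And>i j. i < n \<Longrightarrow> j < n \<Longrightarrow> ar s3 aD i j \<le> R"
        using 7(4) by (auto simp: J_def)
      have tt: "vr s3 vU = U" "vr s3 vSl = 4 * U" "\<And>u. u \<le> U \<Longrightarrow> ar s3 aTab 0 u = stab U u" "\<And>j. 1 \<le> j \<Longrightarrow> j \<le> U \<Longrightarrow> ar s3 aLt 0 j = ltab U j" "ar s3 aLt 0 0 = 0"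
        using J3(2) by (auto simp: tabs_def)
      have UR': "U < R" using UU(3) by linarith
      have "Suc l * (U * cstep) \<le> L * (U * cstep)" using 7(1) by (intro mult_right_mono) auto
      then have cc: "vr s3 vCnt + 2 * (U * cstep) \<le> R" using J3(3) cR by simp
      have lt: "ar s3 aLt 0 t \<le> R" if "t \<le> U" for t
      proof (cases "t = 0")
        case False
        have "ltab U t \<le> lvl U t * stab U U" by (simp add: ltab_def)
        also have "\<dots> \<le> U * (U * U)" using lvl_props(3)[of t U] False that SU[of U] by (intro mult_le_mono) auto
        finally have "ltab U t \<le> U * U * U" by (simp add: mult.assoc)
        then show ?thesis using tt(4)[of t] False that UR by simp
      qed (use tt in simp)
      have La: "ar s3 aTab 0 t + vr s3 vSl \<le> R" if "t \<le> U" for t using tt(2,3) that SU[OF that] UU by simp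
      show ?case
      proof (rule tri_weaken[OF square_correct[OF J3(1) G tt(1) UR' cc J3(5) lt La]], goal_cases)
        case (6 s4)
        have "tabs s4" by (rule tabs_frame[OF J3(2) 6(2)]) auto
        then have t4: "tabs (s4\<lparr>vr := (vr s4)(68 := Suc l)\<rparr>)" by (auto simp: tabs_def)
        have e4: "env (s4\<lparr>vr := (vr s4)(68 := Suc l)\<rparr>)" using 6(1) by (intro env_vr) auto
        have "squared n (ar s3 aD) (ar s3 aLt 0) (\<lambda>t. ar s3 aTab 0 t + vr s3 vSl) U (ar s4 aD) = squared n (ar s3 aD) (ltab U) (\<lambda>t. stab U t + 4 * U) U (ar s4 aD)"
          by (rule squared_cong) (use tt in auto)
        then have sq4: "squared n (ar s3 aD) (ltab U) (\<lambda>t. stab U t + 4 * U) U (ar s4 aD)" using 6(1) by blast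
        then have "?sq (Suc l) D0 (ar s4 aD)" using J3(4) by auto
        moreover have "ar s4 aD i j \<le> R" if "i < n" "j < n" for i j using sq4 that J3(5)[OF that] unfolding squared_def by (meson le_trans)
        moreover have "vr s4 vCnt \<le> 2 * (Suc l * (U * cstep))" using 6(1) J3(3) by simp
        ultimately show ?case using t4 e4 by (simp add: J_def del: squares.simps)
      qed auto
    next
      case 6
      have "env (s2\<lparr>vr := (vr s2)(68 := 0)\<rparr>)" using e2 by (intro env_vr) auto
      moreover have "tabs (s2\<lparr>vr := (vr s2)(68 := 0)\<rparr>)" using t2 by (auto simp: tabs_def)
      ultimately show ?case using c2 D2 D0_le by (simp add: J_def)
    qed (use t2 L_less RW in \<open>auto simp: tabs_def\<close>)
    show ?case
    proof (rule tri_Seq[OF loop, where Tb = "n * (n * (U + 2) + 1)"], goal_cases)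
      case (1 s3)
      have J3: "env s3" "tabs s3" "?sq L D0 (ar s3 aD)" "\<And>i j. i < n \<Longrightarrow> j < n \<Longrightarrow> ar s3 aD i j \<le> R" using 1(1) by (auto simp: J_def)
      show ?case
        by (rule tri_weaken[OF decode_correct[OF J3(1,2,4)]]) (use J3(3) in blast)+
    qed simp
  qed simp
qed (simp add: tmain_def)

end

section \<open>Accuracy of the logarithmic scale\<close>

lemma nat_div_bounds:
  assumes "0 < y"
  shows "real (x div y) \<le> real x / real y" "real x / real y \<le> real (x div y) + 1"
proof -
  have "real x = real (x div y) * real y + real (x mod y)" by (metis div_mult_mod_eq of_nat_add of_nat_mult)
  moreover have "real (x mod y) \<le> real y" using assms by (simp add: less_imp_le)
  ultimately show "real (x div y) \<le> real x / real y" "real x / real y \<le> real (x div y) + 1"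
    using assms by (auto simp: field_simps)
qed

locale log_scale =
  fixes U :: nat
  assumes U64: "64 \<le> U"
begin

abbreviation S :: real where "S \<equiv> real (stab U U)"

text \<open>The real number represented by a key. The unit is derived from the tabulated octave
  \<open>S\<close> rather than from \<open>U\<^sup>2 ln 2\<close>, so that whole octaves are exact
  powers of two.\<close>

definition val :: "real \<Rightarrow> real" where "val x = 2 powr (x / S)"

lemma U0: "0 < real U" "64 \<le> real U" using U64 by auto

lemma ln_step: "ln (1 + real (Suc u) / real U) = ln (1 + real u / real U) + ln (1 + 1 / (real U + real u))"
proof -
  have p: "0 < real U + real u" using U0 by simp
  have "(1 + real u / real U) * (1 + 1 / (real U + real u)) = 1 + real (Suc u) / real U"
  proof -
    have "1 + real u / real U = (real U + real u) / real U" "1 + 1 / (real U + real u) = (real U + real u + 1) / (real U + real u)"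
      "1 + real (Suc u) / real U = (real U + real u + 1) / real U" using p U0 by (auto simp: add_divide_distrib)
    then show ?thesis using p by simp
  qed
  moreover have "0 < 1 + real u / real U" "0 < 1 + 1 / (real U + real u)" using p U0 by (auto intro!: add_pos_nonneg)
  ultimately show ?thesis using ln_mult_pos[of "1 + real u / real U" "1 + 1 / (real U + real u)"] by metis
qed

lemma stab_Suc: "stab U (Suc u) = stab U u + (U * U) div (U + u)" by (simp add: stab_def)

text \<open>Telescoping with \<open>ln (1 + 1 / y) \<le> 1 / y\<close>; each integer division loses
  at most \<open>1\<close>.\<close>

lemma stab_lower: "real U * real U * ln (1 + real u / real U) - real u \<le> real (stab U u)"
proof (induction u)
  case 0
  then show ?case by (simp add: stab_def)
next
  case (Suc u)
  have p: "0 < real U + real u" using U0 by simp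
  have "ln (1 + 1 / (real U + real u)) \<le> 1 / (real U + real u)" using p by (intro ln_add_one_self_le_self) simp
  then have "real U * real U * ln (1 + 1 / (real U + real u)) \<le> real U * real U * (1 / (real U + real u))"
    by (rule mult_left_mono) simp
  also have "\<dots> = real (U * U) / real (U + u)" by simp
  also have "\<dots> \<le> real ((U * U) div (U + u)) + 1"
    using U64 by (intro nat_div_bounds) simp
  finally show ?case using Suc unfolding ln_step stab_Suc by (simp add: algebra_simps)
qed

text \<open>Telescoping with \<open>1 / (y + 1) \<le> ln (1 + 1 / y)\<close>; the differences
  \<open>1 / y - 1 / (y + 1)\<close> add up to the last term.\<close>

lemma stab_upper': "real (stab U u) \<le> real U * real U * ln (1 + real u / real U) + real U * real U * (1 / real U - 1 / (real U + real u))"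
proof (induction u)
  case 0
  then show ?case by (simp add: stab_def)
next
  case (Suc u)
  let ?x = "real U + real u"
  have p: "0 < ?x" using U0 by simp
  have "ln (1 - 1 / (?x + 1)) \<le> - (1 / (?x + 1))" using ln_le_minus_one[of "1 - 1 / (?x + 1)"] p by simp
  moreover have "ln (1 + 1 / ?x) = - ln (1 - 1 / (?x + 1))"
  proof -
    have "1 - 1 / (?x + 1) = inverse (1 + 1 / ?x)" using p by (simp add: field_simps)
    then show ?thesis using p by (simp add: ln_inverse add_pos_pos)
  qed
  ultimately have "1 / (?x + 1) \<le> ln (1 + 1 / ?x)" by simp
  then have l: "real U * real U * (1 / (?x + 1)) \<le> real U * real U * ln (1 + 1 / ?x)" by (rule mult_left_mono) simp
  have "real ((U * U) div (U + u)) \<le> real U * real U * (1 / ?x)" using nat_div_bounds(1)[of "U + u" "U * U"] U64 by simp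
  then show ?case using l Suc unfolding ln_step stab_Suc by (simp add: algebra_simps)
qed

lemma stab_upper:
  assumes "u \<le> U"
  shows "real (stab U u) \<le> real U * real U * ln (1 + real u / real U) + real U / 2"
proof -
  have "real U * real U * (1 / (2 * real U)) \<le> real U * real U * (1 / (real U + real u))"
    using assms U0 by (intro mult_left_mono divide_left_mono) auto
  then have "real U * real U * (1 / real U - 1 / (real U + real u)) \<le> real U / 2" using U0 by (simp add: algebra_simps)
  then show ?thesis using stab_upper'[of u] by linarith
qed

text \<open>Uses \<open>2 = 4 / 3 * (3 / 2)\<close> and \<open>ln y \<le> y - 1\<close> at the
  reciprocals of the factors: \<open>1 / 4 + 1 / 3 = 7 / 12\<close>.\<close>

lemma ln2: "7 / 12 \<le> ln (2::real)" "ln (2::real) \<le> 1"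
proof -
  have "ln (2::real) = - ln (3 / 4) - ln (2 / 3)" using ln_mult[of "3 / 4" "2 / 3 :: real"] ln_inverse[of "2::real"] by (simp add: inverse_eq_divide)
  then show "7 / 12 \<le> ln (2::real)" using ln_le_minus_one[of "3 / 4 :: real"] ln_le_minus_one[of "2 / 3 :: real"] by simp
  show "ln (2::real) \<le> 1" using ln_le_minus_one[of "2::real"] by simp
qed

text \<open>The octave is at least \<open>U\<^sup>2 * 7 / 12 - U\<close>; because \<open>U\<close>
  is at least \<open>64\<close>, the surplus over \<open>U\<^sup>2 / 2\<close> covers the error
  \<open>U\<close>.\<close>

lemma S_ge: "real U * real U / 2 \<le> S" "0 < S"
proof -
  have "real U * real U * ln 2 - real U \<le> S" using stab_lower[of U] U0 by simp
  moreover have "real U * real U * (7 / 12) \<le> real U * real U * ln 2" using ln2 by (intro mult_left_mono) auto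
  moreover have "64 * real U \<le> real U * real U" using U0 by (intro mult_right_mono) auto
  ultimately show 1: "real U * real U / 2 \<le> S" using U0 by linarith
  have "0 < real U * real U" using U0 by simp
  then show "0 < S" using 1 by linarith
qed

text \<open>The error of the entry itself and that of the octave \<open>S\<close>, scaled by
  \<open>r \<le> 1\<close>, add up to at most \<open>2 * U\<close>. This is the origin of the
  corrections \<open>2 * U\<close> and \<open>4 * U\<close> in the program.\<close>

lemma stab_log:
  assumes "u \<le> U"
  shows "\<bar>real (stab U u) - S * log 2 (1 + real u / real U)\<bar> \<le> 2 * real U"
proof -
  define r where "r = log 2 (1 + real u / real U)"
  define h where "h = real U * real U * ln 2"
  have u: "1 + real u / real U \<le> 2" "1 \<le> 1 + real u / real U" using assms U0 by auto
  have "r \<le> log 2 2" unfolding r_def using u by (intro log_mono) linarith+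
  then have r: "r \<le> 1" by simp
  have r0: "0 \<le> r" unfolding r_def using u(2) by (subst zero_le_log_cancel_iff) linarith+
  note r = r0 r
  have hr: "real U * real U * ln (1 + real u / real U) = r * h" by (simp add: r_def h_def log_def)
  have S: "h - real U \<le> S" "S \<le> h + real U / 2" using stab_lower[of U] stab_upper[of U] U0 by (auto simp: h_def)
  have "r * (h - real U) \<le> r * S" "r * S \<le> r * (h + real U / 2)" using S r by (intro mult_left_mono; simp)+
  then have "r * h - r * real U \<le> r * S" "r * S \<le> r * h + r * real U / 2" by (auto simp: algebra_simps)
  moreover have "r * real U \<le> real U" using r U0 by (simp add: mult_left_le_one_le)
  moreover have "r * h - real u \<le> real (stab U u)" "real (stab U u) \<le> r * h + real U / 2"
    using stab_lower[of u] stab_upper[OF assms] hr by auto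
  moreover have "real u \<le> real U" using assms by simp
  ultimately have "real (stab U u) - r * S \<le> 2 * real U" "r * S - real (stab U u) \<le> 2 * real U" using U0 by linarith+
  then show ?thesis unfolding r_def[symmetric] by (simp add: abs_le_iff mult.commute)
qed

lemma val_add: "val (x + y) = val x * val y" by (simp add: val_def add_divide_distrib powr_add)
lemma val_mono: "x \<le> y \<Longrightarrow> val x \<le> val y" using S_ge by (simp add: val_def divide_right_mono)
lemma val_pos: "0 < val x" by (simp add: val_def)
lemma val_log: "0 < x \<Longrightarrow> val (S * log 2 x) = x" using S_ge by (simp add: val_def)
lemma val_S: "val (real k * S) = 2 ^ k" using S_ge by (simp add: val_def powr_realpow)

text \<open>The factor that belongs to a key difference of \<open>2 * U\<close>, the bound on a
  table error.\<close>

definition \<beta> :: real where "\<beta> = val (2 * real U)"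
text \<open>The loss of one squaring: four table errors, and the rounding of a ratio to a multiple
  of \<open>1 / U\<close>. Encoding and decoding lose no more than
  \<open>\<beta> ^ 2 * (1 + 1 / U)\<close>.\<close>

definition \<gamma> :: real where "\<gamma> = \<beta> ^ 4 * (1 + 1 / real U)"

lemma \<beta>_ge: "1 \<le> \<beta>" unfolding \<beta>_def val_def using S_ge U0 by (intro ge_one_powr_ge_zero) auto

lemma \<gamma>_ge: "\<beta> ^ 2 * (1 + 1 / real U) \<le> \<gamma>" "1 \<le> \<gamma>" "0 < \<gamma>"
proof -
  have "\<beta> ^ 2 \<le> \<beta> ^ 4" using \<beta>_ge by (intro power_increasing) auto
  then show 1: "\<beta> ^ 2 * (1 + 1 / real U) \<le> \<gamma>" unfolding \<gamma>_def using U0 by (intro mult_right_mono) auto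
  have "1 * 1 \<le> \<beta> ^ 2 * (1 + 1 / real U)" using \<beta>_ge U0 by (intro mult_mono one_le_power) auto
  then show "1 \<le> \<gamma>" "0 < \<gamma>" using 1 by linarith+
qed

text \<open>\<open>S \<ge> U\<^sup>2 / 2\<close> gives \<open>\<beta> \<le> exp (4 / U)\<close>;
  four such factors and \<open>1 + 1 / U \<le> exp (1 / U)\<close> make the
  \<open>17\<close>.\<close>

lemma \<gamma>_le: "\<gamma> \<le> exp (17 / real U)"
proof -
  have "2 * real U / S \<le> 2 * real U / (real U * real U / 2)" using S_ge U0 by (intro divide_left_mono) auto
  also have "\<dots> = 4 / real U" using U0 by (simp add: field_simps)
  finally have "2 * real U / S * ln 2 \<le> 4 / real U * 1" using ln2 U0 S_ge by (intro mult_mono) auto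
  then have "\<beta> \<le> exp (4 / real U)" by (simp add: \<beta>_def val_def powr_def)
  then have "\<beta> ^ 4 \<le> exp (4 / real U) ^ 4" using \<beta>_ge by (intro power_mono) auto
  moreover have "1 + 1 / real U \<le> exp (1 / real U)" by (rule exp_ge_add_one_self)
  ultimately have "\<gamma> \<le> exp (4 / real U) ^ 4 * exp (1 / real U)" unfolding \<gamma>_def using \<beta>_ge U0 by (intro mult_mono) auto
  also have "\<dots> = exp (17 / real U)" by (simp add: exp_of_nat_mult[symmetric] exp_add[symmetric] add_divide_distrib[symmetric])
  finally show ?thesis .
qed

lemma val_stab:
  assumes "u \<le> U"
  shows "1 + real u / real U \<le> val (real (stab U u) + 2 * real U)" "val (real (stab U u)) \<le> (1 + real u / real U) * \<beta>"
proof -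
  let ?x = "1 + real u / real U"
  have x: "0 < ?x" using U0 by (simp add: add_pos_nonneg)
  have "S * log 2 ?x \<le> real (stab U u) + 2 * real U" "real (stab U u) \<le> S * log 2 ?x + 2 * real U"
    using stab_log[OF assms] by linarith+
  then have "val (S * log 2 ?x) \<le> val (real (stab U u) + 2 * real U)" "val (real (stab U u)) \<le> val (S * log 2 ?x + 2 * real U)"
    by (auto intro!: val_mono)
  then show "?x \<le> val (real (stab U u) + 2 * real U)" "val (real (stab U u)) \<le> ?x * \<beta>"
    using val_log[OF x] by (auto simp: val_add \<beta>_def)
qed

text \<open>Writing \<open>j * 2 ^ s = U + y\<close> reduces the claim to the table entry at
  \<open>y\<close>, because the \<open>s\<close> octaves are exact.\<close>

lemma val_ltab:
  assumes "1 \<le> j" "j \<le> U"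
  shows "val (- real (ltab U j)) \<le> real j / real U * \<beta>" "real j / real U \<le> val (- real (ltab U j)) * \<beta>"
proof -
  let ?s = "lvl U j"
  note lp = lvl_props[OF assms]
  define y where "y = j * 2 ^ ?s - U"
  have y: "y \<le> U" "real y = real j * 2 ^ ?s - real U" using lp(1,2) by (auto simp: y_def of_nat_diff)
  have sy: "stab U y \<le> ?s * stab U U"
  proof (cases ?s)
    case 0
    then have "y = 0" using lp(1) assms by (simp add: y_def)
    then show ?thesis by (simp add: stab_def)
  next
    case (Suc k)
    have "stab U y \<le> 1 * stab U U" using stab_mono[OF y(1)] by simp
    also have "\<dots> \<le> ?s * stab U U" using Suc by (intro mult_right_mono) auto
    finally show ?thesis .
  qed
  have lt: "real (ltab U j) = real ?s * S - real (stab U y)" unfolding ltab_def y_def[symmetric] using sy by (simp add: of_nat_diff)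
  let ?x = "1 + real y / real U"
  have x: "?x = real j / real U * 2 ^ ?s" using y(2) U0 by (simp add: field_simps)
  have x0: "0 < real j / real U" using assms U0 by simp
  have "log 2 ?x = log 2 (real j / real U) + real ?s" unfolding x log_mult_pos[OF x0 zero_less_power[OF zero_less_numeral]] by (simp add: log_nat_power)
  then have "S * log 2 ?x = S * log 2 (real j / real U) + real ?s * S" by (simp add: algebra_simps)
  then have "- real (ltab U j) \<le> S * log 2 (real j / real U) + 2 * real U" "S * log 2 (real j / real U) \<le> - real (ltab U j) + 2 * real U"
    using stab_log[OF y(1)] lt by linarith+
  then have "val (- real (ltab U j)) \<le> val (S * log 2 (real j / real U) + 2 * real U)" "val (S * log 2 (real j / real U)) \<le> val (- real (ltab U j) + 2 * real U)"
    by (auto intro!: val_mono)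
  then show "val (- real (ltab U j)) \<le> real j / real U * \<beta>" "real j / real U \<le> val (- real (ltab U j)) * \<beta>"
    unfolding val_add val_log[OF x0] \<beta>_def by auto
qed

lemma ltab_U: "ltab U U = 0"
proof -
  have "lvl U U = 0" unfolding lvl_def by (rule Least_equality) auto
  then show ?thesis by (simp add: ltab_def stab_def)
qed

text \<open>The condition gives \<open>val b \<le> val a * (t / U)\<close> up to a factor
  \<open>\<beta>\<close>. One half of the slack \<open>4 * U\<close> pays for this factor, the other
  half for the table error at \<open>1 + t / U\<close>.\<close>

lemma candidate_sound:
  assumes "1 \<le> t" "t \<le> U" and b: "b + ltab U t \<le> a"
  shows "val (real a) + val (real b) \<le> val (real (a + (stab U t + 4 * U)))"
proof -
  have "real b \<le> real a + - real (ltab U t)" using b by linarith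
  then have "val (real b) \<le> val (real a) * val (- real (ltab U t))" using val_mono val_add by metis
  also have "\<dots> \<le> val (real a) * (real t / real U * \<beta>)" using val_ltab(1)[OF assms(1,2)] val_pos[of "real a"] by (intro mult_left_mono) auto
  also have "\<dots> \<le> val (real a) * (\<beta> * (1 + real t / real U)) - val (real a) * 1"
  proof -
    have "val (real a) * 1 \<le> val (real a) * \<beta>" using \<beta>_ge val_pos[of "real a"] by (intro mult_left_mono) auto
    then show ?thesis by (simp add: algebra_simps)
  qed
  finally have "val (real a) + val (real b) \<le> val (real a) * (\<beta> * (1 + real t / real U))" by simp
  also have "\<dots> \<le> val (real a) * (\<beta> * val (real (stab U t) + 2 * real U))"
    using val_stab(1)[OF assms(2)] \<beta>_ge val_pos[of "real a"] by (intro mult_left_mono) auto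
  also have "\<dots> = val (real (a + (stab U t + 4 * U)))" unfolding \<beta>_def val_add[symmetric] by (simp add: algebra_simps)
  finally show ?thesis .
qed

text \<open>The least admissible index is the witness; it exists because \<open>ltab U U = 0\<close>
  and \<open>b \<le> a\<close>. Minimality bounds \<open>t / U\<close> by \<open>\<beta>\<close>
  times \<open>val b / val a\<close>, so that the candidate with \<open>Suc t\<close> only costs
  another \<open>1 + 1 / U\<close>, besides table errors.\<close>

lemma candidate_complete:
  assumes "b \<le> a"
  shows "\<exists>t<U. b + ltab U (Suc t) \<le> a \<and> val (real (a + (stab U (Suc t) + 4 * U))) \<le> \<gamma> * (val (real a) + val (real b))"
proof -
  let ?P = "\<lambda>t. b + ltab U (Suc t) \<le> a"
  let ?A = "val (real a)" and ?B = "val (real b)"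
  define t where "t = (LEAST t. ?P t)"
  have p: "?P (U - 1)" using ltab_U assms U64 by simp
  have t: "?P t" "t \<le> U - 1" unfolding t_def using LeastI[of ?P, OF p] Least_le[of ?P, OF p] by auto
  then have tU: "t < U" using U64 by linarith
  have A: "0 < ?A" "0 < ?B" by (rule val_pos)+
  have "?A * (real t / real U) \<le> \<beta> * ?B"
  proof (cases t)
    case 0
    then show ?thesis using A \<beta>_ge by simp
  next
    case (Suc k)
    then have "\<not> ?P k" using not_less_Least[of k ?P] unfolding t_def[symmetric] by simp
    then have "real a + - real (ltab U t) \<le> real b" using Suc by simp
    then have B: "?A * val (- real (ltab U t)) \<le> ?B" using val_mono val_add by metis
    have "?A * (real t / real U) \<le> ?A * (val (- real (ltab U t)) * \<beta>)" using val_ltab(2)[of t] Suc tU A by (intro mult_left_mono) auto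
    also have "\<dots> \<le> \<beta> * ?B" using mult_left_mono[OF B, of \<beta>] \<beta>_ge by (simp add: algebra_simps)
    finally show ?thesis .
  qed
  then have "?A * (1 + real (Suc t) / real U) \<le> ?A * (1 + 1 / real U) + \<beta> * ?B" by (simp add: algebra_simps add_divide_distrib)
  also have "\<dots> \<le> \<beta> * (1 + 1 / real U) * ?A + \<beta> * (1 + 1 / real U) * ?B"
  proof (rule add_mono)
    have "1 * (1 + 1 / real U) \<le> \<beta> * (1 + 1 / real U)" "\<beta> * 1 \<le> \<beta> * (1 + 1 / real U)" using \<beta>_ge U0 by (intro mult_mono; simp)+
    then show "?A * (1 + 1 / real U) \<le> \<beta> * (1 + 1 / real U) * ?A" "\<beta> * ?B \<le> \<beta> * (1 + 1 / real U) * ?B"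
      using A by (auto simp: mult.commute[of ?A] intro!: mult_right_mono)
  qed
  finally have m: "?A * (1 + real (Suc t) / real U) \<le> \<beta> * (1 + 1 / real U) * (?A + ?B)" by (simp add: algebra_simps)
  have "real (a + (stab U (Suc t) + 4 * U)) = real a + (real (stab U (Suc t)) + (2 * real U + 2 * real U))" by simp
  then have "val (real (a + (stab U (Suc t) + 4 * U))) = ?A * (val (real (stab U (Suc t))) * (\<beta> * \<beta>))" by (simp only: val_add \<beta>_def)
  also have "\<dots> \<le> ?A * (((1 + real (Suc t) / real U) * \<beta>) * (\<beta> * \<beta>))"
    using val_stab(2)[of "Suc t"] tU A \<beta>_ge by (intro mult_left_mono mult_right_mono) auto
  also have "\<dots> = (\<beta> * \<beta> * \<beta>) * (?A * (1 + real (Suc t) / real U))" by simp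
  also have "\<dots> \<le> (\<beta> * \<beta> * \<beta>) * (\<beta> * (1 + 1 / real U) * (?A + ?B))" using m \<beta>_ge by (intro mult_left_mono) auto
  also have "\<dots> = \<gamma> * (?A + ?B)" by (simp add: \<gamma>_def power4_eq_xxxx)
  finally show ?thesis using t tU by blast
qed

text \<open>Truncation to \<open>w\<close> bits and then to multiples of \<open>E\<close> together
  loses less than one unit \<open>E\<close>. Raising the index by one therefore yields an upper
  bound for \<open>x\<close>, at the price of a factor \<open>1 + 1 / U\<close>.\<close>

lemma encoded_val:
  assumes UE: "U * E = 2 ^ (w - 1)" and w: "1 \<le> w" and x: "1 \<le> x"
    and m: "m = fl_mantissa w x" "k = nat (fl_exponent x)"
  shows "2 ^ (w - 1) \<le> m" "m < 2 ^ w" "x \<le> val (real (encoded R U E m k))" "val (real (encoded R U E m k)) \<le> \<gamma> * x" "2 ^ k \<le> x"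
proof -
  define z where "z = x / 2 ^ k"
  have k: "fl_exponent x = int k" using m(2) x unfolding fl_exponent_def by simp
  have "real_of_int (fl_exponent x) \<le> log 2 x" "log 2 x < real_of_int (fl_exponent x) + 1" unfolding fl_exponent_def by linarith+
  then have lx: "real k \<le> log 2 x" "log 2 x < real k + 1" using k by auto
  have "2 powr real k \<le> x" using lx(1) x by (subst (asm) le_log_iff) auto
  then show xk: "2 ^ k \<le> x" by (simp add: powr_realpow)
  have "x < 2 powr (real k + 1)" using lx(2) x by (subst (asm) log_less_iff) auto
  then have xk': "x < 2 * 2 ^ k" by (simp add: powr_add powr_realpow)
  have z: "1 \<le> z" "z < 2" using xk xk' by (auto simp: z_def field_simps)
  have e: "x * 2 powr (real w - 1 - real_of_int (fl_exponent x)) = z * 2 ^ (w - 1)"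
  proof -
    have "real w - 1 - real_of_int (fl_exponent x) = real (w - 1) - real k" unfolding k using w by (simp add: of_nat_diff)
    then have "2 powr (real w - 1 - real_of_int (fl_exponent x)) = 2 powr real (w - 1) / 2 powr real k" by (simp only: powr_diff)
    also have "\<dots> = 2 ^ (w - 1) / 2 ^ k" by (simp only: powr_realpow zero_less_numeral)
    finally show ?thesis by (simp add: z_def)
  qed
  have z0: "0 \<le> z * 2 ^ (w - 1)" using z by simp
  have m1: "real m \<le> z * 2 ^ (w - 1)" "z * 2 ^ (w - 1) < real m + 1" unfolding m(1) fl_mantissa_def e using z0 by linarith+
  have "(2::real) ^ (w - 1) \<le> z * 2 ^ (w - 1)" using z by simp
  then have "(2::real) ^ (w - 1) < real m + 1" using m1 by linarith
  then have "real (2 ^ (w - 1)) < real (m + 1)" by simp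
  then have "2 ^ (w - 1) < m + 1" by (simp only: of_nat_less_iff)
  then show lo: "2 ^ (w - 1) \<le> m" by simp
  have ww: "2 ^ w = 2 * (2::'a::comm_semiring_1) ^ (w - 1)" using w by (cases w) auto
  have "z * 2 ^ (w - 1) < 2 * 2 ^ (w - 1)" using z by (intro mult_strict_right_mono) auto
  then have "real m < 2 * 2 ^ (w - 1)" using m1 by linarith
  then have "real m < real (2 ^ w)" by (simp add: ww)
  then show hi: "m < 2 ^ w" by (simp only: of_nat_less_iff)
  have E: "E \<noteq> 0" using UE by (cases E) auto
  have "U = (U * E) div E" using E by (rule nonzero_mult_div_cancel_right[symmetric])
  also have "\<dots> \<le> m div E" using lo UE by (intro div_le_mono) simp
  finally have Ule: "U \<le> m div E" .
  have "m < (2 * U) * E" using hi UE unfolding ww by (simp add: mult.assoc)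
  then have "m div E < 2 * U" by (simp add: less_mult_imp_div_less)
  then obtain u where u: "m div E + 1 = U + u" "m div E - U + 1 = u" "1 \<le> u" "u \<le> U" using Ule by (intro that[of "m div E - U + 1"]) auto
  have w2: "(2::real) ^ (w - 1) = real U * real E" using UE by (metis of_nat_mult of_nat_numeral of_nat_power)
  have "m div E * E \<le> m" by simp
  then have "real (m div E * E) \<le> z * 2 ^ (w - 1)" using m1 by linarith
  then have "real (m div E) * real E \<le> z * real U * real E" unfolding w2 of_nat_mult mult.assoc .
  then have d1: "real (m div E) \<le> z * real U" using E by simp
  have "m < (m div E + 1) * E" using E dividend_less_div_times[of E m] by (simp add: algebra_simps)
  then have "m + 1 \<le> (m div E + 1) * E" by simp
  then have "real (m + 1) \<le> real (m div E + 1) * real E" by (metis of_nat_le_iff of_nat_mult)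
  moreover have "z * 2 ^ (w - 1) = z * real U * real E" unfolding w2 mult.assoc ..
  ultimately have "z * real U * real E \<le> real (m div E + 1) * real E" using m1(2) by linarith
  then have d2: "z * real U \<le> real (U + u)" using E u by simp
  have lo2: "z \<le> 1 + real u / real U" using d2 U0 by (simp add: field_simps)
  have "real (m div E) + 1 = real U + real u" using u(1) by (metis of_nat_1 of_nat_add)
  then have "(real U + real u) / real U \<le> (z * real U + 1) / real U" using d1 U0 by (intro divide_right_mono) linarith+
  then have "1 + real u / real U \<le> z + 1 / real U" using U0 by (simp add: add_divide_distrib)
  also have "\<dots> \<le> z + z * (1 / real U)" using z U0 by (simp add: divide_right_mono)
  finally have hi2: "1 + real u / real U \<le> z * (1 + 1 / real U)" by (simp add: algebra_simps)
  have m0: "m \<noteq> 0" using lo by (metis le_zero_eq power_not_zero zero_neq_numeral)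
  have "real (encoded R U E m k) = real k * S + (real (stab U u) + 2 * real U)" unfolding encoded_def u(2) if_not_P[OF m0] by simp
  then have v: "val (real (encoded R U E m k)) = 2 ^ k * val (real (stab U u) + 2 * real U)" by (simp only: val_add val_S)
  have xz: "x = 2 ^ k * z" by (simp add: z_def)
  have "z \<le> val (real (stab U u) + 2 * real U)" using lo2 val_stab(1)[OF u(4)] by linarith
  then show "x \<le> val (real (encoded R U E m k))" unfolding v xz by simp
  have "val (real (stab U u) + 2 * real U) = val (real (stab U u)) * \<beta>" by (simp add: val_add \<beta>_def)
  also have "\<dots> \<le> (z * (1 + 1 / real U) * \<beta>) * \<beta>"
  proof (rule mult_right_mono)
    show "val (real (stab U u)) \<le> z * (1 + 1 / real U) * \<beta>"
      using val_stab(2)[OF u(4)] mult_right_mono[OF hi2, of \<beta>] \<beta>_ge by linarith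
  qed (use \<beta>_ge in simp)
  also have "\<dots> = (\<beta> ^ 2 * (1 + 1 / real U)) * z" by (simp add: power2_eq_square)
  also have "\<dots> \<le> \<gamma> * z" using \<gamma>_ge(1) z by (intro mult_right_mono) auto
  finally show "val (real (encoded R U E m k)) \<le> \<gamma> * x" unfolding v xz by (simp add: mult.left_commute)
qed

text \<open>If the search ends at \<open>u = U\<close>, the significand \<open>2\<close> is written
  as \<open>1\<close> in the next octave, so the output is \<open>(1 + u / U) * 2 ^ X\<close> in
  both cases. Minimality of \<open>u\<close> bounds the output from above.\<close>

lemma decoded_val:
  assumes UE: "U * E = 2 ^ (w - 1)" and d: "d < R" "decoded R U E d m x"
  shows "m \<noteq> 0" "val (real d) \<le> real m * 2 ^ x / 2 ^ (w - 1)" "real m * 2 ^ x / 2 ^ (w - 1) \<le> \<gamma> * val (real d)"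
proof -
  define X where "X = (d + 2 * U) div stab U U"
  define r where "r = (d + 2 * U) mod stab U U"
  obtain u where u: "u \<le> U" "r \<le> stab U u" "\<And>u'. u' < u \<Longrightarrow> stab U u' < r"
    "if u < U then m = (U + u) * E \<and> x = X else m = U * E \<and> x = X + 1"
    using d unfolding decoded_def X_def[symmetric] r_def[symmetric] by auto
  have E: "E \<noteq> 0" using UE by (cases E) auto
  show "m \<noteq> 0" using u(4) E U64 by (auto split: if_splits)
  have w2: "(2::real) ^ (w - 1) = real U * real E" using UE by (metis of_nat_mult of_nat_numeral of_nat_power)
  have o: "real m * 2 ^ x / 2 ^ (w - 1) = (1 + real u / real U) * 2 ^ X" unfolding w2
  proof (cases "u < U")
    case True
    then show "real m * 2 ^ x / (real U * real E) = (1 + real u / real U) * 2 ^ X" using u(4) E U0 by (simp add: field_simps)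
  next
    case False
    then have "real u = real U" using u(1) by simp
    then show "real m * 2 ^ x / (real U * real E) = (1 + real u / real U) * 2 ^ X" using u(4) False E U0 by (simp add: field_simps)
  qed
  have "X * stab U U + r = d + 2 * U" unfolding X_def r_def by (rule div_mult_mod_eq)
  then have "real X * S + real r = real d + 2 * real U" by (metis of_nat_add of_nat_mult of_nat_numeral)
  then have d1: "real d = real X * S + (real r - 2 * real U)" and d2: "real X * S + (real r + 2 * real U) = real d + (2 * real U + 2 * real U)" by linarith+
  have vd: "val (real d) = 2 ^ X * val (real r - 2 * real U)" unfolding d1 val_add val_S ..
  have v2: "2 ^ X * val (real r + 2 * real U) = val (real d) * (\<beta> * \<beta>)" unfolding \<beta>_def val_add[symmetric] val_S[symmetric] d2 ..
  have "val (real r - 2 * real U) * \<beta> = val (real r)" unfolding \<beta>_def val_add[symmetric] by simp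
  also have "\<dots> \<le> val (real (stab U u))" using u(2) by (intro val_mono) simp
  also have "\<dots> \<le> (1 + real u / real U) * \<beta>" by (rule val_stab(2)[OF u(1)])
  finally have "val (real r - 2 * real U) \<le> 1 + real u / real U" using \<beta>_ge by simp
  then show "val (real d) \<le> real m * 2 ^ x / 2 ^ (w - 1)" unfolding o vd by simp
  have "1 + real u / real U \<le> (1 + 1 / real U) * val (real r + 2 * real U)"
  proof (cases u)
    case 0
    have "val 0 \<le> val (real r + 2 * real U)" by (rule val_mono) simp
    then have "1 \<le> val (real r + 2 * real U)" by (simp add: val_def)
    then have "1 * 1 \<le> (1 + 1 / real U) * val (real r + 2 * real U)" using U0 by (intro mult_mono) auto
    then show ?thesis using 0 by simp
  next
    case (Suc k)
    have "1 + real k / real U \<le> val (real (stab U k) + 2 * real U)" using u(1) Suc by (intro val_stab) simp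
    also have "\<dots> \<le> val (real r + 2 * real U)" using u(3)[of k] Suc by (intro val_mono) simp
    finally have "(1 + 1 / real U) * (1 + real k / real U) \<le> (1 + 1 / real U) * val (real r + 2 * real U)" using U0 by (intro mult_left_mono) auto
    moreover have "(1 + 1 / real U) * (1 + real k / real U) = 1 + real u / real U + real k / (real U * real U)" using Suc by (simp add: algebra_simps add_divide_distrib)
    moreover have "0 \<le> real k / (real U * real U)" by simp
    ultimately show ?thesis by linarith
  qed
  then have "(1 + real u / real U) * 2 ^ X \<le> (1 + 1 / real U) * val (real r + 2 * real U) * 2 ^ X" by (rule mult_right_mono) simp
  also have "\<dots> = (\<beta> ^ 2 * (1 + 1 / real U)) * val (real d)" using v2 by (simp add: power2_eq_square algebra_simps)
  also have "\<dots> \<le> \<gamma> * val (real d)" using \<gamma>_ge(1) val_pos[of "real d"] by (intro mult_right_mono) auto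
  finally show "real m * 2 ^ x / 2 ^ (w - 1) \<le> \<gamma> * val (real d)" unfolding o .
qed

end

section \<open>Walks\<close>

lemma sum_lessThan_add: "(\<Sum>i<a + b. f i) = (\<Sum>i<a. f i) + (\<Sum>i<b. f (a + i :: nat) :: 'a :: comm_monoid_add)"
  by (induction b) (auto simp: add.assoc)

lemma walk_weight_split:
  assumes "h < length p"
  shows "walk_weight G p = walk_weight G (take (Suc h) p) + walk_weight G (drop h p)"
proof -
  have l: "length p - 1 = h + (length p - 1 - h)" using assms by simp
  have "walk_weight G p = (\<Sum>i<h. G (p ! i) (p ! Suc i)) + (\<Sum>i<length p - 1 - h. G (p ! (h + i)) (p ! Suc (h + i)))"
    unfolding walk_weight_def by (subst l) (rule sum_lessThan_add)
  moreover have "walk_weight G (take (Suc h) p) = (\<Sum>i<h. G (p ! i) (p ! Suc i))"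
    using assms unfolding walk_weight_def by (intro sum.cong) auto
  moreover have "walk_weight G (drop h p) = (\<Sum>i<length p - 1 - h. G (p ! (h + i)) (p ! Suc (h + i)))"
    using assms unfolding walk_weight_def by (intro sum.cong) auto
  ultimately show ?thesis by simp
qed

lemma walk_take:
  assumes "p \<in> walks n u v" "h < length p"
  shows "take (Suc h) p \<in> walks n u (p ! h)" "drop h p \<in> walks n (p ! h) v" "p ! h < n"
proof -
  have p: "p \<noteq> []" "hd p = u" "last p = v" "set p \<subseteq> {..<n}" using assms by (auto simp: walks_def)
  have "last (take (Suc h) p) = p ! h" using assms(2) by (simp add: take_Suc_conv_app_nth)
  then show "take (Suc h) p \<in> walks n u (p ! h)" using p set_take_subset[of "Suc h" p] by (auto simp: walks_def)
  show "drop h p \<in> walks n (p ! h) v" using p assms(2) set_drop_subset[of h p] by (auto simp: walks_def hd_drop_conv_nth)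
  show "p ! h < n" using p(4) nth_mem[OF assms(2)] by auto
qed

lemma walk_concat:
  assumes "p \<in> walks n u k" "q \<in> walks n k v"
  shows "p @ tl q \<in> walks n u v" "walk_weight G (p @ tl q) = walk_weight G p + walk_weight G q"
proof -
  have p: "p \<noteq> []" "hd p = u" "last p = k" "set p \<subseteq> {..<n}" and q: "q \<noteq> []" "hd q = k" "last q = v" "set q \<subseteq> {..<n}"
    using assms by (auto simp: walks_def)
  obtain q' where q': "q = k # q'" using q by (cases q) auto
  show "p @ tl q \<in> walks n u v" using p q q' by (auto simp: walks_def)
  have "take (Suc (length p - 1)) (p @ tl q) = p" using p by simp
  moreover have "drop (length p - 1) (p @ tl q) = q"
    using p q' append_butlast_last_id[OF p(1)] by (metis append.assoc append_Cons append_Nil append_eq_conv_conj length_butlast list.sel(3))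
  ultimately show "walk_weight G (p @ tl q) = walk_weight G p + walk_weight G q"
    using walk_weight_split[of "length p - 1" "p @ tl q" G] p(1) by (cases p) auto
qed

lemma walk_edge:
  assumes "weighted_digraph n G" "p \<in> walks n u v" "i < length p - 1"
  shows "0 \<le> G (p ! i) (p ! Suc i)" "p ! i < n" "p ! Suc i < n"
proof -
  show 1: "p ! i < n" "p ! Suc i < n" using walk_take(3)[OF assms(2)] assms(3) by auto
  then have "1 \<le> G (p ! i) (p ! Suc i)" using assms(1) by (simp add: weighted_digraph_def)
  then show "0 \<le> G (p ! i) (p ! Suc i)" by (rule order_trans[rotated]) simp
qed

lemma walk_weight_nonneg: "weighted_digraph n G \<Longrightarrow> p \<in> walks n u v \<Longrightarrow> 0 \<le> walk_weight G p"
  unfolding walk_weight_def by (rule sum_nonneg) (simp add: walk_edge(1))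

text \<open>Cutting out the part between two visits of a vertex shortens the walk and cannot
  increase its weight, since all weights are nonnegative.\<close>

lemma short_walk:
  assumes G: "weighted_digraph n G"
  shows "p \<in> walks n u v \<Longrightarrow> \<exists>q\<in>walks n u v. length q \<le> n \<and> walk_weight G q \<le> walk_weight G p"
proof (induction "length p" arbitrary: p rule: less_induct)
  case less
  show ?case
  proof (cases "length p \<le> n")
    case True
    then show ?thesis using less(2) by auto
  next
    case False
    have "set p \<subseteq> {..<n}" using less(2) by (simp add: walks_def)
    then have "card (set p) \<le> n" using card_mono[of "{..<n}" "set p"] by simp
    then have "\<not> distinct p" using False distinct_card by fastforce
    then obtain a b where ab: "a < b" "b < length p" "p ! a = p ! b" unfolding distinct_conv_nth by (metis nat_neq_iff)
    have al: "a < length p" using ab by simp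
    note ta = walk_take[OF less(2) al] and tb = walk_take[OF less(2) ab(2)]
    define q where "q = take (Suc a) p @ tl (drop b p)"
    have d: "drop b p \<in> walks n (p ! a) v" using tb(2) ab(3) by simp
    have q: "q \<in> walks n u v" "walk_weight G q = walk_weight G (take (Suc a) p) + walk_weight G (drop b p)"
      unfolding q_def using walk_concat[OF ta(1) d] by auto
    have ba: "b - a < length (drop a p)" using ab by simp
    have "drop (b - a) (drop a p) = drop b p" using ab by simp
    then have "walk_weight G (drop a p) = walk_weight G (take (Suc (b - a)) (drop a p)) + walk_weight G (drop b p)"
      using walk_weight_split[OF ba, of G] by simp
    moreover have "0 \<le> walk_weight G (take (Suc (b - a)) (drop a p))" using walk_weight_nonneg[OF G walk_take(1)[OF ta(2) ba]] .
    ultimately have "walk_weight G (drop b p) \<le> walk_weight G (drop a p)" by (simp add: ereal_le_add_self2)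
    then have "walk_weight G q \<le> walk_weight G p" unfolding q(2) walk_weight_split[OF al, of G] by (rule add_left_mono)
    moreover have "length q < length p" unfolding q_def using ab by simp
    ultimately show ?thesis using less(1)[OF _ q(1)] order_trans by blast
  qed
qed

lemma max_weight_ge:
  shows "u < n \<Longrightarrow> v < n \<Longrightarrow> G u v \<noteq> \<infinity> \<Longrightarrow> real_of_ereal (G u v) \<le> max_weight n G" "1 \<le> max_weight n G"
proof -
  have "{real_of_ereal (G u v) |u v. u < n \<and> v < n \<and> G u v \<noteq> \<infinity>} \<subseteq> (\<lambda>(u, v). real_of_ereal (G u v)) ` ({..<n} \<times> {..<n})" by auto
  then have "finite {real_of_ereal (G u v) |u v. u < n \<and> v < n \<and> G u v \<noteq> \<infinity>}" by (rule finite_subset) auto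
  then show "u < n \<Longrightarrow> v < n \<Longrightarrow> G u v \<noteq> \<infinity> \<Longrightarrow> real_of_ereal (G u v) \<le> max_weight n G" "1 \<le> max_weight n G"
    unfolding max_weight_def by (auto intro!: Max_ge)
qed

lemma walk_weight_le_max:
  assumes G: "weighted_digraph n G" and p: "p \<in> walks n u v" "walk_weight G p = ereal x"
  shows "x \<le> real (length p - 1) * max_weight n G"
proof -
  have e: "G (p ! i) (p ! Suc i) \<le> ereal (max_weight n G)" if i: "i < length p - 1" for i
  proof -
    have nn: "\<And>j. j < length p - 1 \<Longrightarrow> 0 \<le> G (p ! j) (p ! Suc j)" by (rule walk_edge(1)[OF G p(1)])
    then have "G (p ! i) (p ! Suc i) \<le> walk_weight G p" unfolding walk_weight_def using i sum_mono2[of "{..<length p - 1}" "{i}" "\<lambda>i. G (p ! i) (p ! Suc i)"] by simp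
    then have "G (p ! i) (p ! Suc i) \<noteq> \<infinity>" using p(2) by auto
    moreover have "G (p ! i) (p ! Suc i) \<noteq> -\<infinity>" using nn[OF i] by auto
    ultimately show ?thesis using max_weight_ge(1)[of "p ! i" n "p ! Suc i" G] walk_edge(2,3)[OF G p(1) i]
      by (cases "G (p ! i) (p ! Suc i)") auto
  qed
  have "walk_weight G p \<le> (\<Sum>i<length p - 1. ereal (max_weight n G))" unfolding walk_weight_def using e by (intro sum_mono) auto
  also have "\<dots> = ereal (real (length p - 1) * max_weight n G)" by simp
  finally show ?thesis using p(2) by simp
qed

lemma distance_self:
  assumes "weighted_digraph n G" "u < n"
  shows "distance n G u u = 0"
proof (rule antisym)
  have "[u] \<in> walks n u u" using assms by (simp add: walks_def)
  then have "distance n G u u \<le> walk_weight G [u]" unfolding distance_def by (rule INF_lower)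
  then show "distance n G u u \<le> 0" by (simp add: walk_weight_def)
  show "0 \<le> distance n G u u" unfolding distance_def by (rule INF_greatest) (rule walk_weight_nonneg[OF assms(1)])
qed

section \<open>Keys compared with weights of walks\<close>

context log_scale
begin

text \<open>A candidate overestimates the sum of two keys, and the walks behind these keys can be
  concatenated. A key below \<open>R\<close> only arises from summands below
  \<open>R\<close>.\<close>

lemma squares_sound:
  assumes D0: "\<And>i j. i < n \<Longrightarrow> j < n \<Longrightarrow> D0 i j \<le> R \<and> (D0 i j < R \<longrightarrow> (\<exists>p\<in>walks n i j. walk_weight G p \<le> ereal (val (real (D0 i j)))))"
    and "squares n (ltab U) (\<lambda>t. stab U t + 4 * U) U l D0 D" "i < n" "j < n"
  shows "D i j \<le> R \<and> (D i j < R \<longrightarrow> (\<exists>p\<in>walks n i j. walk_weight G p \<le> ereal (val (real (D i j)))))"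
  using assms(2-)
proof (induction l arbitrary: D i j)
  case 0
  then show ?case using D0 by simp
next
  case (Suc l)
  from Suc.prems(1) obtain E where E: "squares n (ltab U) (\<lambda>t. stab U t + 4 * U) U l D0 E" "squared n E (ltab U) (\<lambda>t. stab U t + 4 * U) U D"
    by auto
  note IH = Suc.IH[OF E(1)]
  note ij = Suc.prems(2,3)
  have le: "D i j \<le> E i j" using E(2) ij unfolding squared_def by blast
  show ?case
  proof (cases "D i j = E i j")
    case True
    then show ?thesis using IH[OF ij] by simp
  next
    case False
    then obtain tr t k where t: "t < U" "k < n" "small tr E i j k + ltab U (Suc t) \<le> large tr E i j k" "D i j = large tr E i j k + (stab U (Suc t) + 4 * U)"
      using E(2) ij unfolding squared_def by blast
    have v: "val (real (large tr E i j k)) + val (real (small tr E i j k)) \<le> val (real (D i j))"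
      unfolding t(4) using t(1,3) by (intro candidate_sound) auto
    have "(\<exists>p\<in>walks n i j. walk_weight G p \<le> ereal (val (real (D i j))))" if "D i j < R"
    proof -
      have "large tr E i j k < R" "small tr E i j k < R" using that t(3,4) by linarith+
      then have "E i k < R" "E k j < R" by (auto simp: small_def large_def split: if_splits)
      then obtain p q where p: "p \<in> walks n i k" "walk_weight G p \<le> ereal (val (real (E i k)))" and q: "q \<in> walks n k j" "walk_weight G q \<le> ereal (val (real (E k j)))"
        using IH[OF ij(1) t(2)] IH[OF t(2) ij(2)] by blast
      have "walk_weight G (p @ tl q) \<le> ereal (val (real (E i k))) + ereal (val (real (E k j)))"
        unfolding walk_concat(2)[OF p(1) q(1)] using p(2) q(2) by (rule add_mono)
      also have "\<dots> \<le> ereal (val (real (D i j)))" using v by (auto simp: small_def large_def split: if_splits)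
      finally show ?thesis using walk_concat(1)[OF p(1) q(1)] by blast
    qed
    then show ?thesis using le IH[OF ij] by auto
  qed
qed

text \<open>A walk with more than \<open>2 ^ l\<close> edges is split at vertex number
  \<open>2 ^ l\<close>. Every squaring contributes a factor \<open>\<gamma>\<close>, and so does the
  encoding. Walks without edges are excluded, because the diagonal of \<open>D0\<close> encodes the
  weights of loops.\<close>

lemma squares_complete:
  assumes G: "weighted_digraph n G" and D0: "\<And>i j x. i < n \<Longrightarrow> j < n \<Longrightarrow> G i j = ereal x \<Longrightarrow> val (real (D0 i j)) \<le> \<gamma> * x"
    and "squares n (ltab U) (\<lambda>t. stab U t + 4 * U) U l D0 D" "i < n" "j < n" "p \<in> walks n i j" "2 \<le> length p" "length p \<le> Suc (2 ^ l)" "walk_weight G p = ereal x"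
  shows "val (real (D i j)) \<le> \<gamma> ^ Suc l * x"
  using assms(3-)
proof (induction l arbitrary: D i j p x)
  case 0
  then have "length p = 2" by simp
  then obtain u v where p: "p = [u, v]" by (auto simp: numeral_2_eq_2 length_Suc_conv)
  then have "u = i" "v = j" using 0 by (auto simp: walks_def)
  then show ?case using 0 p D0[of i j x] by (simp add: walk_weight_def)
next
  case (Suc l)
  from Suc.prems(1) obtain E where E: "squares n (ltab U) (\<lambda>t. stab U t + 4 * U) U l D0 E" "squared n E (ltab U) (\<lambda>t. stab U t + 4 * U) U D"
    by auto
  note IH = Suc.IH[OF E(1)]
  note ij = Suc.prems(2,3) and p = Suc.prems(4-7)
  have x0: "0 \<le> x" using walk_weight_nonneg[OF G p(1)] p(4) by simp
  show ?case
  proof (cases "length p \<le> Suc (2 ^ l)")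
    case True
    have "D i j \<le> E i j" using E(2) ij unfolding squared_def by blast
    then have "val (real (D i j)) \<le> val (real (E i j))" by (intro val_mono) simp
    also have "\<dots> \<le> \<gamma> ^ Suc l * x" by (rule IH[OF ij p(1,2) True p(4)])
    also have "\<dots> \<le> \<gamma> ^ Suc (Suc l) * x" using \<gamma>_ge x0 by (intro mult_right_mono power_increasing) auto
    finally show ?thesis .
  next
    case False
    let ?h = "2 ^ l :: nat"
    have h: "?h < length p" using False by simp
    define k where "k = p ! ?h"
    define p1 p2 where "p1 = take (Suc ?h) p" and "p2 = drop ?h p"
    have w: "p1 \<in> walks n i k" "p2 \<in> walks n k j" "k < n" using walk_take[OF p(1) h] by (auto simp: p1_def p2_def k_def)
    have l1: "length p1 = Suc ?h" using h False by (auto simp: p1_def)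
    then have l1': "2 \<le> length p1" "length p1 \<le> Suc ?h" by simp_all
    have l2: "length p2 = length p - ?h" by (simp add: p2_def)
    then have l2': "2 \<le> length p2" "length p2 \<le> Suc ?h" using False p(3) by simp_all
    have ww: "walk_weight G p1 + walk_weight G p2 = ereal x" using walk_weight_split[OF h, of G] p(4) by (simp add: p1_def p2_def)
    have nn: "0 \<le> walk_weight G p1" "0 \<le> walk_weight G p2" using walk_weight_nonneg[OF G] w by auto
    obtain y z where yz: "walk_weight G p1 = ereal y" "walk_weight G p2 = ereal z" "x = y + z"
      using ww nn by (cases "walk_weight G p1"; cases "walk_weight G p2") auto
    have A: "val (real (E i k)) \<le> \<gamma> ^ Suc l * y" by (rule IH[OF ij(1) w(3) w(1) l1' yz(1)])
    have B: "val (real (E k j)) \<le> \<gamma> ^ Suc l * z" by (rule IH[OF w(3) ij(2) w(2) l2' yz(2)])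
    define tr where "tr \<longleftrightarrow> E i k \<le> E k j"
    have "small tr E i j k \<le> large tr E i j k" unfolding tr_def small_def large_def by auto
    from candidate_complete[OF this] obtain t where t: "t < U" "small tr E i j k + ltab U (Suc t) \<le> large tr E i j k"
      "val (real (large tr E i j k + (stab U (Suc t) + 4 * U))) \<le> \<gamma> * (val (real (large tr E i j k)) + val (real (small tr E i j k)))" by blast
    have "D i j \<le> large tr E i j k + (stab U (Suc t) + 4 * U)" using E(2) ij t(1,2) w(3) unfolding squared_def by blast
    then have "val (real (D i j)) \<le> val (real (large tr E i j k + (stab U (Suc t) + 4 * U)))" by (intro val_mono) (simp only: of_nat_le_iff)
    also note t(3)
    also have "val (real (large tr E i j k)) + val (real (small tr E i j k)) = val (real (E i k)) + val (real (E k j))"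
      by (auto simp: small_def large_def)
    also have "\<gamma> * (val (real (E i k)) + val (real (E k j))) \<le> \<gamma> * (\<gamma> ^ Suc l * y + \<gamma> ^ Suc l * z)"
      using A B \<gamma>_ge by (intro mult_left_mono add_mono) auto
    also have "\<dots> = \<gamma> ^ Suc (Suc l) * x" by (simp add: yz(3) algebra_simps)
    finally show ?thesis .
  qed
qed

end

context solver
begin

sublocale log_scale U by standard (rule U1(2))

text \<open>\<open>L\<close> squarings, encoding and decoding make \<open>L + 2\<close> factors. By
  the choice of \<open>U\<close> the exponent \<open>17 * (L + 2) / U\<close> is at most
  \<open>17 / 64 * \<epsilon>\<close>, hence below \<open>\<epsilon> / 2\<close>, and
  \<open>exp y \<le> 1 + 2 * y\<close> in this range.\<close>

lemma \<gamma>_power: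
  assumes "1 / 2 ^ e \<le> \<epsilon>" "\<epsilon> < 1 / 10"
  shows "\<gamma> ^ (L + 2) \<le> 1 + \<epsilon>"
proof -
  define y where "y = 17 * real (L + 2) / real U"
  have "real (L + 2) \<le> real (2 ^ a)" using a(1) by (simp only: of_nat_le_iff)
  then have "real (L + 2) * 64 * 2 ^ e \<le> 2 ^ a * 64 * 2 ^ e" by simp
  then have "real (L + 2) * 64 * 2 ^ e \<le> real U" unfolding U_def by (simp add: mult.commute mult.left_commute)
  then have "17 * real (L + 2) / real U \<le> 17 / 64 * (1 / 2 ^ e)" using U0 by (simp add: field_simps)
  moreover have "0 \<le> 17 * real (L + 2) / real U" "0 < 1 / (2::real) ^ e" by simp_all
  ultimately have y: "0 \<le> y" "y \<le> \<epsilon> / 2" "y \<le> 1 / 20" using assms unfolding y_def[symmetric] by linarith+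
  have "\<gamma> ^ (L + 2) \<le> exp (17 / real U) ^ (L + 2)" using \<gamma>_le \<gamma>_ge by (intro power_mono) auto
  also have "\<dots> = exp y" by (simp only: exp_of_nat_mult[symmetric]) (simp add: y_def algebra_simps)
  also have "\<dots> \<le> 1 + y + y\<^sup>2" using y by (intro exp_bound) auto
  also have "\<dots> \<le> 1 + y + y * 1" using y by (simp add: power2_eq_square mult_left_le)
  finally show ?thesis using y by simp
qed

text \<open>\<open>KR\<close> prevents a finite distance from reaching the key \<open>R\<close>: a
  walk of at most \<open>n\<close> vertices weighs at most \<open>n\<close> times the maximal
  weight, and the accumulated loss is below a factor \<open>2\<close>.\<close>

lemma solver_output:
  assumes H: "weighted_digraph n H" and \<epsilon>: "1 / 2 ^ e \<le> \<epsilon>" "\<epsilon> < 1 / 10"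
    and f: "\<And>i j. i < n \<Longrightarrow> j < n \<Longrightarrow> (f (2 * (i * n + j)), f (2 * (i * n + j) + 1)) = fl_encode w (H i j)"
    and KR: "real U * real U * (1 + log 2 (real n * max_weight n H)) < real R"
    and sq: "squares n (ltab U) (\<lambda>t. stab U t + 4 * U) U L D0 D" and ij: "i < n" "j < n"
    and wr: "written (D i j) i j m x"
  shows "distance n H i j \<le> fl_decode w (m, x) \<and> fl_decode w (m, x) \<le> ereal (1 + \<epsilon>) * distance n H i j"
proof (cases "i = j")
  case True
  then show ?thesis using wr distance_self[OF H ij(1)] by (simp add: written_def fl_decode_def)
next
  case False
  then have wd: "decoded R U E (D i j) m x" using wr by (simp add: written_def)
  have \<epsilon>0: "0 < \<epsilon>" using \<epsilon>(1) by (rule less_le_trans[rotated]) simp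
  have enc: "y \<le> val (real (D0 i j))" "val (real (D0 i j)) \<le> \<gamma> * y" if "i < n" "j < n" "H i j = ereal y" for i j y
  proof -
    have "1 \<le> y" using H that by (auto simp: weighted_digraph_def) (metis ereal_less_eq(3) one_ereal_def)
    moreover have "f (2 * (i * n + j)) = fl_mantissa w y" "f (2 * (i * n + j) + 1) = nat (fl_exponent y)"
      using f[OF that(1,2)] that(3) by (auto simp: fl_encode_def)
    ultimately show "y \<le> val (real (D0 i j))" "val (real (D0 i j)) \<le> \<gamma> * y"
      unfolding D0_def using encoded_val(3,4)[OF UE(1) w1] by auto
  qed
  have inf: "D0 i j = R" if "i < n" "j < n" "H i j = \<infinity>" for i j
    using f[OF that(1,2)] that(3) by (simp add: D0_def encoded_def fl_encode_def)
  have fin: "H i j = \<infinity> \<or> (\<exists>y. H i j = ereal y)" if "i < n" "j < n" for i j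
  proof (cases "H i j")
    case MInf
    then have "1 \<le> (-\<infinity> :: ereal)" using H that by (metis weighted_digraph_def)
    then show ?thesis by simp
  qed auto
  have s0: "D0 i j \<le> R \<and> (D0 i j < R \<longrightarrow> (\<exists>p\<in>walks n i j. walk_weight H p \<le> ereal (val (real (D0 i j)))))" if ij: "i < n" "j < n" for i j
  proof (intro conjI impI)
    show "D0 i j \<le> R" by (rule D0_le[OF ij])
    assume "D0 i j < R"
    then obtain y where y: "H i j = ereal y" using inf[OF ij] fin[OF ij] by auto
    have "[i, j] \<in> walks n i j" using ij by (auto simp: walks_def)
    moreover have "walk_weight H [i, j] \<le> ereal (val (real (D0 i j)))" using enc(1)[OF ij y] y by (simp add: walk_weight_def)
    ultimately show "\<exists>p\<in>walks n i j. walk_weight H p \<le> ereal (val (real (D0 i j)))" by blast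
  qed
  note sound = squares_sound[OF s0 sq ij]
  have cpl: "val (real (D i j)) \<le> \<gamma> ^ Suc L * y" if p: "p \<in> walks n i j" "length p \<le> n" "walk_weight H p = ereal y" for p y
  proof (rule squares_complete[OF H enc(2) sq ij p(1) _ _ p(3)])
    have "p \<noteq> []" "hd p = i" "last p = j" using p(1) by (auto simp: walks_def)
    then show "2 \<le> length p" using False by (cases p; cases "tl p") auto
    show "length p \<le> Suc (2 ^ L)" using p(2) L(1) by simp
  qed auto
  have gp: "\<gamma> ^ Suc L * \<gamma> \<le> 1 + \<epsilon>" using \<gamma>_power[OF \<epsilon>] by (simp add: mult.commute mult.left_commute)
  have gp': "\<gamma> ^ Suc L \<le> \<gamma> ^ Suc L * \<gamma>" using mult_left_mono[OF \<gamma>_ge(2), of "\<gamma> ^ Suc L"] \<gamma>_ge(3) by simp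
  show ?thesis
  proof (cases "R \<le> D i j")
    case True
    then have o: "fl_decode w (m, x) = \<infinity>" using wd by (simp add: decoded_def fl_decode_def)
    have "walk_weight H p = \<infinity>" if p: "p \<in> walks n i j" for p
    proof (rule ccontr)
      assume ni: "walk_weight H p \<noteq> \<infinity>"
      obtain q where q: "q \<in> walks n i j" "length q \<le> n" "walk_weight H q \<le> walk_weight H p" using short_walk[OF H p] by blast
      obtain y where y: "walk_weight H q = ereal y" using q(3) ni walk_weight_nonneg[OF H q(1)] by (cases "walk_weight H q") auto
      have M: "1 \<le> max_weight n H" by (rule max_weight_ge(2))
      have "y \<le> real (length q - 1) * max_weight n H" by (rule walk_weight_le_max[OF H q(1) y])
      also have "\<dots> \<le> real n * max_weight n H" using q(2) M by (intro mult_right_mono) auto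
      finally have y1: "y \<le> real n * max_weight n H" .
      have y0: "0 \<le> y" using walk_weight_nonneg[OF H q(1)] y by simp
      have g2: "\<gamma> ^ Suc L \<le> 2" using gp gp' \<epsilon>(2) by linarith
      have "val (real R) \<le> val (real (D i j))" using True by (intro val_mono) simp
      also have "\<dots> \<le> \<gamma> ^ Suc L * y" by (rule cpl[OF q(1,2) y])
      also have "\<dots> \<le> 2 * (real n * max_weight n H)" using g2 y0 y1 by (intro mult_mono) auto
      finally have v: "2 powr (real R / S) \<le> 2 * (real n * max_weight n H)" by (simp add: val_def)
      have nM: "1 * 1 \<le> real n * max_weight n H" using n1 M by (intro mult_mono) auto
      have "real R / S \<le> log 2 (2 * (real n * max_weight n H))" using v nM by (subst le_log_iff) auto
      also have "\<dots> = 1 + log 2 (real n * max_weight n H)" using nM by (subst log_mult_pos) auto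
      finally have "real R \<le> S * (1 + log 2 (real n * max_weight n H))" using S_ge by (simp add: field_simps)
      also have "\<dots> \<le> real U * real U * (1 + log 2 (real n * max_weight n H))"
      proof (rule mult_right_mono)
        show "S \<le> real U * real U" using SU[of U] by (metis of_nat_le_iff of_nat_mult order_refl)
        show "0 \<le> 1 + log 2 (real n * max_weight n H)" using nM zero_le_log_cancel_iff[of 2 "real n * max_weight n H"] by linarith
      qed
      finally show False using KR by simp
    qed
    then have "\<infinity> \<le> distance n H i j" unfolding distance_def by (intro INF_greatest) simp
    then have "distance n H i j = \<infinity>" by simp
    then show ?thesis using o \<epsilon>0 by simp
  next
    case dR: False
    then have dR: "D i j < R" by simp
    note dv = decoded_val[OF UE(1) dR wd]
    define o' where "o' = real m * 2 ^ x / 2 ^ (w - 1)"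
    have o: "fl_decode w (m, x) = ereal o'" using dv(1) by (simp add: fl_decode_def o'_def)
    obtain p where p: "p \<in> walks n i j" "walk_weight H p \<le> ereal (val (real (D i j)))" using sound dR by blast
    have "distance n H i j \<le> walk_weight H p" unfolding distance_def using p(1) by (rule INF_lower)
    also note p(2)
    also have "ereal (val (real (D i j))) \<le> ereal o'" using dv(2) by (simp add: o'_def)
    finally have lo: "distance n H i j \<le> ereal o'" .
    have "ereal (o' / (1 + \<epsilon>)) \<le> distance n H i j" unfolding distance_def
    proof (rule INF_greatest)
      fix p assume p: "p \<in> walks n i j"
      obtain q where q: "q \<in> walks n i j" "length q \<le> n" "walk_weight H q \<le> walk_weight H p" using short_walk[OF H p] by blast
      have "ereal (o' / (1 + \<epsilon>)) \<le> walk_weight H q"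
      proof (cases "walk_weight H q")
        case (real y)
        have y0: "0 \<le> y" using walk_weight_nonneg[OF H q(1)] real by simp
        have "o' \<le> \<gamma> * val (real (D i j))" using dv(3) by (simp add: o'_def)
        also have "\<dots> \<le> \<gamma> * (\<gamma> ^ Suc L * y)" using cpl[OF q(1,2) real] \<gamma>_ge by (intro mult_left_mono) auto
        also have "\<dots> = (\<gamma> ^ Suc L * \<gamma>) * y" by simp
        also have "\<dots> \<le> (1 + \<epsilon>) * y" using gp y0 by (rule mult_right_mono)
        finally show ?thesis using \<epsilon>0 real by (simp add: field_simps)
      qed (use walk_weight_nonneg[OF H q(1)] in auto)
      then show "ereal (o' / (1 + \<epsilon>)) \<le> walk_weight H p" using q(3) by (rule order_trans)
    qed
    then have "ereal (1 + \<epsilon>) * ereal (o' / (1 + \<epsilon>)) \<le> ereal (1 + \<epsilon>) * distance n H i j" using \<epsilon>0 by (intro ereal_mult_left_mono) auto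
    then have "ereal o' \<le> ereal (1 + \<epsilon>) * distance n H i j" using \<epsilon>0 by simp
    then show ?thesis using lo o by simp
  qed
qed

end

section \<open>Running time\<close>

lemma ceil_log_exists: "\<exists>k. x \<le> 2 ^ k \<and> (k = 0 \<or> 2 ^ (k - 1) < x)" for x :: nat
proof -
  let ?P = "\<lambda>k. x \<le> 2 ^ k"
  have p: "?P x" by simp
  have "(LEAST k. ?P k) = 0 \<or> 2 ^ ((LEAST k. ?P k) - 1) < x"
    using not_less_Least[of "(LEAST k. ?P k) - 1" ?P] by fastforce
  then show ?thesis using LeastI[of ?P, OF p] by blast
qed

lemma ceil_log_bound:
  fixes x :: nat
  assumes "k = 0 \<or> 2 ^ (k - 1) < x" "1 \<le> x"
  shows "real k \<le> 1 + log 2 (real x)"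
proof (cases "k = 0")
  case False
  then have "2 ^ (k - 1) < x" using assms by simp
  then have "real (2 ^ (k - 1)) < real x" by (simp only: of_nat_less_iff)
  then have "2 powr real (k - 1) < real x" by (simp add: powr_realpow)
  then have "real (k - 1) < log 2 (real x)" using assms(2) by (subst less_log_iff) auto
  then show ?thesis using False by (simp add: of_nat_diff)
next
  case True
  then show ?thesis using assms(2) by simp
qed

text \<open>Because of \<open>n \<le> q * q\<close> there are at most \<open>2 * q\<close> blocks
  per row, so the terms with \<open>n * n * nb\<close> are absorbed by \<open>n * n * q\<close>. The
  simulated runs cost \<open>nb\<close> times \<open>n * q * q\<close>, where
  \<open>nb * q \<le> n + q\<close>.\<close>

lemma attempt_ticks_le:
  assumes "1 \<le> n" "1 \<le> q" "n \<le> q * q"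
  shows "attempt_ticks n q \<le> 44 * (n * n * q) + 2 * (n * q * q)"
proof -
  define nb where "nb = n div q + 1"
  have "n div q \<le> q * q div q" using assms(3) by (rule div_le_mono)
  then have nb: "nb \<le> 2 * q" "nb + q + 1 \<le> 4 * q" using assms(2) by (auto simp: nb_def)
  have "n div q * q \<le> n" by simp
  then have nbq: "nb * q \<le> n + q" by (simp add: nb_def)
  have n2: "n \<le> n * n" "1 \<le> n * n" "n \<le> n * q" "n \<le> n * n * q" using assms by auto
  have a: "n * nb * (n + 1) \<le> 4 * (n * n * q)"
  proof -
    have "n * nb * (n + 1) \<le> n * (2 * q) * (2 * n)" using nb assms by (intro mult_le_mono) auto
    also have "\<dots> = 4 * (n * n * q)" by simp
    finally show ?thesis .
  qed
  have b: "n * (n * (nb + q + 1) + 1) \<le> 5 * (n * n * q)"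
  proof -
    have "n * (n * (nb + q + 1)) \<le> n * (n * (4 * q))" using nb by (intro mult_le_mono) auto
    also have "\<dots> = 4 * (n * n * q)" by simp
    finally have "n * (n * (nb + q + 1)) + n \<le> 5 * (n * n * q)" using n2(4) by linarith
    then show ?thesis by (simp only: distrib_left mult_1_right)
  qed
  have c: "nb * (1 + n + 6 * (n * (n + 1))) \<le> 28 * (n * n * q)"
  proof -
    have "n * (n + 1) = n * n + n" by simp
    then have "1 + n + 6 * (n * (n + 1)) \<le> 14 * (n * n)" using n2 by linarith
    then have "nb * (1 + n + 6 * (n * (n + 1))) \<le> (2 * q) * (14 * (n * n))" using nb by (intro mult_le_mono) auto
    also have "\<dots> = 28 * (n * n * q)" by simp
    finally show ?thesis .
  qed
  have d: "nb * q * (n + n * q) \<le> 2 * (n * n * q) + 2 * (n * q * q)"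
  proof -
    have "nb * q * (n + n * q) \<le> (n + q) * (2 * (n * q))" using nbq n2(3) by (intro mult_le_mono) auto
    then show ?thesis by (simp add: algebra_simps)
  qed
  have "nb * Suc (group_ticks n q) = nb * (1 + n + 6 * (n * (n + 1))) + nb * q * (n + n * q)"
    unfolding group_ticks_def by (simp add: algebra_simps)
  then have "attempt_ticks n q = n * nb * (n + 1) + n * (n * (nb + q + 1) + 1) + (nb * (1 + n + 6 * (n * (n + 1))) + nb * q * (n + n * q)) + n * (n * (nb + q + 1) + 1)"
    unfolding attempt_ticks_def nb_def[symmetric] Let_def by (simp only:)
  then show ?thesis using a b c d by linarith
qed

text \<open>\<open>n * n * q\<close> is the geometric mean of \<open>n ^ 3\<close> and
  \<open>n * q * q\<close>, and the latter is at most \<open>4 * Lq\<close>. With \<open>Lq\<close>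
  of order \<open>n powr \<tau>\<close> this is the origin of the exponent
  \<open>(\<tau> + 3) / 2\<close>.\<close>

lemma attempt_ticks_sqrt:
  assumes "1 \<le> n" "1 \<le> q" "n \<le> q * q" "n * q * q \<le> 4 * Lq"
  shows "real (attempt_ticks n q) \<le> 44 * sqrt (4 * (real n ^ 3 * real Lq)) + 8 * real Lq"
proof -
  have q: "real n * real q * real q \<le> 4 * real Lq" using assms(4) by (metis of_nat_le_iff of_nat_mult of_nat_numeral)
  have "(real n * real n * real q)\<^sup>2 = real n ^ 3 * (real n * real q * real q)" by (simp add: power2_eq_square power3_eq_cube)
  also have "\<dots> \<le> real n ^ 3 * (4 * real Lq)" using q by (rule mult_left_mono) simp
  finally have "real n * real n * real q \<le> sqrt (4 * (real n ^ 3 * real Lq))" by (intro real_le_rsqrt) simp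
  moreover have "real (attempt_ticks n q) \<le> real (44 * (n * n * q) + 2 * (n * q * q))" using attempt_ticks_le[OF assms(1-3)] by (simp only: of_nat_le_iff)
  ultimately show ?thesis using q by simp
qed

text \<open>The three logarithmic factors stem from the \<open>L\<close> squarings, from the factor
  of \<open>U\<close> besides \<open>1 / \<epsilon>\<close>, and from the attempts of a dominance
  product.\<close>

lemma (in solver) tmain_le:
  fixes l N \<epsilon> c1 c2 :: real
  assumes l: "1 \<le> l" and \<epsilon>: "0 < \<epsilon>" "\<epsilon> < 1" and N: "real n * real n \<le> N" and c: "1 \<le> c1" "1 \<le> c2"
    and U: "real U \<le> 1280 * l / \<epsilon>" and Ll: "real L + 2 \<le> 5 * l" and Fl: "real F + 1 \<le> c1 * l"
    and At: "real AT + 1 \<le> c2 * N" and Gl: "real G \<le> 10 * l" and Ful: "real Fu \<le> 12 * l"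
  shows "real tmain \<le> (10 * (38 + 1280 * (c1 * c2 + 3)) + 20520) * (N / \<epsilon> * l ^ 3)"
proof -
  define Z where "Z = N / \<epsilon>"
  have n1': "1 \<le> real n" using n1 by simp
  have "real n * 1 \<le> real n * real n" using n1' by (intro mult_left_mono) auto
  then have nN: "real n \<le> N" "1 \<le> N" using N n1' by linarith+
  have "N * \<epsilon> \<le> N * 1" using nN \<epsilon> by (intro mult_left_mono) auto
  then have NZ: "N \<le> Z" using \<epsilon> by (simp add: Z_def field_simps)
  have p: "l \<le> l ^ 2" "l ^ 2 \<le> l ^ 3" "1 \<le> l ^ 2" using l power_increasing[of 1 2 l] power_increasing[of 2 3 l] power_increasing[of 0 2 l] by auto
  have Z0: "1 \<le> Z" using nN NZ by linarith
  have e1: "N \<le> l * N" using mult_right_mono[OF l, of N] nN by simp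
  have e2: "l * N \<le> l ^ 2 * Z" using p(1) NZ l nN by (intro mult_mono) auto
  have e3: "l ^ 2 * Z \<le> l ^ 3 * Z" using p(2) Z0 by (intro mult_right_mono) auto
  have e4: "l \<le> l * N" using mult_left_mono[OF nN(2), of l] l by simp
  define c3 where "c3 = 38 + 1280 * (c1 * c2 + 3)"
  have U0': "0 \<le> 1280 * l / \<epsilon>" using l \<epsilon> by simp
  have td: "real tdom \<le> c1 * c2 * (l * N)"
  proof -
    have "(real F + 1) * (real AT + 1) \<le> (c1 * l) * (c2 * N)" using Fl At c l nN by (intro mult_mono) auto
    then show ?thesis by (simp add: tdom_def algebra_simps)
  qed
  have x1: "real (U * Suc (tdom + n * (n + 1))) \<le> 1280 * (c1 * c2 + 3) * (l ^ 2 * Z)"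
  proof -
    have "real (Suc (tdom + n * (n + 1))) = 1 + real tdom + real n * real n + real n" by (simp add: algebra_simps)
    then have "real (Suc (tdom + n * (n + 1))) \<le> c1 * c2 * (l * N) + 3 * (l * N)" using td N nN e1 by linarith
    then have "real (Suc (tdom + n * (n + 1))) \<le> (c1 * c2 + 3) * (l * N)" by (simp only: distrib_right)
    then have "real U * real (Suc (tdom + n * (n + 1))) \<le> (1280 * l / \<epsilon>) * ((c1 * c2 + 3) * (l * N))" using U U0' by (intro mult_mono) auto
    also have "\<dots> = 1280 * (c1 * c2 + 3) * (l ^ 2 * Z)" by (simp add: Z_def power2_eq_square)
    finally show ?thesis by (simp only: of_nat_mult)
  qed
  have x2: "real (Suc G * Suc (2 * (n * n))) \<le> 33 * (l * N)"
  proof -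
    have "(real G + 1) * (1 + 2 * (real n * real n)) \<le> (11 * l) * (3 * N)" using Gl l N nN by (intro mult_mono) auto
    then show ?thesis by (simp add: algebra_simps)
  qed
  have th: "real (thalf G U) \<le> c3 * (l ^ 2 * Z)"
  proof -
    have "real (thalf G U) = 3 * (real n * real n) + 2 * real n + real (Suc G * Suc (2 * (n * n))) + real (U * Suc (tdom + n * (n + 1)))"
      unfolding thalf_def by (simp add: algebra_simps)
    then have "real (thalf G U) \<le> 38 * (l ^ 2 * Z) + 1280 * (c1 * c2 + 3) * (l ^ 2 * Z)" using x1 x2 N nN e1 e2 by linarith
    then show ?thesis unfolding c3_def by (simp only: distrib_right)
  qed
  have x3: "real (L * Suc (2 * (n * (n + 1)) + 2 * thalf G U)) \<le> (25 + 10 * c3) * (l ^ 3 * Z)"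
  proof -
    have "real (Suc (2 * (n * (n + 1)) + 2 * thalf G U)) = 1 + 2 * (real n * real n) + 2 * real n + 2 * real (thalf G U)" by (simp add: algebra_simps)
    then have "real (Suc (2 * (n * (n + 1)) + 2 * thalf G U)) \<le> 5 * (l ^ 2 * Z) + 2 * (c3 * (l ^ 2 * Z))" using th N nN e1 e2 by linarith
    then have "real L * real (Suc (2 * (n * (n + 1)) + 2 * thalf G U)) \<le> (5 * l) * (5 * (l ^ 2 * Z) + 2 * (c3 * (l ^ 2 * Z)))"
      using Ll l by (intro mult_mono) auto
    also have "\<dots> = (25 + 10 * c3) * (l ^ 3 * Z)" by (simp add: algebra_simps power2_eq_square power3_eq_cube)
    finally show ?thesis by (simp only: of_nat_mult)
  qed
  have x4: "real (n * (n * (U + 2) + 1)) \<le> 1283 * (l ^ 3 * Z)"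
  proof -
    have "(real n * real n) * real U \<le> N * (1280 * l / \<epsilon>)" using N U U0' nN by (intro mult_mono) auto
    also have "\<dots> = 1280 * (l * Z)" by (simp add: Z_def)
    also have "\<dots> \<le> 1280 * (l ^ 2 * Z)" using mult_right_mono[OF p(1), of Z] Z0 by simp
    finally have "(real n * real n) * real U \<le> 1280 * (l ^ 3 * Z)" using e3 by linarith
    moreover have "real (n * (n * (U + 2) + 1)) = (real n * real n) * real U + 2 * (real n * real n) + real n" by (simp add: algebra_simps)
    ultimately show ?thesis using N nN e1 e2 e3 by linarith
  qed
  have x5: "real tinit \<le> 19210 * (l ^ 3 * Z)"
  proof -
    have "real U * (real Fu + 3) \<le> (1280 * l / \<epsilon>) * (15 * l)" using U U0' Ful l by (intro mult_mono) auto
    also have "\<dots> = 19200 * (l ^ 2 * (1 / \<epsilon>))" by (simp add: power2_eq_square)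
    also have "\<dots> \<le> 19200 * (l ^ 2 * Z)" unfolding Z_def using nN \<epsilon> l by (intro mult_left_mono divide_right_mono) auto
    finally have "real U * (real Fu + 3) \<le> 19200 * (l ^ 2 * Z)" .
    moreover have "real tinit = 2 * real n + 5 + real L + real U * (real Fu + 3)" unfolding tinit_def by (simp add: algebra_simps)
    ultimately show ?thesis using nN e1 e2 e3 e4 Ll l by linarith
  qed
  have "real tmain = real tinit + (real n * real n + real n) + real (L * Suc (2 * (n * (n + 1)) + 2 * thalf G U)) + real (n * (n * (U + 2) + 1))"
    unfolding tmain_def by (simp only: of_nat_add of_nat_mult of_nat_1 distrib_left mult_1_right)
  then have "real tmain \<le> 19210 * (l ^ 3 * Z) + 2 * (l ^ 3 * Z) + (25 + 10 * c3) * (l ^ 3 * Z) + 1283 * (l ^ 3 * Z)"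
    using x3 x4 x5 N nN e1 e2 e3 by linarith
  also have "\<dots> = (10 * c3 + 20520) * (Z * l ^ 3)" by (simp add: algebra_simps)
  finally show ?thesis unfolding c3_def Z_def .
qed

text \<open>All magnitudes are compared with \<open>V\<close>, the product of
  \<open>n / \<epsilon>\<close> and \<open>2 + log 2 M\<close>, where \<open>M\<close> is the
  maximal weight. The word size is a multiple of \<open>log 2 V\<close>, so a fixed power of
  \<open>V\<close> fits below \<open>R\<close>.\<close>

theorem apsp_from_matmul:
  assumes mt: "matmul_in_time \<tau>" and \<tau>: "2 \<le> \<tau>" "\<tau> \<le> 3"
  shows "approx_apsp_in_soft_time (\<lambda>n \<epsilon>. real n powr ((\<tau> + 3) / 2) / \<epsilon>)"
proof -
  obtain P C0 c0 where c0: "c0 > 0" and mm: "\<And>n w K A B s. n \<ge> 1 \<Longrightarrow> (\<forall>i<n. \<forall>j<n. A i j \<le> K \<and> B i j \<le> K) \<Longrightarrow>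
      c0 * log 2 (real n + real K + 1) \<le> real w \<Longrightarrow> matmul_input w n A B s \<Longrightarrow>
      \<exists>s'. halts_within w P (C0 * real n powr \<tau>) s s' \<and> matmul_output n (\<lambda>i j. \<Sum>k<n. A i k * B k j) s'"
    using mt unfolding matmul_in_time_def by blast
  \<comment> \<open>The constant \<open>C0\<close> may be negative; a natural number of at least
    \<open>1\<close> replaces it.\<close>
  define CN where "CN = nat \<lceil>max C0 1\<rceil>"
  have CN: "C0 \<le> real CN" "1 \<le> real CN" unfolding CN_def by linarith+
  \<comment> \<open>The factor \<open>27\<close> bounds \<open>3 powr \<tau>\<close>, which comes
    from the dimension \<open>3 * n\<close>; a further factor \<open>2\<close> absorbs rounding
    up.\<close>
  define \<kappa> where "\<kappa> = 54 * real CN"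
  have \<kappa>: "54 \<le> \<kappa>" using CN by (simp add: \<kappa>_def)
  \<comment> \<open>\<open>B * V ^ 7\<close> dominates every quantity that must stay below
    \<open>R\<close>, and \<open>B < 2 ^ B \<le> V ^ B\<close> explains the exponent
    \<open>k\<close>.\<close>
  define B where "B = 10 ^ 11 * CN"
  define k where "k = 8 + B"
  \<comment> \<open>The first summand makes \<open>V ^ k \<le> R\<close>; the others let the
    simulated word size \<open>w div 4\<close> meet the requirement of the foreign program.\<close>
  define c where "c = real (4 * k + 4) + 4 * c0 + 4"
  define c1 where "c1 = 8 + log 2 \<kappa>"
  define c2 where "c2 = 98 * \<kappa>"
  define ct where "ct = 10 * (38 + 1280 * (c1 * c2 + 3)) + 20520"
  define Cf where "Cf = 8 + real (csz P main) * (ct + 1)"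
  have lk: "0 \<le> log 2 \<kappa>" using \<kappa> by simp
  have c12: "1 \<le> c1" "1 \<le> c2" using \<kappa> lk by (auto simp: c1_def c2_def)
  have "\<exists>s'. halts_within w (prog_of P main) (Cf * (real n powr ((\<tau> + 3) / 2) / \<epsilon>) * ln (real n / \<epsilon>) ^ 3) s s' \<and>
      (\<forall>u<n. \<forall>v<n. distance n H u v \<le> apsp_output w n s' u v \<and> apsp_output w n s' u v \<le> ereal (1 + \<epsilon>) * distance n H u v)"
    if H: "weighted_digraph n H" and \<epsilon>: "0 < \<epsilon>" "\<epsilon> < 1 / 10"
      and w: "c * (log 2 (real n / \<epsilon>) + log 2 (2 + log 2 (max_weight n H))) \<le> real w" and inp: "apsp_input w n H \<epsilon> s" for n H \<epsilon> w s
  proof -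
    have n1: "1 \<le> n" "1 \<le> real n" using H by (auto simp: weighted_digraph_def)
    define M where "M = max_weight n H"
    have M1: "1 \<le> M" unfolding M_def by (rule max_weight_ge(2))
    have lM: "0 \<le> log 2 M" using M1 by simp
    define X where "X = real n / \<epsilon>"
    define Y where "Y = 2 + log 2 M"
    define V where "V = X * Y"
    have Xn: "10 * real n \<le> X" unfolding X_def using \<epsilon> n1 by (simp add: field_simps)
    have X10: "10 \<le> X" using Xn n1 by linarith
    have Y2: "2 \<le> Y" using lM by (simp add: Y_def)
    have XV: "X \<le> V" unfolding V_def using mult_left_mono[of 1 Y X] Y2 X10 by simp
    have YV: "Y \<le> V" unfolding V_def using mult_right_mono[of 1 X Y] Y2 X10 by simp
    have V10: "10 \<le> V" "1 \<le> V" using XV X10 by linarith+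
    have nV: "5 * real n \<le> V" "real n + 1 \<le> V" "real n \<le> V" using Xn XV n1 by linarith+
    have lV: "log 2 V = log 2 X + log 2 Y" unfolding V_def using X10 Y2 by (intro log_mult_pos) auto
    have lV1: "1 \<le> log 2 V" using V10 by simp
    have cw: "c * log 2 V \<le> real w" using w unfolding lV X_def Y_def M_def .
    have kw: "real (4 * k + 4) * log 2 V \<le> real w"
    proof -
      have "real (4 * k + 4) * log 2 V \<le> c * log 2 V" unfolding c_def using c0 lV1 by (intro mult_right_mono) auto
      then show ?thesis using cw by linarith
    qed
    define R :: nat where "R = 2 ^ (w div 4)"
    have "V ^ k \<le> real R" unfolding R_def using word_bound[OF kw] V10 by simp
    moreover have "real B * V ^ 7 < V ^ k"
    proof -
      have "real B < 2 ^ B" using of_nat_less_two_power[of B] by simp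
      also have "\<dots> \<le> V ^ B" using V10 by (intro power_mono) auto
      finally have "real B * V ^ 7 < V ^ B * V ^ 8" using V10 power_increasing[of 7 8 V] by (intro mult_less_le_imp_less) auto
      then show ?thesis by (simp add: k_def power_add mult.commute)
    qed
    ultimately have RV: "real B * V ^ 7 < real R" by linarith
    have hR: "x < real R" if "x \<le> b * V ^ j" "b \<le> 10 ^ 11 * real CN" "j \<le> 7" for x b :: real and j
    proof -
      have "b * V ^ j \<le> real B * V ^ j" using that(2) V10 by (intro mult_right_mono) (auto simp: B_def)
      also have "\<dots> \<le> real B * V ^ 7" using that(3) V10 by (intro mult_left_mono power_increasing) auto
      finally show ?thesis using that(1) RV by linarith
    qed
    define l where "l = ln X"
    have l1: "1 \<le> l"
    proof -
      have "exp 1 \<le> X" using exp_le X10 by linarith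
      then show ?thesis unfolding l_def using X10 by (subst ln_ge_iff) auto
    qed
    have "1 / 2 \<le> ln (2::real)" using log_scale.ln2[of 64] by (simp add: log_scale_def)
    then have lX: "log 2 X \<le> 2 * l" using l1 by (simp add: log_def l_def[symmetric] field_simps)
    have "log 2 (real n) \<le> log 2 X" using n1 Xn by (intro log_mono) auto
    then have ln: "log 2 (real n) \<le> 2 * l" using lX by linarith

    define e where "e = nat (- fl_exponent \<epsilon>)"
    have "log 2 \<epsilon> < 0" using \<epsilon> by simp
    then have e: "real_of_int \<lfloor>log 2 \<epsilon>\<rfloor> = - real e" by (simp add: e_def fl_exponent_def)
    have "- real e \<le> log 2 \<epsilon>" unfolding e[symmetric] by simp
    then have "2 powr (- real e) \<le> \<epsilon>" using \<epsilon> by (subst (asm) le_log_iff) auto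
    then have e1: "1 / 2 ^ e \<le> \<epsilon>" by (simp add: powr_minus powr_realpow field_simps)
    have "log 2 \<epsilon> < - real e + 1" unfolding e[symmetric] by linarith
    then have "\<epsilon> < 2 powr (- real e + 1)" using \<epsilon> by (subst (asm) log_less_iff) auto
    then have "\<epsilon> < 2 / 2 ^ e" by (simp add: powr_diff powr_realpow)
    then have e2: "2 ^ e \<le> 2 / \<epsilon>" using \<epsilon> by (simp add: field_simps)

    obtain L where L: "n \<le> 2 ^ L" "L = 0 \<or> 2 ^ (L - 1) < n" using ceil_log_exists[of n] by blast
    have Ll: "real L + 2 \<le> 5 * l" using ceil_log_bound[OF L(2) n1(1)] ln l1 by linarith
    have Ln: "L \<le> n" using L(2) less_exp[of "L - 1"] by linarith
    obtain a where a0: "L + 2 \<le> 2 ^ a" "a = 0 \<or> 2 ^ (a - 1) < L + 2" using ceil_log_exists[of "L + 2"] by blast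
    then have "a \<noteq> 0" by (cases a) auto
    then have a: "2 ^ a < 2 * (L + 2)" using a0(2) by (cases a) auto
    define U where "U = 64 * 2 ^ a * (2::nat) ^ e"
    define Fu where "Fu = 6 + a + e"
    have UFu: "U = 2 ^ Fu" by (simp add: U_def Fu_def power_add)
    have U1: "real U \<le> 256 * (real L + 2) / \<epsilon>"
    proof -
      have "real (2 ^ a) \<le> real (2 * (L + 2))" using a by (simp only: of_nat_le_iff)
      then have "2 ^ a * 2 ^ e \<le> (2 * (real L + 2)) * (2 / \<epsilon>)" using e2 \<epsilon> by (intro mult_mono) auto
      then have "64 * (2 ^ a * 2 ^ e) \<le> 64 * ((2 * (real L + 2)) * (2 / \<epsilon>))" by (rule mult_left_mono) simp
      also have "\<dots> = 256 * (real L + 2) / \<epsilon>" by simp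
      finally show ?thesis by (simp add: U_def mult.assoc)
    qed
    have Ul: "real U \<le> 1280 * l / \<epsilon>"
    proof -
      have "256 * (real L + 2) / \<epsilon> \<le> 256 * (5 * l) / \<epsilon>" using Ll \<epsilon> by (intro divide_right_mono mult_left_mono) auto
      then show ?thesis using U1 by simp
    qed
    have UX: "real U \<le> 768 * X"
    proof -
      have "real L + 2 \<le> 3 * real n" using Ln n1 by simp
      then have "256 * (real L + 2) / \<epsilon> \<le> 256 * (3 * real n) / \<epsilon>" using \<epsilon> by (intro divide_right_mono mult_left_mono) auto
      then show ?thesis using U1 by (simp add: X_def)
    qed
    have UV: "real U \<le> 768 * V" using UX XV by linarith
    have Ful: "real Fu \<le> 12 * l"
    proof -
      have "real Fu = log 2 (real U)" unfolding UFu by (simp add: log_nat_power)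
      also have "\<dots> \<le> log 2 (1024 * X)" using UX X10 by (intro log_mono) (auto simp: UFu)
      also have "\<dots> = 10 + log 2 X" using X10 log_nat_power[of 2 2 10] by (subst log_mult_pos) auto
      finally show ?thesis using lX l1 by linarith
    qed

    define y where "y = real (3 * n) powr \<tau>"
    define Lq where "Lq = CN * nat \<lceil>y\<rceil>"
    have y1: "real n * real n \<le> y"
    proof -
      have "real n * real n \<le> real (3 * n) ^ 2" by (simp add: power2_eq_square)
      also have "\<dots> = real (3 * n) powr 2" using n1 by (simp add: powr_numeral)
      also have "\<dots> \<le> y" unfolding y_def using \<tau> n1 by (intro powr_mono) auto
      finally show ?thesis .
    qed
    have nn1: "1 \<le> real n * real n" using mult_mono[of 1 "real n" 1 "real n"] n1 by simp
    have yc: "y \<le> real (nat \<lceil>y\<rceil>)" "real (nat \<lceil>y\<rceil>) \<le> y + 1" using y1 nn1 by linarith+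
    have Lq1: "real CN * y \<le> real Lq" unfolding Lq_def using yc by (simp add: mult_left_mono)
    have y2: "y \<le> 27 * real n powr \<tau>"
    proof -
      have "y = 3 powr \<tau> * real n powr \<tau>" unfolding y_def by (simp add: powr_mult)
      moreover have "(3::real) powr \<tau> \<le> 3 powr 3" using \<tau> by (intro powr_mono) auto
      moreover have "(3::real) powr 3 = 27" by (simp add: powr_numeral)
      ultimately show ?thesis by (simp add: mult_right_mono)
    qed
    have Lq2: "real Lq \<le> \<kappa> * real n powr \<tau>"
    proof -
      have "real (nat \<lceil>y\<rceil>) \<le> 54 * real n powr \<tau>" using yc y1 nn1 y2 by linarith
      then have "real CN * real (nat \<lceil>y\<rceil>) \<le> real CN * (54 * real n powr \<tau>)" by (rule mult_left_mono) simp
      then show ?thesis by (simp add: Lq_def \<kappa>_def)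
    qed
    have nt: "real n powr \<tau> \<le> real n ^ 3"
    proof -
      have "real n powr \<tau> \<le> real n powr 3" using \<tau> n1 by (intro powr_mono) auto
      then show ?thesis using n1 by (simp add: powr_numeral)
    qed
    have Lq3: "real Lq \<le> \<kappa> * real n ^ 3" using Lq2 mult_left_mono[OF nt, of \<kappa>] \<kappa> by linarith
    have yLq: "y \<le> real Lq" using Lq1 mult_right_mono[OF CN(2), of y] y1 nn1 by linarith
    have nLq: "n * n \<le> Lq" using y1 yLq by (metis of_nat_le_iff of_nat_mult order_trans)
    have Lq0: "1 \<le> Lq" "1 \<le> real Lq" using yLq y1 nn1 by linarith+
    have n3: "real n ^ 3 \<le> V ^ 3" using nV by (intro power_mono) auto
    have LqV: "real Lq \<le> \<kappa> * V ^ 3" using Lq3 mult_left_mono[OF n3, of \<kappa>] \<kappa> by linarith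

    obtain F where F: "Lq \<le> 2 ^ F" "F = 0 \<or> 2 ^ (F - 1) < Lq" using ceil_log_exists[of Lq] by blast
    have F4: "Lq \<le> 4 ^ F" using F(1) power_mono[of "2::nat" 4 F] by simp
    have Fl: "real F + 1 \<le> c1 * l"
    proof -
      have "log 2 (real Lq) \<le> log 2 (\<kappa> * real n ^ 3)" using Lq3 Lq0 by (intro log_mono) auto
      also have "\<dots> = log 2 \<kappa> + 3 * log 2 (real n)" using \<kappa> n1 by (subst log_mult_pos) (auto simp: log_nat_power)
      finally have "real F + 1 \<le> 2 + log 2 \<kappa> + 6 * l" using ceil_log_bound[OF F(2) Lq0(1)] ln by linarith
      moreover have "(2 + log 2 \<kappa>) * 1 \<le> (2 + log 2 \<kappa>) * l" using l1 lk by (intro mult_left_mono) auto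
      ultimately show ?thesis by (simp add: c1_def algebra_simps)
    qed
    have FLq: "F \<le> Lq" using F(2) less_exp[of "F - 1"] by linarith

    define N where "N = real n powr ((\<tau> + 3) / 2)"
    have N2: "N\<^sup>2 = real n ^ 3 * real n powr \<tau>"
    proof -
      have "N\<^sup>2 = real n powr (\<tau> + 3)" unfolding N_def by (simp add: power2_eq_square powr_add[symmetric])
      also have "\<dots> = real n powr \<tau> * real n powr 3" by (rule powr_add)
      also have "real n powr 3 = real n ^ 3" using n1 by (simp add: powr_numeral)
      finally show ?thesis by simp
    qed
    have nN: "real n * real n \<le> N"
    proof -
      have "real n powr 2 \<le> N" unfolding N_def using \<tau> n1 by (intro powr_mono) auto
      then show ?thesis using n1 by (simp add: powr_numeral power2_eq_square)
    qed
    have ntN: "real n powr \<tau> \<le> N" unfolding N_def using \<tau> n1 by (intro powr_mono) auto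
    define AT where "AT = nat \<lceil>44 * sqrt (4 * (real n ^ 3 * real Lq)) + 8 * real Lq\<rceil>"
    have At: "real AT + 1 \<le> c2 * N"
    proof -
      have "4 * (real n ^ 3 * real Lq) \<le> 4 * (real n ^ 3 * (\<kappa> * real n powr \<tau>))" using Lq2 by (intro mult_left_mono) auto
      also have "\<dots> = 4 * \<kappa> * N\<^sup>2" by (simp add: N2)
      also have "\<dots> \<le> 4 * \<kappa>\<^sup>2 * N\<^sup>2" using \<kappa> by (intro mult_right_mono) (auto simp: power2_eq_square)
      also have "\<dots> = (2 * \<kappa> * N)\<^sup>2" by (simp add: power_mult_distrib)
      finally have "sqrt (4 * (real n ^ 3 * real Lq)) \<le> 2 * \<kappa> * N" using \<kappa> nN nn1 by (intro real_le_lsqrt) auto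
      moreover have "real Lq \<le> \<kappa> * N" using Lq2 mult_left_mono[OF ntN, of \<kappa>] \<kappa> by linarith
      moreover have "real AT \<le> 44 * sqrt (4 * (real n ^ 3 * real Lq)) + 8 * real Lq + 1" unfolding AT_def
      proof -
        have "0 \<le> sqrt (4 * (real n ^ 3 * real Lq))" by simp
        then show "real (nat \<lceil>44 * sqrt (4 * (real n ^ 3 * real Lq)) + 8 * real Lq\<rceil>) \<le> 44 * sqrt (4 * (real n ^ 3 * real Lq)) + 8 * real Lq + 1" by linarith
      qed
      moreover have "2 \<le> 2 * \<kappa> * N" using mult_mono[of 1 \<kappa> 1 N] \<kappa> nN nn1 by simp
      ultimately show ?thesis by (simp add: c2_def)
    qed

    have Rs: "1000 \<le> R" "100 * (n * n) + 100 < R" "16 * Lq < R" "100 * (U * U * U) < R"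
    proof -
      have "1000 < real R" by (rule hR[of _ 1000 0]) (use CN in auto)
      then show "1000 \<le> R" by linarith
      have "real n * real n \<le> V * V" using nV V10 by (intro mult_mono) auto
      moreover have "1 \<le> V * V" using mult_mono[of 1 V 1 V] V10 by simp
      ultimately have "real (100 * (n * n) + 100) < real R" by (intro hR[of _ 200 2]) (use CN in \<open>auto simp: power2_eq_square\<close>)
      then show "100 * (n * n) + 100 < R" by (simp only: of_nat_less_iff)
      have "real (16 * Lq) < real R" by (rule hR[of _ "16 * \<kappa>" 3]) (use LqV CN in \<open>auto simp: \<kappa>_def\<close>)
      then show "16 * Lq < R" by (simp only: of_nat_less_iff)
      have "real U ^ 3 \<le> (768 * V) ^ 3" using UV by (intro power_mono) auto
      then have "real U ^ 3 \<le> 452984832 * V ^ 3" by (simp add: power_mult_distrib)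
      then have "real (100 * (U * U * U)) < real R" by (intro hR[of _ 45298483200 3]) (use CN in \<open>auto simp: power3_eq_cube\<close>)
      then show "100 * (U * U * U) < R" by (simp only: of_nat_less_iff)
    qed

    interpret ap: apsp w P "2 ^ w" R "w div 4" n Lq F AT
    proof (unfold_locales, goal_cases)
      \<comment> \<open>The assumption on matrix multiplication is used with word size
        \<open>w div 4\<close> and entry bound \<open>1\<close>.\<close>
      case (11 A B \<sigma>)
      have "3 * real n + real 1 + 1 \<le> V" using nV n1 by linarith
      then have "log 2 (real (3 * n) + real 1 + 1) \<le> log 2 V" using n1 by (intro log_mono) auto
      then have "c0 * log 2 (real (3 * n) + real 1 + 1) \<le> c0 * log 2 V" using c0 by (intro mult_left_mono) auto
      also have "\<dots> \<le> real (w div 4)"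
      proof -
        have "(4 * c0 + 4) * log 2 V \<le> c * log 2 V" unfolding c_def using lV1 by (intro mult_right_mono) auto
        then have "4 * (c0 * log 2 V) + 4 * log 2 V \<le> real w" using cw by (simp add: algebra_simps)
        moreover have "real w \<le> real (4 * (w div 4) + 3)" by (simp only: of_nat_le_iff)
        ultimately show ?thesis using lV1 by simp
      qed
      finally have "c0 * log 2 (real (3 * n) + real 1 + 1) \<le> real (w div 4)" .
      from mm[OF _ 11(1) this 11(2)] n1(1) obtain s' where s': "halts_within (w div 4) P (C0 * real (3 * n) powr \<tau>) \<sigma> s'"
        "matmul_output (3 * n) (\<lambda>i j. \<Sum>k<3 * n. A i k * B k j) s'" by auto
      then obtain t where t: "real t \<le> C0 * y" "(step (w div 4) P ^^ t) \<sigma> = s'" "halted P s'" unfolding halts_within_def y_def by blast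
      have "C0 * y \<le> real CN * y" using CN y1 nn1 by (intro mult_right_mono) auto
      then have "t \<le> Lq" using t(1) Lq1 by linarith
      then show ?case using t s' by blast
    next
      case (10 q)
      have "real (attempt_ticks n q) \<le> 44 * sqrt (4 * (real n ^ 3 * real Lq)) + 8 * real Lq" by (rule attempt_ticks_sqrt[OF n1(1) 10])
      then show ?case unfolding AT_def by linarith
    qed (use Rs n1 nLq F4 in \<open>auto simp: R_def\<close>)

    have enc: "(mem s (2 * (i * n + j)), mem s (2 * (i * n + j) + 1)) = fl_encode w (H i j)" if "i < n" "j < n" for i j
      using inp that unfolding apsp_input_def by blast
    have U64: "64 \<le> U" by (simp add: U_def)
    have w1: "1 \<le> w" using Rs(1) unfolding R_def by (cases w) auto
    define E where "E = 2 ^ (w - 1) div U"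
    have UE: "U * E = 2 ^ (w - 1)"
    proof -
      have "(2::nat) ^ Suc Fu \<le> 100 * (U * U * U)" using mult_le_mono[of 1 "U * U" U U] U64 by (simp add: UFu[symmetric])
      also have "\<dots> \<le> R" using Rs by simp
      also have "\<dots> \<le> 2 ^ w" unfolding R_def by (rule power_increasing) auto
      finally have "Suc Fu \<le> w" by (rule power_le_imp_le_exp[rotated]) simp
      then have "U dvd 2 ^ (w - 1)" unfolding UFu by (intro le_imp_power_dvd) linarith
      then show ?thesis by (simp add: E_def)
    qed
    have VV: "V * V * V = V ^ 3" "V \<le> V ^ 3" using V10 power_increasing[of 1 3 V] by (auto simp: power3_eq_cube)
    have UU: "real U * real U \<le> 589824 * (V * V)" using mult_mono[OF UV UV] V10 by simp
    interpret sv: solver w P "2 ^ w" R "w div 4" n Lq F AT L a e U E "2 * L" Fu "mem s"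
    proof (unfold_locales, goal_cases)
      case 8
      have "n * n \<le> 2 ^ L * 2 ^ L" using L(1) by (intro mult_le_mono)
      then show ?case by (simp add: mult_2 power_add)
    next
      case 10
      have "\<kappa> * 1 \<le> \<kappa> * V ^ 3" using V10 \<kappa> by (intro mult_left_mono one_le_power) auto
      then have "real F + 1 \<le> 2 * \<kappa> * V ^ 3" using FLq LqV \<kappa> by linarith
      then have f1: "(real F + 1) * (real n + 1) \<le> (2 * \<kappa> * V ^ 3) * V" using nV V10 \<kappa> by (intro mult_mono) auto
      have f2: "real U * ((real F + 1) * (real n + 1)) \<le> (768 * V) * ((2 * \<kappa> * V ^ 3) * V)"
        by (rule mult_mono[OF UV f1]) (use V10 in auto)
      have f3: "real L \<le> V" using Ln nV by linarith
      have "real L * (real U * ((real F + 1) * (real n + 1))) \<le> V * ((768 * V) * ((2 * \<kappa> * V ^ 3) * V))"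
        by (rule mult_mono[OF f3 f2]) (use V10 in auto)
      also have "\<dots> = 1536 * \<kappa> * V ^ 6" by (simp add: power_def numeral_eq_Suc)
      finally have "real (2 * (L * (U * ap.cstep))) < real R" by (intro hR[of _ "3072 * \<kappa>" 6]) (use CN in \<open>auto simp: ap.cstep_def \<kappa>_def algebra_simps\<close>)
      then show ?case by (simp only: of_nat_less_iff less_imp_le)
    next
      case (11 i j)
      have "H i j \<noteq> \<infinity>" using enc[OF 11(1,2)] 11(3) by (auto simp: fl_encode_def)
      moreover have H1: "1 \<le> H i j" using H 11 by (simp add: weighted_digraph_def)
      ultimately obtain x where x: "H i j = ereal x" "1 \<le> x" by (cases "H i j") (auto simp: one_ereal_def)
      let ?m = "mem s (2 * (i * n + j))" and ?k = "mem s (2 * (i * n + j) + 1)"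
      have mk: "?m = fl_mantissa w x" "?k = nat (fl_exponent x)" using enc[OF 11(1,2)] x by (auto simp: fl_encode_def)
      interpret ls: log_scale U by standard (rule U64)
      note ev = ls.encoded_val[OF UE w1 x(2) mk]
      have "x \<le> M" unfolding M_def using max_weight_ge(1)[OF 11(1,2), of H] x by simp
      then have "2 powr real ?k \<le> M" using ev(5) by (simp add: powr_realpow)
      then have "real ?k \<le> log 2 M" using M1 by (subst le_log_iff) auto
      then have kV: "real ?k + 1 \<le> V" using YV unfolding Y_def by linarith
      have "(real ?k + 1) * (real U * real U) \<le> V * (589824 * (V * V))" by (rule mult_mono[OF kV UU]) (use V10 in auto)
      also have "\<dots> = 589824 * V ^ 3" by (simp add: VV(1)[symmetric])
      finally have "(real ?k + 1) * (real U * real U) + 2 * real U \<le> 591360 * V ^ 3" using UV VV(2) by linarith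
      then have "real ((?k + 1) * (U * U) + 2 * U) \<le> 591360 * V ^ 3" by (simp only: of_nat_add of_nat_mult of_nat_1 of_nat_numeral)
      then have "real ((?k + 1) * (U * U) + 2 * U) < real R" by (intro hR[of _ 591360 3]) (use CN in auto)
      then have "(?k + 1) * (U * U) + 2 * U \<le> R" by linarith
      then show ?case using ev(1,2) by blast
    qed (fact L a0(1) a U_def E_def Rs(4) | simp add: UFu)+

    have KR: "real U * real U * (1 + log 2 (real n * max_weight n H)) < real R"
    proof -
      have "log 2 (real n) \<le> log 2 (2 ^ n)" using n1 by (intro log_mono) (auto simp: less_imp_le)
      then have "log 2 (real n) \<le> real n" by (simp add: log_nat_power)
      moreover have "log 2 (real n * max_weight n H) = log 2 (real n) + log 2 M" unfolding M_def[symmetric] using n1 M1 by (intro log_mult_pos) auto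
      ultimately have "1 + log 2 (real n * max_weight n H) \<le> 2 * V" using YV nV by (simp add: Y_def)
      then have "real U * real U * (1 + log 2 (real n * max_weight n H)) \<le> (real U * real U) * (2 * V)" by (intro mult_left_mono) auto
      also have "\<dots> \<le> 589824 * (V * V) * (2 * V)" using UU V10 by (intro mult_right_mono) auto
      also have "\<dots> = 1179648 * V ^ 3" by (simp add: VV(1)[symmetric])
      finally show ?thesis by (rule hR) (use CN in auto)
    qed
    obtain t st D where big: "ap.big main (start w n e (mem s)) t st" "t \<le> sv.tmain" and
      sq: "squares n (ltab U) (\<lambda>t. stab U t + 4 * U) U L sv.D0 D" and
      wr: "\<And>i j. i < n \<Longrightarrow> j < n \<Longrightarrow> sv.written (D i j) i j (ar st 0 0 (2 * (i * n + j))) (ar st 0 0 (2 * (i * n + j) + 1))"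
      using sv.main_correct unfolding ap.tri_def by blast
    have regs: "pc s = 0" "reg s 0 = w" "reg s 1 = n" "reg s 3 = e" "\<And>r. 4 \<le> r \<Longrightarrow> reg s r = 0"
      using inp by (auto simp: apsp_input_def e_def)
    have mem0: "mem s b = 0" if "R \<le> b" for b
    proof -
      have "2 * n * n \<le> b" using that Rs(2) by simp
      then show ?thesis using inp unfolding apsp_input_def by blast
    qed
    from ap.prog_run[OF regs mem0 big(1)] obtain s' where s': "halts_within w (prog_of P main) (real (8 + csz P main * Suc t)) s s'" "\<forall>j<R. mem s' j = ar st 0 0 j" by blast
    have tm: "real sv.tmain \<le> ct * (N / \<epsilon> * l ^ 3)" unfolding ct_def
      by (rule sv.tmain_le[OF l1 \<epsilon>(1) _ nN c12 Ul Ll Fl At _ Ful]) (use \<epsilon> Ll l1 in auto)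
    have "real (8 + csz P main * Suc t) \<le> Cf * (N / \<epsilon>) * l ^ 3"
    proof -
      have "1 \<le> N / \<epsilon>" using nN nn1 \<epsilon> by (simp add: field_simps)
      then have z: "1 \<le> N / \<epsilon> * l ^ 3" using l1 mult_mono[of 1 "N / \<epsilon>" 1 "l ^ 3"] one_le_power[OF l1, of 3] by simp
      have "real t + 1 \<le> ct * (N / \<epsilon> * l ^ 3) + N / \<epsilon> * l ^ 3" using tm big(2) z by linarith
      then have "real (csz P main) * (real t + 1) \<le> real (csz P main) * (ct * (N / \<epsilon> * l ^ 3) + N / \<epsilon> * l ^ 3)" by (rule mult_left_mono) simp
      then have "8 + real (csz P main) * (real t + 1) \<le> 8 * (N / \<epsilon> * l ^ 3) + real (csz P main) * (ct * (N / \<epsilon> * l ^ 3) + N / \<epsilon> * l ^ 3)" using z by linarith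
      also have "\<dots> = Cf * (N / \<epsilon>) * l ^ 3" by (simp add: Cf_def algebra_simps)
      finally show ?thesis by (simp add: algebra_simps)
    qed
    then have hw: "halts_within w (prog_of P main) (Cf * (N / \<epsilon>) * l ^ 3) s s'" by (rule halts_within_mono[OF s'(1)])
    have "distance n H u v \<le> apsp_output w n s' u v \<and> apsp_output w n s' u v \<le> ereal (1 + \<epsilon>) * distance n H u v" if uv: "u < n" "v < n" for u v
    proof -
      have "2 * (u * n + v) + 1 < R" using sv.io_less[OF uv] by blast
      then have "apsp_output w n s' u v = fl_decode w (ar st 0 0 (2 * (u * n + v)), ar st 0 0 (2 * (u * n + v) + 1))"
        using s'(2) by (simp add: apsp_output_def)
      then show ?thesis using sv.solver_output[OF H e1 \<epsilon>(2) enc KR sq uv wr[OF uv]] by simp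
    qed
    then show ?thesis using hw unfolding N_def l_def X_def by blast
  qed
  moreover have "0 < c" unfolding c_def using c0 by (intro add_nonneg_pos) auto
  ultimately show ?thesis unfolding approx_apsp_in_soft_time_def
    by (intro exI[of _ "prog_of P main"] exI[of _ Cf] exI[of _ 3] exI[of _ c]) blast
qed

text \<open>With a negative constant a larger exponent would lower the bound, hence
  \<open>max C 0\<close>.\<close>

lemma approx_apsp_mono:
  assumes "approx_apsp_in_soft_time (\<lambda>n \<epsilon>. real n powr x / \<epsilon>)" "x \<le> y"
  shows "approx_apsp_in_soft_time (\<lambda>n \<epsilon>. real n powr y / \<epsilon>)"
proof -
  obtain P C k c where c: "c > 0" and h: "\<And>n G \<epsilon> w s. weighted_digraph n G \<Longrightarrow> 0 < \<epsilon> \<Longrightarrow> \<epsilon> < 1 / 10 \<Longrightarrow>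
          c * (log 2 (real n / \<epsilon>) + log 2 (2 + log 2 (max_weight n G))) \<le> real w \<Longrightarrow> apsp_input w n G \<epsilon> s \<Longrightarrow>
          \<exists>s'. halts_within w P (C * (real n powr x / \<epsilon>) * ln (real n / \<epsilon>) ^ k) s s' \<and>
                (\<forall>u<n. \<forall>v<n. distance n G u v \<le> apsp_output w n s' u v \<and> apsp_output w n s' u v \<le> ereal (1 + \<epsilon>) * distance n G u v)"
    using assms(1) unfolding approx_apsp_in_soft_time_def by blast
  have "\<exists>s'. halts_within w P (max C 0 * (real n powr y / \<epsilon>) * ln (real n / \<epsilon>) ^ k) s s' \<and>
                (\<forall>u<n. \<forall>v<n. distance n G u v \<le> apsp_output w n s' u v \<and> apsp_output w n s' u v \<le> ereal (1 + \<epsilon>) * distance n G u v)"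
    if a: "weighted_digraph n G" "0 < \<epsilon>" "\<epsilon> < 1 / 10"
          "c * (log 2 (real n / \<epsilon>) + log 2 (2 + log 2 (max_weight n G))) \<le> real w" "apsp_input w n G \<epsilon> s" for n G \<epsilon> w s
  proof -
    have n: "1 \<le> real n" using a(1) by (simp add: weighted_digraph_def)
    have "C * (real n powr x / \<epsilon>) \<le> max C 0 * (real n powr y / \<epsilon>)"
      using assms(2) n a(2) by (intro mult_mono divide_right_mono powr_mono) auto
    moreover have "1 \<le> real n / \<epsilon>" using n a(2,3) by (simp add: field_simps)
    ultimately have "C * (real n powr x / \<epsilon>) * ln (real n / \<epsilon>) ^ k \<le> max C 0 * (real n powr y / \<epsilon>) * ln (real n / \<epsilon>) ^ k"
      by (intro mult_right_mono) auto
    then show ?thesis using h[OF a] halts_within_mono by blast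
  qed
  then show ?thesis using c unfolding approx_apsp_in_soft_time_def
    by (intro exI[of _ P] exI[of _ "max C 0"] exI[of _ k] exI[of _ c]) blast
qed

theorem theorem3:
  "(\<forall>\<delta>>0. approx_apsp_in_soft_time (\<lambda>n \<epsilon>. real n powr ((\<omega> + \<delta> + 3) / 2) / \<epsilon>)) \<and>
   (matmul_in_time \<omega> \<longrightarrow> approx_apsp_in_soft_time (\<lambda>n \<epsilon>. real n powr ((\<omega> + 3) / 2) / \<epsilon>))"
proof (intro conjI allI impI)
  have ne: "{\<tau>. matmul_in_time \<tau>} \<noteq> {}" using matmul_in_time_3 by auto
  fix \<delta> :: real assume "0 < \<delta>"
  then have "Inf {\<tau>. matmul_in_time \<tau>} < \<omega> + \<delta>" by (simp add: omega_def)
  then obtain \<tau> where \<tau>: "matmul_in_time \<tau>" "\<tau> < \<omega> + \<delta>" using cInf_lessD[OF ne] by blast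
  define \<sigma> where "\<sigma> = min \<tau> 3"
  have "matmul_in_time \<sigma>" using \<tau>(1) matmul_in_time_3 by (simp add: \<sigma>_def min_def)
  moreover have "2 \<le> \<sigma>" "\<sigma> \<le> 3" using matmul_in_time_ge_2[OF \<tau>(1)] by (auto simp: \<sigma>_def)
  ultimately have "approx_apsp_in_soft_time (\<lambda>n \<epsilon>. real n powr ((\<sigma> + 3) / 2) / \<epsilon>)" by (rule apsp_from_matmul)
  then show "approx_apsp_in_soft_time (\<lambda>n \<epsilon>. real n powr ((\<omega> + \<delta> + 3) / 2) / \<epsilon>)"
    by (rule approx_apsp_mono) (use \<tau>(2) in \<open>auto simp: \<sigma>_def\<close>)
next
  assume m: "matmul_in_time \<omega>"
  have "bdd_below {\<tau>. matmul_in_time \<tau>}" using matmul_in_time_ge_2 by (auto intro!: bdd_belowI[of _ 2])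
  then have "\<omega> \<le> 3" unfolding omega_def using matmul_in_time_3 by (intro cInf_lower) auto
  then show "approx_apsp_in_soft_time (\<lambda>n \<epsilon>. real n powr ((\<omega> + 3) / 2) / \<epsilon>)"
    using apsp_from_matmul[OF m matmul_in_time_ge_2[OF m]] by blast
qed

end
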